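(* Let $n\ge 1$, $s\in(0,1)$ and let $B_1\subset\mathbb{R}^n$ be the unit ball. For any $m\in\mathbb{N}$, $m\geq 1$, there exist constants $r_0>0$ and $\beta>0$ such that for all sufficiently small $\epsilon>0$ and for all $q_0\in L^\infty(B_1)$ with $\|q_0\|_{L^\infty(B_1)}\le \frac{r_0}{2}$ there are potentials $q_1,q_2$ with $q_i-q_0\in C^m_0(B_1)$ such that $$\|\Lambda_{q_1}-\Lambda_{q_2}\|_{L^2(B_3\setminus\overline{B}_2)\to L^2(B_3\setminus\overline{B}_2)}\le 8\exp\left(-\epsilon^{-\frac{n}{(2n+3)m}}\right),$$ $$\|q_1-q_2\|_{L^\infty(B_1)}=\epsilon,$$ $$\|q_i-q_0\|_{C^m(\overline{B}_1)}\le\beta,\qquad \|q_i-q_0\|_{L^\infty(B_1)}\le\epsilon,\qquad i\in\{1,2\}.$$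
   Context: $B_r$ is the open ball of radius $r$ centred at $0$ in $\mathbb{R}^n$. Potentials are real-valued. $C^m_0(B_1)$ denotes the $C^m$ functions with compact support in $B_1$. $H^s(\mathbb{R}^n)$ are the $L^2$-based Sobolev spaces, $\widetilde{H}^s(U)$ is the closure of $C_c^\infty(U)$ in $H^s(\mathbb{R}^n)$, and $H^{t}(U)$ is the space of restrictions to $U$ of elements of $H^t(\mathbb{R}^n)$. $(-\Delta)^s$ is the fractional Laplacian on $\mathbb{R}^n$ (Fourier multiplier $|\xi|^{2s}$). Let $q\in L^\infty(B_1)$ be such that $0$ is not a Dirichlet eigenvalue of $(-\Delta)^s+q$ in $B_1$, i.e. the only $v\in\widetilde{H}^s(B_1)$ with $((-\Delta)^s+q)v=0$ in $B_1$ is $v=0$. For $f\in L^2(B_3\setminus\overline{B}_2)$, let $E_0f$ be its extension by zero to $\mathbb{R}^n$; the solution $u$ of $$((-\Delta)^s+q)u=0\ \text{in } B_1,\qquad u=E_0 f\ \text{in }\mathbb{R}^n\setminus B_1$$ is $u=E_0f+v$, where $v\in\widetilde{H}^s(B_1)$ is the unique weak solution of $((-\Delta)^s+q)v=-((-\Delta)^sE_0f)|_{B_1}$ in $B_1$ (the right-hand side is smooth on $\overline{B}_1$ since $E_0f$ is supported in $\overline{B}_3\setminus B_2$). Define $$\Lambda_q f:=(-\Delta)^su|_{B_3\setminus\overline{B}_2},\qquad \Lambda_q: L^2(B_3\setminus\overline{B}_2)\to H^{-2s}(B_3\setminus\overline{B}_2).$$ The difference $\Lambda_{q_1}-\Lambda_{q_2}$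 of two such maps is bounded from $L^2(B_3\setminus\overline{B}_2)$ to $L^2(B_3\setminus\overline{B}_2)$, and the operator norm in the claim is the norm of this bounded operator. The estimate for $\Lambda_{q_1}-\Lambda_{q_2}$ is understood to include that both maps are defined. "Sufficiently small" is uniform with respect to $q_0$. *)

theory Defs
  imports "HOL-Analysis.Analysis" "HOL-Probability.Essential_Supremum"
begin

section \<open>Functions of class C^m and test functions\<close>

primrec partial_derivs ::
  "'a::euclidean_space list \<Rightarrow> ('a \<Rightarrow> 'b::real_normed_vector) \<Rightarrow> 'a \<Rightarrow> 'b" where
  "partial_derivs [] f = f"
| "partial_derivs (b # bs) f = (\<lambda>x. frechet_derivative (partial_derivs bs f) (at x) b)"

text \<open>Partial derivatives are indexed by words of coordinate directions. For functions of class
  C^m their order is irrelevant, so these words represent the multi-indices of length at most m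
  (a multi-index may be represented by several words).\<close>

definition deriv_words :: "nat \<Rightarrow> 'a::euclidean_space list set" where
  "deriv_words m = {bs. set bs \<subseteq> Basis \<and> length bs \<le> m}"

definition C_fun :: "nat \<Rightarrow> ('a::euclidean_space \<Rightarrow> 'b::real_normed_vector) \<Rightarrow> bool" where
  "C_fun m f \<longleftrightarrow>
     (\<forall>bs\<in>deriv_words m. continuous_on UNIV (partial_derivs bs f) \<and>
        (length bs < m \<longrightarrow> (\<forall>x. partial_derivs bs f differentiable (at x))))"

definition compactly_supported_in :: "'a::euclidean_space set \<Rightarrow> ('a \<Rightarrow> 'b::zero) \<Rightarrow> bool" where
  "compactly_supported_in U f \<longleftrightarrow>
     compact (closure {x. f x \<noteq> 0}) \<and> closure {x. f x \<noteq> 0} \<subseteq> U"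

text \<open>Functions with compact support in U are regarded as functions on the whole space, extended
  by zero.\<close>

definition Cc :: "nat \<Rightarrow> 'a::euclidean_space set \<Rightarrow> ('a \<Rightarrow> 'b::real_normed_vector) set" where
  "Cc m U = {f. C_fun m f \<and> compactly_supported_in U f}"

definition test_functions :: "'a::euclidean_space set \<Rightarrow> ('a \<Rightarrow> complex) set" where
  "test_functions U = (\<Inter>m. Cc m U)"

text \<open>The maximum over all multi-indices of length at most m of the supremum norms over S of the
  partial derivatives.\<close>

definition C_norm :: "nat \<Rightarrow> 'a::euclidean_space set \<Rightarrow> ('a \<Rightarrow> 'b::real_normed_vector) \<Rightarrow> real" where
  "C_norm m S f = (SUP (bs, x) \<in> deriv_words m \<times> S. norm (partial_derivs bs f x))"


section \<open>Lebesgue spaces\<close>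

text \<open>Elements are representatives, not equivalence classes; only their values on U matter.\<close>

definition L2 :: "'a::euclidean_space set \<Rightarrow> ('a \<Rightarrow> complex) set" where
  "L2 U = {f \<in> borel_measurable (lebesgue_on U). integrable (lebesgue_on U) (\<lambda>x. (cmod (f x))\<^sup>2)}"

definition L2_norm :: "'a::euclidean_space set \<Rightarrow> ('a \<Rightarrow> complex) \<Rightarrow> real" where
  "L2_norm U f = sqrt (\<integral>x. (cmod (f x))\<^sup>2 \<partial>lebesgue_on U)"

definition Linf_norm :: "'a::euclidean_space set \<Rightarrow> ('a \<Rightarrow> real) \<Rightarrow> ereal" where
  "Linf_norm U q = esssup (lebesgue_on U) (\<lambda>x. ereal \<bar>q x\<bar>)"

definition Linf :: "'a::euclidean_space set \<Rightarrow> ('a \<Rightarrow> real) set" where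
  "Linf U = {q \<in> borel_measurable (lebesgue_on U). Linf_norm U q < \<infinity>}"

definition extend_zero :: "'a set \<Rightarrow> ('a \<Rightarrow> complex) \<Rightarrow> 'a \<Rightarrow> complex" where
  "extend_zero U f = (\<lambda>x. if x \<in> U then f x else 0)"


section \<open>Fourier transform, Sobolev spaces, fractional Laplacian\<close>

definition fourier_integral :: "('a::euclidean_space \<Rightarrow> complex) \<Rightarrow> 'a \<Rightarrow> complex" where
  "fourier_integral f \<xi> = (\<integral>x. exp (- \<i> * of_real (x \<bullet> \<xi>)) * f x \<partial>lebesgue)"

definition inverse_fourier_integral :: "('a::euclidean_space \<Rightarrow> complex) \<Rightarrow> 'a \<Rightarrow> complex" where
  "inverse_fourier_integral f \<xi> =
     (\<integral>x. exp (\<i> * of_real (x \<bullet> \<xi>)) * f x \<partial>lebesgue) / of_real ((2 * pi) ^ DIM('a))"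

text \<open>The Fourier--Plancherel transform on L2: the limit in mean of the Fourier integrals of the
  truncations to balls. It is determined up to a null set.\<close>

definition fourier_L2 :: "('a::euclidean_space \<Rightarrow> complex) \<Rightarrow> 'a \<Rightarrow> complex" where
  "fourier_L2 u = (SOME g. g \<in> L2 UNIV \<and>
     (\<lambda>k::nat. L2_norm UNIV (\<lambda>\<xi>. fourier_integral (extend_zero (ball 0 (real k)) u) \<xi> - g \<xi>))
       \<longlonglongrightarrow> 0)"

text \<open>The following are used for nonnegative order s only, where H^s consists of L2 functions.\<close>

definition sobolev :: "real \<Rightarrow> ('a::euclidean_space \<Rightarrow> complex) set" where
  "sobolev s = {u \<in> L2 UNIV.
     integrable lebesgue (\<lambda>\<xi>. (1 + (norm \<xi>)\<^sup>2) powr s * (cmod (fourier_L2 u \<xi>))\<^sup>2)}"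

definition sobolev_norm :: "real \<Rightarrow> ('a::euclidean_space \<Rightarrow> complex) \<Rightarrow> real" where
  "sobolev_norm s u =
     sqrt (\<integral>\<xi>. (1 + (norm \<xi>)\<^sup>2) powr s * (cmod (fourier_L2 u \<xi>))\<^sup>2 \<partial>lebesgue)"

definition sobolev_tilde :: "real \<Rightarrow> 'a::euclidean_space set \<Rightarrow> ('a \<Rightarrow> complex) set" where
  "sobolev_tilde s U = {u \<in> sobolev s.
     \<forall>e>0. \<exists>\<phi>\<in>test_functions U. sobolev_norm s (\<lambda>x. u x - \<phi> x) < e}"

text \<open>Distributions are functionals on test functions, with the bilinear pairing (no complex
  conjugation).\<close>

type_synonym 'a distr = "('a \<Rightarrow> complex) \<Rightarrow> complex"

text \<open>For u in L2, the distribution whose Fourier transform is |\<xi>|^(2s) times that of u. In general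
  it is not a function, but it is of Sobolev order -2s.\<close>

definition frac_laplacian :: "real \<Rightarrow> ('a::euclidean_space \<Rightarrow> complex) \<Rightarrow> 'a distr" where
  "frac_laplacian s u \<phi> =
     (\<integral>\<xi>. of_real (norm \<xi> powr (2 * s)) * fourier_L2 u \<xi> * inverse_fourier_integral \<phi> \<xi> \<partial>lebesgue)"


section \<open>The exterior value problem and the Dirichlet-to-Neumann map\<close>

definition schroedinger ::
  "real \<Rightarrow> ('a::euclidean_space \<Rightarrow> real) \<Rightarrow> 'a set \<Rightarrow> ('a \<Rightarrow> complex) \<Rightarrow> 'a distr" where
  "schroedinger s q \<Omega> v \<phi> =
     frac_laplacian s v \<phi> + (\<integral>x. of_real (q x) * v x * \<phi> x \<partial>lebesgue_on \<Omega>)"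

definition zero_dirichlet_eigenvalue ::
  "real \<Rightarrow> 'a::euclidean_space set \<Rightarrow> ('a \<Rightarrow> real) \<Rightarrow> bool" where
  "zero_dirichlet_eigenvalue s \<Omega> q \<longleftrightarrow>
     (\<exists>v\<in>sobolev_tilde s \<Omega>. \<not> (AE x in lebesgue. v x = 0) \<and>
        (\<forall>\<phi>\<in>test_functions \<Omega>. schroedinger s q \<Omega> v \<phi> = 0))"

text \<open>The standing hypothesis under which the Dirichlet-to-Neumann map is defined.\<close>

definition admissible :: "real \<Rightarrow> 'a::euclidean_space set \<Rightarrow> ('a \<Rightarrow> real) \<Rightarrow> bool" where
  "admissible s \<Omega> q \<longleftrightarrow> q \<in> Linf \<Omega> \<and> \<not> zero_dirichlet_eigenvalue s \<Omega> q"

text \<open>The solution with exterior data f on W is f, extended by zero, plus a correction v. Testing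
  with smooth functions is equivalent, by density, to the weak formulation over
  sobolev_tilde s \<Omega>.\<close>

definition is_correction ::
  "real \<Rightarrow> 'a::euclidean_space set \<Rightarrow> 'a set \<Rightarrow> ('a \<Rightarrow> real) \<Rightarrow> ('a \<Rightarrow> complex) \<Rightarrow> ('a \<Rightarrow> complex) \<Rightarrow> bool"
  where
  "is_correction s \<Omega> W q f v \<longleftrightarrow> v \<in> sobolev_tilde s \<Omega> \<and>
     (\<forall>\<phi>\<in>test_functions \<Omega>. schroedinger s q \<Omega> v \<phi> = - frac_laplacian s (extend_zero W f) \<phi>)"

text \<open>For admissible q the correction is unique up to a null set, so the choice is immaterial.\<close>

definition exterior_solution ::
  "real \<Rightarrow> 'a::euclidean_space set \<Rightarrow> 'a set \<Rightarrow> ('a \<Rightarrow> real) \<Rightarrow> ('a \<Rightarrow> complex) \<Rightarrow> 'a \<Rightarrow> complex" where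
  "exterior_solution s \<Omega> W q f =
     (\<lambda>x. extend_zero W f x + (SOME v. is_correction s \<Omega> W q f v) x)"

definition dn_map ::
  "real \<Rightarrow> 'a::euclidean_space set \<Rightarrow> 'a set \<Rightarrow> ('a \<Rightarrow> real) \<Rightarrow> ('a \<Rightarrow> complex) \<Rightarrow> 'a distr" where
  "dn_map s \<Omega> W q f =
     restrict (frac_laplacian s (exterior_solution s \<Omega> W q f)) (test_functions W)"

text \<open>Operator norm from L2(W) to L2(W) of a map with values in the distributions on W. It is
  infinite if T does not map L2(W) boundedly to L2(W).\<close>

definition L2_bounded_by ::
  "'a::euclidean_space set \<Rightarrow> (('a \<Rightarrow> complex) \<Rightarrow> 'a distr) \<Rightarrow> real \<Rightarrow> bool" where
  "L2_bounded_by W T C \<longleftrightarrow>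
     (\<forall>f\<in>L2 W. \<exists>g\<in>L2 W. (\<forall>\<phi>\<in>test_functions W. T f \<phi> = (\<integral>x. g x * \<phi> x \<partial>lebesgue_on W)) \<and>
        L2_norm W g \<le> C * L2_norm W f)"

definition L2_opnorm ::
  "'a::euclidean_space set \<Rightarrow> (('a \<Rightarrow> complex) \<Rightarrow> 'a distr) \<Rightarrow> ereal" where
  "L2_opnorm W T = Inf {ereal C |C. 0 \<le> C \<and> L2_bounded_by W T C}"

end

theory Submission
  imports Defs "HOL-Probability.Characteristic_Functions"
begin

text \<open>The statement is proved by counting: there are far more separated potentials than there are
  distinguishable Dirichlet-to-Neumann maps, so two separated potentials must have almost the same
  map.

  Many potentials. A grid of M points per coordinate carries disjointly supported bumps of height
  \<epsilon> and width of order 1/M. Their derivatives of order at most m are of size \<epsilon> M^m, hence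
  bounded when M is of size \<epsilon>^(-1/m). Choosing a set of grid points gives 2^(M^n) perturbations of
  q0 with values in [0, \<epsilon>], any two of which differ by exactly \<epsilon> at some point (bumps_family).

  Few maps. For potentials below the constant pot_bound, which plays the part of r0, the Dirichlet
  form is coercive by a Poincare inequality (sform_coercive), so that the problem is uniquely
  solvable with a uniform bound (weak_solution_exists, weak_solution_bound) and no zero eigenvalue
  occurs (no_zero_eigenvalue). On functions supported outside B_1 the fractional Laplacian is
  visible in B_1 only through its kernel c |x - y|^(-n-2s) with |x| < 1 and 2 < |y| < 3, where it is
  smooth (frac_laplacian_kernel). There the kernel is approximated, with error of order (18/19)^L, by
  a sum of (2L+1)^n products of a monomial in x and a function of y (kernel_finite_rank). Up to that
  error the map of q is determined by the matrix of moments: the integrals over B_1 of a monomial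
  times the solution with another monomial as right-hand side (dn_difference_bound). The moments
  are uniformly bounded (moment_bound). It therefore suffices to record finitely many numbers with
  an accuracy that is exponentially small in L, which distinguishes at most exp (C L^(2n+1)) maps.

  Comparison. Put X = \<epsilon>^(-\<gamma>) with \<gamma> = n / ((2n+3) m), and let L be a multiple of X. The error is
  then below exp (-X), there are exp (C X^(2n+1)) classes of maps, and there are exp (c X^(2n+3))
  potentials, because M^n is of size \<epsilon>^(-n/m) = X^(2n+3) (parameter_choice, grid_resolution). For
  small \<epsilon> the pigeonhole principle (pigeonhole_complex_vectors) gives two potentials in one class.

  The analytic groundwork is Plancherel's theorem, proved by Gaussian regularization, and the kernel
  formula, proved by writing |\<xi>|^(2s) as an integral of 1 - exp (-t |\<xi>|^2) over t, which reduces it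
  to the heat kernel.\<close>

section \<open>Square-integrable functions\<close>

text \<open>An arbitrary measure is allowed, because the argument moves between Lebesgue measure, its Borel
  restriction and the restriction to the exterior domain.\<close>

definition sq_int :: "'a measure \<Rightarrow> ('a \<Rightarrow> complex) \<Rightarrow> bool" where
  "sq_int M f \<longleftrightarrow> f \<in> borel_measurable M \<and> integrable M (\<lambda>x. (cmod (f x))\<^sup>2)"

definition norm2 :: "'a measure \<Rightarrow> ('a \<Rightarrow> complex) \<Rightarrow> real" where
  "norm2 M f = sqrt (\<integral>x. (cmod (f x))\<^sup>2 \<partial>M)"

lemma sq_int_measurable [measurable_dest]: "sq_int M f \<Longrightarrow> f \<in> borel_measurable M"
  by (simp add: sq_int_def)

lemma sq_int_integrable: "sq_int M f \<Longrightarrow> integrable M (\<lambda>x. (cmod (f x))\<^sup>2)"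
  by (simp add: sq_int_def)

lemma norm2_nonneg [simp]: "0 \<le> norm2 M f"
  by (simp add: norm2_def)

lemma norm2_squared: "(norm2 M f)\<^sup>2 = (\<integral>x. (cmod (f x))\<^sup>2 \<partial>M)"
  by (simp add: norm2_def)

lemma sq_int_bound:
  assumes "sq_int M g" "f \<in> borel_measurable M" "AE x in M. cmod (f x) \<le> c * cmod (g x)"
  shows "sq_int M f"
proof -
  have "integrable M (\<lambda>x. c\<^sup>2 * (cmod (g x))\<^sup>2)"
    using assms(1) by (auto simp: sq_int_def)
  then have "integrable M (\<lambda>x. (cmod (f x))\<^sup>2)"
  proof (rule Bochner_Integration.integrable_bound)
    show "AE x in M. norm ((cmod (f x))\<^sup>2) \<le> norm (c\<^sup>2 * (cmod (g x))\<^sup>2)"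
      using assms(3) by eventually_elim (simp add: power_mono flip: power_mult_distrib)
  qed (use assms(2) in measurable)
  then show ?thesis using assms by (simp add: sq_int_def)
qed

lemma norm2_bound:
  assumes "sq_int M g" "f \<in> borel_measurable M" "AE x in M. cmod (f x) \<le> c * cmod (g x)" "c \<ge> 0"
  shows "norm2 M f \<le> c * norm2 M g"
proof -
  have f: "sq_int M f" using sq_int_bound[OF assms(1-3)] .
  have "(\<integral>x. (cmod (f x))\<^sup>2 \<partial>M) \<le> (\<integral>x. c\<^sup>2 * (cmod (g x))\<^sup>2 \<partial>M)"
  proof (rule integral_mono_AE)
    show "AE x in M. (cmod (f x))\<^sup>2 \<le> c\<^sup>2 * (cmod (g x))\<^sup>2"
      using assms(3) by eventually_elim (simp add: power_mono flip: power_mult_distrib)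
  qed (use f assms(1) in \<open>auto simp: sq_int_def\<close>)
  then have "norm2 M f \<le> sqrt (c\<^sup>2 * (\<integral>x. (cmod (g x))\<^sup>2 \<partial>M))"
    by (simp add: norm2_def)
  then show ?thesis using assms(4) by (simp add: norm2_def real_sqrt_mult)
qed

lemma sq_int_cong_AE:
  "sq_int M g \<Longrightarrow> f \<in> borel_measurable M \<Longrightarrow> AE x in M. f x = g x \<Longrightarrow> sq_int M f"
  by (rule sq_int_bound[of M g f 1]) auto

lemma norm2_cong_AE:
  assumes "f \<in> borel_measurable M" "g \<in> borel_measurable M" "AE x in M. f x = g x"
  shows "norm2 M f = norm2 M g"
  unfolding norm2_def
  using assms by (intro arg_cong[where f=sqrt] integral_cong_AE) auto

lemma sq_int_add:
  assumes "sq_int M f" "sq_int M g"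
  shows "sq_int M (\<lambda>x. f x + g x)"
proof -
  have "integrable M (\<lambda>x. 2 * (cmod (f x))\<^sup>2 + 2 * (cmod (g x))\<^sup>2)"
    using assms by (auto simp: sq_int_def)
  then have "integrable M (\<lambda>x. (cmod (f x + g x))\<^sup>2)"
  proof (rule Bochner_Integration.integrable_bound)
    have "(cmod (f x + g x))\<^sup>2 \<le> 2 * (cmod (f x))\<^sup>2 + 2 * (cmod (g x))\<^sup>2" for x
    proof -
      have "(cmod (f x + g x))\<^sup>2 \<le> (cmod (f x) + cmod (g x))\<^sup>2"
        by (simp add: norm_triangle_ineq power_mono)
      also have "\<dots> \<le> 2 * (cmod (f x))\<^sup>2 + 2 * (cmod (g x))\<^sup>2"
        using sum_squares_bound[of "cmod (f x)" "cmod (g x)"] by (simp add: power2_sum)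
      finally show ?thesis .
    qed
    then show "AE x in M. norm ((cmod (f x + g x))\<^sup>2)
        \<le> norm (2 * (cmod (f x))\<^sup>2 + 2 * (cmod (g x))\<^sup>2)" by simp
  qed (use assms in \<open>auto simp: sq_int_def\<close>)
  then show ?thesis using assms by (auto simp: sq_int_def)
qed

lemma sq_int_cmult: "sq_int M f \<Longrightarrow> sq_int M (\<lambda>x. c * f x)"
  by (rule sq_int_bound[of M f _ "cmod c"]) (auto simp: norm_mult sq_int_def)

lemma sq_int_uminus: "sq_int M f \<Longrightarrow> sq_int M (\<lambda>x. - f x)"
  using sq_int_cmult[of M f "-1"] by simp

lemma sq_int_diff: "sq_int M f \<Longrightarrow> sq_int M g \<Longrightarrow> sq_int M (\<lambda>x. f x - g x)"
  using sq_int_add[of M f "\<lambda>x. - g x"] sq_int_uminus[of M g] by simp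

lemma sq_int_cnj: "sq_int M f \<Longrightarrow> sq_int M (\<lambda>x. cnj (f x))"
  by (auto simp: sq_int_def intro: measurable_compose[OF _ borel_measurable_continuous_onI[OF continuous_on_cnj[OF continuous_on_id]]])

lemma sq_int_zero [simp]: "sq_int M (\<lambda>x. 0)"
  by (simp add: sq_int_def)

lemma sq_int_sum:
  "finite I \<Longrightarrow> (\<And>i. i \<in> I \<Longrightarrow> sq_int M (f i)) \<Longrightarrow> sq_int M (\<lambda>x. \<Sum>i\<in>I. f i x)"
  by (induction I rule: finite_induct) (auto intro: sq_int_add)

lemmas sq_int_intros = sq_int_add sq_int_diff sq_int_cmult sq_int_uminus sq_int_cnj

lemma norm2_cnj [simp]: "norm2 M (\<lambda>x. cnj (f x)) = norm2 M f"
  by (simp add: norm2_def)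

lemma norm2_zero [simp]: "norm2 M (\<lambda>x. 0) = 0"
  by (simp add: norm2_def)

lemma norm2_cmult: "norm2 M (\<lambda>x. c * f x) = cmod c * norm2 M f"
  by (simp add: norm2_def norm_mult power_mult_distrib real_sqrt_mult)

lemma norm2_uminus [simp]: "norm2 M (\<lambda>x. - f x) = norm2 M f"
  by (simp add: norm2_def)

lemma norm2_minus_commute: "norm2 M (\<lambda>x. f x - g x) = norm2 M (\<lambda>x. g x - f x)"
  by (simp add: norm2_def norm_minus_commute)

lemma sq_int_mult_integrable:
  assumes "sq_int M f" "sq_int M g"
  shows "integrable M (\<lambda>x. f x * g x)"
proof -
  have "integrable M (\<lambda>x. (cmod (f x))\<^sup>2 + (cmod (g x))\<^sup>2)"
    using assms by (auto simp: sq_int_def)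
  then show ?thesis
  proof (rule Bochner_Integration.integrable_bound)
    show "AE x in M. norm (f x * g x) \<le> norm ((cmod (f x))\<^sup>2 + (cmod (g x))\<^sup>2)"
    proof (rule AE_I2)
      fix x
      have "2 * (cmod (f x) * cmod (g x)) \<le> (cmod (f x))\<^sup>2 + (cmod (g x))\<^sup>2"
        using sum_squares_bound[of "cmod (f x)" "cmod (g x)"] by simp
      moreover have "0 \<le> cmod (f x) * cmod (g x)" by simp
      ultimately show "norm (f x * g x) \<le> norm ((cmod (f x))\<^sup>2 + (cmod (g x))\<^sup>2)"
        unfolding norm_mult real_norm_def by linarith
    qed
  qed (use assms in \<open>auto simp: sq_int_def\<close>)
qed

lemma Cauchy_Schwarz_norm2_abs:
  assumes "sq_int M f" "sq_int M g"
  shows "(\<integral>x. cmod (f x) * cmod (g x) \<partial>M) \<le> norm2 M f * norm2 M g"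
proof -
  define I where "I = (\<integral>x. cmod (f x) * cmod (g x) \<partial>M)"
  have int: "integrable M (\<lambda>x. cmod (f x) * cmod (g x))"
    using integrable_norm[OF sq_int_mult_integrable[OF assms]] by (simp add: norm_mult)
  have I0: "I \<ge> 0" unfolding I_def by (intro integral_nonneg_AE) auto
  have [measurable]: "f \<in> borel_measurable M" "g \<in> borel_measurable M"
    using assms by (auto simp: sq_int_def)
  have "(\<integral>\<^sup>+x. ennreal (cmod (f x)) * ennreal (cmod (g x)) \<partial>M)\<^sup>2
      \<le> (\<integral>\<^sup>+x. (ennreal (cmod (f x)))^2 \<partial>M) * (\<integral>\<^sup>+x. (ennreal (cmod (g x)))^2 \<partial>M)"
    by (rule Cauchy_Schwarz_nn_integral) auto
  also have "(\<integral>\<^sup>+x. ennreal (cmod (f x)) * ennreal (cmod (g x)) \<partial>M) = ennreal I"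
    unfolding I_def using int by (subst nn_integral_eq_integral[symmetric]) (auto simp: ennreal_mult)
  also have "(\<integral>\<^sup>+x. (ennreal (cmod (f x)))^2 \<partial>M) = ennreal ((norm2 M f)\<^sup>2)"
    unfolding norm2_squared using assms
    by (subst nn_integral_eq_integral[symmetric]) (auto simp: sq_int_def ennreal_power)
  also have "(\<integral>\<^sup>+x. (ennreal (cmod (g x)))^2 \<partial>M) = ennreal ((norm2 M g)\<^sup>2)"
    unfolding norm2_squared using assms
    by (subst nn_integral_eq_integral[symmetric]) (auto simp: sq_int_def ennreal_power)
  finally have "ennreal (I\<^sup>2) \<le> ennreal ((norm2 M f * norm2 M g)\<^sup>2)"
    using I0 by (simp add: ennreal_power power_mult_distrib flip: ennreal_mult)
  then have "I\<^sup>2 \<le> (norm2 M f * norm2 M g)\<^sup>2" by simp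
  then show ?thesis unfolding I_def by (rule power2_le_imp_le) simp
qed

lemma Cauchy_Schwarz_norm2:
  assumes "sq_int M f" "sq_int M g"
  shows "cmod (\<integral>x. f x * g x \<partial>M) \<le> norm2 M f * norm2 M g"
proof -
  have "cmod (\<integral>x. f x * g x \<partial>M) \<le> (\<integral>x. cmod (f x * g x) \<partial>M)" by (rule integral_norm_bound)
  also have "\<dots> \<le> norm2 M f * norm2 M g"
    using Cauchy_Schwarz_norm2_abs[OF assms] by (simp add: norm_mult)
  finally show ?thesis .
qed

lemma norm2_triangle:
  assumes "sq_int M f" "sq_int M g"
  shows "norm2 M (\<lambda>x. f x + g x) \<le> norm2 M f + norm2 M g"
proof -
  have int: "integrable M (\<lambda>x. cmod (f x) * cmod (g x))"
    using integrable_norm[OF sq_int_mult_integrable[OF assms]] by (simp add: norm_mult)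
  have "(norm2 M (\<lambda>x. f x + g x))\<^sup>2
      \<le> (\<integral>x. (cmod (f x))\<^sup>2 + (cmod (g x))\<^sup>2 + 2 * (cmod (f x) * cmod (g x)) \<partial>M)"
    unfolding norm2_squared
  proof (rule integral_mono)
    show "(cmod (f x + g x))\<^sup>2 \<le> (cmod (f x))\<^sup>2 + (cmod (g x))\<^sup>2 + 2 * (cmod (f x) * cmod (g x))" for x
      using power_mono[OF norm_triangle_ineq[of "f x" "g x"], of 2] by (simp add: power2_sum)
  qed (use assms sq_int_add[OF assms] int in \<open>auto simp: sq_int_def\<close>)
  also have "\<dots> = (norm2 M f)\<^sup>2 + (norm2 M g)\<^sup>2 + 2 * (\<integral>x. cmod (f x) * cmod (g x) \<partial>M)"
    unfolding norm2_squared using assms int by (simp add: sq_int_def)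
  also have "\<dots> \<le> (norm2 M f + norm2 M g)\<^sup>2"
    using Cauchy_Schwarz_norm2_abs[OF assms] by (simp add: power2_sum)
  finally show ?thesis by (rule power2_le_imp_le) simp
qed

lemma norm2_triangle_diff:
  assumes "sq_int M f" "sq_int M g" "sq_int M h"
  shows "norm2 M (\<lambda>x. f x - h x) \<le> norm2 M (\<lambda>x. f x - g x) + norm2 M (\<lambda>x. g x - h x)"
  using norm2_triangle[of M "\<lambda>x. f x - g x" "\<lambda>x. g x - h x"] assms by (simp add: sq_int_diff)

lemma norm2_diff_bound:
  assumes "sq_int M f" "sq_int M g"
  shows "\<bar>norm2 M f - norm2 M g\<bar> \<le> norm2 M (\<lambda>x. f x - g x)"
  using norm2_triangle[of M "\<lambda>x. f x - g x" g] norm2_triangle[of M "\<lambda>x. g x - f x" f] assms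
  by (simp add: sq_int_diff norm2_minus_commute[of M g f])

lemma norm2_eq_0_AE:
  assumes "sq_int M f" "norm2 M f = 0"
  shows "AE x in M. f x = 0"
proof -
  have "(\<integral>x. (cmod (f x))\<^sup>2 \<partial>M) = 0" using assms(2) by (simp add: norm2_def)
  then show ?thesis
    using assms(1) by (subst (asm) integral_nonneg_eq_0_iff_AE) (auto simp: sq_int_def)
qed

lemma norm2_limit_unique:
  assumes "\<And>k. sq_int M (f k)" "sq_int M g" "sq_int M h"
    "(\<lambda>k. norm2 M (\<lambda>x. f k x - g x)) \<longlonglongrightarrow> 0" "(\<lambda>k. norm2 M (\<lambda>x. f k x - h x)) \<longlonglongrightarrow> 0"
  shows "AE x in M. g x = h x"
proof -
  have "norm2 M (\<lambda>x. g x - h x) \<le> 0"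
  proof (rule LIMSEQ_le_const)
    show "(\<lambda>k. norm2 M (\<lambda>x. f k x - g x) + norm2 M (\<lambda>x. f k x - h x)) \<longlonglongrightarrow> 0"
      using tendsto_add[OF assms(4,5)] by simp
    show "\<exists>N. \<forall>n\<ge>N. norm2 M (\<lambda>x. g x - h x)
        \<le> norm2 M (\<lambda>x. f n x - g x) + norm2 M (\<lambda>x. f n x - h x)"
      using norm2_triangle_diff[OF assms(2) assms(1) assms(3)]
      by (auto simp: norm2_minus_commute[of M g])
  qed
  then have "norm2 M (\<lambda>x. g x - h x) = 0" using norm2_nonneg[of M] by (simp add: antisym)
  from norm2_eq_0_AE[OF sq_int_diff[OF assms(2,3)] this] show ?thesis by simp
qed

lemma norm2_tendsto:
  assumes "\<And>k. sq_int M (f k)" "sq_int M g" "(\<lambda>k. norm2 M (\<lambda>x. f k x - g x)) \<longlonglongrightarrow> 0"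
  shows "(\<lambda>k. norm2 M (f k)) \<longlonglongrightarrow> norm2 M g"
proof -
  have "(\<lambda>k. norm2 M (f k) - norm2 M g) \<longlonglongrightarrow> 0"
    by (rule Lim_null_comparison[OF _ assms(3)])
       (auto intro!: always_eventually norm2_diff_bound assms)
  then show ?thesis by (simp add: LIM_zero_iff)
qed

lemma integral_mult_tendsto:
  assumes "\<And>k. sq_int M (f k)" "sq_int M g" "(\<lambda>k. norm2 M (\<lambda>x. f k x - g x)) \<longlonglongrightarrow> 0"
    "sq_int M h"
  shows "(\<lambda>k. \<integral>x. f k x * h x \<partial>M) \<longlonglongrightarrow> (\<integral>x. g x * h x \<partial>M)"
proof -
  have "(\<lambda>k. (\<integral>x. f k x * h x \<partial>M) - (\<integral>x. g x * h x \<partial>M)) \<longlonglongrightarrow> 0"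
  proof (rule Lim_null_comparison)
    show "(\<lambda>k. norm2 M (\<lambda>x. f k x - g x) * norm2 M h) \<longlonglongrightarrow> 0"
      using tendsto_mult_right[OF assms(3), of "norm2 M h"] by simp
    show "\<forall>\<^sub>F k in sequentially. norm ((\<integral>x. f k x * h x \<partial>M) - (\<integral>x. g x * h x \<partial>M))
        \<le> norm2 M (\<lambda>x. f k x - g x) * norm2 M h"
    proof (intro always_eventually allI)
      fix k
      have "(\<integral>x. f k x * h x \<partial>M) - (\<integral>x. g x * h x \<partial>M) = (\<integral>x. (f k x - g x) * h x \<partial>M)"
        using assms by (simp add: sq_int_mult_integrable left_diff_distrib)
      then show "norm ((\<integral>x. f k x * h x \<partial>M) - (\<integral>x. g x * h x \<partial>M))
          \<le> norm2 M (\<lambda>x. f k x - g x) * norm2 M h"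
        using Cauchy_Schwarz_norm2[OF sq_int_diff[OF assms(1) assms(2)] assms(4)] by simp
    qed
  qed
  then show ?thesis by (simp add: LIM_zero_iff)
qed

lemma norm2_nn_integral:
  assumes "sq_int M f"
  shows "(\<integral>\<^sup>+x. ennreal ((cmod (f x))\<^sup>2) \<partial>M) = ennreal ((norm2 M f)\<^sup>2)"
  unfolding norm2_squared using assms by (subst nn_integral_eq_integral) (auto simp: sq_int_def)

text \<open>Passing to the limit under the norm needs only almost everywhere convergence, by Fatou's lemma.\<close>

lemma sq_int_Fatou:
  assumes f: "\<And>k. sq_int M (f k)" and bd: "\<And>k. norm2 M (f k) \<le> c"
    and g: "g \<in> borel_measurable M" and lim: "AE x in M. (\<lambda>k. f k x) \<longlonglongrightarrow> g x"
  shows "sq_int M g" "norm2 M g \<le> c"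
proof -
  have c: "c \<ge> 0" using bd[of 0] norm2_nonneg[of M "f 0"] by linarith
  have [measurable]: "f k \<in> borel_measurable M" for k using f by (auto simp: sq_int_def)
  note g[measurable]
  have "(\<integral>\<^sup>+x. ennreal ((cmod (g x))\<^sup>2) \<partial>M)
      = (\<integral>\<^sup>+x. liminf (\<lambda>k. ennreal ((cmod (f k x))\<^sup>2)) \<partial>M)"
  proof (rule nn_integral_cong_AE)
    show "AE x in M. ennreal ((cmod (g x))\<^sup>2) = liminf (\<lambda>k. ennreal ((cmod (f k x))\<^sup>2))"
      using lim
    proof eventually_elim
      case (elim x)
      then have "(\<lambda>k. ennreal ((cmod (f k x))\<^sup>2)) \<longlonglongrightarrow> ennreal ((cmod (g x))\<^sup>2)"
        by (intro tendsto_intros)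
      then show ?case by (intro lim_imp_Liminf[symmetric]) auto
    qed
  qed
  also have "\<dots> \<le> liminf (\<lambda>k. \<integral>\<^sup>+x. ennreal ((cmod (f k x))\<^sup>2) \<partial>M)"
    by (rule nn_integral_liminf) measurable
  also have "\<dots> \<le> liminf (\<lambda>k. ennreal (c\<^sup>2))"
    by (intro Liminf_mono always_eventually allI)
       (simp add: norm2_nn_integral[OF f] power_mono[OF bd])
  also have "\<dots> = ennreal (c\<^sup>2)" by (simp add: Liminf_const)
  finally have *: "(\<integral>\<^sup>+x. ennreal ((cmod (g x))\<^sup>2) \<partial>M) \<le> ennreal (c\<^sup>2)" .
  have "integrable M (\<lambda>x. (cmod (g x))\<^sup>2)"
    by (rule integrableI_bounded) (use * in \<open>auto simp: less_top[symmetric] top_unique\<close>)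
  then show 1: "sq_int M g" by (simp add: sq_int_def)
  from * have "(norm2 M g)\<^sup>2 \<le> c\<^sup>2" using norm2_nn_integral[OF 1] by simp
  then show "norm2 M g \<le> c" using c by (rule power2_le_imp_le)
qed

text \<open>The Riesz--Fischer argument: along a subsequence whose increments have summable norms, the sum of
  the absolute increments is square integrable, hence finite almost everywhere. So the subsequence
  converges almost everywhere, and Fatou's lemma turns this into convergence in norm.\<close>

lemma sq_int_complete:
  assumes f: "\<And>k. sq_int M (f k)"
    and cau: "\<And>e. e > 0 \<Longrightarrow> \<exists>N. \<forall>k\<ge>N. \<forall>l\<ge>N. norm2 M (\<lambda>x. f k x - f l x) \<le> e"
  obtains g where "sq_int M g" "(\<lambda>k. norm2 M (\<lambda>x. f k x - g x)) \<longlonglongrightarrow> 0"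
proof -
  have [measurable]: "f k \<in> borel_measurable M" for k using f by (auto simp: sq_int_def)
  have "\<exists>N. \<forall>k\<ge>N. \<forall>l\<ge>N. norm2 M (\<lambda>x. f k x - f l x) \<le> (1/2)^j" for j::nat
    by (rule cau) simp
  then obtain N where N: "\<And>j k l. k \<ge> N j \<Longrightarrow> l \<ge> N j \<Longrightarrow> norm2 M (\<lambda>x. f k x - f l x) \<le> (1/2)^j"
    by metis
  \<comment> \<open>r j dominates all thresholds N 0, ..., N j, so the increments of h have norm at most 2^(-j).\<close>
  define r where "r j = (\<Sum>i\<le>j. N i) + j" for j
  have r: "r j \<ge> N i" if "i \<le> j" for i j
    using that by (auto simp: r_def intro!: trans_le_add1 member_le_sum[where f=N])
  have rj: "r j \<ge> j" for j by (simp add: r_def)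
  define h where "h j = f (r j)" for j
  have h: "sq_int M (h j)" for j by (simp add: h_def f)
  have [measurable]: "h j \<in> borel_measurable M" for j by (simp add: h_def)
  define d where "d j x = h (Suc j) x - h j x" for j x
  have d: "sq_int M (d j)" for j unfolding d_def by (intro sq_int_diff h)
  have [measurable]: "d j \<in> borel_measurable M" for j using d by (auto simp: sq_int_def)
  have dn: "norm2 M (d j) \<le> (1/2)^j" for j
    unfolding d_def h_def by (rule N) (auto intro: r)
  define S where "S k x = complex_of_real (\<Sum>j<k. cmod (d j x))" for k x
  have S: "sq_int M (S k)" "norm2 M (S k) \<le> (\<Sum>j<k. (1/2)^j)" for k
  proof (induction k)
    case (Suc k)
    have *: "S (Suc k) = (\<lambda>x. S k x + complex_of_real (cmod (d k x)))"
      by (auto simp: S_def)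
    have D: "sq_int M (\<lambda>x. complex_of_real (cmod (d k x)))"
      using d[of k] by (auto simp: sq_int_def)
    have Dn: "norm2 M (\<lambda>x. complex_of_real (cmod (d k x))) = norm2 M (d k)" by (simp add: norm2_def)
    { case 1 show ?case unfolding * using Suc D by (intro sq_int_add) }
    { case 2 show ?case unfolding *
        using norm2_triangle[OF Suc(1) D] Suc(2) dn[of k] by (simp add: Dn) }
  next
    case 0
    have "S 0 = (\<lambda>x. 0)" by (auto simp: S_def)
    { case 1 then show ?case using \<open>S 0 = _\<close> by simp }
    { case 2 then show ?case using \<open>S 0 = _\<close> by simp }
  qed
  have geo: "(\<Sum>j<k. (1/2::real)^j) \<le> 2" for k
    by (simp add: sum_gp_strict)
  have "(\<integral>\<^sup>+x. (SUP k. ennreal ((cmod (S k x))\<^sup>2)) \<partial>M) = (SUP k. \<integral>\<^sup>+x. ennreal ((cmod (S k x))\<^sup>2) \<partial>M)"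
  proof (rule nn_integral_monotone_convergence_SUP)
    show "incseq (\<lambda>k x. ennreal ((cmod (S k x))\<^sup>2))"
    proof (rule incseq_SucI, rule le_funI)
      fix k x
      have "(\<Sum>j<k. cmod (d j x)) \<ge> 0" by (intro sum_nonneg) auto
      then have "cmod (S k x) \<le> cmod (S (Suc k) x)"
        unfolding S_def norm_of_real by simp
      then show "ennreal ((cmod (S k x))\<^sup>2) \<le> ennreal ((cmod (S (Suc k) x))\<^sup>2)"
        by (intro ennreal_leI power_mono) auto
    qed
  qed (unfold S_def, measurable)
  also have "\<dots> \<le> ennreal (2\<^sup>2)"
  proof (rule SUP_least)
    fix k
    have "norm2 M (S k) \<le> 2" using S(2)[of k] geo[of k] by linarith
    then show "(\<integral>\<^sup>+x. ennreal ((cmod (S k x))\<^sup>2) \<partial>M) \<le> ennreal (2\<^sup>2)"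
      unfolding norm2_nn_integral[OF S(1)] by (intro ennreal_leI power_mono) auto
  qed
  finally have "(\<integral>\<^sup>+x. (SUP k. ennreal ((cmod (S k x))\<^sup>2)) \<partial>M) \<noteq> \<infinity>"
    by (auto simp: top_unique)
  then have "AE x in M. (SUP k. ennreal ((cmod (S k x))\<^sup>2)) \<noteq> \<infinity>"
    by (intro nn_integral_PInf_AE) (unfold S_def, measurable)
  then have conv: "AE x in M. convergent (\<lambda>k. h k x)"
  proof eventually_elim
    case (elim x)
    then obtain B where B: "B \<ge> 0" "(SUP k. ennreal ((cmod (S k x))\<^sup>2)) = ennreal B"
      by (cases "SUP k. ennreal ((cmod (S k x))\<^sup>2)") auto
    have "(\<Sum>j<k. cmod (d j x)) \<le> sqrt B" for k
    proof -
      have "ennreal ((cmod (S k x))\<^sup>2) \<le> ennreal B" unfolding B(2)[symmetric] by (rule SUP_upper) simp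
      then have "(cmod (S k x))\<^sup>2 \<le> B" using B(1) by simp
      then have "cmod (S k x) \<le> sqrt B" by (simp add: real_le_rsqrt)
      then show ?thesis unfolding S_def norm_of_real by linarith
    qed
    then have "summable (\<lambda>j. cmod (d j x))"
      by (intro summableI_nonneg_bounded[of _ "sqrt B"]) auto
    then have "summable (\<lambda>j. d j x)" by (rule summable_norm_cancel)
    then have "convergent (\<lambda>k. \<Sum>j<k. d j x)" by (simp add: summable_iff_convergent)
    moreover have "(\<Sum>j<k. d j x) = h k x - h 0 x" for k
      unfolding d_def by (rule sum_lessThan_telescope)
    ultimately have "convergent (\<lambda>k. h k x - h 0 x)" by simp
    from convergent_add[OF this convergent_const[of "h 0 x"]] show ?case by simp
  qed
  define g where "g x = lim (\<lambda>k. h k x)" for x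
  have gm[measurable]: "g \<in> borel_measurable M"
    unfolding g_def by (rule borel_measurable_lim_metric) measurable
  have lim: "AE x in M. (\<lambda>k. h k x) \<longlonglongrightarrow> g x"
    using conv by eventually_elim (simp add: g_def convergent_LIMSEQ_iff)
  have *: "sq_int M (\<lambda>x. f k x - g x)" "norm2 M (\<lambda>x. f k x - g x) \<le> (1/2)^j" if "k \<ge> N j" for k j
  proof -
    have "AE x in M. (\<lambda>i. f k x - h (i+j) x) \<longlonglongrightarrow> f k x - g x"
      using lim by eventually_elim (intro tendsto_intros LIMSEQ_ignore_initial_segment)
    moreover have "norm2 M (\<lambda>x. f k x - h (i+j) x) \<le> (1/2)^j" for i
      unfolding h_def by (rule N) (use that in \<open>auto intro: r\<close>)
    ultimately show "sq_int M (\<lambda>x. f k x - g x)" "norm2 M (\<lambda>x. f k x - g x) \<le> (1/2)^j"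
      using sq_int_Fatou[of M "\<lambda>i x. f k x - h (i+j) x" "(1/2)^j" "\<lambda>x. f k x - g x"]
        sq_int_diff[OF f h] by auto
  qed
  have "sq_int M (\<lambda>x. f (N 0) x - (f (N 0) x - g x))"
    by (rule sq_int_diff[OF f *(1)[of 0]]) simp
  then have "sq_int M g" by simp
  moreover have "(\<lambda>k. norm2 M (\<lambda>x. f k x - g x)) \<longlonglongrightarrow> 0"
  proof (rule LIMSEQ_I)
    fix e :: real assume "e > 0"
    then obtain j where j: "(1/2)^j < e" using real_arch_pow_inv[of e "1/2"] by auto
    show "\<exists>no. \<forall>k\<ge>no. norm (norm2 M (\<lambda>x. f k x - g x) - 0) < e"
      using *(2) j by (intro exI[of _ "N j"]) (auto intro: le_less_trans)
  qed
  ultimately show ?thesis using that by blast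
qed

section \<open>Fourier transforms of Gaussians\<close>

lemma measurable_cnj [measurable]: "cnj \<in> borel_measurable borel"
  by (intro borel_measurable_continuous_onI continuous_intros)

lemma lborel_integral_prod:
  fixes f :: "'a::euclidean_space \<Rightarrow> real \<Rightarrow> complex"
  assumes "\<And>b. b \<in> Basis \<Longrightarrow> integrable lborel (f b)"
  shows "integrable lborel (\<lambda>x::'a. \<Prod>b\<in>Basis. f b (x \<bullet> b))"
    and "(\<integral>x. (\<Prod>b\<in>Basis. f b (x \<bullet> b)) \<partial>lborel) = (\<Prod>b\<in>Basis. \<integral>x. f b x \<partial>lborel)"
proof -
  interpret product_sigma_finite "\<lambda>b::'a. lborel :: real measure" by standard
  have [measurable]: "f b \<in> borel_measurable borel" if "b \<in> Basis" for b
    using assms[OF that] by auto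
  have m: "(\<lambda>x::'a. \<Prod>b\<in>Basis. f b (x \<bullet> b)) \<in> borel_measurable borel" by measurable
  have eq: "(\<Prod>b\<in>Basis. f b ((\<Sum>c\<in>Basis. x c *\<^sub>R c) \<bullet> b)) = (\<Prod>b\<in>Basis. f b (x b))" for x :: "'a \<Rightarrow> real"
    by (intro prod.cong) auto
  have T: "(\<lambda>x. \<Sum>c\<in>Basis. x c *\<^sub>R c) \<in> (\<Pi>\<^sub>M b\<in>(Basis::'a set). lborel) \<rightarrow>\<^sub>M borel" by measurable
  show "integrable lborel (\<lambda>x::'a. \<Prod>b\<in>Basis. f b (x \<bullet> b))"
    by (subst lborel_eq, subst integrable_distr_eq[OF T m], subst eq)
       (rule product_integrable_prod[OF finite_Basis assms])
  show "(\<integral>x. (\<Prod>b\<in>Basis. f b (x \<bullet> b)) \<partial>lborel) = (\<Prod>b\<in>Basis. \<integral>x. f b x \<partial>lborel)"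
    by (subst lborel_eq, subst integral_distr[OF T m], subst eq)
       (rule product_integral_prod[OF finite_Basis assms])
qed

text \<open>The characteristic function of the normal distribution, rescaled.\<close>

lemma gaussian_fourier_1:
  fixes t x :: real
  assumes "t > 0"
  shows "integrable lborel (\<lambda>\<xi>. iexp (x * \<xi>) * of_real (exp (- t * \<xi>\<^sup>2)))" (is ?int)
    and "(\<integral>\<xi>. iexp (x * \<xi>) * of_real (exp (- t * \<xi>\<^sup>2)) \<partial>lborel)
      = of_real (sqrt (pi / t) * exp (- x\<^sup>2 / (4 * t)))" (is ?eq)
proof -
  define c where "c = sqrt (2 * t)"
  have c: "c > 0" "c\<^sup>2 = 2 * t" using assms by (auto simp: c_def)
  define h where "h u = iexp (x / c * u) * of_real (std_normal_density u)" for u :: real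
  have hi: "integrable lborel h"
    unfolding h_def
  proof (rule Bochner_Integration.integrable_bound)
    show "integrable lborel std_normal_density" by (simp add: integrable_normal_density)
  qed (auto simp: norm_mult)
  have hI: "integral\<^sup>L lborel h = of_real (exp (- x\<^sup>2 / (4 * t)))"
  proof -
    have "char std_normal_distribution (x / c) = integral\<^sup>L lborel h"
      unfolding char_def h_def
      by (subst integral_density) (auto simp: scaleR_conv_of_real mult.commute normal_density_nonneg)
    then show ?thesis
      using c by (simp add: char_std_normal_distribution power_divide)
  qed
  have eq: "iexp (x * \<xi>) * of_real (exp (- t * \<xi>\<^sup>2)) = of_real (sqrt (2 * pi)) * h (0 + c * \<xi>)" for \<xi>
    using c by (simp add: h_def std_normal_density_def power_mult_distrib)
  show ?int
    unfolding eq using lborel_integrable_real_affine[OF hi, of c 0] c by (intro integrable_mult_right) auto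
  have "integral\<^sup>L lborel h = c *\<^sub>R (\<integral>\<xi>. h (0 + c * \<xi>) \<partial>lborel)"
    using lborel_integral_real_affine[of c h 0] c by simp
  then have *: "(\<integral>\<xi>. h (0 + c * \<xi>) \<partial>lborel) = of_real (1 / c) * integral\<^sup>L lborel h"
    using c by (simp add: scaleR_conv_of_real)
  have "sqrt (2 * pi) / c = sqrt (pi / t)" unfolding c_def using assms
    by (simp add: real_sqrt_divide[symmetric])
  then have "complex_of_real (sqrt (2 * pi)) * of_real (1 / c) = of_real (sqrt (pi / t))"
    by (metis of_real_mult times_divide_eq_right mult_1_right)
  then show ?eq
    unfolding eq integral_mult_right_zero * hI mult.assoc[symmetric] by simp
qed

lemma norm_squared_Basis: "(norm (v::'a::euclidean_space))\<^sup>2 = (\<Sum>b\<in>Basis. (v \<bullet> b)\<^sup>2)"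
  unfolding power2_norm_eq_inner by (subst euclidean_inner) (simp add: power2_eq_square)

text \<open>The Fourier transform of exp (-t |\<xi>|^2), that is, (2 \<pi>)^n times the heat kernel at time t.\<close>

definition gauss_kernel :: "real \<Rightarrow> 'a::euclidean_space \<Rightarrow> real" where
  "gauss_kernel t z = sqrt (pi / t) ^ DIM('a) * exp (- (norm z)\<^sup>2 / (4 * t))"

lemma gauss_kernel_nonneg: "t > 0 \<Longrightarrow> 0 \<le> gauss_kernel t z"
  by (simp add: gauss_kernel_def)

lemma gauss_kernel_measurable [measurable]: "gauss_kernel t \<in> borel_measurable borel"
  unfolding gauss_kernel_def[abs_def] by measurable

text \<open>Both sides factor over the coordinates.\<close>

lemma gaussian_fourier:
  fixes x :: "'a::euclidean_space"
  assumes "t > 0"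
  shows "integrable lborel (\<lambda>\<xi>::'a. iexp (x \<bullet> \<xi>) * of_real (exp (- t * (norm \<xi>)\<^sup>2)))" (is ?int)
    and "(\<integral>\<xi>. iexp (x \<bullet> \<xi>) * of_real (exp (- t * (norm \<xi>)\<^sup>2)) \<partial>lborel)
      = of_real (gauss_kernel t x)" (is ?eq)
proof -
  define f where "f b y = iexp ((x \<bullet> b) * y) * of_real (exp (- t * y\<^sup>2))" for b :: 'a and y
  have f: "integrable lborel (f b)" for b
    unfolding f_def by (rule gaussian_fourier_1[OF assms])
  have eq: "iexp (x \<bullet> \<xi>) * of_real (exp (- t * (norm \<xi>)\<^sup>2)) = (\<Prod>b\<in>Basis. f b (\<xi> \<bullet> b))" for \<xi>
  proof -
    have "(\<Prod>b\<in>Basis. f b (\<xi> \<bullet> b))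
        = exp (\<Sum>b\<in>Basis. \<i> * of_real ((x \<bullet> b) * (\<xi> \<bullet> b))) * of_real (exp (\<Sum>b\<in>Basis. - t * (\<xi> \<bullet> b)\<^sup>2))"
      by (simp add: f_def prod.distrib exp_sum)
    also have "(\<Sum>b\<in>Basis. \<i> * complex_of_real ((x \<bullet> b) * (\<xi> \<bullet> b))) = \<i> * of_real (x \<bullet> \<xi>)"
      by (subst euclidean_inner[of x \<xi>]) (simp add: sum_distrib_left)
    also have "(\<Sum>b\<in>Basis. - t * (\<xi> \<bullet> b)\<^sup>2) = - t * (norm \<xi>)\<^sup>2"
      by (simp add: norm_squared_Basis sum_distrib_left sum_negf)
    finally show ?thesis by simp
  qed
  show ?int unfolding eq by (rule lborel_integral_prod[OF f])
  have "(\<integral>\<xi>. iexp (x \<bullet> \<xi>) * of_real (exp (- t * (norm \<xi>)\<^sup>2)) \<partial>lborel)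
      = (\<Prod>b\<in>Basis. \<integral>y. f b y \<partial>lborel)"
    unfolding eq by (rule lborel_integral_prod[OF f])
  also have "\<dots> = (\<Prod>b\<in>Basis. of_real (sqrt (pi / t) * exp (- (x \<bullet> b)\<^sup>2 / (4 * t))))"
    unfolding f_def by (intro prod.cong refl gaussian_fourier_1(2)[OF assms])
  also have "\<dots> = of_real (sqrt (pi / t) ^ DIM('a) * exp (\<Sum>b\<in>Basis. - (x \<bullet> b)\<^sup>2 / (4 * t)))"
    by (simp add: prod.distrib exp_sum)
  also have "(\<Sum>b\<in>Basis. - (x \<bullet> b)\<^sup>2 / (4 * t)) = - (norm x)\<^sup>2 / (4 * t)"
    by (simp add: norm_squared_Basis sum_negf flip: sum_divide_distrib)
  finally show ?eq by (simp add: gauss_kernel_def)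
qed

lemma gaussian_integrable:
  "t > 0 \<Longrightarrow> integrable lborel (\<lambda>\<xi>::'a::euclidean_space. exp (- t * (norm \<xi>)\<^sup>2))"
  using integrable_norm[OF gaussian_fourier(1)[of t 0]] by (simp add: norm_mult)

lemma gaussian_integral:
  assumes "t > 0"
  shows "(\<integral>(\<xi>::'a::euclidean_space). exp (- t * (norm \<xi>)\<^sup>2) \<partial>lborel) = sqrt (pi / t) ^ DIM('a)"
proof -
  have "(\<integral>(\<xi>::'a). complex_of_real (exp (- t * (norm \<xi>)\<^sup>2)) \<partial>lborel)
      = complex_of_real (gauss_kernel t (0::'a))"
    using gaussian_fourier(2)[OF assms, of "0::'a"]
    by (simp only: inner_zero_left of_real_0 mult_zero_right exp_zero mult_1_left)
  then have "complex_of_real (\<integral>(\<xi>::'a). exp (- t * (norm \<xi>)\<^sup>2) \<partial>lborel)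
      = complex_of_real (gauss_kernel t (0::'a))"
    by (simp only: integral_complex_of_real)
  then show ?thesis unfolding of_real_eq_iff by (simp add: gauss_kernel_def)
qed

text \<open>The Fourier integral over the Borel-Lebesgue measure, for which Fubini's theorem is available. It
  agrees with the transform over the completed measure by fourier_integral_eq_fint below.\<close>

definition fint :: "('a::euclidean_space \<Rightarrow> complex) \<Rightarrow> 'a \<Rightarrow> complex" where
  "fint f \<xi> = (\<integral>x. iexp (- (x \<bullet> \<xi>)) * f x \<partial>lborel)"

lemma fint_integrable:
  "integrable lborel f \<Longrightarrow> integrable lborel (\<lambda>x::'a::euclidean_space. iexp (x \<bullet> \<xi>) * f x)"
  "integrable lborel f \<Longrightarrow> integrable lborel (\<lambda>x::'a::euclidean_space. iexp (- (x \<bullet> \<xi>)) * f x)"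
  by (rule Bochner_Integration.integrable_bound[of _ f]; auto simp: norm_mult)+

lemma fint_measurable [measurable]:
  assumes [measurable]: "f \<in> borel_measurable borel"
  shows "fint f \<in> borel_measurable borel"
  unfolding fint_def[abs_def] by measurable

lemma integrable_tensor:
  fixes u :: "'a::euclidean_space \<Rightarrow> complex" and w :: "'b::euclidean_space \<Rightarrow> complex"
  assumes u: "integrable lborel u" and w: "integrable lborel w"
  shows "integrable (lborel \<Otimes>\<^sub>M lborel) (\<lambda>p. u (fst p) * w (snd p))"
proof -
  have [measurable]: "u \<in> borel_measurable borel" "w \<in> borel_measurable borel" using assms by auto
  show ?thesis
  proof (rule lborel_pair.Fubini_integrable)
    show "integrable lborel (\<lambda>x. \<integral> y. norm (u (fst (x, y)) * w (snd (x, y))) \<partial>lborel)"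
      using u by (simp add: norm_mult)
    show "AE x in lborel. integrable lborel (\<lambda>y. u (fst (x, y)) * w (snd (x, y)))"
      using w by simp
  qed measurable
qed

lemma fint_mult:
  fixes u w :: "'a::euclidean_space \<Rightarrow> complex"
  assumes u: "integrable lborel u" and w: "integrable lborel w"
  shows "fint u \<xi> * fint w (-\<xi>)
    = (\<integral>p. iexp ((snd p - fst p) \<bullet> \<xi>) * (u (fst p) * w (snd p)) \<partial>(lborel \<Otimes>\<^sub>M lborel))"
proof -
  define U where "U x = iexp (- (x \<bullet> \<xi>)) * u x" for x
  define W where "W x = iexp (x \<bullet> \<xi>) * w x" for x
  have U: "integrable lborel U" unfolding U_def using u by (rule fint_integrable)
  have W: "integrable lborel W" unfolding W_def using w by (rule fint_integrable)
  have "(\<integral>p. iexp ((snd p - fst p) \<bullet> \<xi>) * (u (fst p) * w (snd p)) \<partial>(lborel \<Otimes>\<^sub>M lborel))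
      = (\<integral>p. U (fst p) * W (snd p) \<partial>(lborel \<Otimes>\<^sub>M lborel))"
    unfolding U_def W_def
    by (intro Bochner_Integration.integral_cong refl)
       (simp add: inner_diff_left algebra_simps exp_diff exp_minus divide_simps)
  also have "\<dots> = (\<integral>x. (\<integral>y. U x * W y \<partial>lborel) \<partial>lborel)"
    using lborel_pair.integral_fst'[OF integrable_tensor[OF U W]] by simp
  also have "\<dots> = fint u \<xi> * fint w (-\<xi>)"
    unfolding fint_def U_def W_def by simp
  finally show ?thesis by simp
qed

text \<open>The Gaussian weight makes the integral over the frequency absolutely convergent, so that it
  can be carried out first.\<close>

lemma fint_gaussian_parseval:
  fixes u w :: "'a::euclidean_space \<Rightarrow> complex"
  assumes u: "integrable lborel u" and w: "integrable lborel w" and t: "t > 0"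
  shows "(\<integral>\<xi>. of_real (exp (- t * (norm \<xi>)\<^sup>2)) * (fint u \<xi> * fint w (-\<xi>)) \<partial>lborel)
    = (\<integral>p. of_real (gauss_kernel t (fst p - snd p)) * (u (fst p) * w (snd p)) \<partial>(lborel \<Otimes>\<^sub>M lborel))"
proof -
  have [measurable]: "u \<in> borel_measurable borel" "w \<in> borel_measurable borel" using assms by auto
  define F where "F p \<xi> = iexp ((snd p - fst p) \<bullet> \<xi>) * of_real (exp (- t * (norm \<xi>)\<^sup>2)) * (u (fst p) * w (snd p))"
    for p :: "'a \<times> 'a" and \<xi> :: 'a
  have mfst: "fst \<in> borel_measurable (borel :: ('a \<times> 'a) measure)"
    and msnd: "snd \<in> borel_measurable (borel :: ('a \<times> 'a) measure)"
    by (auto intro!: borel_measurable_continuous_onI continuous_intros)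
  have [measurable]: "(\<lambda>q. fst (fst q)) \<in> borel_measurable ((lborel :: ('a \<times> 'a) measure) \<Otimes>\<^sub>M (lborel :: 'a measure))"
    "(\<lambda>q. snd (fst q)) \<in> borel_measurable ((lborel :: ('a \<times> 'a) measure) \<Otimes>\<^sub>M (lborel :: 'a measure))"
    by (rule measurable_compose[OF measurable_fst]; simp add: mfst msnd)+
  have int: "integrable (lborel \<Otimes>\<^sub>M lborel) (case_prod F)"
  proof (rule Bochner_Integration.integrable_bound)
    show "integrable (lborel \<Otimes>\<^sub>M lborel)
        (\<lambda>q::('a\<times>'a)\<times>'a. (u (fst (fst q)) * w (snd (fst q))) * complex_of_real (exp (- t * (norm (snd q))\<^sup>2)))"
      using integrable_tensor[OF u w] gaussian_integrable[OF t]
      by (intro integrable_tensor[of "\<lambda>p. u (fst p) * w (snd p)" "\<lambda>\<xi>. complex_of_real (exp (- t * (norm \<xi>)\<^sup>2))"]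
            integrable_of_real) (auto simp: lborel_prod)
    show "case_prod F \<in> borel_measurable (lborel \<Otimes>\<^sub>M lborel)"
      unfolding F_def case_prod_beta by measurable
  qed (auto simp: F_def norm_mult)
  have "(\<integral>\<xi>. of_real (exp (- t * (norm \<xi>)\<^sup>2)) * (fint u \<xi> * fint w (-\<xi>)) \<partial>lborel)
      = (\<integral>\<xi>. (\<integral>p. F p \<xi> \<partial>lborel) \<partial>lborel)"
    unfolding fint_mult[OF u w] F_def lborel_prod
    by (simp add: integral_mult_right_zero[symmetric] mult_ac del: integral_mult_right_zero)
  also have "\<dots> = (\<integral>p. (\<integral>\<xi>. F p \<xi> \<partial>lborel) \<partial>lborel)"
    by (rule lborel_pair.Fubini_integral[OF int])
  also have "(\<lambda>p. \<integral>\<xi>. F p \<xi> \<partial>lborel)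
      = (\<lambda>p. of_real (gauss_kernel t (fst p - snd p)) * (u (fst p) * w (snd p)))"
  proof
    fix p :: "'a \<times> 'a"
    have "gauss_kernel t (snd p - fst p) = gauss_kernel t (fst p - snd p)"
      by (simp add: gauss_kernel_def norm_minus_commute)
    then show "(\<integral>\<xi>. F p \<xi> \<partial>lborel) = of_real (gauss_kernel t (fst p - snd p)) * (u (fst p) * w (snd p))"
      unfolding F_def using gaussian_fourier(2)[OF t, of "snd p - fst p"] by simp
  qed
  finally show ?thesis by (simp add: lborel_prod)
qed

lemma lborel_integral_affine:
  fixes g :: "'a::euclidean_space \<Rightarrow> 'b::{banach, second_countable_topology}"
  assumes [measurable]: "g \<in> borel_measurable borel" and c: "c \<noteq> 0"
  shows "(\<integral>x. g x \<partial>lborel) = \<bar>c\<bar> ^ DIM('a) *\<^sub>R (\<integral>x. g (a + c *\<^sub>R x) \<partial>lborel)"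
  by (subst lborel_affine[OF c, of a], subst integral_density)
     (auto simp: integral_distr)

lemma fint_cnj: "fint (\<lambda>x. cnj (u x)) (-\<xi>) = cnj (fint u \<xi>)"
  unfolding fint_def
  by (rule trans[OF _ Bochner_Integration.integral_cnj], intro Bochner_Integration.integral_cong refl) (simp add: exp_cnj)

text \<open>Let the Gaussian weight in the previous identity, applied to u and its conjugate, tend to 1. On
  the space side the Gaussian kernels concentrate at the diagonal, where continuity of u gives the
  limit.\<close>

lemma plancherel_continuous:
  fixes u :: "'a::euclidean_space \<Rightarrow> complex"
  assumes cont: "continuous_on UNIV u" and supp: "\<And>x. norm x \<ge> R \<Longrightarrow> u x = 0"
  shows "integrable lborel (\<lambda>\<xi>. (cmod (fint u \<xi>))\<^sup>2)"
    and "(\<integral>\<xi>. (cmod (fint u \<xi>))\<^sup>2 \<partial>lborel) = (2*pi)^DIM('a) * (\<integral>x. (cmod (u x))\<^sup>2 \<partial>lborel)"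
proof -
  have [measurable]: "u \<in> borel_measurable borel" using cont by (rule borel_measurable_continuous_onI)
  have "compact (u ` cball 0 R)"
    using cont by (intro compact_continuous_image) (auto intro: continuous_on_subset)
  then obtain B0 where "\<forall>z\<in>u ` cball 0 R. norm z \<le> B0"
    using compact_imp_bounded bounded_iff by blast
  then have B0: "\<And>x. norm x \<le> R \<Longrightarrow> cmod (u x) \<le> B0" by auto
  define B where "B = max 0 B0"
  have B: "cmod (u x) \<le> B" "B \<ge> 0" for x
    using B0[of x] supp[of x] by (cases "norm x \<le> R"; force simp: B_def)+
  have int_ind: "integrable lborel (\<lambda>x::'a. B * indicator (cball 0 R) x)"
    by (intro integrable_mult_right integrable_real_indicator emeasure_bounded_finite) auto
  have u: "integrable lborel u"
    by (rule Bochner_Integration.integrable_bound[OF int_ind])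
       (use B supp in \<open>auto simp: indicator_def not_le\<close>)
  have uc: "integrable lborel (\<lambda>x. cnj (u x))" using u by simp
  define n where "n = DIM('a)"
  define t where "t k = 1 / real (Suc k)" for k
  have t: "t k > 0" for k by (simp add: t_def)
  define I where "I k = (\<integral>\<xi>. exp (- t k * (norm \<xi>)\<^sup>2) * (cmod (fint u \<xi>))\<^sup>2 \<partial>lborel)" for k
  define E where "E y = (2 * sqrt pi) ^ n * exp (- (norm y)\<^sup>2)" for y :: 'a
  have E0: "E y \<ge> 0" for y by (simp add: E_def)
  have [measurable]: "E \<in> borel_measurable borel" unfolding E_def[abs_def] by measurable
  \<comment> \<open>In coordinates x + 2 sqrt(t) y centred at x the weight becomes a fixed Gaussian E, so that g converges
  by dominated convergence.\<close>
  define g where "g k x = (\<integral>y. of_real (E y) * cnj (u (x + (2 * sqrt (t k)) *\<^sub>R y)) \<partial>lborel)"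
    for k and x :: 'a
  have gi: "integrable lborel (\<lambda>y::'a. E y * B)"
    using gaussian_integrable[of 1, where 'a='a] by (simp add: E_def)
  have gbound: "cmod (g k x) \<le> (\<integral>(y::'a). E y * B \<partial>lborel)" for k x
    unfolding g_def
    by (rule Bochner_Integration.integral_norm_bound_integral[OF _ gi], rule Bochner_Integration.integrable_bound[OF gi])
       (use B E0 in \<open>auto simp: norm_mult mult_left_mono abs_mult\<close>)
  have glim: "(\<lambda>k. g k x) \<longlonglongrightarrow> of_real ((2*pi) ^ n) * cnj (u x)" for x
  proof -
    have tl: "t \<longlonglongrightarrow> 0" unfolding t_def using LIMSEQ_inverse_real_of_nat by (simp add: inverse_eq_divide)
    have "(\<lambda>k. g k x) \<longlonglongrightarrow> (\<integral>(y::'a). of_real (E y) * cnj (u (x + (2 * sqrt 0) *\<^sub>R y)) \<partial>lborel)"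
      unfolding g_def
    proof (rule integral_dominated_convergence[OF _ _ gi])
      show "AE y in lborel. (\<lambda>k. of_real (E y) * cnj (u (x + (2 * sqrt (t k)) *\<^sub>R y)))
        \<longlonglongrightarrow> of_real (E y) * cnj (u (x + (2 * sqrt 0) *\<^sub>R y))"
      proof (rule AE_I2)
        fix y :: 'a
        have 1: "(\<lambda>k. x + (2 * sqrt (t k)) *\<^sub>R y) \<longlonglongrightarrow> x + (2 * sqrt 0) *\<^sub>R y"
          by (intro tendsto_intros tl)
        have 2: "isCont u (x + (2 * sqrt 0) *\<^sub>R y)"
          using cont by (simp add: continuous_on_eq_continuous_at)
        show "(\<lambda>k. of_real (E y) * cnj (u (x + (2 * sqrt (t k)) *\<^sub>R y)))
          \<longlonglongrightarrow> of_real (E y) * cnj (u (x + (2 * sqrt 0) *\<^sub>R y))"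
          by (rule tendsto_mult[OF tendsto_const tendsto_cnj[OF isCont_tendsto_compose[OF 2 1]]])
      qed
    qed (use B E0 in \<open>auto simp: norm_mult mult_left_mono abs_mult\<close>)
    also have "(\<integral>(y::'a). of_real (E y) * cnj (u (x + (2 * sqrt 0) *\<^sub>R y)) \<partial>lborel)
        = of_real (\<integral>y. E y \<partial>lborel) * cnj (u x)"
      by (simp add: integral_complex_of_real)
    also have "(\<integral>y. E y \<partial>lborel) = (2*pi) ^ n"
    proof -
      have "(\<integral>y. E y \<partial>lborel) = (2 * sqrt pi) ^ n * sqrt pi ^ n"
        using gaussian_integral[of 1, where 'a='a] by (simp add: E_def n_def)
      also have "\<dots> = (2 * sqrt pi * sqrt pi) ^ n" by (rule power_mult_distrib[symmetric])
      finally show ?thesis by (simp add: mult.assoc)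
    qed
    finally show ?thesis .
  qed
  have ind: "integrable lborel (\<lambda>\<xi>. exp (- t k * (norm \<xi>)\<^sup>2) * (cmod (fint u \<xi>))\<^sup>2)" for k
  proof (rule Bochner_Integration.integrable_bound)
    define C where "C = (\<integral>x. cmod (u x) \<partial>lborel)"
    have C: "cmod (fint u \<xi>) \<le> C" for \<xi>
      unfolding fint_def C_def using integral_norm_bound[of lborel "\<lambda>x. iexp (- (x \<bullet> \<xi>)) * u x"]
      by (simp add: norm_mult)
    show "integrable lborel (\<lambda>\<xi>::'a. exp (- t k * (norm \<xi>)\<^sup>2) * C\<^sup>2)"
      using gaussian_integrable[OF t, where 'a='a] by simp
    show "AE \<xi> in lborel. norm (exp (- t k * (norm \<xi>)\<^sup>2) * (cmod (fint u \<xi>))\<^sup>2) \<le> norm (exp (- t k * (norm \<xi>)\<^sup>2) * C\<^sup>2)"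
      using C by (auto simp: abs_mult power_mono)
  qed measurable
  have Ik: "of_real (I k) = (\<integral>x. u x * g k x \<partial>lborel)" for k
  proof -
    have "complex_of_real (I k) = (\<integral>\<xi>. of_real (exp (- t k * (norm \<xi>)\<^sup>2)) * (fint u \<xi> * fint (\<lambda>x. cnj (u x)) (-\<xi>)) \<partial>lborel)"
      unfolding I_def fint_cnj
      by (simp only: complex_norm_square[symmetric] of_real_mult[symmetric] integral_complex_of_real)
    also have "\<dots> = (\<integral>p. of_real (gauss_kernel (t k) (fst p - snd p)) * (u (fst p) * cnj (u (snd p))) \<partial>(lborel \<Otimes>\<^sub>M lborel))"
      by (rule fint_gaussian_parseval[OF u uc t])
    also have "\<dots> = (\<integral>x. (\<integral>y. of_real (gauss_kernel (t k) (x - y)) * (u x * cnj (u y)) \<partial>lborel) \<partial>lborel)"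
    proof -
      have "integrable (lborel \<Otimes>\<^sub>M lborel) (\<lambda>p. of_real (gauss_kernel (t k) (fst p - snd p)) * (u (fst p) * cnj (u (snd p))))"
      proof (rule Bochner_Integration.integrable_bound)
        show "integrable (lborel \<Otimes>\<^sub>M lborel) (\<lambda>p. of_real (sqrt (pi / t k) ^ n) * (u (fst p) * cnj (u (snd p))))"
          using integrable_tensor[OF u uc] by simp
        show "AE p in lborel \<Otimes>\<^sub>M lborel. norm (of_real (gauss_kernel (t k) (fst p - snd p)) * (u (fst p) * cnj (u (snd p))))
           \<le> norm (of_real (sqrt (pi / t k) ^ n) * (u (fst p) * cnj (u (snd p))))"
        proof (rule AE_I2)
          fix p :: "'a \<times> 'a"
          have "0 \<le> gauss_kernel (t k) (fst p - snd p)" by (rule gauss_kernel_nonneg[OF t])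
          moreover have "gauss_kernel (t k) (fst p - snd p) \<le> sqrt (pi / t k) ^ n"
            unfolding gauss_kernel_def n_def using t[of k] by (intro mult_left_le) auto
          ultimately show "norm (of_real (gauss_kernel (t k) (fst p - snd p)) * (u (fst p) * cnj (u (snd p))))
           \<le> norm (of_real (sqrt (pi / t k) ^ n) * (u (fst p) * cnj (u (snd p))))"
            unfolding norm_mult norm_of_real by (intro mult_right_mono) auto
        qed
      qed measurable
      from lborel_pair.integral_fst'[OF this] show ?thesis by simp
    qed
    also have "\<dots> = (\<integral>x. u x * g k x \<partial>lborel)"
    proof (intro Bochner_Integration.integral_cong refl)
      fix x :: 'a
      have c: "2 * sqrt (t k) \<noteq> 0" using t[of k] by simp
      have "(\<integral>y. of_real (gauss_kernel (t k) (x - y)) * cnj (u y) \<partial>lborel)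
        = \<bar>2 * sqrt (t k)\<bar> ^ DIM('a) *\<^sub>R (\<integral>y. of_real (gauss_kernel (t k) (x - (x + (2 * sqrt (t k)) *\<^sub>R y))) * cnj (u (x + (2 * sqrt (t k)) *\<^sub>R y)) \<partial>lborel)"
        by (rule lborel_integral_affine[OF _ c]) measurable
      also have "\<dots> = g k x"
        unfolding g_def integral_scaleR_right[symmetric]
      proof (intro Bochner_Integration.integral_cong refl)
        fix y :: 'a
        have "\<bar>2 * sqrt (t k)\<bar> ^ DIM('a) * gauss_kernel (t k) (x - (x + (2 * sqrt (t k)) *\<^sub>R y))
            = (\<bar>2 * sqrt (t k)\<bar> * sqrt (pi / t k)) ^ n * exp (- (norm y)\<^sup>2)"
        proof -
          have "gauss_kernel (t k) (x - (x + (2 * sqrt (t k)) *\<^sub>R y)) = sqrt (pi / t k) ^ n * exp (- (norm y)\<^sup>2)"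
            using t[of k] by (simp add: gauss_kernel_def n_def power_mult_distrib)
          then show ?thesis unfolding n_def[symmetric] by (simp only: mult.assoc[symmetric] power_mult_distrib)
        qed
        also have "\<bar>2 * sqrt (t k)\<bar> * sqrt (pi / t k) = 2 * sqrt pi"
          using t[of k] by (simp add: real_sqrt_divide)
        finally have "\<bar>2 * sqrt (t k)\<bar> ^ DIM('a) * gauss_kernel (t k) (x - (x + (2 * sqrt (t k)) *\<^sub>R y))
            = E y" by (simp add: E_def)
        then show "\<bar>2 * sqrt (t k)\<bar> ^ DIM('a) *\<^sub>R (of_real (gauss_kernel (t k) (x - (x + (2 * sqrt (t k)) *\<^sub>R y))) * cnj (u (x + (2 * sqrt (t k)) *\<^sub>R y)))
          = of_real (E y) * cnj (u (x + (2 * sqrt (t k)) *\<^sub>R y))"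
          unfolding scaleR_conv_of_real mult.assoc[symmetric] of_real_mult[symmetric] by simp
      qed
      finally have *: "(\<integral>y. of_real (gauss_kernel (t k) (x - y)) * cnj (u y) \<partial>lborel) = g k x" .
      have "(\<integral>y. of_real (gauss_kernel (t k) (x - y)) * (u x * cnj (u y)) \<partial>lborel)
          = (\<integral>y. u x * (of_real (gauss_kernel (t k) (x - y)) * cnj (u y)) \<partial>lborel)"
        by (simp only: mult_ac)
      then show "(\<integral>y. of_real (gauss_kernel (t k) (x - y)) * (u x * cnj (u y)) \<partial>lborel) = u x * g k x"
        using * by simp
    qed
    finally show ?thesis .
  qed
  define G where "G = (\<integral>(y::'a). E y * B \<partial>lborel)"
  have "(\<lambda>k. \<integral>x. u x * g k x \<partial>lborel) \<longlonglongrightarrow> (\<integral>x. u x * (of_real ((2*pi) ^ n) * cnj (u x)) \<partial>lborel)"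
  proof (rule integral_dominated_convergence)
    show "integrable lborel (\<lambda>x. cmod (u x) * G)" using u by simp
    show "AE x in lborel. norm (u x * g k x) \<le> cmod (u x) * G" for k
      using gbound by (auto simp: norm_mult G_def intro!: mult_left_mono)
    show "AE x in lborel. (\<lambda>k. u x * g k x) \<longlonglongrightarrow> u x * (of_real ((2*pi) ^ n) * cnj (u x))"
      by (intro AE_I2 tendsto_intros glim)
    show "(\<lambda>x. u x * g k x) \<in> borel_measurable lborel" for k unfolding g_def by measurable
  qed auto
  also have "(\<integral>x. u x * (of_real ((2*pi) ^ n) * cnj (u x)) \<partial>lborel) = of_real ((2*pi)^n * (\<integral>x. (cmod (u x))\<^sup>2 \<partial>lborel))"
  proof -
    have "u x * (of_real ((2*pi) ^ n) * cnj (u x)) = of_real ((2*pi)^n * (cmod (u x))\<^sup>2)" for x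
      by (simp only: of_real_mult complex_norm_square mult_ac)
    then show ?thesis by (simp only: integral_complex_of_real integral_mult_right_zero)
  qed
  finally have "(\<lambda>k. complex_of_real (I k)) \<longlonglongrightarrow> of_real ((2*pi)^n * (\<integral>x. (cmod (u x))\<^sup>2 \<partial>lborel))"
    unfolding Ik .
  then have Ilim: "I \<longlonglongrightarrow> (2*pi)^n * (\<integral>x. (cmod (u x))\<^sup>2 \<partial>lborel)"
    by (simp only: tendsto_of_real_iff)
  \<comment> \<open>The Gaussian weights increase to 1: monotone convergence gives integrability and the value at once.\<close>
  have mono: "mono (\<lambda>k. exp (- t k * (norm \<xi>)\<^sup>2) * (cmod (fint u \<xi>))\<^sup>2)" for \<xi>
  proof (intro monoI mult_right_mono)
    fix j k :: nat assume "j \<le> k"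
    then have "t k \<le> t j" by (simp add: t_def frac_le)
    then show "exp (- t j * (norm \<xi>)\<^sup>2) \<le> exp (- t k * (norm \<xi>)\<^sup>2)" by (simp add: mult_right_mono)
  qed auto
  have lim: "(\<lambda>k. exp (- t k * (norm \<xi>)\<^sup>2) * (cmod (fint u \<xi>))\<^sup>2) \<longlonglongrightarrow> (cmod (fint u \<xi>))\<^sup>2" for \<xi>
  proof -
    have tl: "t \<longlonglongrightarrow> 0" unfolding t_def using LIMSEQ_inverse_real_of_nat by (simp add: inverse_eq_divide)
    have "(\<lambda>k. exp (- t k * (norm \<xi>)\<^sup>2) * (cmod (fint u \<xi>))\<^sup>2) \<longlonglongrightarrow> exp (- 0 * (norm \<xi>)\<^sup>2) * (cmod (fint u \<xi>))\<^sup>2"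
      by (intro tendsto_intros tl)
    then show ?thesis by simp
  qed
  show "integrable lborel (\<lambda>\<xi>. (cmod (fint u \<xi>))\<^sup>2)"
    by (rule integral_monotone_convergence_nonneg(1)[OF ind _ _ _ Ilim[unfolded I_def[abs_def]]])
       (use mono lim in auto)
  show "(\<integral>\<xi>. (cmod (fint u \<xi>))\<^sup>2 \<partial>lborel) = (2*pi)^DIM('a) * (\<integral>x. (cmod (u x))\<^sup>2 \<partial>lborel)"
    unfolding n_def[symmetric]
    by (rule integral_monotone_convergence_nonneg(2)[OF ind _ _ _ Ilim[unfolded I_def[abs_def]]])
       (use mono lim in auto)
qed

section \<open>The Fourier--Plancherel transform\<close>

lemma borel_representative:
  fixes f :: "'a::euclidean_space \<Rightarrow> complex"
  assumes "f \<in> borel_measurable lebesgue"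
  obtains g where "g \<in> borel_measurable borel" "AE x in lebesgue. f x = g x"
proof -
  have "(\<lambda>x. Re (f x)) \<in> borel_measurable lebesgue" "(\<lambda>x. Im (f x)) \<in> borel_measurable lebesgue"
    using assms by auto
  then obtain a b where a: "a \<in> borel_measurable lborel" "AE x in lborel. Re (f x) = a x"
    and b: "b \<in> borel_measurable lborel" "AE x in lborel. Im (f x) = b x"
    using completion_ex_borel_measurable_real[of "\<lambda>x. Re (f x)" lborel]
      completion_ex_borel_measurable_real[of "\<lambda>x. Im (f x)" lborel] by blast
  have "AE x in lborel. f x = Complex (a x) (b x)"
    using a(2) b(2) by eventually_elim (simp add: complex_eq_iff)
  moreover have "(\<lambda>x. Complex (a x) (b x)) \<in> borel_measurable borel"
    using a b by (simp add: borel_measurable_complex_iff)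
  ultimately show ?thesis using that AE_completion by blast
qed

lemma lborel_imp_lebesgue_measurable:
  "f \<in> borel_measurable borel \<Longrightarrow> f \<in> borel_measurable lebesgue"
  by (rule measurable_completion) simp

lemma fourier_integral_eq_fint:
  assumes "f \<in> borel_measurable lebesgue" "g \<in> borel_measurable borel" "AE x in lebesgue. f x = g x"
  shows "fourier_integral f = fint g"
proof
  fix \<xi>
  have e: "(\<lambda>x. exp (- \<i> * of_real (x \<bullet> \<xi>))) \<in> borel_measurable (borel::'a measure)" by measurable
  note [measurable] = assms(1) lborel_imp_lebesgue_measurable[OF assms(2)] lborel_imp_lebesgue_measurable[OF e]
  have "fourier_integral f \<xi> = (\<integral>x. exp (- \<i> * of_real (x \<bullet> \<xi>)) * g x \<partial>lebesgue)"
    unfolding fourier_integral_def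
  proof (rule integral_cong_AE)
    show "AE x in lebesgue. exp (- \<i> * of_real (x \<bullet> \<xi>)) * f x = exp (- \<i> * of_real (x \<bullet> \<xi>)) * g x"
      using assms(3) by eventually_elim simp
  qed measurable
  also have "\<dots> = fint g \<xi>"
    unfolding fint_def using assms(2) by (subst integral_completion) auto
  finally show "fourier_integral f \<xi> = fint g \<xi>" .
qed

lemma fourier_integral_measurable:
  assumes "f \<in> borel_measurable lebesgue"
  shows "fourier_integral f \<in> borel_measurable borel"
proof -
  obtain g where "g \<in> borel_measurable borel" "AE x in lebesgue. f x = g x"
    using borel_representative[OF assms] .
  with fourier_integral_eq_fint[OF assms this] show ?thesis by simp
qed

text \<open>Square-integrable functions vanishing almost everywhere outside a ball. Their Fourier
  integrals converge absolutely.\<close>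

definition L2_ball :: "real \<Rightarrow> ('a::euclidean_space \<Rightarrow> complex) \<Rightarrow> bool" where
  "L2_ball R u \<longleftrightarrow> sq_int lebesgue u \<and> (AE x in lebesgue. norm x \<ge> R \<longrightarrow> u x = 0)"

lemma L2_ball_sq_int: "L2_ball R u \<Longrightarrow> sq_int lebesgue u"
  by (simp add: L2_ball_def)

lemma L2_ball_mono:
  assumes "L2_ball R u" "R \<le> S"
  shows "L2_ball S u"
proof -
  have "AE x in lebesgue. norm x \<ge> R \<longrightarrow> u x = 0" using assms(1) by (simp add: L2_ball_def)
  then have "AE x in lebesgue. norm x \<ge> S \<longrightarrow> u x = 0" by eventually_elim (use assms(2) in auto)
  then show ?thesis using assms(1) by (simp add: L2_ball_def)
qed

lemma L2_ball_lincomb: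
  assumes "L2_ball R u" "L2_ball R w"
  shows "L2_ball R (\<lambda>x. a * u x + b * w x)"
proof -
  have "AE x in lebesgue. norm x \<ge> R \<longrightarrow> u x = 0" "AE x in lebesgue. norm x \<ge> R \<longrightarrow> w x = 0"
    using assms by (auto simp: L2_ball_def)
  then have "AE x in lebesgue. norm x \<ge> R \<longrightarrow> a * u x + b * w x = 0" by eventually_elim auto
  then show ?thesis using assms by (auto simp: L2_ball_def intro: sq_int_intros)
qed

lemma L2_ball_diff: "L2_ball R u \<Longrightarrow> L2_ball R w \<Longrightarrow> L2_ball R (\<lambda>x. u x - w x)"
  using L2_ball_lincomb[of R u w 1 "-1"] by simp

lemma sq_int_indicator_ball: "sq_int lebesgue (\<lambda>x::'a::euclidean_space. indicator (ball 0 R) x)"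
proof -
  have "integrable lebesgue (\<lambda>x::'a. indicator (ball 0 R) x :: real)"
    by (intro integrable_real_indicator) (auto intro: emeasure_bounded_finite[unfolded infinity_ennreal_def])
  moreover have "(\<lambda>x::'a. (cmod (indicator (ball 0 R) x))\<^sup>2) = indicator (ball 0 R)"
    by (auto simp: indicator_def)
  ultimately show ?thesis by (auto simp: sq_int_def intro!: borel_measurable_indicator)
qed

lemma L2_ball_L1_bound:
  fixes u :: "'a::euclidean_space \<Rightarrow> complex"
  assumes "L2_ball R u"
  shows "integrable lebesgue u"
    and "(\<integral>x. cmod (u x) \<partial>lebesgue) \<le> norm2 lebesgue (\<lambda>x::'a. indicator (ball 0 R) x) * norm2 lebesgue u"
proof -
  have u: "sq_int lebesgue u" "AE x in lebesgue. norm x \<ge> R \<longrightarrow> u x = 0"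
    using assms by (auto simp: L2_ball_def)
  note um = sq_int_measurable[OF u(1)]
  note um[measurable]
  note ind = sq_int_indicator_ball[where 'a='a, of R]
  have ae: "AE x in lebesgue. indicator (ball 0 R) x * u x = u x"
    using u(2) by eventually_elim (auto simp: indicator_def)
  have int: "integrable lebesgue (\<lambda>x. indicator (ball 0 R) x * u x)"
    by (rule sq_int_mult_integrable[OF ind u(1)])
  show "integrable lebesgue u"
    by (rule integrable_cong_AE_imp[OF int um]) (use ae in eventually_elim, simp)
  have "(\<integral>x. cmod (u x) \<partial>lebesgue) = (\<integral>x. cmod (indicator (ball 0 R) x) * cmod (u x) \<partial>lebesgue)"
  proof (rule integral_cong_AE)
    show "AE x in lebesgue. cmod (u x) = cmod (indicator (ball 0 R) x) * cmod (u x)"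
      using ae by eventually_elim (metis norm_mult)
  qed (use sq_int_measurable[OF ind] in measurable)
  also have "\<dots> \<le> norm2 lebesgue (\<lambda>x::'a. indicator (ball 0 R) x) * norm2 lebesgue u"
    by (rule Cauchy_Schwarz_norm2_abs[OF ind u(1)])
  finally show "(\<integral>x. cmod (u x) \<partial>lebesgue) \<le> norm2 lebesgue (\<lambda>x::'a. indicator (ball 0 R) x) * norm2 lebesgue u" .
qed

lemma iexp_times_integrable:
  assumes "integrable lebesgue u"
  shows "integrable lebesgue (\<lambda>x::'a::euclidean_space. exp (- \<i> * of_real (x \<bullet> \<xi>)) * u x)"
proof (rule Bochner_Integration.integrable_bound[OF assms])
  have "(\<lambda>x. exp (- \<i> * of_real (x \<bullet> \<xi>))) \<in> borel_measurable (borel::'a measure)" by measurable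
  from lborel_imp_lebesgue_measurable[OF this]
  show "(\<lambda>x. exp (- \<i> * of_real (x \<bullet> \<xi>)) * u x) \<in> borel_measurable lebesgue" using assms by auto
qed (auto simp: norm_mult)

lemma fourier_integral_bound:
  assumes "integrable lebesgue u"
  shows "cmod (fourier_integral u \<xi>) \<le> (\<integral>x. cmod (u x) \<partial>lebesgue)"
  unfolding fourier_integral_def
  by (rule order_trans[OF integral_norm_bound]) (simp add: norm_mult)

lemma fourier_integral_lincomb:
  assumes "integrable lebesgue u" "integrable lebesgue w"
  shows "fourier_integral (\<lambda>x. a * u x + b * w x) \<xi> = a * fourier_integral u \<xi> + b * fourier_integral w \<xi>"
proof -
  have "fourier_integral (\<lambda>x. a * u x + b * w x) \<xi>
      = (\<integral>x. a * (exp (- \<i> * of_real (x \<bullet> \<xi>)) * u x) + b * (exp (- \<i> * of_real (x \<bullet> \<xi>)) * w x) \<partial>lebesgue)"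
    unfolding fourier_integral_def by (simp add: algebra_simps)
  also have "\<dots> = a * fourier_integral u \<xi> + b * fourier_integral w \<xi>"
    unfolding fourier_integral_def
    using iexp_times_integrable[OF assms(1), of \<xi>] iexp_times_integrable[OF assms(2), of \<xi>]
    by (subst Bochner_Integration.integral_add) auto
  finally show ?thesis .
qed

lemma fourier_integral_diff:
  assumes "integrable lebesgue u" "integrable lebesgue w"
  shows "fourier_integral (\<lambda>x. u x - w x) \<xi> = fourier_integral u \<xi> - fourier_integral w \<xi>"
  using fourier_integral_lincomb[OF assms, of 1 "-1"] by simp

lemma fourier_integral_cong_AE:
  assumes "u \<in> borel_measurable lebesgue" "w \<in> borel_measurable lebesgue" "AE x in lebesgue. u x = w x"
  shows "fourier_integral u = fourier_integral w"
proof -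
  obtain g where g: "g \<in> borel_measurable borel" "AE x in lebesgue. w x = g x"
    using borel_representative[OF assms(2)] .
  have "AE x in lebesgue. u x = g x" using assms(3) g(2) by eventually_elim simp
  then show ?thesis
    using fourier_integral_eq_fint[OF assms(1) g(1)] fourier_integral_eq_fint[OF assms(2) g] by simp
qed

subsection \<open>Density of continuous functions\<close>

text \<open>The radial projection onto the disc of radius k. Measurable functions are approximated by
  continuous ones only pointwise, and clamping supplies the domination needed for convergence in
  norm.\<close>

definition clamp_ball :: "real \<Rightarrow> complex \<Rightarrow> complex" where
  "clamp_ball k z = of_real (k / max k (cmod z)) * z"

lemma clamp_ball_norm: "k > 0 \<Longrightarrow> cmod (clamp_ball k z) \<le> k" "k > 0 \<Longrightarrow> cmod (clamp_ball k z) \<le> cmod z"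
proof -
  have eq: "cmod (clamp_ball k z) = (k / max k (cmod z)) * cmod z" if "k > 0"
    unfolding clamp_ball_def norm_mult norm_of_real using that by simp
  show "cmod (clamp_ball k z) \<le> k" if "k > 0"
    unfolding eq[OF that] using that by (simp add: divide_le_eq max_def)
  show "cmod (clamp_ball k z) \<le> cmod z" if "k > 0"
    unfolding eq[OF that] using that by (intro mult_left_le_one_le) (auto simp: divide_le_eq max_def)
qed

lemma clamp_ball_id: "k > 0 \<Longrightarrow> cmod z \<le> k \<Longrightarrow> clamp_ball k z = z"
  by (simp add: clamp_ball_def max_def)

lemma clamp_ball_continuous: "k > 0 \<Longrightarrow> continuous_on UNIV (clamp_ball k)"
  unfolding clamp_ball_def[abs_def] by (intro continuous_intros) (auto simp: max_def)

lemma norm2_dominated: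
  assumes "\<And>k. f k \<in> borel_measurable M" "g \<in> borel_measurable M"
    "integrable M w" "\<And>k. AE x in M. (cmod (f k x - g x))\<^sup>2 \<le> w x"
    "AE x in M. (\<lambda>k. f k x) \<longlonglongrightarrow> g x"
  shows "(\<lambda>k. norm2 M (\<lambda>x. f k x - g x)) \<longlonglongrightarrow> 0"
proof -
  have "(\<lambda>k. \<integral>x. (cmod (f k x - g x))\<^sup>2 \<partial>M) \<longlonglongrightarrow> (\<integral>x. 0 \<partial>M)"
  proof (rule integral_dominated_convergence[OF _ _ assms(3)])
    show "AE x in M. (\<lambda>k. (cmod (f k x - g x))\<^sup>2) \<longlonglongrightarrow> 0"
      using assms(5)
    proof eventually_elim
      case (elim x)
      have "(\<lambda>k. (cmod (f k x - g x))\<^sup>2) \<longlonglongrightarrow> (cmod (g x - g x))\<^sup>2"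
        by (intro tendsto_intros elim)
      then show ?case by simp
    qed
  qed (use assms in auto)
  then have "(\<lambda>k. sqrt (\<integral>x. (cmod (f k x - g x))\<^sup>2 \<partial>M)) \<longlonglongrightarrow> sqrt 0"
    by (intro tendsto_real_sqrt) simp
  then show ?thesis by (simp add: norm2_def)
qed

text \<open>First clamp u to a bounded function, then approximate it almost everywhere by continuous functions,
  clamped at the same level and cut off outside the ball of radius R + 1.\<close>

lemma continuous_dense:
  fixes u :: "'a::euclidean_space \<Rightarrow> complex"
  assumes u: "L2_ball R u" and e: "e > 0"
  obtains v where "continuous_on UNIV v" "\<And>x. norm x \<ge> R + 1 \<Longrightarrow> v x = 0" "L2_ball (R+1) v"
    "norm2 lebesgue (\<lambda>x. v x - u x) < e"
proof -
  have us: "sq_int lebesgue u" "AE x in lebesgue. norm x \<ge> R \<longrightarrow> u x = 0"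
    using u by (auto simp: L2_ball_def)
  note um = sq_int_measurable[OF us(1)]
  note um[measurable]
  have cm: "(\<lambda>x. clamp_ball k (f x)) \<in> borel_measurable lebesgue"
    if "f \<in> borel_measurable lebesgue" "k > 0" for k :: real and f :: "'a \<Rightarrow> complex"
    by (rule measurable_compose[OF that(1) borel_measurable_continuous_onI[OF clamp_ball_continuous[OF that(2)]]])
  have "(\<lambda>k::nat. norm2 lebesgue (\<lambda>x. clamp_ball (Suc k) (u x) - u x)) \<longlonglongrightarrow> 0"
  proof (rule norm2_dominated)
    show "integrable lebesgue (\<lambda>x. 4 * (cmod (u x))\<^sup>2)" using us(1) by (simp add: sq_int_def)
    show "AE x in lebesgue. (cmod (clamp_ball (Suc k) (u x) - u x))\<^sup>2 \<le> 4 * (cmod (u x))\<^sup>2" for k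
    proof (rule AE_I2)
      fix x
      have "cmod (clamp_ball (Suc k) (u x) - u x) \<le> 2 * cmod (u x)"
        using norm_triangle_ineq4[of "clamp_ball (Suc k) (u x)" "u x"] clamp_ball_norm(2)[of "Suc k" "u x"] by simp
      from power_mono[OF this, of 2]
      show "(cmod (clamp_ball (Suc k) (u x) - u x))\<^sup>2 \<le> 4 * (cmod (u x))\<^sup>2" by (simp add: power_mult_distrib)
    qed
    show "AE x in lebesgue. (\<lambda>k. clamp_ball (Suc k) (u x)) \<longlonglongrightarrow> u x"
    proof (rule AE_I2)
      fix x
      obtain N :: nat where "cmod (u x) \<le> real N" using real_arch_simple by blast
      then have "\<forall>\<^sub>F k in sequentially. clamp_ball (Suc k) (u x) = u x"
        by (intro eventually_sequentiallyI[of N] clamp_ball_id) auto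
      then show "(\<lambda>k. clamp_ball (Suc k) (u x)) \<longlonglongrightarrow> u x" by (rule tendsto_eventually)
    qed
  qed (use cm um in auto)
  from LIMSEQ_D[OF this half_gt_zero[OF e]]
  obtain k :: nat where k: "norm2 lebesgue (\<lambda>x. clamp_ball (Suc k) (u x) - u x) < e / 2"
    by force
  define K where "K = real (Suc k)"
  have K: "K > 0" by (simp add: K_def)
  have "u measurable_on UNIV" using um by (intro lebesgue_measurable_imp_measurable_on) auto
  then obtain N g where N: "negligible N" and g: "\<And>n::nat. continuous_on UNIV (g n)"
    and lim: "\<And>x. x \<notin> N \<Longrightarrow> (\<lambda>n. g n x) \<longlonglongrightarrow> u x"
    by (auto simp: measurable_on_def)
  define cut where "cut x = complex_of_real (max 0 (min 1 (R + 1 - norm x)))" for x :: 'a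
  have cut: "cmod (cut x) \<le> 1" "norm x \<ge> R + 1 \<Longrightarrow> cut x = 0" "norm x \<le> R \<Longrightarrow> cut x = 1" for x
    by (auto simp: cut_def max_def min_def)
  define v where "v n x = cut x * clamp_ball K (g n x)" for n x
  have v: "continuous_on UNIV (v n)" for n
    unfolding v_def cut_def
    by (intro continuous_intros g continuous_on_compose2[OF clamp_ball_continuous[OF K] g]) auto
  have vm: "v n \<in> borel_measurable lebesgue" for n
    by (intro lborel_imp_lebesgue_measurable borel_measurable_continuous_onI v)
  have v0: "v n x = 0" if "norm x \<ge> R + 1" for n x using cut(2)[OF that] by (simp add: v_def)
  have vb: "cmod (v n x) \<le> K" for n x
    using mult_mono[OF cut(1)[of x] clamp_ball_norm(1)[OF K, of "g n x"]] by (simp add: v_def norm_mult)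
  have ind: "integrable lebesgue (\<lambda>x::'a. 4 * K\<^sup>2 * indicator (ball 0 (R+1)) x)"
    by (intro integrable_mult_right integrable_real_indicator)
       (auto intro: emeasure_bounded_finite[unfolded infinity_ennreal_def])
  have vL: "L2_ball (R+1) (v n)" for n
  proof -
    have "cmod (v n x) \<le> K * cmod (indicator (ball 0 (R+1)) x)" for x
      using vb[of n x] v0[of x n] by (cases "norm x \<ge> R + 1") (auto simp: indicator_def)
    then have "sq_int lebesgue (v n)"
      by (intro sq_int_bound[OF sq_int_indicator_ball[of "R+1"] vm[of n], of K]) auto
    then show ?thesis using v0 by (auto simp: L2_ball_def)
  qed
  have "(\<lambda>n. norm2 lebesgue (\<lambda>x. v n x - clamp_ball K (u x))) \<longlonglongrightarrow> 0"
  proof (rule norm2_dominated[OF _ _ ind])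
    show "AE x in lebesgue. (cmod (v n x - clamp_ball K (u x)))\<^sup>2 \<le> 4 * K\<^sup>2 * indicator (ball 0 (R+1)) x" for n
      using us(2)
    proof eventually_elim
      case (elim x)
      show ?case
      proof (cases "norm x \<ge> R + 1")
        case True
        then show ?thesis using elim v0[OF True, of n] by (simp add: clamp_ball_def)
      next
        case False
        have "cmod (v n x - clamp_ball K (u x)) \<le> 2 * K"
          using norm_triangle_ineq4[of "v n x" "clamp_ball K (u x)"] vb[of n x] clamp_ball_norm(1)[OF K, of "u x"] by simp
        from power_mono[OF this, of 2] show ?thesis using False by (simp add: power_mult_distrib)
      qed
    qed
    have "AE x in lebesgue. x \<notin> N"
      using N by (metis AE_not_in negligible_iff_null_sets)
    then show "AE x in lebesgue. (\<lambda>n. v n x) \<longlonglongrightarrow> clamp_ball K (u x)"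
      using us(2)
    proof eventually_elim
      case (elim x)
      have "(\<lambda>n. v n x) \<longlonglongrightarrow> cut x * clamp_ball K (u x)"
        unfolding v_def using lim[OF elim(1)] clamp_ball_continuous[OF K]
        by (intro tendsto_intros continuous_on_tendsto_compose[of UNIV "clamp_ball K"]) auto
      moreover have "cut x * clamp_ball K (u x) = clamp_ball K (u x)"
        using elim(2) cut(3)[of x] by (cases "norm x \<le> R") (auto simp: clamp_ball_def)
      ultimately show ?case by simp
    qed
  qed (use cm[OF um K] vm in auto)
  from LIMSEQ_D[OF this half_gt_zero[OF e]]
  obtain n where n: "norm2 lebesgue (\<lambda>x. v n x - clamp_ball K (u x)) < e / 2" by force
  have "sq_int lebesgue (\<lambda>x. clamp_ball K (u x))"
    using cm[OF um K] clamp_ball_norm(2)[OF K] by (intro sq_int_bound[OF us(1), of _ 1]) auto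
  from norm2_triangle_diff[OF L2_ball_sq_int[OF vL[of n]] this us(1)] n k
  have "norm2 lebesgue (\<lambda>x. v n x - u x) < e" by (simp add: K_def)
  then show ?thesis using that v v0 vL by blast
qed

subsection \<open>Plancherel's identity\<close>

text \<open>The constant by which the unnormalized transform multiplies L2 norms.\<close>

definition planch :: "'a::euclidean_space itself \<Rightarrow> real" where
  "planch _ = sqrt ((2 * pi) ^ DIM('a))"

lemma planch_pos [simp]: "planch TYPE('a::euclidean_space) > 0"
  by (simp add: planch_def)

lemma planch_squared: "(planch TYPE('a::euclidean_space))\<^sup>2 = (2 * pi) ^ DIM('a)"
  by (simp add: planch_def)

lemma norm2_lborel: "f \<in> borel_measurable borel \<Longrightarrow> norm2 lebesgue f = norm2 lborel f"
  unfolding norm2_def by (subst integral_completion) auto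

lemma sq_int_lborel: "f \<in> borel_measurable borel \<Longrightarrow> sq_int lebesgue f \<longleftrightarrow> sq_int lborel f"
  unfolding sq_int_def by (subst integrable_completion) (auto intro: lborel_imp_lebesgue_measurable)

lemma plancherel_continuous':
  fixes v :: "'a::euclidean_space \<Rightarrow> complex"
  assumes "continuous_on UNIV v" "\<And>x. norm x \<ge> R \<Longrightarrow> v x = 0"
  shows "sq_int lebesgue (fourier_integral v)"
    and "norm2 lebesgue (fourier_integral v) = planch TYPE('a) * norm2 lebesgue v"
proof -
  have m: "v \<in> borel_measurable borel" using assms(1) by (rule borel_measurable_continuous_onI)
  have eq: "fourier_integral v = fint v"
    by (rule fourier_integral_eq_fint) (use m in \<open>auto intro: lborel_imp_lebesgue_measurable\<close>)
  have f: "fint v \<in> borel_measurable borel" using m by (rule fint_measurable)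
  show "sq_int lebesgue (fourier_integral v)"
    unfolding eq sq_int_lborel[OF f] using plancherel_continuous(1)[OF assms] f by (simp add: sq_int_def)
  show "norm2 lebesgue (fourier_integral v) = planch TYPE('a) * norm2 lebesgue v"
    unfolding eq norm2_lborel[OF f] norm2_lborel[OF m]
    using plancherel_continuous(2)[OF assms] by (simp add: norm2_def planch_def real_sqrt_mult)
qed

text \<open>Fourier integrals of functions in a fixed ball depend continuously on the function, pointwise
  because the L1 norm is dominated by the L2 norm. So the identity passes from the dense class to
  the limit, with Fatou's lemma giving convergence of the transforms in norm.\<close>

lemma plancherel_L2_ball:
  fixes u :: "'a::euclidean_space \<Rightarrow> complex"
  assumes u: "L2_ball R u"
  shows "sq_int lebesgue (fourier_integral u)"
    and "norm2 lebesgue (fourier_integral u) = planch TYPE('a) * norm2 lebesgue u"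
proof -
  have "\<exists>v. continuous_on UNIV v \<and> (\<forall>x. norm x \<ge> R + 1 \<longrightarrow> v x = 0) \<and> L2_ball (R+1) v
    \<and> norm2 lebesgue (\<lambda>x. v x - u x) < 1 / Suc k" for k :: nat
    using continuous_dense[OF u, of "1 / Suc k"] by (metis of_nat_0_less_iff zero_less_Suc zero_less_divide_1_iff)
  then obtain v where v: "\<And>k. continuous_on UNIV (v k)" "\<And>k x. norm x \<ge> R + 1 \<Longrightarrow> v k x = 0"
    "\<And>k. L2_ball (R+1) (v k)" "\<And>k. norm2 lebesgue (\<lambda>x. v k x - u x) < 1 / Suc k"
    by metis
  note us = L2_ball_sq_int[OF u] and vs = L2_ball_sq_int[OF v(3)]
  have u': "L2_ball (R+1) u" using u by (rule L2_ball_mono) simp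
  define P where "P = planch TYPE('a)"
  have P: "P > 0" by (simp add: P_def)
  have ui: "integrable lebesgue u" and vi: "integrable lebesgue (v k)" for k
    using L2_ball_L1_bound(1) u v(3) by blast+
  have lim0: "(\<lambda>k. norm2 lebesgue (\<lambda>x. v k x - u x)) \<longlonglongrightarrow> 0"
    by (rule Lim_null_comparison[OF _ LIMSEQ_inverse_real_of_nat])
       (use v(4) in \<open>auto intro!: always_eventually simp: inverse_eq_divide less_imp_le\<close>)
  have pt: "(\<lambda>k. fourier_integral (v k) \<xi>) \<longlonglongrightarrow> fourier_integral u \<xi>" for \<xi>
  proof -
    define C where "C = norm2 lebesgue (\<lambda>x::'a. indicator (ball 0 (R+1)) x)"
    have "(\<lambda>k. fourier_integral (v k) \<xi> - fourier_integral u \<xi>) \<longlonglongrightarrow> 0"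
    proof (rule Lim_null_comparison)
      show "(\<lambda>k. C * norm2 lebesgue (\<lambda>x. v k x - u x)) \<longlonglongrightarrow> 0"
        using tendsto_mult_left[OF lim0, of C] by simp
      show "\<forall>\<^sub>F k in sequentially. norm (fourier_integral (v k) \<xi> - fourier_integral u \<xi>)
          \<le> C * norm2 lebesgue (\<lambda>x. v k x - u x)"
      proof (intro always_eventually allI)
        fix k
        have d: "L2_ball (R+1) (\<lambda>x. v k x - u x)" using v(3) u' by (rule L2_ball_diff)
        show "norm (fourier_integral (v k) \<xi> - fourier_integral u \<xi>) \<le> C * norm2 lebesgue (\<lambda>x. v k x - u x)"
          unfolding fourier_integral_diff[OF vi ui, symmetric] C_def
          by (rule order_trans[OF fourier_integral_bound L2_ball_L1_bound(2)[OF d]])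
             (use ui vi in auto)
      qed
    qed
    then show ?thesis by (simp add: LIM_zero_iff)
  qed
  have fv: "sq_int lebesgue (fourier_integral (v k))"
    "norm2 lebesgue (fourier_integral (v k)) = P * norm2 lebesgue (v k)" for k
    unfolding P_def
    using plancherel_continuous'(1)[of "v k" "R + 1"] plancherel_continuous'(2)[of "v k" "R + 1"] v(1,2) by auto
  have fm: "fourier_integral u \<in> borel_measurable lebesgue"
    by (intro lborel_imp_lebesgue_measurable fourier_integral_measurable borel_measurable_integrable[OF ui])
  have diff: "sq_int lebesgue (\<lambda>\<xi>. fourier_integral (v k) \<xi> - fourier_integral u \<xi>)"
    "norm2 lebesgue (\<lambda>\<xi>. fourier_integral (v k) \<xi> - fourier_integral u \<xi>) \<le> P * (2 / Suc k)" for k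
  proof -
    have "AE \<xi> in lebesgue. (\<lambda>l. fourier_integral (v k) \<xi> - fourier_integral (v (k + l)) \<xi>)
        \<longlonglongrightarrow> fourier_integral (v k) \<xi> - fourier_integral u \<xi>"
      using pt by (intro AE_I2 tendsto_intros) (subst add.commute, rule LIMSEQ_ignore_initial_segment, simp)
    moreover have "norm2 lebesgue (\<lambda>\<xi>. fourier_integral (v k) \<xi> - fourier_integral (v (k + l)) \<xi>) \<le> P * (2 / Suc k)" for l
    proof -
      have "norm2 lebesgue (\<lambda>\<xi>. fourier_integral (v k) \<xi> - fourier_integral (v (k + l)) \<xi>)
          = norm2 lebesgue (fourier_integral (\<lambda>x. v k x - v (k + l) x))"
        by (intro arg_cong[where f="norm2 lebesgue"] ext fourier_integral_diff[symmetric] vi)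
      also have "\<dots> = P * norm2 lebesgue (\<lambda>x. v k x - v (k + l) x)"
        unfolding P_def by (rule plancherel_continuous'(2)[of _ "R+1"]) (use v(1,2) in \<open>auto intro!: continuous_intros\<close>)
      also have "norm2 lebesgue (\<lambda>x. v k x - v (k + l) x) \<le> 2 / Suc k"
      proof -
        have "1 / real (Suc (k + l)) \<le> 1 / Suc k" by (intro frac_le) auto
        then show ?thesis
          using norm2_triangle_diff[OF vs us vs, of k "k + l"] v(4)[of k] v(4)[of "k+l"]
          by (simp add: norm2_minus_commute[of _ u])
      qed
      finally show ?thesis using P by simp
    qed
    ultimately show "sq_int lebesgue (\<lambda>\<xi>. fourier_integral (v k) \<xi> - fourier_integral u \<xi>)"
      "norm2 lebesgue (\<lambda>\<xi>. fourier_integral (v k) \<xi> - fourier_integral u \<xi>) \<le> P * (2 / Suc k)"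
      using sq_int_Fatou[of lebesgue "\<lambda>l \<xi>. fourier_integral (v k) \<xi> - fourier_integral (v (k + l)) \<xi>"
          "P * (2 / Suc k)" "\<lambda>\<xi>. fourier_integral (v k) \<xi> - fourier_integral u \<xi>"]
        sq_int_diff[OF fv(1) fv(1)] sq_int_measurable[OF fv(1)] fm by auto
  qed
  have "sq_int lebesgue (\<lambda>\<xi>. fourier_integral (v 0) \<xi> - (fourier_integral (v 0) \<xi> - fourier_integral u \<xi>))"
    by (rule sq_int_diff[OF fv(1) diff(1)])
  then show fs: "sq_int lebesgue (fourier_integral u)" by simp
  have "(\<lambda>k. norm2 lebesgue (\<lambda>\<xi>. fourier_integral (v k) \<xi> - fourier_integral u \<xi>)) \<longlonglongrightarrow> 0"
  proof (rule Lim_null_comparison)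
    show "(\<lambda>k. P * (2 / Suc k)) \<longlonglongrightarrow> 0"
      using tendsto_mult_left[OF LIMSEQ_inverse_real_of_nat, of "2 * P"]
      by (simp add: inverse_eq_divide mult_ac)
  qed (use diff(2) in auto)
  from norm2_tendsto[OF fv(1) fs this]
  have "(\<lambda>k. P * norm2 lebesgue (v k)) \<longlonglongrightarrow> norm2 lebesgue (fourier_integral u)"
    by (simp add: fv(2))
  moreover have "(\<lambda>k. P * norm2 lebesgue (v k)) \<longlonglongrightarrow> P * norm2 lebesgue u"
    by (intro tendsto_intros norm2_tendsto vs us lim0)
  ultimately show "norm2 lebesgue (fourier_integral u) = planch TYPE('a) * norm2 lebesgue u"
    unfolding P_def using LIMSEQ_unique by blast
qed

subsection \<open>The transform on L2\<close>

lemma L2_iff: "f \<in> L2 S \<longleftrightarrow> sq_int (lebesgue_on S) f"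
  by (simp add: L2_def sq_int_def)

lemma L2_UNIV_iff: "f \<in> L2 UNIV \<longleftrightarrow> sq_int lebesgue f"
  by (simp add: L2_iff lebesgue_on_UNIV_eq)

lemma L2_norm_UNIV: "L2_norm UNIV f = norm2 lebesgue f"
  by (simp add: L2_norm_def norm2_def lebesgue_on_UNIV_eq)

definition trunc :: "nat \<Rightarrow> ('a::euclidean_space \<Rightarrow> complex) \<Rightarrow> 'a \<Rightarrow> complex" where
  "trunc k u = extend_zero (ball 0 (real k)) u"

lemma trunc_L2_ball:
  assumes "sq_int lebesgue u"
  shows "L2_ball (real k) (trunc k u)"
proof -
  have [measurable]: "u \<in> borel_measurable lebesgue" using assms by (rule sq_int_measurable)
  have [measurable]: "ball 0 (real k) \<in> sets lebesgue" by auto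
  have "trunc k u \<in> borel_measurable lebesgue"
    unfolding trunc_def extend_zero_def by measurable
  then have "sq_int lebesgue (trunc k u)"
    by (intro sq_int_bound[OF assms, of _ 1]) (auto simp: trunc_def extend_zero_def)
  then show ?thesis by (auto simp: L2_ball_def trunc_def extend_zero_def)
qed

lemma trunc_tendsto:
  fixes u :: "'a::euclidean_space \<Rightarrow> complex"
  assumes "sq_int lebesgue u"
  shows "(\<lambda>k. norm2 lebesgue (\<lambda>x. trunc k u x - u x)) \<longlonglongrightarrow> 0"
proof (rule norm2_dominated)
  show "integrable lebesgue (\<lambda>x. (cmod (u x))\<^sup>2)" using assms by (simp add: sq_int_def)
  show "AE x in lebesgue. (\<lambda>k. trunc k u x) \<longlonglongrightarrow> u x"
  proof (rule AE_I2)
    fix x :: 'a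
    obtain N :: nat where "norm x < real N" using reals_Archimedean2 by blast
    then have "\<forall>\<^sub>F k in sequentially. trunc k u x = u x"
      by (intro eventually_sequentiallyI[of N]) (auto simp: trunc_def extend_zero_def)
    then show "(\<lambda>k. trunc k u x) \<longlonglongrightarrow> u x" by (rule tendsto_eventually)
  qed
qed (use assms sq_int_measurable[OF L2_ball_sq_int[OF trunc_L2_ball[OF assms]]] in
  \<open>auto simp: trunc_def extend_zero_def sq_int_def\<close>)

text \<open>The transforms of the truncations form a Cauchy sequence by Plancherel's identity, so the limit in
  mean, which is chosen by a description operator, exists.\<close>

lemma fourier_L2_spec:
  fixes u :: "'a::euclidean_space \<Rightarrow> complex"
  assumes u: "sq_int lebesgue u"
  shows "sq_int lebesgue (fourier_L2 u)"
    and "(\<lambda>k. norm2 lebesgue (\<lambda>\<xi>. fourier_integral (trunc k u) \<xi> - fourier_L2 u \<xi>)) \<longlonglongrightarrow> 0"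
proof -
  define f where "f k = fourier_integral (trunc k u)" for k
  note tb = trunc_L2_ball[OF u]
  note ts = L2_ball_sq_int[OF tb]
  have fd: "norm2 lebesgue (\<lambda>\<xi>. f k \<xi> - f l \<xi>) = planch TYPE('a) * norm2 lebesgue (\<lambda>x. trunc k u x - trunc l u x)" for k l
  proof -
    have "L2_ball (max k l) (\<lambda>x. trunc k u x - trunc l u x)"
      by (intro L2_ball_diff L2_ball_mono[OF tb]) auto
    note pl = plancherel_L2_ball(2)[OF this]
    have "(\<lambda>\<xi>. f k \<xi> - f l \<xi>) = fourier_integral (\<lambda>x. trunc k u x - trunc l u x)"
      unfolding f_def by (intro ext fourier_integral_diff[symmetric] L2_ball_L1_bound(1)[OF tb])
    then show ?thesis using pl by simp
  qed
  obtain g where "sq_int lebesgue g" "(\<lambda>k. norm2 lebesgue (\<lambda>x. f k x - g x)) \<longlonglongrightarrow> 0"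
  proof (rule sq_int_complete)
    show "sq_int lebesgue (f k)" for k unfolding f_def by (rule plancherel_L2_ball(1)[OF tb])
    fix e :: real assume "e > 0"
    define e' where "e' = e / planch TYPE('a) / 2"
    have "e' > 0" using \<open>e > 0\<close> by (simp add: e'_def)
    from LIMSEQ_D[OF trunc_tendsto[OF u] this]
    obtain N where N: "\<And>k. k \<ge> N \<Longrightarrow> norm2 lebesgue (\<lambda>x. trunc k u x - u x) < e'" by force
    show "\<exists>N. \<forall>k\<ge>N. \<forall>l\<ge>N. norm2 lebesgue (\<lambda>x. f k x - f l x) \<le> e"
    proof (intro exI allI impI)
      fix k l assume kl: "k \<ge> N" "l \<ge> N"
      have "norm2 lebesgue (\<lambda>x. trunc k u x - trunc l u x) \<le> 2 * e'"
        using norm2_triangle_diff[OF ts u ts, of k l] N[OF kl(1)] N[OF kl(2)]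
        by (simp add: norm2_minus_commute[of _ u])
      then show "norm2 lebesgue (\<lambda>x. f k x - f l x) \<le> e"
        unfolding fd e'_def using planch_pos[where 'a='a] by (simp add: field_simps)
    qed
  qed
  then have "\<exists>g. g \<in> L2 UNIV \<and> (\<lambda>k::nat. L2_norm UNIV (\<lambda>\<xi>. fourier_integral (extend_zero (ball 0 (real k)) u) \<xi> - g \<xi>)) \<longlonglongrightarrow> 0"
    unfolding L2_UNIV_iff L2_norm_UNIV f_def trunc_def by blast
  from someI_ex[OF this, folded fourier_L2_def]
  show "sq_int lebesgue (fourier_L2 u)"
    "(\<lambda>k. norm2 lebesgue (\<lambda>\<xi>. fourier_integral (trunc k u) \<xi> - fourier_L2 u \<xi>)) \<longlonglongrightarrow> 0"
    by (auto simp: L2_UNIV_iff L2_norm_UNIV trunc_def)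
qed

lemma plancherel:
  fixes u :: "'a::euclidean_space \<Rightarrow> complex"
  assumes u: "sq_int lebesgue u"
  shows "norm2 lebesgue (fourier_L2 u) = planch TYPE('a) * norm2 lebesgue u"
proof -
  note tb = trunc_L2_ball[OF u]
  have "(\<lambda>k. norm2 lebesgue (fourier_integral (trunc k u))) \<longlonglongrightarrow> norm2 lebesgue (fourier_L2 u)"
    by (rule norm2_tendsto[OF plancherel_L2_ball(1)[OF tb] fourier_L2_spec[OF u]])
  moreover have "(\<lambda>k. planch TYPE('a) * norm2 lebesgue (trunc k u)) \<longlonglongrightarrow> planch TYPE('a) * norm2 lebesgue u"
    by (intro tendsto_intros norm2_tendsto L2_ball_sq_int[OF tb] u trunc_tendsto)
  ultimately show ?thesis
    unfolding plancherel_L2_ball(2)[OF tb] by (rule LIMSEQ_unique)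
qed

lemma norm2_lincomb_tendsto:
  assumes "\<And>k. sq_int M (f k)" "sq_int M f'" "(\<lambda>k. norm2 M (\<lambda>x. f k x - f' x)) \<longlonglongrightarrow> 0"
    "\<And>k. sq_int M (g k)" "sq_int M g'" "(\<lambda>k. norm2 M (\<lambda>x. g k x - g' x)) \<longlonglongrightarrow> 0"
  shows "(\<lambda>k. norm2 M (\<lambda>x. (a * f k x + b * g k x) - (a * f' x + b * g' x))) \<longlonglongrightarrow> 0"
proof (rule Lim_null_comparison)
  show "(\<lambda>k. cmod a * norm2 M (\<lambda>x. f k x - f' x) + cmod b * norm2 M (\<lambda>x. g k x - g' x)) \<longlonglongrightarrow> 0"
    using tendsto_add[OF tendsto_mult_left[OF assms(3), of "cmod a"] tendsto_mult_left[OF assms(6), of "cmod b"]] by simp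
  show "\<forall>\<^sub>F k in sequentially. norm (norm2 M (\<lambda>x. (a * f k x + b * g k x) - (a * f' x + b * g' x)))
      \<le> cmod a * norm2 M (\<lambda>x. f k x - f' x) + cmod b * norm2 M (\<lambda>x. g k x - g' x)"
  proof (intro always_eventually allI)
    fix k
    have eq: "(a * f k x + b * g k x) - (a * f' x + b * g' x) = a * (f k x - f' x) + b * (g k x - g' x)" for x
      by (simp add: algebra_simps)
    show "norm (norm2 M (\<lambda>x. (a * f k x + b * g k x) - (a * f' x + b * g' x)))
      \<le> cmod a * norm2 M (\<lambda>x. f k x - f' x) + cmod b * norm2 M (\<lambda>x. g k x - g' x)"
      unfolding eq norm2_cmult[symmetric]
      using norm2_triangle[OF sq_int_cmult[OF sq_int_diff[OF assms(1,2)], of a k] sq_int_cmult[OF sq_int_diff[OF assms(4,5)], of b k]] by simp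
  qed
qed

lemma fourier_L2_lincomb:
  fixes u w :: "'a::euclidean_space \<Rightarrow> complex"
  assumes u: "sq_int lebesgue u" and w: "sq_int lebesgue w"
  shows "AE \<xi> in lebesgue. fourier_L2 (\<lambda>x. a * u x + b * w x) \<xi> = a * fourier_L2 u \<xi> + b * fourier_L2 w \<xi>"
proof (rule norm2_limit_unique)
  have uw: "sq_int lebesgue (\<lambda>x. a * u x + b * w x)" using u w by (intro sq_int_intros)
  define f where "f k \<xi> = a * fourier_integral (trunc k u) \<xi> + b * fourier_integral (trunc k w) \<xi>" for k \<xi>
  have f: "f k = fourier_integral (trunc k (\<lambda>x. a * u x + b * w x))" for k
  proof
    fix \<xi>
    have "trunc k (\<lambda>x. a * u x + b * w x) = (\<lambda>x. a * trunc k u x + b * trunc k w x)"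
      by (auto simp: trunc_def extend_zero_def)
    then show "f k \<xi> = fourier_integral (trunc k (\<lambda>x. a * u x + b * w x)) \<xi>"
      unfolding f_def using fourier_integral_lincomb[OF L2_ball_L1_bound(1)[OF trunc_L2_ball[OF u]]
          L2_ball_L1_bound(1)[OF trunc_L2_ball[OF w]]] by simp
  qed
  show "sq_int lebesgue (f k)" for k
    unfolding f using plancherel_L2_ball(1)[OF trunc_L2_ball[OF uw]] .
  show "sq_int lebesgue (fourier_L2 (\<lambda>x. a * u x + b * w x))" by (rule fourier_L2_spec[OF uw])
  show "sq_int lebesgue (\<lambda>\<xi>. a * fourier_L2 u \<xi> + b * fourier_L2 w \<xi>)"
    using u w by (intro sq_int_intros fourier_L2_spec)
  show "(\<lambda>k. norm2 lebesgue (\<lambda>\<xi>. f k \<xi> - fourier_L2 (\<lambda>x. a * u x + b * w x) \<xi>)) \<longlonglongrightarrow> 0"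
    unfolding f by (rule fourier_L2_spec[OF uw])
  show "(\<lambda>k. norm2 lebesgue (\<lambda>\<xi>. f k \<xi> - (a * fourier_L2 u \<xi> + b * fourier_L2 w \<xi>))) \<longlonglongrightarrow> 0"
    unfolding f_def
    by (rule norm2_lincomb_tendsto) (use u w in \<open>auto intro!: fourier_L2_spec plancherel_L2_ball trunc_L2_ball\<close>)
qed

lemma fourier_L2_diff:
  assumes "sq_int lebesgue u" "sq_int lebesgue w"
  shows "AE \<xi> in lebesgue. fourier_L2 (\<lambda>x. u x - w x) \<xi> = fourier_L2 u \<xi> - fourier_L2 w \<xi>"
  using fourier_L2_lincomb[OF assms, of 1 "-1"] by simp

text \<open>For functions in a ball the truncations are eventually constant.\<close>

lemma fourier_L2_L2_ball:
  fixes u :: "'a::euclidean_space \<Rightarrow> complex"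
  assumes u: "L2_ball R u"
  shows "AE \<xi> in lebesgue. fourier_L2 u \<xi> = fourier_integral u \<xi>"
proof (rule norm2_limit_unique)
  have us: "sq_int lebesgue u" "AE x in lebesgue. norm x \<ge> R \<longrightarrow> u x = 0" using u by (auto simp: L2_ball_def)
  note tb = trunc_L2_ball[OF us(1)]
  show "sq_int lebesgue (fourier_integral (trunc k u))" for k by (rule plancherel_L2_ball[OF tb])
  show "sq_int lebesgue (fourier_L2 u)" by (rule fourier_L2_spec[OF us(1)])
  show "sq_int lebesgue (fourier_integral u)" by (rule plancherel_L2_ball[OF u])
  show "(\<lambda>k. norm2 lebesgue (\<lambda>\<xi>. fourier_integral (trunc k u) \<xi> - fourier_L2 u \<xi>)) \<longlonglongrightarrow> 0"
    by (rule fourier_L2_spec[OF us(1)])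
  obtain N :: nat where N: "R \<le> real N" using real_arch_simple by blast
  have "norm2 lebesgue (\<lambda>\<xi>. fourier_integral (trunc k u) \<xi> - fourier_integral u \<xi>) = 0" if "k \<ge> N" for k
  proof -
    have "AE x in lebesgue. trunc k u x = u x"
      using us(2) by eventually_elim (use N that in \<open>auto simp: trunc_def extend_zero_def\<close>)
    then have "fourier_integral (trunc k u) = fourier_integral u"
      by (intro fourier_integral_cong_AE sq_int_measurable L2_ball_sq_int[OF tb] us)
    then show ?thesis by simp
  qed
  then show "(\<lambda>k. norm2 lebesgue (\<lambda>\<xi>. fourier_integral (trunc k u) \<xi> - fourier_integral u \<xi>)) \<longlonglongrightarrow> 0"
    by (intro tendsto_eventually eventually_sequentiallyI)
qed

section \<open>Functions of class C^m\<close>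

lemma deriv_words_ConsD: "b # bs \<in> deriv_words m \<Longrightarrow> b \<in> Basis \<and> bs \<in> deriv_words m \<and> length bs < m"
  by (auto simp: deriv_words_def)

lemma C_funD:
  assumes "C_fun m f" "bs \<in> deriv_words m"
  shows "continuous_on UNIV (partial_derivs bs f)"
    and "length bs < m \<Longrightarrow> (partial_derivs bs f has_derivative frechet_derivative (partial_derivs bs f) (at x)) (at x)"
  using assms frechet_derivative_works by (auto simp: C_fun_def)

text \<open>Used for scalar multiples and for conjugation.\<close>

lemma partial_derivs_bounded_linear:
  assumes T: "bounded_linear T" and f: "C_fun m f" and bs: "bs \<in> deriv_words m"
  shows "partial_derivs bs (\<lambda>x. T (f x)) = (\<lambda>x. T (partial_derivs bs f x))"
  using bs
proof (induction bs)
  case (Cons b bs)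
  note * = deriv_words_ConsD[OF Cons.prems]
  have "((\<lambda>x. T (partial_derivs bs f x)) has_derivative (\<lambda>h. T (frechet_derivative (partial_derivs bs f) (at x) h))) (at x)" for x
    using * by (intro bounded_linear.has_derivative[OF T] C_funD(2)[OF f]) auto
  from frechet_derivative_at[OF this, symmetric] Cons.IH *
  show ?case by (simp del: frechet_derivative_at)
qed simp

lemma partial_derivs_add:
  assumes f: "C_fun m f" and g: "C_fun m g" and bs: "bs \<in> deriv_words m"
  shows "partial_derivs bs (\<lambda>x. f x + g x) = (\<lambda>x. partial_derivs bs f x + partial_derivs bs g x)"
  using bs
proof (induction bs)
  case (Cons b bs)
  note * = deriv_words_ConsD[OF Cons.prems]
  have "((\<lambda>x. partial_derivs bs f x + partial_derivs bs g x) has_derivative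
      (\<lambda>h. frechet_derivative (partial_derivs bs f) (at x) h + frechet_derivative (partial_derivs bs g) (at x) h)) (at x)" for x
    using * by (intro has_derivative_add C_funD(2)[OF f] C_funD(2)[OF g]) auto
  from frechet_derivative_at[OF this, symmetric] Cons.IH *
  show ?case by simp
qed simp

lemma C_fun_bounded_linear:
  assumes T: "bounded_linear T" and f: "C_fun m f"
  shows "C_fun m (\<lambda>x. T (f x))"
proof -
  have "(\<lambda>x. T (partial_derivs bs f x)) differentiable at x" if "length bs < m" "bs \<in> deriv_words m" for bs x
    using bounded_linear.has_derivative[OF T C_funD(2)[OF f that(2) that(1)]] by (auto simp: differentiable_def)
  then show ?thesis
    unfolding C_fun_def
    by (auto simp: partial_derivs_bounded_linear[OF T f] intro!: bounded_linear.continuous_on[OF T] C_funD(1)[OF f])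
qed

lemma C_fun_add:
  assumes f: "C_fun m f" and g: "C_fun m g"
  shows "C_fun m (\<lambda>x. f x + g x)"
proof -
  have "(\<lambda>x. partial_derivs bs f x + partial_derivs bs g x) differentiable at x"
    if "length bs < m" "bs \<in> deriv_words m" for bs x
    using has_derivative_add[OF C_funD(2)[OF f that(2) that(1)] C_funD(2)[OF g that(2) that(1)]]
    by (auto simp: differentiable_def)
  then show ?thesis
    unfolding C_fun_def
    by (auto simp: partial_derivs_add[OF f g] intro!: continuous_intros C_funD(1)[OF f] C_funD(1)[OF g])
qed

lemma partial_derivs_zero: "partial_derivs bs (\<lambda>x. 0) = (\<lambda>x. 0)"
proof (induction bs)
  case (Cons b bs)
  have "frechet_derivative (\<lambda>x::'a. 0::'b) (at x) = (\<lambda>h. 0)" for x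
    by (rule frechet_derivative_at[symmetric]) simp
  with Cons show ?case by simp
qed simp

lemma C_fun_zero: "C_fun m (\<lambda>x. 0)"
  by (simp add: C_fun_def partial_derivs_zero)

lemma C_fun_continuous: "C_fun m f \<Longrightarrow> continuous_on UNIV f"
  using C_funD(1)[of m f "[]"] by (simp add: deriv_words_def)

text \<open>It is easier to produce a compact set outside of which f vanishes than to handle the closure of
  the set where it does not.\<close>

lemma compactly_supported_in_iff:
  "compactly_supported_in U f \<longleftrightarrow> (\<exists>K. compact K \<and> K \<subseteq> U \<and> (\<forall>x. x \<notin> K \<longrightarrow> f x = 0))"
proof
  assume "compactly_supported_in U f"
  then show "\<exists>K. compact K \<and> K \<subseteq> U \<and> (\<forall>x. x \<notin> K \<longrightarrow> f x = 0)"
    unfolding compactly_supported_in_def using subsetD[OF closure_subset, of _ "{x. f x \<noteq> 0}"]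
    by (intro exI[of _ "closure {x. f x \<noteq> 0}"]) blast
next
  assume "\<exists>K. compact K \<and> K \<subseteq> U \<and> (\<forall>x. x \<notin> K \<longrightarrow> f x = 0)"
  then obtain K where K: "compact K" "K \<subseteq> U" "{x. f x \<noteq> 0} \<subseteq> K" by auto
  then have "closure {x. f x \<noteq> 0} \<subseteq> K" by (simp add: closure_minimal compact_imp_closed)
  moreover have "compact (closure {x. f x \<noteq> 0})"
    using bounded_subset[OF compact_imp_bounded[OF K(1)] K(3)] by (simp add: compact_closure)
  ultimately show "compactly_supported_in U f" using K(2) by (auto simp: compactly_supported_in_def)
qed

lemma test_functionsI:
  assumes "\<And>m. C_fun m f" "compact K" "K \<subseteq> U" "\<And>x. x \<notin> K \<Longrightarrow> f x = 0"
  shows "f \<in> test_functions U"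
proof -
  have "compactly_supported_in U f"
    unfolding compactly_supported_in_iff using assms(2-4) by (intro exI[of _ K]) simp
  then show ?thesis using assms(1) by (simp add: test_functions_def Cc_def)
qed

lemma test_functionsE:
  assumes "f \<in> test_functions U"
  obtains K where "\<forall>m. C_fun m f" "compact K" "K \<subseteq> U" "\<forall>x. x \<notin> K \<longrightarrow> f x = 0"
proof -
  from assms have f: "\<forall>m. C_fun m f" and "compactly_supported_in U f"
    by (auto simp: test_functions_def Cc_def)
  then show ?thesis
    using that unfolding compactly_supported_in_iff by blast
qed

lemma test_functions_C_fun: "f \<in> test_functions U \<Longrightarrow> C_fun m f"
  by (simp add: test_functions_def Cc_def)

lemma test_functions_lincomb:
  assumes "f \<in> test_functions U" "g \<in> test_functions U"
  shows "(\<lambda>x. a * f x + b * g x) \<in> test_functions U"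
proof -
  obtain K where K: "compact K" "K \<subseteq> U" "\<forall>x. x \<notin> K \<longrightarrow> f x = 0"
    using assms(1) by (rule test_functionsE)
  obtain L where L: "compact L" "L \<subseteq> U" "\<forall>x. x \<notin> L \<longrightarrow> g x = 0"
    using assms(2) by (rule test_functionsE)
  show ?thesis
  proof (rule test_functionsI[of _ "K \<union> L"])
    show "C_fun m (\<lambda>x. a * f x + b * g x)" for m
      by (rule C_fun_add[OF C_fun_bounded_linear[OF bounded_linear_mult_right] C_fun_bounded_linear[OF bounded_linear_mult_right]])
         (use assms in \<open>auto intro: test_functions_C_fun\<close>)
  qed (use K L in \<open>auto intro: compact_Un\<close>)
qed

lemma test_functions_diff:
  "f \<in> test_functions U \<Longrightarrow> g \<in> test_functions U \<Longrightarrow> (\<lambda>x. f x - g x) \<in> test_functions U"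
  using test_functions_lincomb[of f U g 1 "-1"] by simp

lemma test_functions_cnj:
  assumes "f \<in> test_functions U"
  shows "(\<lambda>x. cnj (f x)) \<in> test_functions U"
proof -
  obtain K where K: "compact K" "K \<subseteq> U" "\<forall>x. x \<notin> K \<longrightarrow> f x = 0"
    using assms by (rule test_functionsE)
  show ?thesis
  proof (rule test_functionsI[of _ K])
    show "C_fun m (\<lambda>x. cnj (f x))" for m
      by (rule C_fun_bounded_linear[OF bounded_linear_cnj test_functions_C_fun[OF assms]])
  qed (use K in auto)
qed

lemma test_functions_zero: "(\<lambda>x. 0) \<in> test_functions U"
  by (rule test_functionsI[of _ "{}"]) (auto intro: C_fun_zero)

lemma test_functions_continuous: "f \<in> test_functions U \<Longrightarrow> continuous_on UNIV f"
  using C_fun_continuous[OF test_functions_C_fun[of f U 0]] .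

lemma test_functions_outside: "f \<in> test_functions U \<Longrightarrow> x \<notin> U \<Longrightarrow> f x = 0"
  by (erule test_functionsE) blast

lemma continuous_L2_ball:
  fixes v :: "'a::euclidean_space \<Rightarrow> complex"
  assumes v: "continuous_on UNIV v" and v0: "\<And>x. norm x \<ge> R \<Longrightarrow> v x = 0"
  shows "L2_ball R v"
proof -
  have vm: "v \<in> borel_measurable lebesgue"
    by (intro lborel_imp_lebesgue_measurable borel_measurable_continuous_onI v)
  have "compact (v ` cball 0 R)"
    by (intro compact_continuous_image continuous_on_subset[OF v]) auto
  then obtain K where K: "\<forall>z\<in>v ` cball 0 R. norm z \<le> K"
    using compact_imp_bounded bounded_iff by blast
  have "cmod (v x) \<le> K * cmod (indicator (ball 0 R) x)" for x
    using K v0[of x] by (cases "norm x \<ge> R") (auto simp: indicator_def)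
  then have "sq_int lebesgue v"
    by (intro sq_int_bound[OF sq_int_indicator_ball[of R] vm, of K]) auto
  then show ?thesis using v0 by (auto simp: L2_ball_def)
qed

lemma test_functions_L2_ball:
  assumes "\<phi> \<in> test_functions U" "U \<subseteq> ball 0 R"
  shows "L2_ball R \<phi>"
proof (rule continuous_L2_ball)
  show "continuous_on UNIV \<phi>" using assms(1) by (rule test_functions_continuous)
  fix x :: 'a assume "norm x \<ge> R"
  then have "x \<notin> U" using assms(2) by auto
  then show "\<phi> x = 0" using test_functions_outside[OF assms(1)] by blast
qed

section \<open>Decay of Fourier transforms of test functions\<close>

lemma fourier_integral_continuous_eq:
  assumes "continuous_on UNIV v"
  shows "fourier_integral v = fint v"
  using borel_measurable_continuous_onI[OF assms]
  by (intro fourier_integral_eq_fint) (auto intro: lborel_imp_lebesgue_measurable)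

lemma continuous_lborel_integrable:
  fixes v :: "'a::euclidean_space \<Rightarrow> complex"
  assumes v: "continuous_on UNIV v" and v0: "\<And>x. norm x \<ge> R \<Longrightarrow> v x = 0"
  shows "integrable lborel v"
  using L2_ball_L1_bound(1)[OF continuous_L2_ball[OF assms]] borel_measurable_continuous_onI[OF v]
  by (subst (asm) integrable_completion) auto

lemma has_derivative_imp_quotient_tendsto:
  fixes f :: "real \<Rightarrow> complex"
  assumes "(f has_derivative (\<lambda>h. h *\<^sub>R d)) (at 0)"
  shows "((\<lambda>t. (f t - f 0) /\<^sub>R t) \<longlongrightarrow> d) (at 0)"
proof -
  have "((\<lambda>h. norm (f h - f 0 - h *\<^sub>R d) / norm h) \<longlongrightarrow> 0) (at 0)"
    using assms unfolding has_derivative_at by simp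
  moreover have "norm (f h - f 0 - h *\<^sub>R d) / norm h = norm ((f h - f 0) /\<^sub>R h - d)" if "h \<noteq> 0" for h
  proof -
    have "(f h - f 0) /\<^sub>R h - d = inverse h *\<^sub>R (f h - f 0 - h *\<^sub>R d)"
      using that by (simp add: scaleR_diff_right)
    then show ?thesis by (simp add: divide_inverse mult.commute)
  qed
  ultimately have "((\<lambda>h. norm ((f h - f 0) /\<^sub>R h - d)) \<longlongrightarrow> 0) (at 0)"
    by (elim Lim_transform_eventually) (auto simp: eventually_at_filter)
  then have "((\<lambda>h. (f h - f 0) /\<^sub>R h - d) \<longlongrightarrow> 0) (at 0)" by (rule tendsto_norm_zero_cancel)
  then show ?thesis by (simp add: LIM_zero_iff)
qed

text \<open>The difference quotients of g converge to the partial derivative, and translating g multiplies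
  its transform by a character; this replaces an integration by parts.\<close>

lemma fint_partial_derivative:
  fixes g g' :: "'a::euclidean_space \<Rightarrow> complex"
  assumes b: "b \<in> Basis"
    and g: "continuous_on UNIV g" "\<And>x. norm x \<ge> R \<Longrightarrow> g x = 0"
    and g': "continuous_on UNIV g'" "\<And>x. norm x \<ge> R \<Longrightarrow> g' x = 0"
    and deriv: "\<And>x. \<exists>D. (g has_derivative D) (at x) \<and> D b = g' x"
  shows "fint g' \<xi> = \<i> * of_real (\<xi> \<bullet> b) * fint g \<xi>"
proof -
  have gi: "integrable lborel g" using g by (rule continuous_lborel_integrable)
  note [measurable] = borel_measurable_continuous_onI[OF g(1)] borel_measurable_continuous_onI[OF g'(1)]
  have nb: "norm b = 1" using b by simp
  have "compact (g' ` cball 0 R)"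
    by (intro compact_continuous_image continuous_on_subset[OF g'(1)]) auto
  then obtain K0 where K0: "\<forall>z\<in>g' ` cball 0 R. norm z \<le> K0"
    using compact_imp_bounded bounded_iff by blast
  define K where "K = max 0 K0"
  have K: "cmod (g' x) \<le> K" "K \<ge> 0" for x
    using K0 g'(2)[of x] by (cases "norm x \<le> R"; force simp: K_def)+
  have hd: "((\<lambda>t. g (x + t *\<^sub>R b)) has_derivative (\<lambda>h. h *\<^sub>R g' (x + t *\<^sub>R b))) (at t)" for x t
  proof -
    obtain D where D: "(g has_derivative D) (at (x + t *\<^sub>R b))" "D b = g' (x + t *\<^sub>R b)"
      using deriv by blast
    have "((\<lambda>t. x + t *\<^sub>R b) has_derivative (\<lambda>h. h *\<^sub>R b)) (at t)"
      by (auto intro!: derivative_eq_intros)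
    from has_derivative_compose[OF this D(1)]
    have "((\<lambda>t. g (x + t *\<^sub>R b)) has_derivative (\<lambda>h. D (h *\<^sub>R b))) (at t)" .
    moreover have "D (h *\<^sub>R b) = h *\<^sub>R g' (x + t *\<^sub>R b)" for h
      using D(2) linear_scale[OF has_derivative_linear[OF D(1)]] by simp
    ultimately show ?thesis by simp
  qed
  have lip: "cmod (g (x + t *\<^sub>R b) - g x) \<le> K * \<bar>t\<bar>" for x t
  proof -
    have "norm (g (x + t *\<^sub>R b) - g (x + 0 *\<^sub>R b)) \<le> K * norm (t - 0)"
    proof (rule differentiable_bound[of UNIV])
      show "((\<lambda>t. g (x + t *\<^sub>R b)) has_derivative (\<lambda>h. h *\<^sub>R g' (x + t *\<^sub>R b))) (at t within UNIV)" for t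
        using hd by simp
      show "onorm (\<lambda>h::real. h *\<^sub>R g' (x + t *\<^sub>R b)) \<le> K" for t
      proof (rule onorm_le)
        fix h :: real
        show "norm (h *\<^sub>R g' (x + t *\<^sub>R b)) \<le> K * norm h"
          using mult_left_mono[OF K(1)[of "x + t *\<^sub>R b"], of "\<bar>h\<bar>"] by (simp add: mult.commute)
      qed
    qed auto
    then show ?thesis by simp
  qed
  define h where "h k = 1 / real (Suc k)" for k
  have h: "h k > 0" "h k \<le> 1" for k by (auto simp: h_def)
  have hlim: "h \<longlonglongrightarrow> 0" unfolding h_def using LIMSEQ_inverse_real_of_nat by (simp add: inverse_eq_divide)
  have hlim': "filterlim h (at 0) sequentially"
    using hlim h(1) by (simp add: filterlim_at less_imp_neq[THEN not_sym])
  define q where "q k x = (g (x + h k *\<^sub>R b) - g x) /\<^sub>R h k" for k x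
  have qlim: "(\<lambda>k. q k x) \<longlonglongrightarrow> g' x" for x
  proof -
    have "((\<lambda>t. g (x + t *\<^sub>R b)) has_derivative (\<lambda>h. h *\<^sub>R g' x)) (at 0)"
      using hd[of x 0] by simp
    from has_derivative_imp_quotient_tendsto[OF this]
    have "((\<lambda>t. (g (x + t *\<^sub>R b) - g x) /\<^sub>R t) \<longlongrightarrow> g' x) (at 0)" by simp
    from filterlim_compose[OF this hlim'] show ?thesis by (simp add: q_def)
  qed
  have qb: "cmod (q k x) \<le> K" for k x
  proof -
    have "cmod (q k x) = cmod (g (x + h k *\<^sub>R b) - g x) / h k"
      using h(1)[of k] by (simp add: q_def divide_inverse mult.commute)
    then show ?thesis using lip[of x "h k"] h(1)[of k] by (simp add: divide_le_eq)
  qed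
  have q0: "q k x = 0" if "norm x \<ge> R + 1" for k x
  proof -
    have "norm (x + h k *\<^sub>R b) \<ge> norm x - norm (h k *\<^sub>R b)" by (rule norm_diff_ineq)
    then have "norm (x + h k *\<^sub>R b) \<ge> R" using that h[of k] nb by simp
    then show ?thesis using g(2)[of x] g(2)[of "x + h k *\<^sub>R b"] that by (simp add: q_def)
  qed
  have qm[measurable]: "q k \<in> borel_measurable borel" for k unfolding q_def by measurable
  have "(\<lambda>k. fint (q k) \<xi>) \<longlonglongrightarrow> fint g' \<xi>"
    unfolding fint_def
  proof (rule integral_dominated_convergence)
    show "integrable lborel (\<lambda>x::'a. K * indicator (cball 0 (R+1)) x)"
      by (intro integrable_mult_right integrable_real_indicator emeasure_bounded_finite) auto
    show "AE x in lborel. norm (iexp (- (x \<bullet> \<xi>)) * q k x) \<le> K * indicator (cball 0 (R+1)) x" for k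
    proof (rule AE_I2)
      fix x :: 'a
      show "norm (iexp (- (x \<bullet> \<xi>)) * q k x) \<le> K * indicator (cball 0 (R+1)) x"
        using qb[of k x] q0[of x k] by (cases "norm x \<le> R + 1") (auto simp: norm_mult)
    qed
    show "AE x in lborel. (\<lambda>k. iexp (- (x \<bullet> \<xi>)) * q k x) \<longlonglongrightarrow> iexp (- (x \<bullet> \<xi>)) * g' x"
      by (intro AE_I2 tendsto_intros qlim)
  qed measurable
  moreover have "fint (q k) \<xi> = ((iexp (h k * (\<xi> \<bullet> b)) - 1) /\<^sub>R h k) * fint g \<xi>" for k
  proof -
    have tr: "fint g \<xi> = (\<integral>x. iexp (- ((h k *\<^sub>R b + x) \<bullet> \<xi>)) * g (h k *\<^sub>R b + x) \<partial>lborel)"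
      unfolding fint_def
      using lborel_integral_affine[of "\<lambda>x. iexp (- (x \<bullet> \<xi>)) * g x" 1 "h k *\<^sub>R b"] by simp
    have eq: "iexp (- ((h k *\<^sub>R b + x) \<bullet> \<xi>)) = iexp (- (h k * (\<xi> \<bullet> b))) * iexp (- (x \<bullet> \<xi>))" for x
      unfolding exp_add[symmetric] distrib_left[symmetric] of_real_add[symmetric]
      by (simp only: inner_add_left inner_scaleR_left inner_commute[of b] minus_add_distrib)
    have tr2: "(\<integral>x. iexp (- (x \<bullet> \<xi>)) * g (x + h k *\<^sub>R b) \<partial>lborel) = iexp (h k * (\<xi> \<bullet> b)) * fint g \<xi>"
    proof -
      have "fint g \<xi> = (\<integral>x. iexp (- (h k * (\<xi> \<bullet> b))) * (iexp (- (x \<bullet> \<xi>)) * g (x + h k *\<^sub>R b)) \<partial>lborel)"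
        unfolding tr eq by (simp only: mult.assoc add.commute[of "h k *\<^sub>R b"])
      also have "\<dots> = iexp (- (h k * (\<xi> \<bullet> b))) * (\<integral>x. iexp (- (x \<bullet> \<xi>)) * g (x + h k *\<^sub>R b) \<partial>lborel)"
        by (rule integral_mult_right_zero)
      finally have "iexp (h k * (\<xi> \<bullet> b)) * fint g \<xi>
          = (iexp (h k * (\<xi> \<bullet> b)) * iexp (- (h k * (\<xi> \<bullet> b)))) * (\<integral>x. iexp (- (x \<bullet> \<xi>)) * g (x + h k *\<^sub>R b) \<partial>lborel)"
        by (simp only: mult.assoc)
      also have "iexp (h k * (\<xi> \<bullet> b)) * iexp (- (h k * (\<xi> \<bullet> b))) = 1"
        unfolding exp_add[symmetric] by simp
      finally show ?thesis by simp
    qed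
    have gi2: "integrable lborel (\<lambda>x. iexp (- (x \<bullet> \<xi>)) * g (x + h k *\<^sub>R b))"
    proof (rule fint_integrable(2), rule continuous_lborel_integrable[where R = "R+1"])
      show "continuous_on UNIV (\<lambda>x. g (x + h k *\<^sub>R b))"
        by (rule continuous_on_compose2[OF g(1)]) (auto intro!: continuous_intros)
      fix x :: 'a assume "norm x \<ge> R + 1"
      have "norm (x + h k *\<^sub>R b) \<ge> norm x - norm (h k *\<^sub>R b)" by (rule norm_diff_ineq)
      then have "norm (x + h k *\<^sub>R b) \<ge> R" using \<open>norm x \<ge> R + 1\<close> h[of k] nb by simp
      then show "g (x + h k *\<^sub>R b) = 0" by (rule g(2))
    qed
    have "fint (q k) \<xi> = (\<integral>x. of_real (inverse (h k)) * (iexp (- (x \<bullet> \<xi>)) * g (x + h k *\<^sub>R b) - iexp (- (x \<bullet> \<xi>)) * g x) \<partial>lborel)"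
      unfolding fint_def q_def
      by (intro Bochner_Integration.integral_cong refl)
         (simp only: scaleR_conv_of_real right_diff_distrib mult.left_commute)
    also have "\<dots> = of_real (inverse (h k)) * (iexp (h k * (\<xi> \<bullet> b)) * fint g \<xi> - fint g \<xi>)"
      unfolding integral_mult_right_zero Bochner_Integration.integral_diff[OF gi2 fint_integrable(2)[OF gi]] tr2
      unfolding fint_def ..
    finally show ?thesis by (simp only: scaleR_conv_of_real left_diff_distrib mult_1_left mult.assoc)
  qed
  moreover have "(\<lambda>k. (iexp (h k * (\<xi> \<bullet> b)) - 1) /\<^sub>R h k) \<longlonglongrightarrow> \<i> * of_real (\<xi> \<bullet> b)"
  proof -
    define A where "A = \<i> * complex_of_real (\<xi> \<bullet> b)"
    have eq: "iexp (t * (\<xi> \<bullet> b)) = exp (t *\<^sub>R A)" for t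
      by (simp only: A_def scaleR_conv_of_real of_real_mult mult.left_commute)
    have "((\<lambda>t. exp (t *\<^sub>R A)) has_derivative (\<lambda>h. h *\<^sub>R A)) (at 0)"
      using exp_scaleR_has_vector_derivative_right[of A 0 UNIV] by (simp add: has_vector_derivative_def)
    from has_derivative_imp_quotient_tendsto[OF this]
    have "((\<lambda>t. (iexp (t * (\<xi> \<bullet> b)) - 1) /\<^sub>R t) \<longlongrightarrow> \<i> * of_real (\<xi> \<bullet> b)) (at 0)"
      unfolding eq A_def[symmetric] by simp
    from filterlim_compose[OF this hlim'] show ?thesis by simp
  qed
  then have "(\<lambda>k. ((iexp (h k * (\<xi> \<bullet> b)) - 1) /\<^sub>R h k) * fint g \<xi>) \<longlonglongrightarrow> \<i> * of_real (\<xi> \<bullet> b) * fint g \<xi>"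
    by (intro tendsto_intros)
  ultimately show ?thesis using LIMSEQ_unique by simp
qed

lemma partial_derivs_outside:
  fixes f :: "'a::euclidean_space \<Rightarrow> 'b::real_normed_vector"
  assumes "\<And>x. norm x > R \<Longrightarrow> f x = 0"
  shows "norm x > R \<Longrightarrow> partial_derivs bs f x = 0"
proof (induction bs arbitrary: x)
  case (Cons b bs)
  have "(partial_derivs bs f has_derivative (\<lambda>h. 0)) (at x)"
  proof (rule has_derivative_transform_within_open[of "\<lambda>x. 0" _ _ _ "{x. norm x > R}"])
    show "open {x::'a. norm x > R}" by (intro open_Collect_less continuous_intros)
  qed (use Cons in auto)
  from frechet_derivative_at[OF this, symmetric] show ?case by simp
qed (use assms in simp)

text \<open>The transform of (1 - Laplacian) \<phi> is (1 + |\<xi>|^2) times that of \<phi>, and the former is square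
  integrable because it belongs to a continuous function of compact support.\<close>

lemma fourier_integral_decay:
  fixes \<phi> :: "'a::euclidean_space \<Rightarrow> complex"
  assumes C: "C_fun 2 \<phi>" and R: "\<And>x. norm x \<ge> R \<Longrightarrow> \<phi> x = 0"
  shows "sq_int lebesgue (\<lambda>\<xi>. of_real (1 + (norm \<xi>)\<^sup>2) * fourier_integral \<phi> \<xi>)"
proof -
  define S where "S = R + 1"
  define d where "d b = partial_derivs [b] \<phi>" for b
  define dd where "dd b = partial_derivs [b, b] \<phi>" for b
  have w: "[b] \<in> deriv_words 2" "[b,b] \<in> deriv_words 2" "[] \<in> deriv_words 2" if "b \<in> Basis" for b :: 'a
    using that by (auto simp: deriv_words_def)
  have out: "\<phi> x = 0" "d b x = 0" "dd b x = 0" if "norm x \<ge> S" for x b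
    unfolding d_def dd_def
    using that partial_derivs_outside[of R \<phi> x "[b]"] partial_derivs_outside[of R \<phi> x "[b,b]"] R[of x]
    by (auto simp: S_def R)
  have c: "continuous_on UNIV \<phi>" by (rule C_fun_continuous[OF C])
  have cd: "continuous_on UNIV (d b)" "continuous_on UNIV (dd b)" if "b \<in> Basis" for b
    unfolding d_def dd_def using C_funD(1)[OF C] w[OF that] by blast+
  have f1: "fint (d b) \<xi> = \<i> * of_real (\<xi> \<bullet> b) * fint \<phi> \<xi>" if "b \<in> Basis" for b \<xi>
    using that c out(1) cd(1)[OF that] out(2)
  proof (rule fint_partial_derivative)
    show "\<exists>D. (\<phi> has_derivative D) (at x) \<and> D b = d b x" for x
      using C_funD(2)[OF C w(3)[OF that], of x] by (auto simp: d_def)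
  qed
  have f2: "fint (dd b) \<xi> = \<i> * of_real (\<xi> \<bullet> b) * fint (d b) \<xi>" if "b \<in> Basis" for b \<xi>
    using that cd(1)[OF that] out(2) cd(2)[OF that] out(3)
  proof (rule fint_partial_derivative)
    show "\<exists>D. (d b has_derivative D) (at x) \<and> D b = dd b x" for x
      using C_funD(2)[OF C w(1)[OF that], of x] by (auto simp: d_def dd_def)
  qed
  define L where "L x = \<phi> x - (\<Sum>b\<in>Basis. dd b x)" for x
  have L: "continuous_on UNIV L" "\<And>x. norm x \<ge> S \<Longrightarrow> L x = 0"
    unfolding L_def using c cd(2) out by (auto intro!: continuous_intros)
  have i: "integrable lborel \<phi>" "b \<in> Basis \<Longrightarrow> integrable lborel (dd b)" for b
    using continuous_lborel_integrable[OF c out(1)] continuous_lborel_integrable[OF cd(2) out(3)] by auto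
  have "fint L \<xi> = of_real (1 + (norm \<xi>)\<^sup>2) * fint \<phi> \<xi>" for \<xi>
  proof -
    have "fint L \<xi> = (\<integral>x. iexp (- (x \<bullet> \<xi>)) * \<phi> x - (\<Sum>b\<in>Basis. iexp (- (x \<bullet> \<xi>)) * dd b x) \<partial>lborel)"
      unfolding fint_def L_def by (simp add: right_diff_distrib sum_distrib_left)
    also have "\<dots> = fint \<phi> \<xi> - (\<Sum>b\<in>Basis. fint (dd b) \<xi>)"
    proof -
      have j: "integrable lborel (\<lambda>x. iexp (- (x \<bullet> \<xi>)) * dd b x)" if "b \<in> Basis" for b
        by (rule fint_integrable(2)[OF i(2)[OF that]])
      then have "integrable lborel (\<lambda>x. \<Sum>b\<in>Basis. iexp (- (x \<bullet> \<xi>)) * dd b x)"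
        by (intro Bochner_Integration.integrable_sum)
      note d = Bochner_Integration.integral_diff[OF fint_integrable(2)[OF i(1)] this, of \<xi>]
      have s: "(\<integral>x. (\<Sum>b\<in>Basis. iexp (- (x \<bullet> \<xi>)) * dd b x) \<partial>lborel)
          = (\<Sum>b\<in>Basis. \<integral>x. iexp (- (x \<bullet> \<xi>)) * dd b x \<partial>lborel)"
        by (rule Bochner_Integration.integral_sum[OF j])
      show ?thesis using d unfolding fint_def s .
    qed
    also have "(\<Sum>b\<in>Basis. fint (dd b) \<xi>) = (\<Sum>b\<in>Basis. - of_real ((\<xi> \<bullet> b)\<^sup>2) * fint \<phi> \<xi>)"
    proof (intro sum.cong refl)
      fix b :: 'a assume b: "b \<in> Basis"
      have "fint (dd b) \<xi> = (\<i> * of_real (\<xi> \<bullet> b))\<^sup>2 * fint \<phi> \<xi>"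
        unfolding f2[OF b] f1[OF b] by (simp only: power2_eq_square mult.assoc)
      then show "fint (dd b) \<xi> = - of_real ((\<xi> \<bullet> b)\<^sup>2) * fint \<phi> \<xi>"
        by (simp add: power_mult_distrib)
    qed
    also have "\<dots> = - of_real ((norm \<xi>)\<^sup>2) * fint \<phi> \<xi>"
      unfolding norm_squared_Basis by (simp add: sum_distrib_right sum_negf)
    finally show ?thesis by (simp add: algebra_simps)
  qed
  then have "fourier_integral L = (\<lambda>\<xi>. of_real (1 + (norm \<xi>)\<^sup>2) * fourier_integral \<phi> \<xi>)"
    unfolding fourier_integral_continuous_eq[OF c] fourier_integral_continuous_eq[OF L(1)] by auto
  then show ?thesis
    using plancherel_L2_ball(1)[OF continuous_L2_ball[OF L]] by simp
qed

lemma test_functions_decay: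
  assumes "\<phi> \<in> test_functions U" "bounded U"
  shows "sq_int lebesgue (\<lambda>\<xi>. of_real (1 + (norm \<xi>)\<^sup>2) * fourier_integral \<phi> \<xi>)"
proof -
  obtain R where R: "\<forall>x\<in>U. norm x < R"
    using assms(2) bounded_pos_less by blast
  show ?thesis
    by (rule fourier_integral_decay[OF test_functions_C_fun[OF assms(1)], of R])
       (use R test_functions_outside[OF assms(1)] in force)
qed

section \<open>The fractional Laplacian as an integral operator off the diagonal\<close>

lemma integrable_powr_unit:
  fixes a :: real
  assumes "a > -1"
  shows "integrable lborel (\<lambda>t::real. if 0 < t \<and> t \<le> 1 then t powr a else 0)"
proof -
  have "(\<lambda>t. t powr a) absolutely_integrable_on {0..1}"
    by (intro nonnegative_absolutely_integrable_1 integrable_on_powr_from_0 assms) auto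
  then have "integrable lborel (\<lambda>t. indicator {0..1} t *\<^sub>R t powr a)"
    unfolding set_integrable_def by (subst (asm) integrable_completion) auto
  moreover have "(\<lambda>t. indicator {0..1} t *\<^sub>R t powr a) = (\<lambda>t::real. if 0 < t \<and> t \<le> 1 then t powr a else 0)"
    by (auto simp: indicator_def fun_eq_iff)
  ultimately show ?thesis by simp
qed

lemma integrable_powr_tail:
  fixes a :: real
  assumes "a < -1"
  shows "integrable lborel (\<lambda>t::real. if 1 \<le> t then t powr a else 0)"
proof -
  have "(\<lambda>t. t powr a) integrable_on {1..}"
    using has_integral_powr_to_inf[OF assms, of 1] by (auto simp: integrable_on_def)
  then have "(\<lambda>t. t powr a) absolutely_integrable_on {1..}"
    by (intro nonnegative_absolutely_integrable_1) auto
  then have "integrable lborel (\<lambda>t. indicator {1..} t *\<^sub>R t powr a)"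
    unfolding set_integrable_def by (subst (asm) integrable_completion) auto
  moreover have "(\<lambda>t. indicator {1..} t *\<^sub>R t powr a) = (\<lambda>t::real. if 1 \<le> t then t powr a else 0)"
    by (auto simp: indicator_def fun_eq_iff)
  ultimately show ?thesis by simp
qed

text \<open>The constant in the subordination formula: the integral of t^(-1-s) (1 - exp (-t r^2)) over t is
  this constant times r^(2s).\<close>

definition subord_const :: "real \<Rightarrow> real" where
  "subord_const s = (\<integral>t. (if 0 < t then t powr (-1-s) * (1 - exp (- t)) else 0) \<partial>lborel)"

text \<open>The corresponding constant for the heat kernel: the integral of t^(-1-s) times the Gaussian kernel
  at distance r is this constant times r^(-n-2s).\<close>

definition heat_const :: "nat \<Rightarrow> real \<Rightarrow> real" where
  "heat_const n s = (\<integral>t. (if 0 < t then t powr (-1-s) * (sqrt (pi / t) ^ n * exp (- 1 / (4 * t))) else 0) \<partial>lborel)"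

lemma subord_integrable:
  assumes "0 < s" "s < 1"
  shows "integrable lborel (\<lambda>t::real. if 0 < t then t powr (-1-s) * (1 - exp (- t)) else 0)"
proof (rule Bochner_Integration.integrable_bound)
  show "integrable lborel (\<lambda>t::real. (if 0 < t \<and> t \<le> 1 then t powr (-s) else 0) + (if 1 \<le> t then t powr (-1-s) else 0))"
    using assms by (intro Bochner_Integration.integrable_add integrable_powr_unit integrable_powr_tail) auto
  show "AE t in lborel. norm (if 0 < t then t powr (-1-s) * (1 - exp (- t)) else 0)
      \<le> norm ((if 0 < t \<and> t \<le> 1 then t powr (-s) else 0) + (if 1 \<le> t then t powr (-1-s) else 0))"
  proof (rule AE_I2)
    fix t :: real
    consider "t \<le> 0" | "0 < t" "t \<le> 1" | "t > 1" by linarith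
    then show "norm (if 0 < t then t powr (-1-s) * (1 - exp (- t)) else 0)
      \<le> norm ((if 0 < t \<and> t \<le> 1 then t powr (-s) else 0) + (if 1 \<le> t then t powr (-1-s) else 0))"
    proof cases
      case 2
      have "t powr (-1-s) * (1 - exp (- t)) \<le> t powr (-1-s) * t"
        using exp_ge_add_one_self[of "-t"] by (intro mult_left_mono) auto
      also have "\<dots> = t powr (-s)"
        using 2 powr_add[of t "-1-s" 1] by simp
      also have "\<dots> \<le> t powr (-s) + (if 1 \<le> t then t powr (-1-s) else 0)" by simp
      finally show ?thesis using 2 by (simp add: abs_mult)
    next
      case 3
      then show ?thesis by (simp add: abs_mult mult_left_le)
    qed simp
  qed
qed measurable

lemma subord_const_pos:
  assumes "0 < s" "s < 1"
  shows "subord_const s > 0"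
proof -
  define c where "c = 2 powr (-1-s) * (1 - exp (-1))"
  have c: "c > 0" by (simp add: c_def)
  have "c = (\<integral>t. c * indicator {1..2} t \<partial>(lborel::real measure))" by simp
  also have "\<dots> \<le> subord_const s"
    unfolding subord_const_def
  proof (rule integral_mono)
    show "integrable lborel (\<lambda>t::real. c * indicator {1..2} t)" by simp
    fix t :: real
    show "c * indicator {1..2} t \<le> (if 0 < t then t powr (-1-s) * (1 - exp (- t)) else 0)"
    proof (cases "t \<in> {1..2}")
      case True
      then have "2 powr (-1-s) \<le> t powr (-1-s)" using assms by (intro powr_mono2') auto
      then have "c \<le> t powr (-1-s) * (1 - exp (- t))"
        unfolding c_def using True by (intro mult_mono) auto
      then show ?thesis using True by simp
    qed simp
  qed (rule subord_integrable[OF assms])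
  finally show ?thesis using c by linarith
qed

text \<open>Away from the origin the Gaussian decays faster than any power of t as t tends to 0, which keeps
  the integrals against t^(-1-s) finite.\<close>

lemma gaussian_small_time:
  assumes "0 < t" "t \<le> 1"
  shows "sqrt (pi / t) ^ n * exp (- 1 / (4 * t)) \<le> pi ^ n * (4 * real (n + Suc j)) ^ (n + Suc j) * t ^ Suc j"
proof -
  define N where "N = n + Suc j"
  have N: "N > 0" by (simp add: N_def)
  have "1 \<le> pi / t" using assms pi_gt3 by (simp add: le_divide_eq)
  then have "pi / t * 1 \<le> pi / t * (pi / t)" using assms by (intro mult_left_mono) auto
  then have "sqrt (pi / t) \<le> pi / t" using assms by (intro real_le_lsqrt) (simp_all only: power2_eq_square mult_1_right, simp)
  then have 1: "sqrt (pi / t) ^ n \<le> (pi / t) ^ n" using assms by (intro power_mono) auto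
  define y where "y = 1 / (4 * t * real N)"
  have y: "y > 0" using assms N by (simp add: y_def)
  have "y ^ N \<le> exp y ^ N" using exp_ge_add_one_self[of y] y by (intro power_mono) linarith+
  also have "exp y ^ N = exp (1 / (4 * t))"
    using N by (simp add: exp_of_nat_mult[symmetric] y_def)
  finally have "exp (- (1 / (4 * t))) \<le> 1 / y ^ N"
    using y by (simp add: exp_minus inverse_eq_divide frac_le)
  also have "1 / y ^ N = (4 * real N * t) ^ N" using assms by (simp add: y_def power_one_over[symmetric] mult_ac)
  finally have "sqrt (pi / t) ^ n * exp (- 1 / (4 * t)) \<le> (pi / t) ^ n * (4 * real N * t) ^ N"
    using 1 assms by (intro mult_mono) auto
  also have "\<dots> = pi ^ n * (4 * real N) ^ N * (t ^ N / t ^ n)"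
    by (simp add: power_divide power_mult_distrib)
  also have "t ^ N / t ^ n = t ^ Suc j" using assms by (simp add: N_def power_add)
  finally show ?thesis unfolding N_def by simp
qed

lemma heat_integrable:
  assumes "0 < s" "s < 1"
  shows "integrable lborel (\<lambda>t::real. if 0 < t then t powr (-1-s) * (sqrt (pi / t) ^ n * exp (- 1 / (4 * t))) else 0)"
proof (rule Bochner_Integration.integrable_bound)
  define K :: real where "K = pi ^ n * (4 * real (n + Suc 1)) ^ (n + Suc 1)"
  have K: "K \<ge> 0" by (simp add: K_def)
  show "integrable lborel (\<lambda>t::real. K * (if 0 < t \<and> t \<le> 1 then t powr 0 else 0) + sqrt pi ^ n * (if 1 \<le> t then t powr (-1-s) else 0))"
    using assms by (intro Bochner_Integration.integrable_add integrable_mult_right integrable_powr_unit integrable_powr_tail) auto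
  show "AE t in lborel. norm (if 0 < t then t powr (-1-s) * (sqrt (pi / t) ^ n * exp (- 1 / (4 * t))) else 0)
      \<le> norm (K * (if 0 < t \<and> t \<le> 1 then t powr 0 else 0) + sqrt pi ^ n * (if 1 \<le> t then t powr (-1-s) else 0))"
  proof (rule AE_I2)
    fix t :: real
    consider "t \<le> 0" | "0 < t" "t \<le> 1" | "t > 1" by linarith
    then show "norm (if 0 < t then t powr (-1-s) * (sqrt (pi / t) ^ n * exp (- 1 / (4 * t))) else 0)
      \<le> norm (K * (if 0 < t \<and> t \<le> 1 then t powr 0 else 0) + sqrt pi ^ n * (if 1 \<le> t then t powr (-1-s) else 0))"
    proof cases
      case 2
      have "t powr (-1-s) \<le> t powr (-2)" using 2 assms by (intro powr_mono') auto
      then have "t powr (-1-s) * (sqrt (pi / t) ^ n * exp (- 1 / (4 * t))) \<le> t powr (-2) * (K * t ^ Suc 1)"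
        by (rule mult_mono[OF _ gaussian_small_time[OF 2, of n 1, folded K_def]]) (use 2 in auto)
      also have "\<dots> = K * (t powr (-2) * t powr 2)"
        using 2 by (simp add: powr_numeral power2_eq_square)
      also have "t powr (-2) * t powr 2 = 1" using 2 powr_add[of t "-2" 2] by simp
      finally have A: "t powr (-1-s) * (sqrt (pi / t) ^ n * exp (- 1 / (4 * t))) \<le> K" by simp
      have B: "0 \<le> t powr (-1-s) * (sqrt (pi / t) ^ n * exp (- 1 / (4 * t)))" using 2 by simp
      have C: "0 \<le> sqrt pi ^ n * (if 1 \<le> t then t powr (-1-s) else 0)" by simp
      have D: "K * (if 0 < t \<and> t \<le> 1 then t powr 0 else 0) = K" using 2 by simp
      have E: "(if 0 < t then t powr (-1-s) * (sqrt (pi / t) ^ n * exp (- 1 / (4 * t))) else 0)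
          = t powr (-1-s) * (sqrt (pi / t) ^ n * exp (- 1 / (4 * t)))" using 2 by simp
      show ?thesis unfolding real_norm_def D E using A B C by linarith
    next
      case 3
      have "sqrt (pi / t) ^ n \<le> sqrt pi ^ n"
        using 3 by (intro power_mono) (auto simp: divide_le_eq)
      then have "sqrt (pi / t) ^ n * exp (- 1 / (4 * t)) \<le> sqrt pi ^ n * 1"
        using 3 by (intro mult_mono) auto
      then have A: "t powr (-1-s) * (sqrt (pi / t) ^ n * exp (- 1 / (4 * t))) \<le> sqrt pi ^ n * t powr (-1-s)"
        unfolding mult.commute[of "t powr (-1-s)"] by (intro mult_right_mono) simp_all
      have B: "0 \<le> t powr (-1-s) * (sqrt (pi / t) ^ n * exp (- 1 / (4 * t)))" using 3 by simp
      show ?thesis unfolding real_norm_def using 3 A B by simp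
    qed simp
  qed
qed measurable

text \<open>Scaling the time variable by r^2 in the two integrals.\<close>

lemma subord_integral:
  assumes s: "0 < s" "s < 1" and r: "r \<ge> 0"
  shows "integrable lborel (\<lambda>t::real. if 0 < t then t powr (-1-s) * (1 - exp (- t * r\<^sup>2)) else 0)"
    and "(\<integral>t. (if 0 < t then t powr (-1-s) * (1 - exp (- t * r\<^sup>2)) else 0) \<partial>lborel) = r powr (2 * s) * subord_const s"
proof -
  define f where "f t = (if 0 < t then t powr (-1-s) * (1 - exp (- t * r\<^sup>2)) else 0)" for t :: real
  define a where "a t = (if 0 < t then t powr (-1-s) * (1 - exp (- t)) else 0)" for t :: real
  have *: "integrable lborel f \<and> integral\<^sup>L lborel f = r powr (2 * s) * subord_const s"
  proof (cases "r = 0")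
    case True
    have "f = (\<lambda>t. 0)" unfolding f_def True by auto
    then show ?thesis using True by simp
  next
    case False
    define c where "c = 1 / r\<^sup>2"
    have r0: "r > 0" using r False by simp
    have c: "c > 0" "c * r\<^sup>2 = 1" using r0 by (auto simp: c_def)
    have eq: "f (0 + c * t) = c powr (-1-s) * a t" for t
    proof (cases "t > 0")
      case True
      have "- (c * t) * r\<^sup>2 = - t" using c(2) by (metis mult.commute mult.left_commute mult_1_right mult_minus_left)
      then show ?thesis using c True by (simp add: f_def a_def powr_mult zero_less_mult_iff)
    next
      case False
      then show ?thesis using c by (simp add: f_def a_def zero_less_mult_iff)
    qed
    have ai: "integrable lborel a" unfolding a_def by (rule subord_integrable[OF s])
    have fi: "integrable lborel f"
      using lborel_integrable_real_affine_iff[of c f 0] c ai unfolding eq by simp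
    have "integral\<^sup>L lborel f = \<bar>c\<bar> *\<^sub>R (\<integral>t. f (0 + c * t) \<partial>lborel)"
      using c by (intro lborel_integral_real_affine) simp
    also have "\<dots> = c * (c powr (-1-s) * subord_const s)"
      unfolding eq subord_const_def a_def[symmetric] using c by simp
    also have "c * c powr (-1-s) = r powr (2 * s)"
    proof -
      have "c * c powr (-1-s) = c powr (-s)" using c powr_add[of c 1 "-1-s"] by simp
      moreover have "c = r powr (-2)" using r0 by (simp add: c_def powr_minus powr_numeral divide_inverse)
      then have "c powr (-s) = r powr (2 * s)" by (simp only: powr_powr) simp
      ultimately show ?thesis by simp
    qed
    then have "c * (c powr (-1-s) * subord_const s) = r powr (2 * s) * subord_const s"
      by (simp only: mult.assoc[symmetric])
    finally show ?thesis using fi by simp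
  qed
  then show "integrable lborel (\<lambda>t::real. if 0 < t then t powr (-1-s) * (1 - exp (- t * r\<^sup>2)) else 0)"
    "(\<integral>t. (if 0 < t then t powr (-1-s) * (1 - exp (- t * r\<^sup>2)) else 0) \<partial>lborel) = r powr (2 * s) * subord_const s"
    unfolding f_def by blast+
qed

lemma heat_integral:
  fixes z :: "'a::euclidean_space" and s :: real
  assumes s: "0 < s" "s < 1" and z: "z \<noteq> 0"
  shows "integrable lborel (\<lambda>t::real. if 0 < t then t powr (-1-s) * gauss_kernel t z else 0)"
    and "(\<integral>t. (if 0 < t then t powr (-1-s) * gauss_kernel t z else 0) \<partial>lborel)
      = norm z powr (- (real DIM('a) + 2 * s)) * heat_const DIM('a) s"
proof -
  define n where "n = DIM('a)"
  define r where "r = norm z"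
  have r: "r > 0" using z by (simp add: r_def)
  define f where "f t = (if 0 < t then t powr (-1-s) * gauss_kernel t z else 0)" for t :: real
  define a where "a t = (if 0 < t then t powr (-1-s) * (sqrt (pi / t) ^ n * exp (- 1 / (4 * t))) else 0)" for t :: real
  define c where "c = r\<^sup>2"
  have c: "c > 0" using r by (simp add: c_def)
  have eq: "f (0 + c * t) = (c powr (-1-s) * (1 / r) ^ n) * a t" for t
  proof (cases "t > 0")
    case True
    have "sqrt (pi / (c * t)) = (1 / r) * sqrt (pi / t)"
      using r True by (simp add: c_def real_sqrt_divide real_sqrt_mult)
    then have 1: "sqrt (pi / (c * t)) ^ n = (1 / r) ^ n * sqrt (pi / t) ^ n" by (simp only: power_mult_distrib)
    have 2: "- r\<^sup>2 / (4 * (c * t)) = - 1 / (4 * t)" using r True by (simp add: c_def)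
    have 3: "(c * t) powr (-1-s) = c powr (-1-s) * t powr (-1-s)" using c True by (simp add: powr_mult)
    have "f (0 + c * t) = (c * t) powr (-1-s) * (sqrt (pi / (c * t)) ^ n * exp (- r\<^sup>2 / (4 * (c * t))))"
      using c True by (simp add: f_def gauss_kernel_def n_def r_def)
    also have "\<dots> = (c powr (-1-s) * (1 / r) ^ n) * (t powr (-1-s) * (sqrt (pi / t) ^ n * exp (- 1 / (4 * t))))"
      unfolding 1 2 3 by (simp only: mult.assoc mult.left_commute)
    finally show ?thesis using True by (simp only: a_def if_True)
  next
    case False
    then show ?thesis using c by (simp add: f_def a_def zero_less_mult_iff)
  qed
  have ai: "integrable lborel a" unfolding a_def by (rule heat_integrable[OF s])
  have fi: "integrable lborel f"
    using lborel_integrable_real_affine_iff[of c f 0] c ai unfolding eq by simp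
  have "integral\<^sup>L lborel f = \<bar>c\<bar> *\<^sub>R (\<integral>t. f (0 + c * t) \<partial>lborel)"
    using c by (intro lborel_integral_real_affine) simp
  also have "\<dots> = c * ((c powr (-1-s) * (1 / r) ^ n) * heat_const n s)"
    unfolding eq heat_const_def a_def[symmetric] using c by simp
  also have "\<dots> = (c * c powr (-1-s) * (1 / r) ^ n) * heat_const n s"
    by (simp only: mult.assoc)
  also have "c * c powr (-1-s) * (1 / r) ^ n = r powr (- (n + 2 * s))"
  proof -
    have "c * c powr (-1-s) = c powr (-s)" using c powr_add[of c 1 "-1-s"] by simp
    moreover have "c = r powr 2" using r by (simp add: c_def powr_numeral)
    then have "c powr (-s) = r powr (-2 * s)" by (simp only: powr_powr) simp
    ultimately have 1: "c * c powr (-1-s) = r powr (-2 * s)" by simp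
    have 2: "(1 / r) ^ n = r powr (- real n)"
      using r by (simp add: powr_minus powr_realpow power_one_over divide_inverse power_inverse)
    show ?thesis unfolding 1 2 powr_add[symmetric] by (simp add: add.commute)
  qed
  finally have "integral\<^sup>L lborel f = r powr (- (n + 2 * s)) * heat_const n s" .
  with fi show "integrable lborel (\<lambda>t::real. if 0 < t then t powr (-1-s) * gauss_kernel t z else 0)"
    "(\<integral>t. (if 0 < t then t powr (-1-s) * gauss_kernel t z else 0) \<partial>lborel)
      = norm z powr (- (real DIM('a) + 2 * s)) * heat_const DIM('a) s"
    unfolding f_def r_def n_def by blast+
qed

lemma heat_const_nonneg: "heat_const n s \<ge> 0"
  unfolding heat_const_def by (intro integral_nonneg_AE AE_I2) simp

lemma gauss_kernel_far_bound:
  fixes z :: "'a::euclidean_space"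
  assumes "norm z \<ge> 1" "t > 0"
  shows "gauss_kernel t z \<le> sqrt (pi / t) ^ DIM('a) * exp (- 1 / (4 * t))"
proof -
  have "1 \<le> (norm z)\<^sup>2" using assms(1) by simp
  then have "- (norm z)\<^sup>2 / (4 * t) \<le> - 1 / (4 * t)" using assms(2) by (simp add: divide_right_mono)
  then show ?thesis unfolding gauss_kernel_def using assms(2) by (intro mult_left_mono) auto
qed

text \<open>Write |\<xi>|^(2s) as the integral of t^(-1-s) (1 - exp (-t |\<xi>|^2)) over t > 0 and apply the Gaussian
  Parseval identity for every t. Since the supports are separated, the integral of the product of the
  transforms vanishes, so only the Gaussian term survives, and integrating it over t yields the
  kernel.\<close>

lemma subordination_formula:
  fixes u w :: "'a::euclidean_space \<Rightarrow> complex" and s :: real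
  assumes s: "0 < s" "s < 1" and u: "integrable lborel u" and w: "integrable lborel w"
    and H: "integrable lborel (\<lambda>\<xi>. fint u \<xi> * fint w (-\<xi>))"
    and sH: "integrable lborel (\<lambda>\<xi>. of_real (norm \<xi> powr (2 * s)) * (fint u \<xi> * fint w (-\<xi>)))"
    and sep: "\<And>x y. u x * w y \<noteq> 0 \<Longrightarrow> norm (x - y) \<ge> 1"
  shows "of_real (subord_const s) * (\<integral>\<xi>. of_real (norm \<xi> powr (2 * s)) * (fint u \<xi> * fint w (-\<xi>)) \<partial>lborel)
    = - of_real (heat_const DIM('a) s) *
      (\<integral>p. of_real (norm (fst p - snd p) powr (- (real DIM('a) + 2 * s))) * (u (fst p) * w (snd p)) \<partial>(lborel \<Otimes>\<^sub>M lborel))"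
proof -
  note [measurable] = borel_measurable_integrable[OF u, simplified] borel_measurable_integrable[OF w, simplified]
  define n where "n = DIM('a)"
  define h where "h \<xi> = fint u \<xi> * fint w (-\<xi>)" for \<xi>
  have hm[measurable]: "h \<in> borel_measurable borel" unfolding h_def by measurable
  have hi: "integrable lborel h" using H by (simp add: h_def[abs_def])
  define v where "v p = u (fst p) * w (snd p)" for p :: "'a \<times> 'a"
  have vi: "integrable lborel v" unfolding v_def using integrable_tensor[OF u w] by (simp add: lborel_prod)
  have vm[measurable]: "v \<in> borel_measurable borel" using vi by auto
  have sepv: "norm (fst p - snd p) \<ge> 1" if "v p \<noteq> 0" for p using sep that by (simp add: v_def)
  define Q where "Q t = (\<integral>p. of_real (gauss_kernel t (fst p - snd p)) * v p \<partial>lborel)" for t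
  have hQ: "(\<integral>\<xi>. of_real (exp (- t * (norm \<xi>)\<^sup>2)) * h \<xi> \<partial>lborel) = Q t" if "t > 0" for t
    unfolding h_def Q_def v_def using fint_gaussian_parseval[OF u w that] by (simp add: lborel_prod)
  have [measurable]: "(\<lambda>p::'a\<times>'a. fst p - snd p) \<in> borel_measurable borel"
    by (intro borel_measurable_continuous_onI continuous_intros)
  have ehi: "integrable lborel (\<lambda>\<xi>. of_real (exp (- t * (norm \<xi>)\<^sup>2)) * h \<xi>)" if "t > 0" for t
    by (rule Bochner_Integration.integrable_bound[OF hi]) (use that in \<open>auto simp: norm_mult mult_left_le_one_le\<close>)
  have Qb: "cmod (Q t) \<le> (sqrt (pi / t) ^ n * exp (- 1 / (4 * t))) * (\<integral>p. cmod (v p) \<partial>lborel)" if t: "t > 0" for t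
  proof -
    have b: "cmod (of_real (gauss_kernel t (fst p - snd p)) * v p) \<le> (sqrt (pi / t) ^ n * exp (- 1 / (4 * t))) * cmod (v p)" for p
    proof (cases "v p = 0")
      case False
      then show ?thesis
        using gauss_kernel_far_bound[OF sepv[OF False] t] gauss_kernel_nonneg[OF t, of "fst p - snd p"]
        unfolding norm_mult norm_of_real n_def by (intro mult_right_mono) auto
    qed simp
    have "cmod (Q t) \<le> (\<integral>p. (sqrt (pi / t) ^ n * exp (- 1 / (4 * t))) * cmod (v p) \<partial>lborel)"
      unfolding Q_def
    proof (rule Bochner_Integration.integral_norm_bound_integral)
      show i: "integrable lborel (\<lambda>p. (sqrt (pi / t) ^ n * exp (- 1 / (4 * t))) * cmod (v p))"
        by (intro integrable_mult_right integrable_norm vi)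
      show "integrable lborel (\<lambda>p. of_real (gauss_kernel t (fst p - snd p)) * v p)"
        by (rule Bochner_Integration.integrable_bound[OF i]) (use b t in \<open>auto simp: abs_mult\<close>)
    qed (rule b)
    then show ?thesis by simp
  qed
  text \<open>As the time tends to zero, the Gaussian concentrates on the diagonal, which the supports avoid.\<close>
  \<comment> \<open>Parseval for separated supports: Q t tends to 0 with t because the Gaussian is small at distance 1.\<close>
  have h0: "(\<integral>\<xi>. h \<xi> \<partial>lborel) = 0"
  proof -
    define t where "t k = 1 / real (Suc k)" for k
    have t: "t k > 0" "t k \<le> 1" for k by (auto simp: t_def)
    have tl: "t \<longlonglongrightarrow> 0" unfolding t_def using LIMSEQ_inverse_real_of_nat by (simp add: inverse_eq_divide)
    have "(\<lambda>k. \<integral>\<xi>. of_real (exp (- t k * (norm \<xi>)\<^sup>2)) * h \<xi> \<partial>lborel) \<longlonglongrightarrow> (\<integral>\<xi>. of_real (exp (- 0 * (norm \<xi>)\<^sup>2)) * h \<xi> \<partial>lborel)"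
    proof (rule integral_dominated_convergence[where w="\<lambda>\<xi>. cmod (h \<xi>)"])
      show "AE \<xi> in lborel. (\<lambda>k. of_real (exp (- t k * (norm \<xi>)\<^sup>2)) * h \<xi>) \<longlonglongrightarrow> of_real (exp (- 0 * (norm \<xi>)\<^sup>2)) * h \<xi>"
        by (intro AE_I2 tendsto_intros tl)
      show "AE \<xi> in lborel. norm (of_real (exp (- t k * (norm \<xi>)\<^sup>2)) * h \<xi>) \<le> cmod (h \<xi>)" for k
        using t[of k] by (auto simp: norm_mult mult_left_le_one_le)
    qed (use hi in \<open>auto intro: integrable_norm\<close>)
    then have "(\<lambda>k. Q (t k)) \<longlonglongrightarrow> (\<integral>\<xi>. h \<xi> \<partial>lborel)" by (simp add: hQ[OF t(1), simplified])
    moreover have "(\<lambda>k. Q (t k)) \<longlonglongrightarrow> 0"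
    proof (rule Lim_null_comparison)
      define D where "D = pi ^ n * (4 * real (n + Suc 0)) ^ (n + Suc 0) * (\<integral>p. cmod (v p) \<partial>lborel)"
      show "(\<lambda>k. D * t k) \<longlonglongrightarrow> 0" using tendsto_mult_left[OF tl, of D] by simp
      show "\<forall>\<^sub>F k in sequentially. norm (Q (t k)) \<le> D * t k"
      proof (intro always_eventually allI)
        fix k
        have "norm (Q (t k)) \<le> (pi ^ n * (4 * real (n + Suc 0)) ^ (n + Suc 0) * t k ^ Suc 0) * (\<integral>p. cmod (v p) \<partial>lborel)"
          by (rule order_trans[OF Qb[OF t(1)] mult_right_mono[OF gaussian_small_time[OF t]]])
             (intro integral_nonneg_AE AE_I2 norm_ge_zero)
        also have "\<dots> = D * t k" unfolding D_def by (simp only: power_Suc power_0 mult_1_right mult_ac)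
        finally show "norm (Q (t k)) \<le> D * t k" .
      qed
    qed
    ultimately show ?thesis by (rule LIMSEQ_unique)
  qed
  have hQ': "(\<integral>\<xi>. of_real (1 - exp (- t * (norm \<xi>)\<^sup>2)) * h \<xi> \<partial>lborel) = - Q t" if t: "t > 0" for t
  proof -
    have "(\<integral>\<xi>. of_real (1 - exp (- t * (norm \<xi>)\<^sup>2)) * h \<xi> \<partial>lborel)
        = (\<integral>\<xi>. h \<xi> - of_real (exp (- t * (norm \<xi>)\<^sup>2)) * h \<xi> \<partial>lborel)"
      by (simp only: of_real_diff of_real_1 left_diff_distrib mult_1_left)
    also have "\<dots> = (\<integral>\<xi>. h \<xi> \<partial>lborel) - (\<integral>\<xi>. of_real (exp (- t * (norm \<xi>)\<^sup>2)) * h \<xi> \<partial>lborel)"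
      by (rule Bochner_Integration.integral_diff[OF hi ehi[OF t]])
    finally show ?thesis unfolding h0 hQ[OF t] by simp
  qed
  define k where "k t = (if 0 < t then t powr (-1-s) else 0)" for t :: real
  have km[measurable]: "k \<in> borel_measurable borel" unfolding k_def by measurable
  have k0: "k t \<ge> 0" for t by (simp add: k_def)
  \<comment> \<open>Fubini on the frequency side is justified by the integrability of |\<xi>|^(2s) times h.\<close>
  define F1 where "F1 \<xi> t = of_real (k t * (1 - exp (- t * (norm \<xi>)\<^sup>2))) * h \<xi>" for \<xi> t
  have kI: "integrable lborel (\<lambda>t. k t * (1 - exp (- t * (norm \<xi>)\<^sup>2)))"
    "(\<integral>t. k t * (1 - exp (- t * (norm \<xi>)\<^sup>2)) \<partial>lborel) = norm \<xi> powr (2 * s) * subord_const s" for \<xi> :: 'a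
  proof -
    have eq: "(\<lambda>t. k t * (1 - exp (- t * (norm \<xi>)\<^sup>2))) = (\<lambda>t. if 0 < t then t powr (-1-s) * (1 - exp (- t * (norm \<xi>)\<^sup>2)) else 0)"
      by (auto simp: k_def)
    show "integrable lborel (\<lambda>t. k t * (1 - exp (- t * (norm \<xi>)\<^sup>2)))"
      "(\<integral>t. k t * (1 - exp (- t * (norm \<xi>)\<^sup>2)) \<partial>lborel) = norm \<xi> powr (2 * s) * subord_const s"
      unfolding eq using subord_integral[OF s, of "norm \<xi>"] by auto
  qed
  have pos1: "k t * (1 - exp (- t * (norm \<xi>)\<^sup>2)) \<ge> 0" for t and \<xi> :: 'a
    by (cases "t > 0") (auto simp: k_def)
  have F1int: "integrable lborel (F1 \<xi>)" "integral\<^sup>L lborel (F1 \<xi>) = of_real (norm \<xi> powr (2 * s) * subord_const s) * h \<xi>" for \<xi>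
    unfolding F1_def using kI[of \<xi>]
    by (auto intro!: integrable_mult_left integrable_of_real simp: integral_complex_of_real simp del: of_real_mult of_real_diff)
  have F1i: "integrable (lborel \<Otimes>\<^sub>M lborel) (case_prod F1)"
  proof (rule lborel_pair.Fubini_integrable)
    have "(\<integral>t. norm (case_prod F1 (\<xi>, t)) \<partial>lborel) = cmod (of_real (norm \<xi> powr (2 * s)) * h \<xi>) * subord_const s" for \<xi>
    proof -
      have "(\<integral>t. norm (case_prod F1 (\<xi>, t)) \<partial>lborel) = (\<integral>t. k t * (1 - exp (- t * (norm \<xi>)\<^sup>2)) * cmod (h \<xi>) \<partial>lborel)"
        unfolding F1_def case_prod_conv norm_mult norm_of_real using pos1[of _ \<xi>] by simp
      also have "\<dots> = norm \<xi> powr (2 * s) * subord_const s * cmod (h \<xi>)"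
        using kI(2)[of \<xi>] by simp
      finally show ?thesis by (simp add: norm_mult mult_ac)
    qed
    then show "integrable lborel (\<lambda>\<xi>. \<integral>t. norm (case_prod F1 (\<xi>, t)) \<partial>lborel)"
      using integrable_norm[OF sH] unfolding h_def by simp
    show "AE \<xi> in lborel. integrable lborel (\<lambda>t. case_prod F1 (\<xi>, t))"
      using F1int(1) by simp
    show "case_prod F1 \<in> borel_measurable (lborel \<Otimes>\<^sub>M lborel)"
      unfolding F1_def case_prod_beta by measurable
  qed
  have "of_real (subord_const s) * (\<integral>\<xi>. of_real (norm \<xi> powr (2 * s)) * h \<xi> \<partial>lborel)
      = (\<integral>\<xi>. of_real (subord_const s) * (of_real (norm \<xi> powr (2 * s)) * h \<xi>) \<partial>lborel)"
    by (rule integral_mult_right_zero[symmetric])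
  also have "\<dots> = (\<integral>\<xi>. (\<integral>t. F1 \<xi> t \<partial>lborel) \<partial>lborel)"
    using F1int(2) by (simp add: mult_ac)
  also have "\<dots> = (\<integral>t. (\<integral>\<xi>. F1 \<xi> t \<partial>lborel) \<partial>lborel)"
    by (rule lborel_pair.Fubini_integral[OF F1i, symmetric])
  also have "\<dots> = (\<integral>t. - (of_real (k t) * Q t) \<partial>lborel)"
  proof (intro Bochner_Integration.integral_cong refl)
    fix t :: real
    have "(\<integral>\<xi>. F1 \<xi> t \<partial>lborel) = of_real (k t) * (\<integral>\<xi>. of_real (1 - exp (- t * (norm \<xi>)\<^sup>2)) * h \<xi> \<partial>lborel)"
      unfolding F1_def of_real_mult mult.assoc by (rule integral_mult_right_zero)
    then show "(\<integral>\<xi>. F1 \<xi> t \<partial>lborel) = - (of_real (k t) * Q t)"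
      using hQ'[of t] by (cases "t > 0") (simp_all add: k_def)
  qed
  also have "\<dots> = - (\<integral>t. of_real (k t) * Q t \<partial>lborel)" by (rule Bochner_Integration.integral_minus)
  finally have E1: "of_real (subord_const s) * (\<integral>\<xi>. of_real (norm \<xi> powr (2 * s)) * h \<xi> \<partial>lborel)
      = - (\<integral>t. of_real (k t) * Q t \<partial>lborel)" .
  \<comment> \<open>Fubini on the space side is justified by the bound of the kernel at distance at least 1.\<close>
  define F2 where "F2 p t = of_real (k t * gauss_kernel t (fst p - snd p)) * v p" for p :: "'a \<times> 'a" and t
  have gI: "integrable lborel (\<lambda>t. k t * gauss_kernel t z)"
    "(\<integral>t. k t * gauss_kernel t z \<partial>lborel) = norm z powr (- (real DIM('a) + 2 * s)) * heat_const DIM('a) s"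
    if "z \<noteq> 0" for z :: 'a
  proof -
    have eq: "(\<lambda>t. k t * gauss_kernel t z) = (\<lambda>t. if 0 < t then t powr (-1-s) * gauss_kernel t z else 0)"
      by (auto simp: k_def)
    show "integrable lborel (\<lambda>t. k t * gauss_kernel t z)"
      "(\<integral>t. k t * gauss_kernel t z \<partial>lborel) = norm z powr (- (real DIM('a) + 2 * s)) * heat_const DIM('a) s"
      unfolding eq using heat_integral[OF s that] by auto
  qed
  have pos2: "k t * gauss_kernel t z \<ge> 0" for t and z :: 'a
    using gauss_kernel_nonneg[of t z] by (cases "t > 0") (auto simp: k_def)
  have F2int: "integrable lborel (F2 p)"
    "integral\<^sup>L lborel (F2 p) = of_real (norm (fst p - snd p) powr (- (real DIM('a) + 2 * s)) * heat_const DIM('a) s) * v p"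
    "(\<integral>t. norm (F2 p t) \<partial>lborel) = norm (fst p - snd p) powr (- (real DIM('a) + 2 * s)) * heat_const DIM('a) s * cmod (v p)" for p
  proof -
    have "integrable lborel (F2 p) \<and>
      integral\<^sup>L lborel (F2 p) = of_real (norm (fst p - snd p) powr (- (real DIM('a) + 2 * s)) * heat_const DIM('a) s) * v p \<and>
      (\<integral>t. norm (F2 p t) \<partial>lborel) = norm (fst p - snd p) powr (- (real DIM('a) + 2 * s)) * heat_const DIM('a) s * cmod (v p)"
    proof (cases "v p = 0")
      case True
      then have "F2 p = (\<lambda>t. 0)" by (auto simp: F2_def)
      then show ?thesis using True by simp
    next
      case False
      then have z: "fst p - snd p \<noteq> 0" using sepv[OF False] by auto
      have "(\<integral>t. norm (F2 p t) \<partial>lborel) = (\<integral>t. k t * gauss_kernel t (fst p - snd p) * cmod (v p) \<partial>lborel)"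
        unfolding F2_def norm_mult norm_of_real using pos2[of _ "fst p - snd p"] by simp
      also have "\<dots> = norm (fst p - snd p) powr (- (real DIM('a) + 2 * s)) * heat_const DIM('a) s * cmod (v p)"
        using gI(2)[OF z] by simp
      finally have 1: "(\<integral>t. norm (F2 p t) \<partial>lborel) = norm (fst p - snd p) powr (- (real DIM('a) + 2 * s)) * heat_const DIM('a) s * cmod (v p)" .
      have 2: "integrable lborel (F2 p)"
        unfolding F2_def by (intro integrable_mult_left integrable_of_real gI(1)[OF z])
      have 3: "integral\<^sup>L lborel (F2 p) = of_real (norm (fst p - snd p) powr (- (real DIM('a) + 2 * s)) * heat_const DIM('a) s) * v p"
        unfolding F2_def integral_mult_left_zero integral_complex_of_real gI(2)[OF z] ..
      show ?thesis using 1 2 3 by simp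
    qed
    then show "integrable lborel (F2 p)"
    "integral\<^sup>L lborel (F2 p) = of_real (norm (fst p - snd p) powr (- (real DIM('a) + 2 * s)) * heat_const DIM('a) s) * v p"
    "(\<integral>t. norm (F2 p t) \<partial>lborel) = norm (fst p - snd p) powr (- (real DIM('a) + 2 * s)) * heat_const DIM('a) s * cmod (v p)" by blast+
  qed
  have F2i: "integrable (lborel \<Otimes>\<^sub>M lborel) (case_prod F2)"
  proof (rule lborel_pair.Fubini_integrable)
    have mfst: "fst \<in> borel_measurable (borel :: ('a \<times> 'a) measure)"
      and msnd: "snd \<in> borel_measurable (borel :: ('a \<times> 'a) measure)"
      by (auto intro!: borel_measurable_continuous_onI continuous_intros)
    have [measurable]: "(\<lambda>q. fst (fst q)) \<in> borel_measurable ((lborel :: ('a \<times> 'a) measure) \<Otimes>\<^sub>M (lborel :: real measure))"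
      "(\<lambda>q. snd (fst q)) \<in> borel_measurable ((lborel :: ('a \<times> 'a) measure) \<Otimes>\<^sub>M (lborel :: real measure))"
      by (rule measurable_compose[OF measurable_fst]; simp add: mfst msnd)+
    show "case_prod F2 \<in> borel_measurable (lborel \<Otimes>\<^sub>M lborel)"
      unfolding F2_def case_prod_beta gauss_kernel_def v_def by measurable
    show "AE p in lborel. integrable lborel (\<lambda>t. case_prod F2 (p, t))"
      using F2int(1) by simp
    show "integrable lborel (\<lambda>p. \<integral>t. norm (case_prod F2 (p, t)) \<partial>lborel)"
      unfolding case_prod_conv F2int(3)
    proof (rule Bochner_Integration.integrable_bound)
      show "integrable lborel (\<lambda>p. heat_const DIM('a) s * cmod (v p))"
        by (intro integrable_mult_right integrable_norm vi)
      show "AE p in lborel. norm (norm (fst p - snd p) powr (- (real DIM('a) + 2 * s)) * heat_const DIM('a) s * cmod (v p))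
          \<le> norm (heat_const DIM('a) s * cmod (v p))"
      proof (rule AE_I2)
        fix p :: "'a \<times> 'a"
        show "norm (norm (fst p - snd p) powr (- (real DIM('a) + 2 * s)) * heat_const DIM('a) s * cmod (v p))
          \<le> norm (heat_const DIM('a) s * cmod (v p))"
        proof (cases "v p = 0")
          case False
          have "norm (fst p - snd p) powr (- (real DIM('a) + 2 * s)) \<le> norm (fst p - snd p) powr 0"
            using sepv[OF False] s by (intro powr_mono) auto
          then have "norm (fst p - snd p) powr (- (real DIM('a) + 2 * s)) \<le> 1"
            using sepv[OF False] by (cases "fst p = snd p") auto
          then have "norm (fst p - snd p) powr (- (real DIM('a) + 2 * s)) * (heat_const DIM('a) s * cmod (v p)) \<le> heat_const DIM('a) s * cmod (v p)"
            using heat_const_nonneg[of "DIM('a)" s] by (intro mult_left_le_one_le) auto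
          then show ?thesis using heat_const_nonneg[of "DIM('a)" s] by (simp add: abs_mult mult.assoc)
        qed simp
      qed
    qed measurable
  qed
  have "(\<integral>t. of_real (k t) * Q t \<partial>lborel) = (\<integral>t. (\<integral>p. F2 p t \<partial>lborel) \<partial>lborel)"
    unfolding Q_def F2_def of_real_mult mult.assoc integral_mult_right_zero ..
  also have "\<dots> = (\<integral>p. (\<integral>t. F2 p t \<partial>lborel) \<partial>lborel)"
    by (rule lborel_pair.Fubini_integral[OF F2i])
  also have "\<dots> = (\<integral>p. of_real (heat_const DIM('a) s) * (of_real (norm (fst p - snd p) powr (- (real DIM('a) + 2 * s))) * v p) \<partial>lborel)"
    unfolding F2int(2) of_real_mult by (simp only: mult_ac)
  also have "\<dots> = of_real (heat_const DIM('a) s) * (\<integral>p. of_real (norm (fst p - snd p) powr (- (real DIM('a) + 2 * s))) * v p \<partial>lborel)"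
    by (rule integral_mult_right_zero)
  finally show ?thesis
    using E1 unfolding h_def v_def lborel_prod by simp
qed


text \<open>The distance is bounded below by 1 because the kernel is only ever applied to functions with
  supports at distance at least 1; this keeps the kernel bounded.\<close>

definition frac_kernel :: "real \<Rightarrow> 'a::euclidean_space \<Rightarrow> 'a \<Rightarrow> real" where
  "frac_kernel s x y = heat_const DIM('a) s / (subord_const s * (2 * pi) ^ DIM('a))
     * max 1 (norm (x - y)) powr (- (real DIM('a) + 2 * s))"

lemma frac_kernel_measurable [measurable]:
  "(\<lambda>p::'a::euclidean_space \<times> 'a. frac_kernel s (fst p) (snd p)) \<in> borel_measurable (lborel \<Otimes>\<^sub>M lborel)"
  unfolding frac_kernel_def by measurable

lemma frac_kernel_bound:
  fixes x y :: "'a::euclidean_space" and s :: real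
  assumes "0 < s" "s < 1"
  shows "\<bar>frac_kernel s x y\<bar> \<le> heat_const DIM('a) s / (subord_const s * (2 * pi) ^ DIM('a))"
    (is "_ \<le> ?C")
proof -
  have C: "?C \<ge> 0" using heat_const_nonneg[of "DIM('a)" s] subord_const_pos[OF assms] by simp
  have "max 1 (norm (x - y)) powr (- (real DIM('a) + 2 * s)) \<le> max 1 (norm (x - y)) powr 0"
    using assms by (intro powr_mono) auto
  then have "max 1 (norm (x - y)) powr (- (real DIM('a) + 2 * s)) \<le> 1"
    by (simp add: max_def split: if_splits)
  then show ?thesis
    unfolding frac_kernel_def abs_mult abs_of_nonneg[OF C] abs_of_nonneg[OF powr_ge_zero]
    by (rule mult_left_le[OF _ C])
qed

text \<open>This lets the decay of transforms of test functions absorb the multiplier |\<xi>|^(2s).\<close>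

lemma powr_le_one_plus_square:
  fixes r s :: real
  assumes "0 < s" "s < 1" "r \<ge> 0"
  shows "r powr (2 * s) \<le> 1 + r\<^sup>2"
proof (cases "r \<le> 1")
  case True
  then have "r powr (2 * s) \<le> 1" using assms by (intro powr_le1) auto
  then show ?thesis by (simp add: add_increasing2)
next
  case False
  then have "r powr (2 * s) \<le> r powr 2" using assms by (intro powr_mono) auto
  then show ?thesis using False by (simp add: powr_numeral)
qed

text \<open>Replace u by a Borel function supported in U and vanishing outside it exactly. Then the
  subordination formula applies, and the decay of the transform of the test function supplies both
  integrability hypotheses.\<close>

lemma frac_laplacian_kernel:
  fixes u :: "'a::euclidean_space \<Rightarrow> complex"
  assumes s: "0 < s" "s < 1"
    and u: "L2_ball R u" and uU: "AE x in lebesgue. x \<notin> U \<longrightarrow> u x = 0" and U: "U \<in> sets borel"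
    and \<phi>: "\<phi> \<in> test_functions V" and V: "bounded V"
    and sep: "\<And>x y. x \<in> U \<Longrightarrow> y \<in> V \<Longrightarrow> norm (x - y) \<ge> 1"
  shows "frac_laplacian s u \<phi> = - (\<integral>y. (\<integral>x. of_real (frac_kernel s x y) * u x \<partial>lebesgue) * \<phi> y \<partial>lebesgue)"
proof -
  note us = L2_ball_sq_int[OF u]
  note um = sq_int_measurable[OF us]
  obtain u0 where u0: "u0 \<in> borel_measurable borel" "AE x in lebesgue. u x = u0 x"
    using borel_representative[OF um] .
  define w where "w x = (if x \<in> U then u0 x else 0)" for x
  note [measurable] = u0(1) U
  have wm[measurable]: "w \<in> borel_measurable borel" unfolding w_def by measurable
  have uw: "AE x in lebesgue. u x = w x"
    using u0(2) uU by eventually_elim (auto simp: w_def)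
  have wml: "w \<in> borel_measurable lebesgue" by (rule lborel_imp_lebesgue_measurable[OF wm])
  have wi: "integrable lborel w"
  proof -
    have "integrable lebesgue w"
      by (rule integrable_cong_AE_imp[OF L2_ball_L1_bound(1)[OF u] wml]) (use uw in eventually_elim, simp)
    then show ?thesis using wm by (subst (asm) integrable_completion) auto
  qed
  have \<phi>c: "continuous_on UNIV \<phi>" using \<phi> by (rule test_functions_continuous)
  have \<phi>m[measurable]: "\<phi> \<in> borel_measurable borel" using \<phi>c by (rule borel_measurable_continuous_onI)
  obtain R' where R': "V \<subseteq> ball 0 R'" using V by (metis bounded_subset_ballD)
  have \<phi>i: "integrable lborel \<phi>"
    using \<phi>c
  proof (rule continuous_lborel_integrable[of _ R'])
    fix x :: 'a assume "norm x \<ge> R'"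
    then have "x \<notin> V" using R' by auto
    then show "\<phi> x = 0" by (rule test_functions_outside[OF \<phi>])
  qed
  have ufint: "fourier_integral u = fint w" by (rule fourier_integral_eq_fint[OF um wm uw])
  have fw: "sq_int lebesgue (fint w)" using plancherel_L2_ball(1)[OF u] unfolding ufint .
  define \<psi> where "\<psi> x = cnj (\<phi> x)" for x
  have \<psi>: "\<psi> \<in> test_functions V" unfolding \<psi>_def by (rule test_functions_cnj[OF \<phi>])
  have \<phi>\<psi>: "fint \<phi> (-\<xi>) = cnj (fint \<psi> \<xi>)" for \<xi>
    using fint_cnj[of \<psi> \<xi>] by (simp add: \<psi>_def)
  have dec: "sq_int lebesgue (\<lambda>\<xi>. of_real (1 + (norm \<xi>)\<^sup>2) * fint \<psi> \<xi>)"
    using test_functions_decay[OF \<psi> V] unfolding fourier_integral_continuous_eq[OF test_functions_continuous[OF \<psi>]] .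
  define h where "h \<xi> = fint w \<xi> * fint \<phi> (-\<xi>)" for \<xi>
  have hm[measurable]: "h \<in> borel_measurable borel" unfolding h_def by measurable
  have big: "integrable lborel (\<lambda>\<xi>. fint w \<xi> * (of_real (1 + (norm \<xi>)\<^sup>2) * fint \<phi> (-\<xi>)))"
  proof -
    have "integrable lebesgue (\<lambda>\<xi>. fint w \<xi> * cnj (of_real (1 + (norm \<xi>)\<^sup>2) * fint \<psi> \<xi>))"
      by (rule sq_int_mult_integrable[OF fw sq_int_cnj[OF dec]])
    then have "integrable lebesgue (\<lambda>\<xi>. fint w \<xi> * (of_real (1 + (norm \<xi>)\<^sup>2) * fint \<phi> (-\<xi>)))"
      by (simp only: complex_cnj_mult complex_cnj_complex_of_real \<phi>\<psi>)
    then show ?thesis by (subst (asm) integrable_completion) measurable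
  qed
  have bnd: "integrable lborel (\<lambda>\<xi>. of_real (g \<xi>) * h \<xi>)"
    if g: "g \<in> borel_measurable borel" "\<And>\<xi>. \<bar>g \<xi>\<bar> \<le> 1 + (norm \<xi>)\<^sup>2" for g :: "'a \<Rightarrow> real"
  proof (rule Bochner_Integration.integrable_bound[OF big])
    show "(\<lambda>\<xi>. of_real (g \<xi>) * h \<xi>) \<in> borel_measurable lborel" using g(1) by measurable
    show "AE \<xi> in lborel. norm (of_real (g \<xi>) * h \<xi>) \<le> norm (fint w \<xi> * (of_real (1 + (norm \<xi>)\<^sup>2) * fint \<phi> (-\<xi>)))"
    proof (rule AE_I2)
      fix \<xi> :: 'a
      have "norm (of_real (g \<xi>) * h \<xi>) \<le> (1 + (norm \<xi>)\<^sup>2) * norm (h \<xi>)"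
        unfolding norm_mult norm_of_real by (rule mult_right_mono[OF g(2)]) simp
      also have "\<dots> = norm (fint w \<xi> * (of_real (1 + (norm \<xi>)\<^sup>2) * fint \<phi> (-\<xi>)))"
        unfolding h_def norm_mult norm_of_real by (simp add: mult.left_commute)
      finally show "norm (of_real (g \<xi>) * h \<xi>) \<le> norm (fint w \<xi> * (of_real (1 + (norm \<xi>)\<^sup>2) * fint \<phi> (-\<xi>)))" .
    qed
  qed
  have hi: "integrable lborel (\<lambda>\<xi>. fint w \<xi> * fint \<phi> (-\<xi>))"
    using bnd[of "\<lambda>_. 1"] by (simp add: h_def)
  have shi: "integrable lborel (\<lambda>\<xi>. of_real (norm \<xi> powr (2 * s)) * (fint w \<xi> * fint \<phi> (-\<xi>)))"
    using bnd[of "\<lambda>\<xi>. norm \<xi> powr (2 * s)"] powr_le_one_plus_square[OF s] by (simp add: h_def)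
  have sep': "norm (x - y) \<ge> 1" if "w x * \<phi> y \<noteq> 0" for x y
  proof -
    have "x \<in> U" using that by (auto simp: w_def split: if_splits)
    moreover have "y \<in> V" using that test_functions_outside[OF \<phi>] by fastforce
    ultimately show ?thesis by (rule sep)
  qed
  have A0: "subord_const s \<noteq> 0" using subord_const_pos[OF s] by simp
  define X where "X = (\<integral>\<xi>. of_real (norm \<xi> powr (2 * s)) * h \<xi> \<partial>lborel)"
  define Y where "Y = (\<integral>p. of_real (norm (fst p - snd p) powr (- (real DIM('a) + 2 * s))) * (w (fst p) * \<phi> (snd p)) \<partial>(lborel \<Otimes>\<^sub>M lborel))"
  have XY: "of_real (subord_const s) * X = - of_real (heat_const DIM('a) s) * Y"
    unfolding X_def Y_def h_def by (rule subordination_formula[OF s wi \<phi>i hi shi sep'])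
  define P where "P = (2 * pi) ^ DIM('a)"
  have P: "P > 0" by (simp add: P_def)
  have inv: "inverse_fourier_integral \<phi> \<xi> = fint \<phi> (-\<xi>) / of_real P" for \<xi>
    unfolding inverse_fourier_integral_def fint_def P_def
    by (subst integral_completion) auto
  have "frac_laplacian s u \<phi> = (\<integral>\<xi>. of_real (norm \<xi> powr (2 * s)) * h \<xi> / of_real P \<partial>lebesgue)"
    unfolding frac_laplacian_def
  proof (rule integral_cong_AE)
    show "AE \<xi> in lebesgue. of_real (norm \<xi> powr (2 * s)) * fourier_L2 u \<xi> * inverse_fourier_integral \<phi> \<xi>
        = of_real (norm \<xi> powr (2 * s)) * h \<xi> / of_real P"
      using fourier_L2_L2_ball[OF u] unfolding ufint inv h_def by eventually_elim simp
    have 1: "(\<lambda>\<xi>. of_real (norm \<xi> powr (2 * s)) * h \<xi> / of_real P) \<in> borel_measurable borel" by measurable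
    show "(\<lambda>\<xi>. of_real (norm \<xi> powr (2 * s)) * h \<xi> / of_real P) \<in> borel_measurable lebesgue"
      by (rule lborel_imp_lebesgue_measurable[OF 1])
    have 2: "(\<lambda>\<xi>::'a. complex_of_real (norm \<xi> powr (2 * s))) \<in> borel_measurable borel"
      "(\<lambda>\<xi>. fint \<phi> (-\<xi>) / of_real P) \<in> borel_measurable borel" by measurable
    show "(\<lambda>\<xi>. of_real (norm \<xi> powr (2 * s)) * fourier_L2 u \<xi> * inverse_fourier_integral \<phi> \<xi>) \<in> borel_measurable lebesgue"
      unfolding inv
      by (intro borel_measurable_times lborel_imp_lebesgue_measurable[OF 2(1)] lborel_imp_lebesgue_measurable[OF 2(2)]
          sq_int_measurable[OF fourier_L2_spec(1)[OF us]])
  qed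
  also have "\<dots> = X / of_real P"
    unfolding X_def by (subst integral_completion) auto
  also have "\<dots> = - (of_real (heat_const DIM('a) s / (subord_const s * P)) * Y)"
  proof -
    have "X = - of_real (heat_const DIM('a) s) * Y / of_real (subord_const s)"
      using XY A0 by (metis nonzero_mult_div_cancel_left of_real_eq_0_iff)
    then show ?thesis by simp
  qed
  also have "of_real (heat_const DIM('a) s / (subord_const s * P)) * Y
      = (\<integral>p. of_real (frac_kernel s (fst p) (snd p)) * (w (fst p) * \<phi> (snd p)) \<partial>(lborel \<Otimes>\<^sub>M lborel))"
    unfolding Y_def integral_mult_right_zero[symmetric]
  proof (intro Bochner_Integration.integral_cong refl)
    fix p :: "'a \<times> 'a"
    show "of_real (heat_const DIM('a) s / (subord_const s * P)) *
          (of_real (norm (fst p - snd p) powr (- (real DIM('a) + 2 * s))) * (w (fst p) * \<phi> (snd p)))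
        = of_real (frac_kernel s (fst p) (snd p)) * (w (fst p) * \<phi> (snd p))"
    proof (cases "w (fst p) * \<phi> (snd p) = 0")
      case False
      from sep'[OF this] have "max 1 (norm (fst p - snd p)) = norm (fst p - snd p)" by simp
      then show ?thesis unfolding frac_kernel_def P_def by simp
    next
      case True
      show ?thesis unfolding True by simp
    qed
  qed
  also have "\<dots> = (\<integral>y. (\<integral>x. of_real (frac_kernel s x y) * (w x * \<phi> y) \<partial>lborel) \<partial>lborel)"
  proof -
    have "integrable (lborel \<Otimes>\<^sub>M lborel) (\<lambda>p. of_real (frac_kernel s (fst p) (snd p)) * (w (fst p) * \<phi> (snd p)))"
    proof (rule Bochner_Integration.integrable_bound)
      define C where "C = heat_const DIM('a) s / (subord_const s * (2 * pi) ^ DIM('a))"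
      show "integrable (lborel \<Otimes>\<^sub>M lborel) (\<lambda>p. of_real C * (w (fst p) * \<phi> (snd p)))"
        using integrable_tensor[OF wi \<phi>i] by simp
      show "AE p in lborel \<Otimes>\<^sub>M lborel. norm (of_real (frac_kernel s (fst p) (snd p)) * (w (fst p) * \<phi> (snd p)))
          \<le> norm (of_real C * (w (fst p) * \<phi> (snd p)))"
        unfolding norm_mult norm_of_real
        by (intro AE_I2 mult_right_mono order_trans[OF frac_kernel_bound[OF s]])
           (simp_all only: C_def[symmetric] abs_ge_self mult_nonneg_nonneg norm_ge_zero flip: norm_mult)
    qed measurable
    then have "integrable (lborel \<Otimes>\<^sub>M lborel) (case_prod (\<lambda>x y. of_real (frac_kernel s x y) * (w x * \<phi> y)))"
      by (simp only: case_prod_beta')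
    from lborel_pair.integral_snd[OF this, symmetric] show ?thesis by (simp only: case_prod_beta')
  qed
  also have "\<dots> = (\<integral>y. (\<integral>x. of_real (frac_kernel s x y) * u x \<partial>lebesgue) * \<phi> y \<partial>lborel)"
  proof (intro Bochner_Integration.integral_cong refl)
    fix y :: 'a
    have km: "(\<lambda>x. complex_of_real (frac_kernel s x y)) \<in> borel_measurable borel"
      unfolding frac_kernel_def by measurable
    have "(\<integral>x. of_real (frac_kernel s x y) * u x \<partial>lebesgue) = (\<integral>x. of_real (frac_kernel s x y) * w x \<partial>lebesgue)"
    proof (rule integral_cong_AE)
      show "AE x in lebesgue. of_real (frac_kernel s x y) * u x = of_real (frac_kernel s x y) * w x"
        using uw by eventually_elim simp
    qed (intro borel_measurable_times lborel_imp_lebesgue_measurable[OF km] um wml)+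
    also have "\<dots> = (\<integral>x. of_real (frac_kernel s x y) * w x \<partial>lborel)"
      using km wm by (subst integral_completion) auto
    finally show "(\<integral>x. of_real (frac_kernel s x y) * (w x * \<phi> y) \<partial>lborel)
        = (\<integral>x. of_real (frac_kernel s x y) * u x \<partial>lebesgue) * \<phi> y"
      unfolding mult.assoc[symmetric] integral_mult_left_zero by simp
  qed
  also have "\<dots> = (\<integral>y. (\<integral>x. of_real (frac_kernel s x y) * u x \<partial>lebesgue) * \<phi> y \<partial>lebesgue)"
  proof (rule integral_completion[symmetric])
    have "(\<lambda>y. \<integral>x. of_real (frac_kernel s x y) * w x \<partial>lborel) \<in> borel_measurable borel"
      unfolding frac_kernel_def by measurable
    moreover have "(\<integral>x. of_real (frac_kernel s x y) * u x \<partial>lebesgue) = (\<integral>x. of_real (frac_kernel s x y) * w x \<partial>lborel)" for y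
    proof -
      have km: "(\<lambda>x. complex_of_real (frac_kernel s x y)) \<in> borel_measurable borel"
        unfolding frac_kernel_def by measurable
      have "(\<integral>x. of_real (frac_kernel s x y) * u x \<partial>lebesgue) = (\<integral>x. of_real (frac_kernel s x y) * w x \<partial>lebesgue)"
      proof (rule integral_cong_AE)
        show "AE x in lebesgue. of_real (frac_kernel s x y) * u x = of_real (frac_kernel s x y) * w x"
          using uw by eventually_elim simp
      qed (intro borel_measurable_times lborel_imp_lebesgue_measurable[OF km] um wml)+
      also have "\<dots> = (\<integral>x. of_real (frac_kernel s x y) * w x \<partial>lborel)"
        using km wm by (subst integral_completion) auto
      finally show ?thesis .
    qed
    ultimately show "(\<lambda>y. (\<integral>x. of_real (frac_kernel s x y) * u x \<partial>lebesgue) * \<phi> y) \<in> lborel \<rightarrow>\<^sub>M borel"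
      by simp
  qed
  finally show ?thesis .
qed

section \<open>A variational principle\<close>

text \<open>A minimizing sequence of the quadratic functional A v v - 2 l v is Cauchy by the parallelogram law,
  and its first variation tends to zero. The space V is abstract: in the application it consists of
  the test functions, and the limit is taken in the Sobolev space.\<close>

lemma variational_sequence:
  fixes A :: "'v \<Rightarrow> 'v \<Rightarrow> real" and l :: "'v \<Rightarrow> real" and comb :: "real \<Rightarrow> 'v \<Rightarrow> real \<Rightarrow> 'v \<Rightarrow> 'v"
  assumes ne: "z \<in> V"
    and closed: "\<And>a v b w. v \<in> V \<Longrightarrow> w \<in> V \<Longrightarrow> comb a v b w \<in> V"
    and lin: "\<And>a v b w u. v \<in> V \<Longrightarrow> w \<in> V \<Longrightarrow> u \<in> V \<Longrightarrow> A (comb a v b w) u = a * A v u + b * A w u"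
    and sym: "\<And>v w. v \<in> V \<Longrightarrow> w \<in> V \<Longrightarrow> A v w = A w v"
    and llin: "\<And>a v b w. v \<in> V \<Longrightarrow> w \<in> V \<Longrightarrow> l (comb a v b w) = a * l v + b * l w"
    and pos: "\<And>v. v \<in> V \<Longrightarrow> 0 \<le> A v v"
    and bd: "\<And>v. v \<in> V \<Longrightarrow> (l v)\<^sup>2 \<le> C * A v v" and C: "C > 0"
  obtains \<phi> :: "nat \<Rightarrow> 'v" where "\<forall>k. \<phi> k \<in> V"
    "\<forall>k j. A (comb 1 (\<phi> k) (-1) (\<phi> j)) (comb 1 (\<phi> k) (-1) (\<phi> j)) \<le> 2 / Suc k + 2 / Suc j"
    "\<forall>\<psi>\<in>V. (\<lambda>k. A (\<phi> k) \<psi>) \<longlonglongrightarrow> l \<psi>"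
proof -
  define J where "J v = A v v - 2 * l v" for v
  have quad: "A (comb a v b w) (comb a v b w) = a\<^sup>2 * A v v + 2 * a * b * A v w + b\<^sup>2 * A w w"
    if "v \<in> V" "w \<in> V" for a v b w
  proof -
    have c: "comb a v b w \<in> V" using closed that by blast
    have 1: "A v (comb a v b w) = a * A v v + b * A v w"
      using sym[OF that(1) c] lin[OF that(1,2,1), of a b] sym[OF that(2,1)] by simp
    have 2: "A w (comb a v b w) = a * A v w + b * A w w"
      using sym[OF that(2) c] lin[OF that(1,2,2), of a b] by simp
    show ?thesis unfolding lin[OF that c] 1 2 by (simp add: power2_eq_square algebra_simps)
  qed
  have Jlow: "J v \<ge> - C" if "v \<in> V" for v
  proof -
    have "0 \<le> (l v - C)\<^sup>2" by simp
    then have "2 * l v * C \<le> (l v)\<^sup>2 + C\<^sup>2" by (simp add: power2_diff)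
    also have "\<dots> \<le> C * A v v + C * C" using bd[OF that] by (simp add: power2_eq_square)
    finally have "C * (2 * l v) \<le> C * (A v v + C)" by (simp add: algebra_simps)
    then have "2 * l v \<le> A v v + C" using C by simp
    then show ?thesis by (simp add: J_def)
  qed
  define d where "d = Inf (J ` V)"
  have bdd: "bdd_below (J ` V)" using Jlow by (intro bdd_belowI2[of _ "-C"]) auto
  have d: "d \<le> J v" if "v \<in> V" for v unfolding d_def by (intro cInf_lower bdd imageI that)
  have "\<exists>v\<in>V. J v < d + 1 / Suc k" for k :: nat
  proof -
    have "Inf (J ` V) < d + 1 / Suc k" by (simp add: d_def)
    then show ?thesis using cInf_lessD[of "J ` V" "d + 1 / Suc k"] ne by auto
  qed
  then obtain \<phi> where \<phi>: "\<And>k. \<phi> k \<in> V" "\<And>k. J (\<phi> k) < d + 1 / Suc k" by metis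
  have cau: "A (comb 1 (\<phi> k) (-1) (\<phi> j)) (comb 1 (\<phi> k) (-1) (\<phi> j)) \<le> 2 / Suc k + 2 / Suc j" for k j
  proof -
    define m where "m = comb (1/2) (\<phi> k) (1/2) (\<phi> j)"
    have "m \<in> V" unfolding m_def using closed \<phi>(1) by blast
    have Am: "4 * A m m = A (\<phi> k) (\<phi> k) + 2 * A (\<phi> k) (\<phi> j) + A (\<phi> j) (\<phi> j)"
      unfolding m_def quad[OF \<phi>(1) \<phi>(1)] by (simp add: power2_eq_square)
    have lm: "2 * l m = l (\<phi> k) + l (\<phi> j)" unfolding m_def llin[OF \<phi>(1) \<phi>(1)] by simp
    have "A (comb 1 (\<phi> k) (-1) (\<phi> j)) (comb 1 (\<phi> k) (-1) (\<phi> j))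
        = A (\<phi> k) (\<phi> k) - 2 * A (\<phi> k) (\<phi> j) + A (\<phi> j) (\<phi> j)"
      unfolding quad[OF \<phi>(1) \<phi>(1)] by simp
    also have "\<dots> = 2 * J (\<phi> k) + 2 * J (\<phi> j) - 4 * J m"
      unfolding J_def using Am lm by argo
    also have "\<dots> \<le> 2 / Suc k + 2 / Suc j"
      using \<phi>(2)[of k] \<phi>(2)[of j] d[OF \<open>m \<in> V\<close>] by argo
    finally show ?thesis .
  qed
  \<comment> \<open>Minimality along the direction \<psi>, with a suitable step, bounds the first variation by the defect 1/(k+1).\<close>
  have var: "(\<lambda>k. A (\<phi> k) \<psi>) \<longlonglongrightarrow> l \<psi>" if \<psi>: "\<psi> \<in> V" for \<psi>
  proof -
    define a where "a = A \<psi> \<psi>"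
    have a: "a \<ge> 0" using pos[OF \<psi>] by (simp add: a_def)
    have "(A (\<phi> k) \<psi> - l \<psi>)\<^sup>2 \<le> (a + 1) * (1 / Suc k)" for k
    proof -
      define D where "D = A (\<phi> k) \<psi> - l \<psi>"
      define t where "t = - D / (a + 1)"
      have ta: "t * (a + 1) = - D" using a by (simp add: t_def)
      have "J (comb 1 (\<phi> k) t \<psi>) \<ge> d" using closed[OF \<phi>(1) \<psi>] d by blast
      moreover have "J (comb 1 (\<phi> k) t \<psi>) = J (\<phi> k) + 2 * t * D + t * t * a"
        unfolding J_def quad[OF \<phi>(1) \<psi>] llin[OF \<phi>(1) \<psi>] D_def a_def
        by (simp add: power2_eq_square algebra_simps)
      ultimately have "0 \<le> 1 / Suc k + 2 * t * D + t * t * a" using \<phi>(2)[of k] by linarith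
      also have "\<dots> \<le> 1 / Suc k + 2 * t * D + t * (t * (a + 1))"
        by (simp add: algebra_simps)
      also have "\<dots> = 1 / Suc k + t * D" unfolding ta by simp
      finally have "- (t * D) \<le> 1 / Suc k" by linarith
      then have "(a + 1) * (- (t * D)) \<le> (a + 1) * (1 / Suc k)" using a by (intro mult_left_mono) auto
      also have "(a + 1) * (- (t * D)) = D\<^sup>2"
      proof -
        have "(a + 1) * (- (t * D)) = - (t * (a + 1)) * D" by simp
        also have "\<dots> = D\<^sup>2" unfolding ta by (simp add: power2_eq_square)
        finally show ?thesis .
      qed
      finally show ?thesis unfolding D_def .
    qed
    then have "(\<lambda>k. (A (\<phi> k) \<psi> - l \<psi>)\<^sup>2) \<longlonglongrightarrow> 0"
    proof (intro Lim_null_comparison[of "\<lambda>k. (A (\<phi> k) \<psi> - l \<psi>)\<^sup>2" "\<lambda>k. (a + 1) * (1 / Suc k)"])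
      show "(\<lambda>k. (a + 1) * (1 / real (Suc k))) \<longlonglongrightarrow> 0"
        using tendsto_mult_left[OF LIMSEQ_inverse_real_of_nat, of "a + 1"] by (simp add: inverse_eq_divide)
    qed simp
    then have "(\<lambda>k. sqrt ((A (\<phi> k) \<psi> - l \<psi>)\<^sup>2)) \<longlonglongrightarrow> sqrt 0" by (rule tendsto_real_sqrt)
    then have "(\<lambda>k. A (\<phi> k) \<psi> - l \<psi>) \<longlonglongrightarrow> 0" by (simp add: tendsto_rabs_zero_iff)
    then show ?thesis by (simp add: LIM_zero_iff)
  qed
  show ?thesis using that \<phi>(1) cau var by blast
qed

section \<open>Sobolev spaces\<close>

text \<open>The weight of the Sobolev space of order s, as a complex number so that it multiplies transforms.\<close>

definition hw :: "real \<Rightarrow> 'a::euclidean_space \<Rightarrow> complex" where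
  "hw s \<xi> = of_real ((1 + (norm \<xi>)\<^sup>2) powr (s / 2))"

definition sob :: "real \<Rightarrow> ('a::euclidean_space \<Rightarrow> complex) \<Rightarrow> 'a \<Rightarrow> complex" where
  "sob s u \<xi> = hw s \<xi> * fourier_L2 u \<xi>"

text \<open>The Plancherel side of the operator of order s whose square is the fractional Laplacian; its norm is the
  energy of u.\<close>

definition frac_grad :: "real \<Rightarrow> ('a::euclidean_space \<Rightarrow> complex) \<Rightarrow> 'a \<Rightarrow> complex" where
  "frac_grad s u \<xi> = of_real (norm \<xi> powr s) * fourier_L2 u \<xi>"

lemma hw_measurable: "hw s \<in> borel_measurable lebesgue"
proof (rule lborel_imp_lebesgue_measurable)
  show "hw s \<in> borel_measurable borel" unfolding hw_def[abs_def] by measurable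
qed

lemma norm_powr_measurable: "(\<lambda>\<xi>::'a::euclidean_space. complex_of_real (norm \<xi> powr s)) \<in> borel_measurable lebesgue"
proof (rule lborel_imp_lebesgue_measurable)
  show "(\<lambda>\<xi>::'a. complex_of_real (norm \<xi> powr s)) \<in> borel_measurable borel" by measurable
qed

lemma sob_measurable: "sq_int lebesgue u \<Longrightarrow> sob s u \<in> borel_measurable lebesgue"
  unfolding sob_def[abs_def]
  by (intro borel_measurable_times hw_measurable sq_int_measurable[OF fourier_L2_spec(1)])

lemma frac_grad_measurable: "sq_int lebesgue u \<Longrightarrow> frac_grad s u \<in> borel_measurable lebesgue"
  unfolding frac_grad_def[abs_def]
  by (intro borel_measurable_times norm_powr_measurable sq_int_measurable[OF fourier_L2_spec(1)])

lemma hw_squared: "(cmod (hw s \<xi>))\<^sup>2 = (1 + (norm \<xi>)\<^sup>2) powr s"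
proof -
  have "(1 + (norm \<xi>)\<^sup>2) powr (s/2) * (1 + (norm \<xi>)\<^sup>2) powr (s/2) = (1 + (norm \<xi>)\<^sup>2) powr s"
    by (simp add: powr_add[symmetric])
  then show ?thesis unfolding hw_def norm_of_real by (simp add: power2_eq_square)
qed

lemma hw_ge_1: "s \<ge> 0 \<Longrightarrow> 1 \<le> cmod (hw s \<xi>)"
  unfolding hw_def norm_of_real using ge_one_powr_ge_zero[of "1 + (norm \<xi>)\<^sup>2" "s/2"] by simp

lemma norm_powr_le_hw: "s \<ge> 0 \<Longrightarrow> norm \<xi> powr s \<le> cmod (hw s \<xi>)"
proof -
  assume s: "s \<ge> 0"
  have "norm \<xi> powr s \<le> (sqrt (1 + (norm \<xi>)\<^sup>2)) powr s"
    by (intro powr_mono2 s) (auto intro: real_le_rsqrt)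
  also have "\<dots> = (1 + (norm \<xi>)\<^sup>2) powr (s/2)"
    by (simp add: powr_half_sqrt[symmetric] powr_powr)
  also have "\<dots> \<le> cmod (hw s \<xi>)" unfolding hw_def norm_of_real by simp
  finally show ?thesis .
qed

lemma sobolev_iff: "u \<in> sobolev s \<longleftrightarrow> sq_int lebesgue u \<and> sq_int lebesgue (sob s u)"
proof -
  have eq: "(\<lambda>\<xi>. (1 + (norm \<xi>)\<^sup>2) powr s * (cmod (fourier_L2 u \<xi>))\<^sup>2) = (\<lambda>\<xi>. (cmod (sob s u \<xi>))\<^sup>2)"
    unfolding sob_def norm_mult power_mult_distrib hw_squared ..
  show ?thesis
    unfolding sobolev_def L2_UNIV_iff mem_Collect_eq eq
    using sob_measurable[of u s] by (auto simp: sq_int_def)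
qed

lemma sobolev_norm_eq: "sobolev_norm s u = norm2 lebesgue (sob s u)"
  unfolding sobolev_norm_def norm2_def sob_def norm_mult power_mult_distrib hw_squared ..

lemma sob_lincomb:
  assumes "sq_int lebesgue u" "sq_int lebesgue w"
  shows "AE \<xi> in lebesgue. sob s (\<lambda>x. a * u x + b * w x) \<xi> = a * sob s u \<xi> + b * sob s w \<xi>"
  using fourier_L2_lincomb[OF assms, of a b]
  by eventually_elim (simp add: sob_def distrib_left mult.left_commute)

lemma frac_grad_lincomb:
  assumes "sq_int lebesgue u" "sq_int lebesgue w"
  shows "AE \<xi> in lebesgue. frac_grad s (\<lambda>x. a * u x + b * w x) \<xi> = a * frac_grad s u \<xi> + b * frac_grad s w \<xi>"
  using fourier_L2_lincomb[OF assms, of a b]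
  by eventually_elim (simp add: frac_grad_def distrib_left mult.left_commute)

lemma sobolev_lincomb:
  assumes "u \<in> sobolev s" "w \<in> sobolev s"
  shows "(\<lambda>x. a * u x + b * w x) \<in> sobolev s"
proof -
  have u: "sq_int lebesgue u" "sq_int lebesgue (sob s u)" and w: "sq_int lebesgue w" "sq_int lebesgue (sob s w)"
    using assms by (auto simp: sobolev_iff)
  have uw: "sq_int lebesgue (\<lambda>x. a * u x + b * w x)" using u w by (intro sq_int_intros)
  have "sq_int lebesgue (\<lambda>\<xi>. a * sob s u \<xi> + b * sob s w \<xi>)" using u w by (intro sq_int_intros)
  from sq_int_cong_AE[OF this sob_measurable[OF uw] sob_lincomb[OF u(1) w(1)]]
  show ?thesis using uw by (simp add: sobolev_iff)
qed

lemma sobolev_diff: "u \<in> sobolev s \<Longrightarrow> w \<in> sobolev s \<Longrightarrow> (\<lambda>x. u x - w x) \<in> sobolev s"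
  using sobolev_lincomb[of u s w 1 "-1"] by simp

lemma sobolev_norm_lincomb:
  assumes "u \<in> sobolev s" "w \<in> sobolev s"
  shows "sobolev_norm s (\<lambda>x. a * u x + b * w x) \<le> cmod a * sobolev_norm s u + cmod b * sobolev_norm s w"
proof -
  have u: "sq_int lebesgue u" "sq_int lebesgue (sob s u)" and w: "sq_int lebesgue w" "sq_int lebesgue (sob s w)"
    using assms by (auto simp: sobolev_iff)
  have uw: "sq_int lebesgue (\<lambda>x. a * u x + b * w x)" using u w by (intro sq_int_intros)
  have m: "sq_int lebesgue (\<lambda>\<xi>. a * sob s u \<xi> + b * sob s w \<xi>)" using u w by (intro sq_int_intros)
  have "sobolev_norm s (\<lambda>x. a * u x + b * w x) = norm2 lebesgue (\<lambda>\<xi>. a * sob s u \<xi> + b * sob s w \<xi>)"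
    unfolding sobolev_norm_eq
    by (rule norm2_cong_AE[OF sob_measurable[OF uw] sq_int_measurable[OF m] sob_lincomb[OF u(1) w(1)]])
  also have "\<dots> \<le> norm2 lebesgue (\<lambda>\<xi>. a * sob s u \<xi>) + norm2 lebesgue (\<lambda>\<xi>. b * sob s w \<xi>)"
    using u w by (intro norm2_triangle sq_int_intros)
  finally show ?thesis unfolding norm2_cmult sobolev_norm_eq .
qed

lemma norm2_le_sobolev_norm:
  fixes u :: "'a::euclidean_space \<Rightarrow> complex"
  assumes "u \<in> sobolev s" "s \<ge> 0"
  shows "planch TYPE('a) * norm2 lebesgue u \<le> sobolev_norm s u"
proof -
  have u: "sq_int lebesgue u" "sq_int lebesgue (sob s u)" using assms by (auto simp: sobolev_iff)
  have "norm2 lebesgue (fourier_L2 u) \<le> 1 * norm2 lebesgue (sob s u)"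
  proof (rule norm2_bound[OF u(2) sq_int_measurable[OF fourier_L2_spec(1)[OF u(1)]]])
    show "AE \<xi> in lebesgue. cmod (fourier_L2 u \<xi>) \<le> 1 * cmod (sob s u \<xi>)"
      unfolding sob_def norm_mult
      using mult_right_mono[OF hw_ge_1[OF assms(2)] norm_ge_zero] by (intro AE_I2) auto
  qed simp
  then show ?thesis unfolding plancherel[OF u(1)] sobolev_norm_eq by simp
qed

lemma frac_grad_sobolev:
  assumes "u \<in> sobolev s" "s \<ge> 0"
  shows "sq_int lebesgue (frac_grad s u)" "norm2 lebesgue (frac_grad s u) \<le> sobolev_norm s u"
proof -
  have u: "sq_int lebesgue u" "sq_int lebesgue (sob s u)" using assms by (auto simp: sobolev_iff)
  have b: "AE \<xi> in lebesgue. cmod (frac_grad s u \<xi>) \<le> 1 * cmod (sob s u \<xi>)"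
    unfolding sob_def frac_grad_def norm_mult norm_of_real
    using mult_right_mono[OF norm_powr_le_hw[OF assms(2)] norm_ge_zero] by (intro AE_I2) auto
  show "sq_int lebesgue (frac_grad s u)" by (rule sq_int_bound[OF u(2) frac_grad_measurable[OF u(1)] b])
  show "norm2 lebesgue (frac_grad s u) \<le> sobolev_norm s u"
    using norm2_bound[OF u(2) frac_grad_measurable[OF u(1)] b] by (simp add: sobolev_norm_eq)
qed

text \<open>Subadditivity of the power s < 1: the Sobolev norm is controlled by the L2 norm and the energy.\<close>

lemma powr_one_plus_le:
  fixes t s :: real
  assumes "t \<ge> 0" "0 < s" "s < 1"
  shows "(1 + t) powr s \<le> 1 + t powr s"
proof -
  have "(1 + t) powr s = (1 + t) * (1 + t) powr (s - 1)"
    using assms powr_add[of "1 + t" 1 "s - 1"] by simp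
  then have 1: "(1 + t) powr s = (1 + t) powr (s - 1) + t * (1 + t) powr (s - 1)" by (simp add: distrib_right)
  have 2: "(1 + t) powr (s - 1) \<le> 1" using assms powr_mono2'[of "s - 1" 1 "1 + t"] by simp
  have 3: "t * (1 + t) powr (s - 1) \<le> t powr s"
  proof (cases "t = 0")
    case False
    then have t: "t > 0" using assms by simp
    have "t * (1 + t) powr (s - 1) \<le> t * t powr (s - 1)"
      using assms t by (intro mult_left_mono powr_mono2') auto
    also have "\<dots> = t powr s" using t powr_add[of t 1 "s - 1"] by simp
    finally show ?thesis .
  qed simp
  show ?thesis using 1 2 3 by linarith
qed

lemma sobolev_norm_squared_le:
  fixes u :: "'a::euclidean_space \<Rightarrow> complex"
  assumes "u \<in> sobolev s" "0 < s" "s < 1"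
  shows "(sobolev_norm s u)\<^sup>2 \<le> (planch TYPE('a) * norm2 lebesgue u)\<^sup>2 + (norm2 lebesgue (frac_grad s u))\<^sup>2"
proof -
  have u: "sq_int lebesgue u" "sq_int lebesgue (sob s u)" using assms by (auto simp: sobolev_iff)
  have g: "sq_int lebesgue (frac_grad s u)" by (rule frac_grad_sobolev(1)[OF assms(1)]) (use assms in simp)
  note f = fourier_L2_spec(1)[OF u(1)]
  have "(sobolev_norm s u)\<^sup>2 \<le> (\<integral>\<xi>. (cmod (fourier_L2 u \<xi>))\<^sup>2 + (cmod (frac_grad s u \<xi>))\<^sup>2 \<partial>lebesgue)"
    unfolding sobolev_norm_eq norm2_squared
  proof (rule integral_mono)
    fix \<xi> :: 'a
    have "(1 + (norm \<xi>)\<^sup>2) powr s \<le> 1 + ((norm \<xi>)\<^sup>2) powr s" using assms by (intro powr_one_plus_le) auto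
    also have "((norm \<xi>)\<^sup>2) powr s = (norm \<xi> powr s)\<^sup>2"
      by (simp add: power2_eq_square powr_mult)
    finally have "(1 + (norm \<xi>)\<^sup>2) powr s * (cmod (fourier_L2 u \<xi>))\<^sup>2 \<le> (1 + (norm \<xi> powr s)\<^sup>2) * (cmod (fourier_L2 u \<xi>))\<^sup>2"
      by (rule mult_right_mono) simp
    then show "(cmod (sob s u \<xi>))\<^sup>2 \<le> (cmod (fourier_L2 u \<xi>))\<^sup>2 + (cmod (frac_grad s u \<xi>))\<^sup>2"
      unfolding sob_def frac_grad_def norm_mult power_mult_distrib hw_squared norm_of_real power2_abs
      by (simp add: distrib_right)
  qed (use u g f in \<open>auto intro: sq_int_integrable\<close>)
  also have "\<dots> = (norm2 lebesgue (fourier_L2 u))\<^sup>2 + (norm2 lebesgue (frac_grad s u))\<^sup>2"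
    unfolding norm2_squared using g f by (simp add: sq_int_integrable)
  finally show ?thesis unfolding plancherel[OF u(1)] .
qed

lemma test_functions_sobolev:
  assumes \<phi>: "\<phi> \<in> test_functions U" and U: "bounded U" and s: "0 < s" "s < 1"
  shows "\<phi> \<in> sobolev s"
proof -
  obtain R where R: "U \<subseteq> ball 0 R" using U by (metis bounded_subset_ballD)
  have L: "L2_ball R \<phi>" by (rule test_functions_L2_ball[OF \<phi> R])
  note us = L2_ball_sq_int[OF L]
  have "sq_int lebesgue (sob s \<phi>)"
  proof (rule sq_int_bound[OF test_functions_decay[OF \<phi> U] sob_measurable[OF us]])
    show "AE \<xi> in lebesgue. cmod (sob s \<phi> \<xi>) \<le> 1 * cmod (of_real (1 + (norm \<xi>)\<^sup>2) * fourier_integral \<phi> \<xi>)"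
      using fourier_L2_L2_ball[OF L]
    proof eventually_elim
      case (elim \<xi>)
      have "(1 + (norm \<xi>)\<^sup>2) powr (s / 2) \<le> (1 + (norm \<xi>)\<^sup>2) powr 1" using s by (intro powr_mono) auto
      also have "\<dots> = 1 + (norm \<xi>)\<^sup>2" by simp
      finally have "cmod (hw s \<xi>) \<le> cmod (of_real (1 + (norm \<xi>)\<^sup>2))"
        unfolding hw_def norm_of_real by simp
      then show ?case unfolding sob_def elim norm_mult mult_1_left by (intro mult_right_mono) auto
    qed
  qed
  then show ?thesis using us by (simp add: sobolev_iff)
qed

lemma sobolev_tilde_sequence:
  assumes "u \<in> sobolev_tilde s U"
  obtains \<phi> :: "nat \<Rightarrow> 'a::euclidean_space \<Rightarrow> complex" where "\<And>k. \<phi> k \<in> test_functions U"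
    "(\<lambda>k. sobolev_norm s (\<lambda>x. u x - \<phi> k x)) \<longlonglongrightarrow> 0"
proof -
  have "\<exists>\<phi>\<in>test_functions U. sobolev_norm s (\<lambda>x. u x - \<phi> x) < 1 / Suc k" for k
    using assms unfolding sobolev_tilde_def by simp
  then obtain \<phi> where \<phi>: "\<And>k. \<phi> k \<in> test_functions U" "\<And>k. sobolev_norm s (\<lambda>x. u x - \<phi> k x) < 1 / Suc k"
    by metis
  have "(\<lambda>k. sobolev_norm s (\<lambda>x. u x - \<phi> k x)) \<longlonglongrightarrow> 0"
  proof (rule Lim_null_comparison[OF _ LIMSEQ_inverse_real_of_nat])
    show "\<forall>\<^sub>F k in sequentially. norm (sobolev_norm s (\<lambda>x. u x - \<phi> k x)) \<le> inverse (real (Suc k))"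
      using \<phi>(2) by (intro always_eventually allI) (simp add: sobolev_norm_eq inverse_eq_divide less_imp_le)
  qed
  then show ?thesis using that \<phi>(1) by blast
qed

lemma sobolev_tilde_lincomb:
  assumes u: "u \<in> sobolev_tilde s U" and w: "w \<in> sobolev_tilde s U" and U: "bounded U" and s: "0 < s" "s < 1"
  shows "(\<lambda>x. a * u x + b * w x) \<in> sobolev_tilde s U"
proof -
  have us: "u \<in> sobolev s" "w \<in> sobolev s" using u w by (auto simp: sobolev_tilde_def)
  obtain \<phi> where \<phi>: "\<And>k. \<phi> k \<in> test_functions U" "(\<lambda>k. sobolev_norm s (\<lambda>x. u x - \<phi> k x)) \<longlonglongrightarrow> 0"
    using sobolev_tilde_sequence[OF u] by blast
  obtain \<psi> where \<psi>: "\<And>k. \<psi> k \<in> test_functions U" "(\<lambda>k. sobolev_norm s (\<lambda>x. w x - \<psi> k x)) \<longlonglongrightarrow> 0"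
    using sobolev_tilde_sequence[OF w] by blast
  have lim: "(\<lambda>k. sobolev_norm s (\<lambda>x. (a * u x + b * w x) - (a * \<phi> k x + b * \<psi> k x))) \<longlonglongrightarrow> 0"
  proof (rule Lim_null_comparison)
    show "(\<lambda>k. cmod a * sobolev_norm s (\<lambda>x. u x - \<phi> k x) + cmod b * sobolev_norm s (\<lambda>x. w x - \<psi> k x)) \<longlonglongrightarrow> 0"
      using tendsto_add[OF tendsto_mult_left[OF \<phi>(2), of "cmod a"] tendsto_mult_left[OF \<psi>(2), of "cmod b"]] by simp
    show "\<forall>\<^sub>F k in sequentially. norm (sobolev_norm s (\<lambda>x. (a * u x + b * w x) - (a * \<phi> k x + b * \<psi> k x)))
        \<le> cmod a * sobolev_norm s (\<lambda>x. u x - \<phi> k x) + cmod b * sobolev_norm s (\<lambda>x. w x - \<psi> k x)"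
    proof (intro always_eventually allI)
      fix k
      have d: "(\<lambda>x. u x - \<phi> k x) \<in> sobolev s" "(\<lambda>x. w x - \<psi> k x) \<in> sobolev s"
        using us \<phi>(1) \<psi>(1) test_functions_sobolev[OF _ U s] by (auto intro: sobolev_diff)
      have "(\<lambda>x. (a * u x + b * w x) - (a * \<phi> k x + b * \<psi> k x)) = (\<lambda>x. a * (u x - \<phi> k x) + b * (w x - \<psi> k x))"
        by (simp add: algebra_simps)
      then show "norm (sobolev_norm s (\<lambda>x. (a * u x + b * w x) - (a * \<phi> k x + b * \<psi> k x)))
        \<le> cmod a * sobolev_norm s (\<lambda>x. u x - \<phi> k x) + cmod b * sobolev_norm s (\<lambda>x. w x - \<psi> k x)"
        using sobolev_norm_lincomb[OF d, of a b] by (simp add: sobolev_norm_eq)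
    qed
  qed
  have "\<exists>\<phi>\<in>test_functions U. sobolev_norm s (\<lambda>x. (a * u x + b * w x) - \<phi> x) < e" if "e > 0" for e
  proof -
    from LIMSEQ_D[OF lim that] obtain k where
      "norm (sobolev_norm s (\<lambda>x. (a * u x + b * w x) - (a * \<phi> k x + b * \<psi> k x)) - 0) < e" by blast
    then have "sobolev_norm s (\<lambda>x. (a * u x + b * w x) - (a * \<phi> k x + b * \<psi> k x)) < e" by simp
    then show ?thesis by (rule bexI[OF _ test_functions_lincomb[OF \<phi>(1)[of k] \<psi>(1)[of k], of a b]])
  qed
  then show ?thesis using sobolev_lincomb[OF us] by (simp add: sobolev_tilde_def)
qed

text \<open>The Sobolev norm dominates both the L2 norm and the energy, so the quadratic form is continuous
  under approximation by test functions.\<close>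

lemma sobolev_tilde_L2_limit:
  fixes u :: "'a::euclidean_space \<Rightarrow> complex"
  assumes u: "u \<in> sobolev s" and \<phi>: "\<And>k. \<phi> k \<in> sobolev s" and s: "s \<ge> 0"
    and lim: "(\<lambda>k. sobolev_norm s (\<lambda>x. u x - \<phi> k x)) \<longlonglongrightarrow> 0"
  shows "(\<lambda>k. norm2 lebesgue (\<lambda>x. \<phi> k x - u x)) \<longlonglongrightarrow> 0"
    "(\<lambda>k. norm2 lebesgue (\<lambda>\<xi>. frac_grad s (\<phi> k) \<xi> - frac_grad s u \<xi>)) \<longlonglongrightarrow> 0"
proof -
  have d: "(\<lambda>x. u x - \<phi> k x) \<in> sobolev s" for k by (rule sobolev_diff[OF u \<phi>])
  define P where "P = planch TYPE('a)"
  have P: "P > 0" by (simp add: P_def)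
  show "(\<lambda>k. norm2 lebesgue (\<lambda>x. \<phi> k x - u x)) \<longlonglongrightarrow> 0"
  proof (rule Lim_null_comparison)
    show "(\<lambda>k. (1 / P) * sobolev_norm s (\<lambda>x. u x - \<phi> k x)) \<longlonglongrightarrow> 0"
      using tendsto_mult_left[OF lim, of "1 / P"] by simp
    show "\<forall>\<^sub>F k in sequentially. norm (norm2 lebesgue (\<lambda>x. \<phi> k x - u x)) \<le> (1 / P) * sobolev_norm s (\<lambda>x. u x - \<phi> k x)"
      using norm2_le_sobolev_norm[OF d s] P unfolding P_def[symmetric]
      by (intro always_eventually allI) (simp add: norm2_minus_commute[of _ _ u] le_divide_eq mult.commute)
  qed
  show "(\<lambda>k. norm2 lebesgue (\<lambda>\<xi>. frac_grad s (\<phi> k) \<xi> - frac_grad s u \<xi>)) \<longlonglongrightarrow> 0"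
  proof (rule Lim_null_comparison[OF _ lim], intro always_eventually allI)
    fix k
    have us: "sq_int lebesgue u" "sq_int lebesgue (\<phi> k)" using u \<phi> by (auto simp: sobolev_iff)
    have g: "sq_int lebesgue (frac_grad s (\<phi> k))" "sq_int lebesgue (frac_grad s u)"
      using frac_grad_sobolev(1) u \<phi> s by blast+
    have "norm2 lebesgue (\<lambda>\<xi>. frac_grad s u \<xi> - frac_grad s (\<phi> k) \<xi>) = norm2 lebesgue (frac_grad s (\<lambda>x. u x - \<phi> k x))"
    proof (rule norm2_cong_AE[symmetric])
      show "AE \<xi> in lebesgue. frac_grad s (\<lambda>x. u x - \<phi> k x) \<xi> = frac_grad s u \<xi> - frac_grad s (\<phi> k) \<xi>"
        using frac_grad_lincomb[OF us, of s 1 "-1"] by simp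
    qed (use us g in \<open>auto intro!: frac_grad_measurable sq_int_diff sq_int_measurable[OF sq_int_diff[OF g(2,1)]]\<close>)
    also have "\<dots> \<le> sobolev_norm s (\<lambda>x. u x - \<phi> k x)" by (rule frac_grad_sobolev(2)[OF d s])
    finally show "norm (norm2 lebesgue (\<lambda>\<xi>. frac_grad s (\<phi> k) \<xi> - frac_grad s u \<xi>)) \<le> sobolev_norm s (\<lambda>x. u x - \<phi> k x)"
      by (simp add: norm2_minus_commute[of _ "frac_grad s (\<phi> k)"])
  qed
qed

text \<open>Vanishing outside U is preserved by limits in L2.\<close>

lemma sobolev_tilde_outside:
  fixes u :: "'a::euclidean_space \<Rightarrow> complex"
  assumes u: "u \<in> sobolev_tilde s U" and U: "bounded U" "U \<in> sets borel" and s: "0 < s" "s < 1"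
  shows "AE x in lebesgue. x \<notin> U \<longrightarrow> u x = 0"
proof -
  have us: "u \<in> sobolev s" "sq_int lebesgue u" using u by (auto simp: sobolev_tilde_def sobolev_iff)
  note um[measurable] = sq_int_measurable[OF us(2)]
  obtain \<phi> where \<phi>: "\<And>k. \<phi> k \<in> test_functions U" "(\<lambda>k. sobolev_norm s (\<lambda>x. u x - \<phi> k x)) \<longlonglongrightarrow> 0"
    using sobolev_tilde_sequence[OF u] by blast
  have \<phi>s: "\<phi> k \<in> sobolev s" "sq_int lebesgue (\<phi> k)" for k
    using test_functions_sobolev[OF \<phi>(1) U(1) s] by (auto simp: sobolev_iff)
  have lim: "(\<lambda>k. norm2 lebesgue (\<lambda>x. \<phi> k x - u x)) \<longlonglongrightarrow> 0"
    by (rule sobolev_tilde_L2_limit(1)[OF us(1) \<phi>s(1) _ \<phi>(2)]) (use s in simp)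
  define w where "w x = (if x \<in> U then 0 else u x)" for x
  have [measurable]: "U \<in> sets lebesgue" using U(2) by simp
  have wm: "w \<in> borel_measurable lebesgue" unfolding w_def by measurable
  have w: "sq_int lebesgue w" by (rule sq_int_bound[OF us(2) wm, of 1]) (auto simp: w_def)
  have "norm2 lebesgue w \<le> 1 * norm2 lebesgue (\<lambda>x. \<phi> k x - u x)" for k
    by (rule norm2_bound[OF sq_int_diff[OF \<phi>s(2) us(2)] wm])
       (use test_functions_outside[OF \<phi>(1)] in \<open>auto simp: w_def\<close>)
  then have "norm2 lebesgue w \<le> 0"
    using LIMSEQ_le_const[OF lim, of "norm2 lebesgue w"] by simp
  then have "norm2 lebesgue w = 0" using norm2_nonneg[of lebesgue w] by linarith
  from norm2_eq_0_AE[OF w this] show ?thesis by eventually_elim (auto simp: w_def split: if_splits)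
qed

lemma sobolev_tilde_L2_ball:
  assumes "u \<in> sobolev_tilde s U" "U \<subseteq> ball 0 R" "U \<in> sets borel" "0 < s" "s < 1"
  shows "L2_ball R u"
proof -
  have "bounded U" using assms(2) bounded_ball bounded_subset by blast
  from sobolev_tilde_outside[OF assms(1) this assms(3-5)]
  have "AE x in lebesgue. R \<le> norm x \<longrightarrow> u x = 0" by eventually_elim (use assms(2) in auto)
  then show ?thesis using assms(1) by (simp add: L2_ball_def sobolev_tilde_def sobolev_iff)
qed

section \<open>The Dirichlet problem for small potentials\<close>

lemma planch_nonzero [simp]: "planch TYPE('a::euclidean_space) \<noteq> 0"
  by (rule less_imp_neq[OF planch_pos, symmetric])

text \<open>The inner product is conjugate linear in the second argument.\<close>

definition ip :: "('a::euclidean_space \<Rightarrow> complex) \<Rightarrow> ('a \<Rightarrow> complex) \<Rightarrow> complex" where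
  "ip f g = (\<integral>x. f x * cnj (g x) \<partial>lebesgue)"

lemma ip_integrable: "sq_int lebesgue f \<Longrightarrow> sq_int lebesgue g \<Longrightarrow> integrable lebesgue (\<lambda>x. f x * cnj (g x))"
  by (intro sq_int_mult_integrable sq_int_cnj)

lemma ip_lincomb:
  assumes "sq_int lebesgue f" "sq_int lebesgue g" "sq_int lebesgue h"
  shows "ip (\<lambda>x. a * f x + b * g x) h = a * ip f h + b * ip g h"
proof -
  have "ip (\<lambda>x. a * f x + b * g x) h = (\<integral>x. a * (f x * cnj (h x)) + b * (g x * cnj (h x)) \<partial>lebesgue)"
    unfolding ip_def by (simp only: distrib_right mult.assoc)
  also have "\<dots> = a * ip f h + b * ip g h"
    unfolding ip_def using ip_integrable[OF assms(1,3)] ip_integrable[OF assms(2,3)]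
    by (subst Bochner_Integration.integral_add) auto
  finally show ?thesis .
qed

lemma ip_commute: "ip g f = cnj (ip f g)"
proof -
  have "cnj (ip f g) = (\<integral>x. cnj (f x * cnj (g x)) \<partial>lebesgue)"
    unfolding ip_def by (rule Bochner_Integration.integral_cnj[symmetric])
  then show ?thesis unfolding ip_def by (simp add: mult.commute)
qed

lemma ip_self: "ip f f = of_real ((norm2 lebesgue f)\<^sup>2)"
  unfolding ip_def norm2_squared complex_norm_square[symmetric] by (rule integral_complex_of_real)

lemma ip_bound: "sq_int lebesgue f \<Longrightarrow> sq_int lebesgue g \<Longrightarrow> cmod (ip f g) \<le> norm2 lebesgue f * norm2 lebesgue g"
  unfolding ip_def using Cauchy_Schwarz_norm2[of lebesgue f "\<lambda>x. cnj (g x)"] sq_int_cnj[of lebesgue g] by simp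

lemma ip_tendsto:
  assumes "\<And>k. sq_int lebesgue (f k)" "sq_int lebesgue g" "(\<lambda>k. norm2 lebesgue (\<lambda>x. f k x - g x)) \<longlonglongrightarrow> 0"
    "sq_int lebesgue h"
  shows "(\<lambda>k. ip (f k) h) \<longlonglongrightarrow> ip g h"
  unfolding ip_def by (rule integral_mult_tendsto[OF assms(1-3) sq_int_cnj[OF assms(4)]])

lemma ip_cong_AE:
  assumes "f \<in> borel_measurable lebesgue" "f' \<in> borel_measurable lebesgue" "g \<in> borel_measurable lebesgue"
    "AE x in lebesgue. f x = f' x"
  shows "ip f g = ip f' g"
  unfolding ip_def
proof (rule integral_cong_AE)
  have c: "(\<lambda>x. cnj (g x)) \<in> borel_measurable lebesgue"
    using assms(3) by (rule measurable_compose[OF _ measurable_cnj])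
  show "(\<lambda>x. f x * cnj (g x)) \<in> borel_measurable lebesgue" "(\<lambda>x. f' x * cnj (g x)) \<in> borel_measurable lebesgue"
    using assms c by (auto intro: borel_measurable_times)
  show "AE x in lebesgue. f x * cnj (g x) = f' x * cnj (g x)" using assms(4) by eventually_elim simp
qed

definition bounded_potential :: "'a::euclidean_space set \<Rightarrow> real \<Rightarrow> ('a \<Rightarrow> real) \<Rightarrow> bool" where
  "bounded_potential U r q \<longleftrightarrow> q \<in> borel_measurable (lebesgue_on U) \<and> (AE x in lebesgue_on U. \<bar>q x\<bar> \<le> r)"

definition ext :: "'a::euclidean_space set \<Rightarrow> ('a \<Rightarrow> real) \<Rightarrow> 'a \<Rightarrow> complex" where
  "ext U q x = complex_of_real (if x \<in> U then q x else 0)"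

lemma ext_potential:
  assumes q: "bounded_potential U r q" and U: "U \<in> sets lebesgue" and r: "r \<ge> 0"
  shows "ext U q \<in> borel_measurable lebesgue" "AE x in lebesgue. cmod (ext U q x) \<le> r"
proof -
  have "(\<lambda>x. if x \<in> U then q x else 0) \<in> borel_measurable lebesgue"
    using q U by (simp add: bounded_potential_def borel_measurable_if)
  then show "ext U q \<in> borel_measurable lebesgue" unfolding ext_def[abs_def] by measurable
  have "AE x in lebesgue. x \<in> U \<longrightarrow> \<bar>q x\<bar> \<le> r"
    using q U by (simp add: bounded_potential_def AE_restrict_space_iff)
  then show "AE x in lebesgue. cmod (ext U q x) \<le> r"
    by eventually_elim (use r in \<open>auto simp: ext_def\<close>)
qed

lemma ext_mult:
  assumes q: "bounded_potential U r q" and U: "U \<in> sets lebesgue" and r: "r \<ge> 0" and v: "sq_int lebesgue v"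
  shows "sq_int lebesgue (\<lambda>x. ext U q x * v x)" "norm2 lebesgue (\<lambda>x. ext U q x * v x) \<le> r * norm2 lebesgue v"
proof -
  have m: "(\<lambda>x. ext U q x * v x) \<in> borel_measurable lebesgue"
    by (intro borel_measurable_times ext_potential(1)[OF q U r] sq_int_measurable[OF v])
  have b: "AE x in lebesgue. cmod (ext U q x * v x) \<le> r * cmod (v x)"
    using ext_potential(2)[OF q U r] by eventually_elim (simp add: norm_mult mult_right_mono)
  show "sq_int lebesgue (\<lambda>x. ext U q x * v x)" by (rule sq_int_bound[OF v m b])
  show "norm2 lebesgue (\<lambda>x. ext U q x * v x) \<le> r * norm2 lebesgue v" by (rule norm2_bound[OF v m b r])
qed

lemma integral_lebesgue_on_ext:
  assumes "U \<in> sets lebesgue"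
  shows "(\<integral>x. of_real (q x) * v x * w x \<partial>lebesgue_on U) = (\<integral>x. ext U q x * v x * w x \<partial>lebesgue)"
proof -
  have "(\<integral>x. of_real (q x) * v x * w x \<partial>lebesgue_on U) = (\<integral>x. indicator U x *\<^sub>R (of_real (q x) * v x * w x) \<partial>lebesgue)"
    using assms by (intro integral_restrict_space) simp
  also have "\<dots> = (\<integral>x. ext U q x * v x * w x \<partial>lebesgue)"
    by (intro Bochner_Integration.integral_cong refl) (simp add: ext_def indicator_def)
  finally show ?thesis .
qed

text \<open>The form of the Schroedinger operator, made sesquilinear so that its real part on the diagonal is an
  energy. Distributions pair bilinearly, whence the conjugate in schroedinger_eq_sform.\<close>

definition sform :: "real \<Rightarrow> 'a::euclidean_space set \<Rightarrow> ('a \<Rightarrow> real) \<Rightarrow> ('a \<Rightarrow> complex) \<Rightarrow> ('a \<Rightarrow> complex) \<Rightarrow> complex" where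
  "sform s U q v w = ip (frac_grad s v) (frac_grad s w) / of_real ((planch TYPE('a))\<^sup>2) + ip (\<lambda>x. ext U q x * v x) w"

text \<open>Everything below holds for a bounded Borel set; the ball only fixes the size of the Poincare
  constant.\<close>

locale fractional_domain =
  fixes s :: real and U :: "'a::euclidean_space set" and R :: real
  assumes s: "0 < s" "s < 1" and UR: "U \<subseteq> ball 0 R" and Ub: "U \<in> sets borel"
begin

lemma U_bounded: "bounded U"
  using UR bounded_ball bounded_subset by blast

lemma U_lebesgue: "U \<in> sets lebesgue"
  using Ub by simp

lemma test_sobolev: "\<phi> \<in> test_functions U \<Longrightarrow> \<phi> \<in> sobolev s"
  by (rule test_functions_sobolev[OF _ U_bounded s])

lemma test_sobolev_tilde: "\<phi> \<in> test_functions U \<Longrightarrow> \<phi> \<in> sobolev_tilde s U"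
proof -
  assume \<phi>: "\<phi> \<in> test_functions U"
  note \<phi>s = test_sobolev[OF \<phi>]
  then have "sobolev_norm s (\<lambda>x. \<phi> x - \<phi> x) \<le> 0"
    using sobolev_norm_lincomb[of \<phi> s \<phi> 0 0] by simp
  then have "sobolev_norm s (\<lambda>x. \<phi> x - \<phi> x) < e" if "e > 0" for e using that by linarith
  then show ?thesis using \<phi>s \<phi> unfolding sobolev_tilde_def by blast
qed

lemma sobolevD:
  assumes "v \<in> sobolev s"
  shows "sq_int lebesgue v" "sq_int lebesgue (frac_grad s v)"
  using assms frac_grad_sobolev(1)[OF assms] s by (auto simp: sobolev_iff)

lemma schroedinger_eq_sform:
  assumes v: "v \<in> sobolev s" and \<phi>: "\<phi> \<in> test_functions U"
  shows "schroedinger s q U v (\<lambda>x. cnj (\<phi> x)) = sform s U q v \<phi>"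
proof -
  define P where "P = (2 * pi) ^ DIM('a)"
  note vs = sobolevD[OF v]
  have L: "L2_ball R \<phi>" by (rule test_functions_L2_ball[OF \<phi> UR])
  note \<phi>s = sobolevD[OF test_sobolev[OF \<phi>]]
  have cont: "continuous_on UNIV \<phi>" by (rule test_functions_continuous[OF \<phi>])
  have cm: "(\<lambda>x. cnj (\<phi> x)) \<in> borel_measurable borel"
    using borel_measurable_continuous_onI[OF cont] by (rule measurable_compose[OF _ measurable_cnj])
  have inv: "inverse_fourier_integral (\<lambda>x. cnj (\<phi> x)) \<xi> = cnj (fourier_integral \<phi> \<xi>) / of_real P" for \<xi>
  proof -
    have "inverse_fourier_integral (\<lambda>x. cnj (\<phi> x)) \<xi> = fint (\<lambda>x. cnj (\<phi> x)) (-\<xi>) / of_real P"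
      unfolding inverse_fourier_integral_def fint_def P_def using cm by (subst integral_completion) auto
    then show ?thesis unfolding fint_cnj fourier_integral_continuous_eq[OF cont] .
  qed
  have pw: "norm \<xi> powr (2 * s) = norm \<xi> powr s * norm \<xi> powr s" for \<xi> :: 'a
    by (simp add: powr_add[symmetric])
  have "frac_laplacian s v (\<lambda>x. cnj (\<phi> x)) = (\<integral>\<xi>. (frac_grad s v \<xi> * cnj (frac_grad s \<phi> \<xi>)) / of_real P \<partial>lebesgue)"
    unfolding frac_laplacian_def
  proof (rule integral_cong_AE)
    show "AE \<xi> in lebesgue. of_real (norm \<xi> powr (2 * s)) * fourier_L2 v \<xi> * inverse_fourier_integral (\<lambda>x. cnj (\<phi> x)) \<xi>
        = frac_grad s v \<xi> * cnj (frac_grad s \<phi> \<xi>) / of_real P"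
      using fourier_L2_L2_ball[OF L] by eventually_elim (simp add: frac_grad_def inv pw)
    show "(\<lambda>\<xi>. frac_grad s v \<xi> * cnj (frac_grad s \<phi> \<xi>) / of_real P) \<in> borel_measurable lebesgue"
      using ip_integrable[OF vs(2) \<phi>s(2)] by (intro borel_measurable_divide) auto
    have "(\<lambda>\<xi>. cnj (fourier_integral \<phi> \<xi>)) \<in> borel_measurable lebesgue"
      by (rule measurable_compose[OF sq_int_measurable[OF plancherel_L2_ball(1)[OF L]] measurable_cnj])
    then show "(\<lambda>\<xi>. of_real (norm \<xi> powr (2 * s)) * fourier_L2 v \<xi> * inverse_fourier_integral (\<lambda>x. cnj (\<phi> x)) \<xi>) \<in> borel_measurable lebesgue"
      unfolding inv
      by (intro borel_measurable_times borel_measurable_divide norm_powr_measurable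
          sq_int_measurable[OF fourier_L2_spec(1)[OF vs(1)]]) auto
  qed
  also have "\<dots> = ip (frac_grad s v) (frac_grad s \<phi>) / of_real P"
    unfolding ip_def by (rule integral_divide_zero)
  finally show ?thesis
    unfolding schroedinger_def sform_def integral_lebesgue_on_ext[OF U_lebesgue] ip_def planch_squared P_def[symmetric]
    by simp
qed

lemma sform_lincomb:
  assumes q: "bounded_potential U r q" "r \<ge> 0" and v: "v \<in> sobolev s" and w: "w \<in> sobolev s" and u: "u \<in> sobolev s"
  shows "sform s U q (\<lambda>x. a * v x + b * w x) u = a * sform s U q v u + b * sform s U q w u"
proof -
  note vs = sobolevD[OF v] and wsq = sobolevD[OF w] and us = sobolevD[OF u]
  note qv = ext_mult(1)[OF q(1) U_lebesgue q(2) vs(1)] and qw = ext_mult(1)[OF q(1) U_lebesgue q(2) wsq(1)]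
  have lc: "sq_int lebesgue (\<lambda>x. a * v x + b * w x)" using vs wsq by (intro sq_int_intros)
  have gl: "sq_int lebesgue (\<lambda>\<xi>. a * frac_grad s v \<xi> + b * frac_grad s w \<xi>)" using vs wsq by (intro sq_int_intros)
  have 1: "ip (frac_grad s (\<lambda>x. a * v x + b * w x)) (frac_grad s u)
      = a * ip (frac_grad s v) (frac_grad s u) + b * ip (frac_grad s w) (frac_grad s u)"
    unfolding ip_lincomb[OF vs(2) wsq(2) us(2), symmetric]
    by (rule ip_cong_AE[OF frac_grad_measurable[OF lc] sq_int_measurable[OF gl] sq_int_measurable[OF us(2)] frac_grad_lincomb[OF vs(1) wsq(1)]])
  have eq: "(\<lambda>x. ext U q x * (a * v x + b * w x)) = (\<lambda>x. a * (ext U q x * v x) + b * (ext U q x * w x))"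
    by (simp add: distrib_left mult.left_commute)
  have 2: "ip (\<lambda>x. ext U q x * (a * v x + b * w x)) u = a * ip (\<lambda>x. ext U q x * v x) u + b * ip (\<lambda>x. ext U q x * w x) u"
    unfolding eq by (rule ip_lincomb[OF qv qw us(1)])
  show ?thesis unfolding sform_def 1 2 by (simp add: add_divide_distrib distrib_left)
qed

lemma sform_commute: "sform s U q w v = cnj (sform s U q v w)"
proof -
  have "ip (\<lambda>x. ext U q x * w x) v = cnj (ip (\<lambda>x. ext U q x * v x) w)"
  proof -
    have "cnj (ip (\<lambda>x. ext U q x * v x) w) = (\<integral>x. cnj (ext U q x * v x * cnj (w x)) \<partial>lebesgue)"
      unfolding ip_def by (rule Bochner_Integration.integral_cnj[symmetric])
    also have "\<dots> = ip (\<lambda>x. ext U q x * w x) v"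
      unfolding ip_def ext_def by (simp only: complex_cnj_mult complex_cnj_cnj complex_cnj_complex_of_real mult_ac)
    finally show ?thesis by simp
  qed
  moreover have "ip (frac_grad s w) (frac_grad s v) = cnj (ip (frac_grad s v) (frac_grad s w))"
    by (rule ip_commute)
  ultimately show ?thesis by (simp add: sform_def)
qed

lemma sform_tendsto:
  assumes q: "bounded_potential U r q" "r \<ge> 0"
    and \<phi>: "\<And>k. \<phi> k \<in> sobolev s" and v: "v \<in> sobolev s" and w: "w \<in> sobolev s"
    and lim: "(\<lambda>k. sobolev_norm s (\<lambda>x. v x - \<phi> k x)) \<longlonglongrightarrow> 0"
  shows "(\<lambda>k. sform s U q (\<phi> k) w) \<longlonglongrightarrow> sform s U q v w"
proof -
  have s0: "s \<ge> 0" using s by simp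
  note l = sobolev_tilde_L2_limit[OF v \<phi> s0 lim]
  note \<phi>s = sobolevD[OF \<phi>] and vs = sobolevD[OF v] and wsq = sobolevD[OF w]
  note qm = ext_mult[OF q(1) U_lebesgue q(2)]
  have "(\<lambda>k. norm2 lebesgue (\<lambda>x. ext U q x * \<phi> k x - ext U q x * v x)) \<longlonglongrightarrow> 0"
  proof (rule Lim_null_comparison)
    show "(\<lambda>k. r * norm2 lebesgue (\<lambda>x. \<phi> k x - v x)) \<longlonglongrightarrow> 0"
      using tendsto_mult_left[OF l(1), of r] by simp
    show "\<forall>\<^sub>F k in sequentially. norm (norm2 lebesgue (\<lambda>x. ext U q x * \<phi> k x - ext U q x * v x)) \<le> r * norm2 lebesgue (\<lambda>x. \<phi> k x - v x)"
      using qm(2)[OF sq_int_diff[OF \<phi>s(1) vs(1)]]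
      by (intro always_eventually allI) (simp add: right_diff_distrib)
  qed
  then have "(\<lambda>k. ip (\<lambda>x. ext U q x * \<phi> k x) w) \<longlonglongrightarrow> ip (\<lambda>x. ext U q x * v x) w"
    by (rule ip_tendsto[OF qm(1)[OF \<phi>s(1)] qm(1)[OF vs(1)] _ wsq(1)])
  moreover have "(\<lambda>k. ip (frac_grad s (\<phi> k)) (frac_grad s w)) \<longlonglongrightarrow> ip (frac_grad s v) (frac_grad s w)"
    by (rule ip_tendsto[OF \<phi>s(2) vs(2) l(2) wsq(2)])
  ultimately show ?thesis unfolding sform_def by (intro tendsto_intros) simp_all
qed

text \<open>Functions supported in a fixed ball cannot concentrate their transform at low frequencies: the
  transform is bounded by the L1 norm, hence by a multiple of the L2 norm. On a small ball of
  frequencies this contributes at most half of the total mass, and on the rest |\<xi>|^s is bounded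
  below.\<close>

lemma poincare_ex:
  "\<exists>C>0. \<forall>v::'a \<Rightarrow> complex. L2_ball R v \<longrightarrow> v \<in> sobolev s \<longrightarrow> norm2 lebesgue v \<le> C * norm2 lebesgue (frac_grad s v)"
proof -
  define P where "P = planch TYPE('a)"
  have P: "P > 0" by (simp add: P_def)
  define I where "I = norm2 lebesgue (\<lambda>x::'a. indicator (ball 0 R) x)"
  define b where "b = unit_ball_vol DIM('a)"
  have b: "b \<ge> 0" by (simp add: b_def)
  define D where "D = I\<^sup>2 * b + 1"
  have D: "D > 0" using b by (simp add: D_def add_nonneg_pos)
  \<comment> \<open>The radius at which the low frequencies carry at most half of the mass.\<close>
  define \<rho> where "\<rho> = min 1 (P\<^sup>2 / (2 * D))"
  have \<rho>: "0 < \<rho>" "\<rho> \<le> 1" using P D by (auto simp: \<rho>_def)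
  have "\<rho> \<le> P\<^sup>2 / (2 * D)" by (simp add: \<rho>_def)
  then have D\<rho>: "2 * (D * \<rho>) \<le> P\<^sup>2" using D by (simp add: le_divide_eq mult_ac)
  define V where "V = measure lebesgue (ball (0::'a) \<rho>)"
  have "V = b * \<rho> ^ DIM('a)" unfolding V_def b_def using \<rho> by (simp add: content_ball)
  also have "\<dots> \<le> b * \<rho> ^ 1"
    using \<rho> b by (intro mult_left_mono power_decreasing) (auto simp: Suc_le_eq)
  finally have V: "V \<le> b * \<rho>" "V \<ge> 0" by (simp_all add: V_def)
  have IV: "2 * (I\<^sup>2 * V) \<le> P\<^sup>2"
  proof -
    have "I\<^sup>2 * V \<le> I\<^sup>2 * (b * \<rho>)" by (rule mult_left_mono[OF V(1)]) simp
    also have "\<dots> \<le> D * \<rho>" using \<rho> by (simp add: D_def distrib_right)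
    finally show ?thesis using D\<rho> by linarith
  qed
  define C where "C = sqrt (2 * \<rho> powr (- 2 * s)) / P"
  have C: "C > 0" using P \<rho> by (simp add: C_def)
  have "norm2 lebesgue v \<le> C * norm2 lebesgue (frac_grad s v)" if L: "L2_ball R v" and v: "v \<in> sobolev s" for v :: "'a \<Rightarrow> complex"
  proof -
    note vs = sobolevD[OF v]
    define N where "N = norm2 lebesgue v"
    define M where "M = norm2 lebesgue (frac_grad s v)"
    have int1: "integrable lebesgue (\<lambda>\<xi>::'a. (I * N)\<^sup>2 * indicator (ball 0 \<rho>) \<xi>)"
      by (intro integrable_mult_right integrable_real_indicator)
         (auto intro: emeasure_bounded_finite[unfolded infinity_ennreal_def])
    have "(P * N)\<^sup>2 = (\<integral>\<xi>. (cmod (fourier_L2 v \<xi>))\<^sup>2 \<partial>lebesgue)"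
      unfolding P_def N_def plancherel[OF vs(1), symmetric] norm2_squared ..
    also have "\<dots> \<le> (\<integral>\<xi>. (I * N)\<^sup>2 * indicator (ball 0 \<rho>) \<xi> + \<rho> powr (- 2 * s) * (cmod (frac_grad s v \<xi>))\<^sup>2 \<partial>lebesgue)"
    proof (rule integral_mono_AE)
      show "integrable lebesgue (\<lambda>\<xi>. (cmod (fourier_L2 v \<xi>))\<^sup>2)" by (rule sq_int_integrable[OF fourier_L2_spec(1)[OF vs(1)]])
      show "integrable lebesgue (\<lambda>\<xi>. (I * N)\<^sup>2 * indicator (ball 0 \<rho>) \<xi> + \<rho> powr (- 2 * s) * (cmod (frac_grad s v \<xi>))\<^sup>2)"
        by (intro Bochner_Integration.integrable_add int1 integrable_mult_right sq_int_integrable[OF vs(2)])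
      show "AE \<xi> in lebesgue. (cmod (fourier_L2 v \<xi>))\<^sup>2
          \<le> (I * N)\<^sup>2 * indicator (ball 0 \<rho>) \<xi> + \<rho> powr (- 2 * s) * (cmod (frac_grad s v \<xi>))\<^sup>2"
        using fourier_L2_L2_ball[OF L]
      proof eventually_elim
        case (elim \<xi>)
        show ?case
        proof (cases "norm \<xi> < \<rho>")
          case True
          have "cmod (fourier_L2 v \<xi>) \<le> I * N"
            unfolding elim I_def N_def
            by (rule order_trans[OF fourier_integral_bound L2_ball_L1_bound(2)[OF L]]) (rule L2_ball_L1_bound(1)[OF L])
          then have "(cmod (fourier_L2 v \<xi>))\<^sup>2 \<le> (I * N)\<^sup>2" by (rule power_mono) simp
          then show ?thesis using True by (simp add: add_increasing2)
        next
          case False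
          have "\<rho> powr s \<le> norm \<xi> powr s" using False \<rho> s by (intro powr_mono2) auto
          then have "\<rho> powr (- s) * \<rho> powr s \<le> \<rho> powr (- s) * norm \<xi> powr s" by (intro mult_left_mono) auto
          then have "1 \<le> \<rho> powr (- s) * norm \<xi> powr s" using \<rho> by (simp add: powr_add[symmetric])
          then have "1 * cmod (fourier_L2 v \<xi>) \<le> (\<rho> powr (- s) * norm \<xi> powr s) * cmod (fourier_L2 v \<xi>)"
            by (rule mult_right_mono) simp
          then have "cmod (fourier_L2 v \<xi>) \<le> \<rho> powr (- s) * cmod (frac_grad s v \<xi>)"
            by (simp add: frac_grad_def norm_mult mult.assoc)
          then have "(cmod (fourier_L2 v \<xi>))\<^sup>2 \<le> (\<rho> powr (- s) * cmod (frac_grad s v \<xi>))\<^sup>2" by (rule power_mono) simp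
          also have "\<dots> = \<rho> powr (- 2 * s) * (cmod (frac_grad s v \<xi>))\<^sup>2"
            by (simp add: power_mult_distrib power2_eq_square powr_add[symmetric])
          finally show ?thesis by (simp add: add_increasing)
        qed
      qed
    qed
    also have "\<dots> = (I * N)\<^sup>2 * V + \<rho> powr (- 2 * s) * M\<^sup>2"
      unfolding M_def norm2_squared V_def using int1 sq_int_integrable[OF vs(2)]
      by (subst Bochner_Integration.integral_add) auto
    finally have "(P * N)\<^sup>2 \<le> (I * N)\<^sup>2 * V + \<rho> powr (- 2 * s) * M\<^sup>2" .
    moreover have "2 * ((I * N)\<^sup>2 * V) \<le> (P * N)\<^sup>2"
      using mult_right_mono[OF IV, of "N\<^sup>2"] by (simp add: power_mult_distrib mult_ac)
    ultimately have "(P * N)\<^sup>2 \<le> 2 * \<rho> powr (- 2 * s) * M\<^sup>2" by linarith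
    then have "sqrt ((P * N)\<^sup>2) \<le> sqrt (2 * \<rho> powr (- 2 * s) * M\<^sup>2)" by (rule real_sqrt_le_mono)
    also have "sqrt ((P * N)\<^sup>2) = P * N" using P by (simp add: N_def)
    also have "sqrt (2 * \<rho> powr (- 2 * s) * M\<^sup>2) = sqrt (2 * \<rho> powr (- 2 * s)) * M"
      unfolding real_sqrt_mult[of _ "M\<^sup>2"] by (simp add: M_def)
    finally have "N \<le> C * M" using P by (simp add: C_def field_simps)
    then show ?thesis by (simp add: N_def M_def)
  qed
  then show ?thesis using C by blast
qed

definition poincare_const :: real where
  "poincare_const = (SOME C. C > 0 \<and> (\<forall>v::'a \<Rightarrow> complex. L2_ball R v \<longrightarrow> v \<in> sobolev s \<longrightarrow>
     norm2 lebesgue v \<le> C * norm2 lebesgue (frac_grad s v)))"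

lemma poincare_const_pos: "poincare_const > 0"
  and poincare: "L2_ball R (v :: 'a \<Rightarrow> complex) \<Longrightarrow> v \<in> sobolev s \<Longrightarrow> norm2 lebesgue v \<le> poincare_const * norm2 lebesgue (frac_grad s v)"
proof -
  have "\<exists>C. C > 0 \<and> (\<forall>v::'a \<Rightarrow> complex. L2_ball R v \<longrightarrow> v \<in> sobolev s \<longrightarrow>
     norm2 lebesgue v \<le> C * norm2 lebesgue (frac_grad s v))" using poincare_ex by blast
  from someI_ex[OF this, folded poincare_const_def]
  show "poincare_const > 0" "L2_ball R (v :: 'a \<Rightarrow> complex) \<Longrightarrow> v \<in> sobolev s \<Longrightarrow> norm2 lebesgue v \<le> poincare_const * norm2 lebesgue (frac_grad s v)"
    by blast+
qed

text \<open>A potential bounded by this constant absorbs at most half of the energy.\<close>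

definition pot_bound :: real where
  "pot_bound = 1 / (2 * (planch TYPE('a))\<^sup>2 * poincare_const\<^sup>2)"

lemma pot_bound_pos: "pot_bound > 0"
  using poincare_const_pos planch_pos[where 'a='a] by (simp add: pot_bound_def)

text \<open>The potential costs at most pot_bound times the squared L2 norm, which by the Poincare inequality is
  at most half of the energy.\<close>

lemma sform_coercive:
  assumes q: "bounded_potential U pot_bound q" and L: "L2_ball R v" and v: "v \<in> sobolev s"
  shows "(norm2 lebesgue (frac_grad s v))\<^sup>2 / (2 * (planch TYPE('a))\<^sup>2) \<le> Re (sform s U q v v)"
    and "pot_bound * (norm2 lebesgue v)\<^sup>2 \<le> Re (sform s U q v v)"
proof -
  define P where "P = planch TYPE('a)"
  have P: "P > 0" by (simp add: P_def)
  define N where "N = norm2 lebesgue v"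
  define M where "M = norm2 lebesgue (frac_grad s v)"
  note vs = sobolevD[OF v]
  have r0: "pot_bound \<ge> 0" using pot_bound_pos by simp
  note qm = ext_mult[OF q U_lebesgue r0 vs(1)]
  have "cmod (ip (\<lambda>x. ext U q x * v x) v) \<le> pot_bound * N * N"
    by (rule order_trans[OF ip_bound[OF qm(1) vs(1)]]) (simp add: N_def qm(2) mult_right_mono)
  then have "- (pot_bound * N * N) \<le> Re (ip (\<lambda>x. ext U q x * v x) v)"
    using abs_Re_le_cmod[of "ip (\<lambda>x. ext U q x * v x) v"] by linarith
  moreover have "Re (ip (frac_grad s v) (frac_grad s v) / of_real (P\<^sup>2)) = M\<^sup>2 / P\<^sup>2"
    unfolding ip_self M_def of_real_divide[symmetric] by (rule Re_complex_of_real)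
  ultimately have low: "M\<^sup>2 / P\<^sup>2 - pot_bound * N\<^sup>2 \<le> Re (sform s U q v v)"
    unfolding sform_def P_def[symmetric] plus_complex.sel power2_eq_square[of N] mult.assoc[symmetric] by linarith
  have NM: "N \<le> poincare_const * M" unfolding N_def M_def by (rule poincare[OF L v])
  then have "N\<^sup>2 \<le> (poincare_const * M)\<^sup>2" by (rule power_mono) (simp add: N_def)
  then have "pot_bound * N\<^sup>2 \<le> pot_bound * (poincare_const\<^sup>2 * M\<^sup>2)"
    using r0 by (intro mult_left_mono) (simp_all add: power_mult_distrib)
  also have "\<dots> = M\<^sup>2 / (2 * P\<^sup>2)"
    unfolding pot_bound_def P_def[symmetric] using poincare_const_pos P by (simp add: field_simps)
  finally have half: "pot_bound * N\<^sup>2 \<le> M\<^sup>2 / (2 * P\<^sup>2)" .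
  have "M\<^sup>2 / P\<^sup>2 = M\<^sup>2 / (2 * P\<^sup>2) + M\<^sup>2 / (2 * P\<^sup>2)" using P by (simp add: field_simps)
  with low half have "M\<^sup>2 / (2 * P\<^sup>2) \<le> Re (sform s U q v v)" "pot_bound * N\<^sup>2 \<le> Re (sform s U q v v)" by linarith+
  then show "(norm2 lebesgue (frac_grad s v))\<^sup>2 / (2 * (planch TYPE('a))\<^sup>2) \<le> Re (sform s U q v v)"
    "pot_bound * (norm2 lebesgue v)\<^sup>2 \<le> Re (sform s U q v v)"
    by (simp_all add: M_def N_def P_def)
qed

text \<open>Right-hand sides are functions on the whole space, of which only the values on U matter.\<close>

definition weak_solution :: "('a \<Rightarrow> real) \<Rightarrow> ('a \<Rightarrow> complex) \<Rightarrow> ('a \<Rightarrow> complex) \<Rightarrow> bool" where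
  "weak_solution q h v \<longleftrightarrow> v \<in> sobolev_tilde s U \<and>
     (\<forall>\<phi>\<in>test_functions U. schroedinger s q U v \<phi> = (\<integral>x. h x * \<phi> x \<partial>lebesgue))"

lemma weak_solution_sform:
  assumes v: "v \<in> sobolev s"
  shows "(\<forall>\<phi>\<in>test_functions U. schroedinger s q U v \<phi> = (\<integral>x. h x * \<phi> x \<partial>lebesgue))
    \<longleftrightarrow> (\<forall>\<phi>\<in>test_functions U. sform s U q v \<phi> = ip h \<phi>)" (is "?l \<longleftrightarrow> ?r")
proof
  assume l: ?l
  show ?r
  proof
    fix \<phi> assume \<phi>: "\<phi> \<in> test_functions U"
    show "sform s U q v \<phi> = ip h \<phi>"
      unfolding schroedinger_eq_sform[OF v \<phi>, symmetric] ip_def using l test_functions_cnj[OF \<phi>] by blast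
  qed
next
  assume r: ?r
  show ?l
  proof
    fix \<phi> assume \<phi>: "\<phi> \<in> test_functions U"
    note c = test_functions_cnj[OF \<phi>]
    have "schroedinger s q U v (\<lambda>x. cnj (cnj (\<phi> x))) = ip h (\<lambda>x. cnj (\<phi> x))"
      unfolding schroedinger_eq_sform[OF v c] using r c by blast
    then show "schroedinger s q U v \<phi> = (\<integral>x. h x * \<phi> x \<partial>lebesgue)" by (simp add: ip_def)
  qed
qed

text \<open>Test the equation with the solution itself, approximated by test functions, and use coercivity.\<close>

lemma weak_solution_bound:
  assumes q: "bounded_potential U pot_bound q" and v: "weak_solution q h v" and h: "sq_int lebesgue h"
  shows "norm2 lebesgue v \<le> norm2 lebesgue h / pot_bound"
proof -
  have vt: "v \<in> sobolev_tilde s U" using v by (simp add: weak_solution_def)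
  then have vsob: "v \<in> sobolev s" by (simp add: sobolev_tilde_def)
  note vs = sobolevD[OF vsob]
  have L: "L2_ball R v" by (rule sobolev_tilde_L2_ball[OF vt UR Ub s])
  have r0: "pot_bound \<ge> 0" using pot_bound_pos by simp
  obtain \<phi> where \<phi>: "\<And>k. \<phi> k \<in> test_functions U" "(\<lambda>k. sobolev_norm s (\<lambda>x. v x - \<phi> k x)) \<longlonglongrightarrow> 0"
    using sobolev_tilde_sequence[OF vt] by blast
  note \<phi>s = test_sobolev[OF \<phi>(1)]
  have eq: "sform s U q v (\<phi> k) = ip h (\<phi> k)" for k
    using v weak_solution_sform[OF vsob] \<phi>(1) by (simp add: weak_solution_def)
  have "(\<lambda>k. sform s U q (\<phi> k) v) \<longlonglongrightarrow> sform s U q v v"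
    by (rule sform_tendsto[OF q r0 \<phi>s vsob vsob \<phi>(2)])
  moreover have "(\<lambda>k. ip (\<phi> k) h) \<longlonglongrightarrow> ip v h"
    by (rule ip_tendsto[OF sobolevD(1)[OF \<phi>s] vs(1) _ h])
       (rule sobolev_tilde_L2_limit(1)[OF vsob \<phi>s _ \<phi>(2)], use s in simp)
  moreover have "sform s U q (\<phi> k) v = ip (\<phi> k) h" for k
    unfolding sform_commute[of q "\<phi> k" v] eq ip_commute[of "\<phi> k" h] ..
  ultimately have "sform s U q v v = ip v h" using LIMSEQ_unique by simp
  then have "pot_bound * (norm2 lebesgue v)\<^sup>2 \<le> Re (ip v h)" using sform_coercive(2)[OF q L vsob] by simp
  also have "\<dots> \<le> norm2 lebesgue v * norm2 lebesgue h"
    by (rule order_trans[OF complex_Re_le_cmod ip_bound[OF vs(1) h]])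
  finally have "norm2 lebesgue v * (pot_bound * norm2 lebesgue v) \<le> norm2 lebesgue v * norm2 lebesgue h"
    by (simp add: power2_eq_square mult_ac)
  then have "pot_bound * norm2 lebesgue v \<le> norm2 lebesgue h \<or> norm2 lebesgue v = 0"
    using norm2_nonneg[of lebesgue v] by (cases "norm2 lebesgue v = 0") (simp_all add: less_le)
  then show ?thesis
  proof
    assume "pot_bound * norm2 lebesgue v \<le> norm2 lebesgue h"
    then show ?thesis using pot_bound_pos by (simp add: le_divide_eq mult.commute)
  next
    assume "norm2 lebesgue v = 0"
    then show ?thesis using pot_bound_pos by simp
  qed
qed

lemma weak_solution_lincomb:
  assumes q: "bounded_potential U pot_bound q" and v: "weak_solution q h v" and w: "weak_solution q k w"
    and h: "sq_int lebesgue h" and k: "sq_int lebesgue k"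
  shows "weak_solution q (\<lambda>x. a * h x + b * k x) (\<lambda>x. a * v x + b * w x)"
proof -
  have vt: "v \<in> sobolev_tilde s U" "w \<in> sobolev_tilde s U" using v w by (auto simp: weak_solution_def)
  then have sob: "v \<in> sobolev s" "w \<in> sobolev s" by (auto simp: sobolev_tilde_def)
  have lt: "(\<lambda>x. a * v x + b * w x) \<in> sobolev_tilde s U"
    by (rule sobolev_tilde_lincomb[OF vt U_bounded s])
  then have ls: "(\<lambda>x. a * v x + b * w x) \<in> sobolev s" by (simp add: sobolev_tilde_def)
  have r0: "pot_bound \<ge> 0" using pot_bound_pos by simp
  have "\<forall>\<phi>\<in>test_functions U. sform s U q (\<lambda>x. a * v x + b * w x) \<phi> = ip (\<lambda>x. a * h x + b * k x) \<phi>"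
  proof
    fix \<phi> assume \<phi>: "\<phi> \<in> test_functions U"
    have "sform s U q v \<phi> = ip h \<phi>" "sform s U q w \<phi> = ip k \<phi>"
      using v w weak_solution_sform[OF sob(1)] weak_solution_sform[OF sob(2)] \<phi> by (auto simp: weak_solution_def)
    then show "sform s U q (\<lambda>x. a * v x + b * w x) \<phi> = ip (\<lambda>x. a * h x + b * k x) \<phi>"
      using sform_lincomb[OF q r0 sob test_sobolev[OF \<phi>]] ip_lincomb[OF h k sobolevD(1)[OF test_sobolev[OF \<phi>]]] by simp
  qed
  then show ?thesis using lt weak_solution_sform[OF ls] by (simp add: weak_solution_def)
qed

lemma weak_solution_zero: "weak_solution q (\<lambda>x. 0) (\<lambda>x. 0)"
proof -
  have z: "(\<lambda>x::'a. 0::complex) \<in> sobolev_tilde s U" by (rule test_sobolev_tilde[OF test_functions_zero])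
  then have zs: "(\<lambda>x::'a. 0::complex) \<in> sobolev s" by (simp add: sobolev_tilde_def)
  note zz = sobolevD[OF zs]
  have "norm2 lebesgue (frac_grad s (\<lambda>x::'a. 0)) = norm2 lebesgue (\<lambda>\<xi>::'a. 0 * frac_grad s (\<lambda>x. 0) \<xi> + 0 * frac_grad s (\<lambda>x. 0) \<xi>)"
    using frac_grad_lincomb[OF zz(1) zz(1), of s 0 0]
    by (intro norm2_cong_AE frac_grad_measurable zz(1)) auto
  then have g0: "norm2 lebesgue (frac_grad s (\<lambda>x::'a. 0)) = 0" by simp
  have "sform s U q (\<lambda>x. 0) \<phi> = ip (\<lambda>x. 0) \<phi>" if "\<phi> \<in> test_functions U" for \<phi>
  proof -
    have "cmod (ip (frac_grad s (\<lambda>x. 0)) (frac_grad s \<phi>)) \<le> 0"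
      using ip_bound[OF zz(2) sobolevD(2)[OF test_sobolev[OF that]]] g0 by simp
    then show ?thesis by (simp add: sform_def)
  qed
  then have "\<forall>\<phi>\<in>test_functions U. sform s U q (\<lambda>x. 0) \<phi> = ip (\<lambda>x. 0) \<phi>" by blast
  then show ?thesis unfolding weak_solution_def weak_solution_sform[OF zs] using z by blast
qed

text \<open>Minimize the energy over test functions. Only real parts enter the variational principle; replacing
  \<psi> by \<i> \<psi> recovers the imaginary part of the equation. Coercivity makes the minimizing sequence
  Cauchy in the Sobolev norm.\<close>

lemma weak_solution_exists:
  assumes q: "bounded_potential U pot_bound q" and h: "sq_int lebesgue h"
  obtains v where "weak_solution q h v"
proof -
  define P where "P = planch TYPE('a)"
  have P: "P > 0" by (simp add: P_def)
  have s0: "s \<ge> 0" using s by simp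
  have r0: "pot_bound \<ge> 0" using pot_bound_pos by simp
  define V where "V = test_functions U"
  define comb :: "real \<Rightarrow> ('a \<Rightarrow> complex) \<Rightarrow> real \<Rightarrow> ('a \<Rightarrow> complex) \<Rightarrow> 'a \<Rightarrow> complex"
    where "comb a v b w = (\<lambda>x. of_real a * v x + of_real b * w x)" for a v b w
  define A where "A v w = Re (sform s U q v w)" for v w
  define l where "l w = Re (ip w h)" for w
  define N where "N = norm2 lebesgue h"
  define C where "C = N\<^sup>2 / pot_bound + 1"
  have C: "C > 0" using pot_bound_pos by (simp add: C_def add_nonneg_pos)
  have Vs: "v \<in> sobolev s" if "v \<in> V" for v using that test_sobolev by (simp add: V_def)
  note Vq = sobolevD[OF Vs]
  have VL: "L2_ball R v" if "v \<in> V" for v using that test_functions_L2_ball[OF _ UR] by (simp add: V_def)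
  have pos: "0 \<le> A v v" if "v \<in> V" for v
  proof -
    have "0 \<le> pot_bound * (norm2 lebesgue v)\<^sup>2" using r0 by simp
    also have "\<dots> \<le> A v v" unfolding A_def by (rule sform_coercive(2)[OF q VL[OF that] Vs[OF that]])
    finally show ?thesis .
  qed
  have bd: "(l v)\<^sup>2 \<le> C * A v v" if "v \<in> V" for v
  proof -
    have "\<bar>l v\<bar> \<le> norm2 lebesgue v * N"
      unfolding l_def N_def by (rule order_trans[OF abs_Re_le_cmod ip_bound[OF Vq(1)[OF that] h]])
    then have "\<bar>l v\<bar>\<^sup>2 \<le> (norm2 lebesgue v * N)\<^sup>2" by (rule power_mono) simp
    then have "(l v)\<^sup>2 \<le> (N\<^sup>2 / pot_bound) * (pot_bound * (norm2 lebesgue v)\<^sup>2)"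
      using pot_bound_pos by (simp add: power_mult_distrib mult.commute)
    also have "\<dots> \<le> (N\<^sup>2 / pot_bound) * A v v"
      unfolding A_def using sform_coercive(2)[OF q VL[OF that] Vs[OF that]] r0 by (intro mult_left_mono) auto
    also have "\<dots> \<le> C * A v v" using pos[OF that] by (simp add: C_def distrib_right)
    finally show ?thesis .
  qed
  have zV: "(\<lambda>x. 0) \<in> V" by (simp add: V_def test_functions_zero)
  have closed: "comb a v b w \<in> V" if "v \<in> V" "w \<in> V" for a v b w
      using that unfolding comb_def V_def by (rule test_functions_lincomb)
  have lin: "A (comb a v b w) u = a * A v u + b * A w u" if "v \<in> V" "w \<in> V" "u \<in> V" for a v b w u
      unfolding A_def comb_def sform_lincomb[OF q r0 Vs[OF that(1)] Vs[OF that(2)] Vs[OF that(3)]] by simp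
  have sym: "A v w = A w v" for v w unfolding A_def sform_commute[of q v w] by simp
  have llin: "l (comb a v b w) = a * l v + b * l w" if "v \<in> V" "w \<in> V" for a v b w
      unfolding l_def comb_def ip_lincomb[OF Vq(1)[OF that(1)] Vq(1)[OF that(2)] h] by simp
  obtain \<phi>0 :: "nat \<Rightarrow> 'a \<Rightarrow> complex" where \<phi>0: "\<forall>k. \<phi>0 k \<in> V"
    "\<forall>k j. A (comb 1 (\<phi>0 k) (-1) (\<phi>0 j)) (comb 1 (\<phi>0 k) (-1) (\<phi>0 j)) \<le> 2 / Suc k + 2 / Suc j"
    "\<forall>\<psi>\<in>V. (\<lambda>k. A (\<phi>0 k) \<psi>) \<longlonglongrightarrow> l \<psi>"
    by (rule variational_sequence[where A=A and V=V and comb=comb and l=l and C=C, OF zV closed lin sym llin pos bd C])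
  define \<phi> where "\<phi> = \<phi>0"
  have \<phi>: "\<And>k. \<phi> k \<in> V"
    "\<And>k j. A (comb 1 (\<phi> k) (-1) (\<phi> j)) (comb 1 (\<phi> k) (-1) (\<phi> j)) \<le> 2 / Suc k + 2 / Suc j"
    "\<And>\<psi>. \<psi> \<in> V \<Longrightarrow> (\<lambda>k. A (\<phi> k) \<psi>) \<longlonglongrightarrow> l \<psi>"
    using \<phi>0 unfolding \<phi>_def by blast+
  note \<phi>s = Vs[OF \<phi>(1)] and \<phi>q = Vq[OF \<phi>(1)]
  define D where "D = P\<^sup>2 * poincare_const\<^sup>2 + 1"
  have D: "D > 0" by (simp add: D_def add_nonneg_pos)
  have cau: "(sobolev_norm s (\<lambda>x. \<phi> k x - \<phi> j x))\<^sup>2 \<le> D * (2 * P\<^sup>2) * (2 / Suc k + 2 / Suc j)" for k j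
  proof -
    define w where "w x = \<phi> k x - \<phi> j x" for x
    have wc: "comb 1 (\<phi> k) (-1) (\<phi> j) = w" by (auto simp: comb_def w_def)
    have wV: "w \<in> V" unfolding w_def V_def using \<phi>(1) by (intro test_functions_diff) (auto simp: V_def)
    define M where "M = norm2 lebesgue (frac_grad s w)"
    have M: "M\<^sup>2 / (2 * P\<^sup>2) \<le> 2 / Suc k + 2 / Suc j"
    proof -
      have "M\<^sup>2 / (2 * P\<^sup>2) \<le> A w w"
        unfolding A_def M_def P_def by (rule sform_coercive(1)[OF q VL[OF wV] Vs[OF wV]])
      also have "A w w \<le> 2 / Suc k + 2 / Suc j" using \<phi>(2)[of k j] unfolding wc .
      finally show ?thesis .
    qed
    have "(norm2 lebesgue w)\<^sup>2 \<le> (poincare_const * M)\<^sup>2"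
      unfolding M_def by (rule power_mono[OF poincare[OF VL[OF wV] Vs[OF wV]]]) simp
    then have "P\<^sup>2 * (norm2 lebesgue w)\<^sup>2 \<le> P\<^sup>2 * (poincare_const * M)\<^sup>2" by (rule mult_left_mono) simp
    then have "(P * norm2 lebesgue w)\<^sup>2 + M\<^sup>2 \<le> D * M\<^sup>2" by (simp add: D_def power_mult_distrib distrib_right mult.assoc)
    then have "(sobolev_norm s w)\<^sup>2 \<le> D * M\<^sup>2"
      using sobolev_norm_squared_le[OF Vs[OF wV] s] unfolding P_def M_def by linarith
    also have "D * M\<^sup>2 = D * (2 * P\<^sup>2) * (M\<^sup>2 / (2 * P\<^sup>2))" using P by simp
    also have "\<dots> \<le> D * (2 * P\<^sup>2) * (2 / Suc k + 2 / Suc j)" using M D by (intro mult_left_mono) auto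
    finally show ?thesis unfolding w_def .
  qed
  have cau': "\<exists>N. \<forall>k\<ge>N. \<forall>j\<ge>N. sobolev_norm s (\<lambda>x. \<phi> k x - \<phi> j x) \<le> e" if e: "e > 0" for e
  proof -
    define K where "K = D * (2 * P\<^sup>2) * 4"
    have K: "K > 0" using D P by (simp add: K_def)
    obtain N :: nat where N: "K / e\<^sup>2 < real N" using reals_Archimedean2 by blast
    have "sobolev_norm s (\<lambda>x. \<phi> k x - \<phi> j x) \<le> e" if "k \<ge> N" "j \<ge> N" for k j
    proof -
      have "0 < K / e\<^sup>2" using K e by simp
      then have N0: "real N > 0" using N by linarith
      have "real N \<le> real (Suc k)" "real N \<le> real (Suc j)" using that by simp_all
      then have "1 / real (Suc k) \<le> 1 / N" "1 / real (Suc j) \<le> 1 / N"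
        using N0 frac_le[of 1 1 "real N"] by simp_all
      then have "2 / real (Suc k) + 2 / real (Suc j) \<le> 4 / N" by linarith
      then have "D * (2 * P\<^sup>2) * (2 / Suc k + 2 / Suc j) \<le> D * (2 * P\<^sup>2) * (4 / N)"
        using D by (intro mult_left_mono) auto
      also have "\<dots> = K / N" by (simp add: K_def)
      also have "\<dots> \<le> e\<^sup>2"
      proof -
        have "K < real N * e\<^sup>2" using N e by (simp add: pos_divide_less_eq)
        then show ?thesis unfolding pos_divide_le_eq[OF N0] by (simp only: mult.commute less_imp_le)
      qed
      finally have "(sobolev_norm s (\<lambda>x. \<phi> k x - \<phi> j x))\<^sup>2 \<le> e\<^sup>2" using cau[of k j] by linarith
      then show ?thesis by (rule power2_le_imp_le) (use e in simp)
    qed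
    then show ?thesis by blast
  qed
  have \<phi>d: "(\<lambda>x. \<phi> k x - \<phi> j x) \<in> sobolev s" for k j by (rule sobolev_diff[OF \<phi>s \<phi>s])
  obtain v where v: "sq_int lebesgue v" "(\<lambda>k. norm2 lebesgue (\<lambda>x. \<phi> k x - v x)) \<longlonglongrightarrow> 0"
  proof (rule sq_int_complete[OF \<phi>q(1)])
    fix e :: real assume "e > 0"
    then have "e * P > 0" using P by simp
    from cau'[OF this] obtain N where N: "\<forall>k\<ge>N. \<forall>j\<ge>N. sobolev_norm s (\<lambda>x. \<phi> k x - \<phi> j x) \<le> e * P" by blast
    have "norm2 lebesgue (\<lambda>x. \<phi> k x - \<phi> j x) \<le> e" if "k \<ge> N" "j \<ge> N" for k j
    proof -
      have "P * norm2 lebesgue (\<lambda>x. \<phi> k x - \<phi> j x) \<le> e * P"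
        by (rule order_trans[OF norm2_le_sobolev_norm[OF \<phi>d s0, of k j, folded P_def]]) (use N that in blast)
      then show ?thesis using P by (simp add: mult.commute)
    qed
    then show "\<exists>N. \<forall>k\<ge>N. \<forall>l\<ge>N. norm2 lebesgue (\<lambda>x. \<phi> k x - \<phi> l x) \<le> e" by blast
  qed
  have sobq: "sq_int lebesgue (sob s (\<phi> k))" for k using \<phi>s by (simp add: sobolev_iff)
  have sobd: "norm2 lebesgue (\<lambda>\<xi>. sob s (\<phi> k) \<xi> - sob s (\<phi> j) \<xi>) = sobolev_norm s (\<lambda>x. \<phi> k x - \<phi> j x)" for k j
    unfolding sobolev_norm_eq
  proof (rule norm2_cong_AE[symmetric])
    show "AE \<xi> in lebesgue. sob s (\<lambda>x. \<phi> k x - \<phi> j x) \<xi> = sob s (\<phi> k) \<xi> - sob s (\<phi> j) \<xi>"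
      using sob_lincomb[OF \<phi>q(1)[of k] \<phi>q(1)[of j], of s 1 "-1"] by simp
    show "sob s (\<lambda>x. \<phi> k x - \<phi> j x) \<in> borel_measurable lebesgue" by (rule sob_measurable[OF sq_int_diff[OF \<phi>q(1) \<phi>q(1)]])
    show "(\<lambda>\<xi>. sob s (\<phi> k) \<xi> - sob s (\<phi> j) \<xi>) \<in> borel_measurable lebesgue" by (rule sq_int_measurable[OF sq_int_diff[OF sobq sobq]])
  qed
  obtain g where g: "sq_int lebesgue g" "(\<lambda>k. norm2 lebesgue (\<lambda>\<xi>. sob s (\<phi> k) \<xi> - g \<xi>)) \<longlonglongrightarrow> 0"
  proof (rule sq_int_complete[OF sobq])
    show "\<exists>N. \<forall>k\<ge>N. \<forall>l\<ge>N. norm2 lebesgue (\<lambda>\<xi>. sob s (\<phi> k) \<xi> - sob s (\<phi> l) \<xi>) \<le> e" if "e > 0" for e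
      unfolding sobd by (rule cau'[OF that])
  qed
  text \<open>Both limits describe the transform of v, since the Sobolev weight is at least 1.\<close>
  have hw0: "hw s \<xi> \<noteq> 0" for \<xi> :: 'a using hw_ge_1[OF s0, of \<xi>] by auto
  have gq: "sq_int lebesgue (\<lambda>\<xi>. g \<xi> / hw s \<xi>)"
  proof (rule sq_int_bound[OF g(1), of _ 1])
    show "(\<lambda>\<xi>. g \<xi> / hw s \<xi>) \<in> borel_measurable lebesgue"
      by (intro borel_measurable_divide sq_int_measurable[OF g(1)] hw_measurable)
    show "AE \<xi> in lebesgue. cmod (g \<xi> / hw s \<xi>) \<le> 1 * cmod (g \<xi>)"
    proof (rule AE_I2)
      fix \<xi> :: 'a
      have "cmod (g \<xi>) * 1 \<le> cmod (g \<xi>) * cmod (hw s \<xi>)" by (rule mult_left_mono[OF hw_ge_1[OF s0]]) simp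
      then show "cmod (g \<xi> / hw s \<xi>) \<le> 1 * cmod (g \<xi>)" using hw0[of \<xi>] by (simp add: norm_divide divide_le_eq)
    qed
  qed
  have fv: "AE \<xi> in lebesgue. fourier_L2 v \<xi> = g \<xi> / hw s \<xi>"
  proof (rule norm2_limit_unique)
    show "sq_int lebesgue (fourier_L2 (\<phi> k))" for k by (rule fourier_L2_spec(1)[OF \<phi>q(1)])
    show "sq_int lebesgue (fourier_L2 v)" by (rule fourier_L2_spec(1)[OF v(1)])
    show "sq_int lebesgue (\<lambda>\<xi>. g \<xi> / hw s \<xi>)" by (rule gq)
    have "norm2 lebesgue (\<lambda>\<xi>. fourier_L2 (\<phi> k) \<xi> - fourier_L2 v \<xi>) = P * norm2 lebesgue (\<lambda>x. \<phi> k x - v x)" for k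
    proof -
      have "norm2 lebesgue (\<lambda>\<xi>. fourier_L2 (\<phi> k) \<xi> - fourier_L2 v \<xi>) = norm2 lebesgue (fourier_L2 (\<lambda>x. \<phi> k x - v x))"
      proof (rule norm2_cong_AE[symmetric])
        show "AE \<xi> in lebesgue. fourier_L2 (\<lambda>x. \<phi> k x - v x) \<xi> = fourier_L2 (\<phi> k) \<xi> - fourier_L2 v \<xi>"
          by (rule fourier_L2_diff[OF \<phi>q(1) v(1)])
        show "fourier_L2 (\<lambda>x. \<phi> k x - v x) \<in> borel_measurable lebesgue"
          by (rule sq_int_measurable[OF fourier_L2_spec(1)[OF sq_int_diff[OF \<phi>q(1) v(1)]]])
        show "(\<lambda>\<xi>. fourier_L2 (\<phi> k) \<xi> - fourier_L2 v \<xi>) \<in> borel_measurable lebesgue"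
          by (rule sq_int_measurable[OF sq_int_diff[OF fourier_L2_spec(1)[OF \<phi>q(1)] fourier_L2_spec(1)[OF v(1)]]])
      qed
      then show ?thesis unfolding P_def plancherel[OF sq_int_diff[OF \<phi>q(1) v(1)]] .
    qed
    then show "(\<lambda>k. norm2 lebesgue (\<lambda>\<xi>. fourier_L2 (\<phi> k) \<xi> - fourier_L2 v \<xi>)) \<longlonglongrightarrow> 0"
      using tendsto_mult_left[OF v(2), of P] by simp
    show "(\<lambda>k. norm2 lebesgue (\<lambda>\<xi>. fourier_L2 (\<phi> k) \<xi> - g \<xi> / hw s \<xi>)) \<longlonglongrightarrow> 0"
    proof (rule Lim_null_comparison[OF _ g(2)], intro always_eventually allI)
      fix k
      have "norm2 lebesgue (\<lambda>\<xi>. fourier_L2 (\<phi> k) \<xi> - g \<xi> / hw s \<xi>) \<le> 1 * norm2 lebesgue (\<lambda>\<xi>. sob s (\<phi> k) \<xi> - g \<xi>)"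
      proof (rule norm2_bound[OF sq_int_diff[OF sobq g(1)]])
        show "(\<lambda>\<xi>. fourier_L2 (\<phi> k) \<xi> - g \<xi> / hw s \<xi>) \<in> borel_measurable lebesgue"
          by (rule sq_int_measurable[OF sq_int_diff[OF fourier_L2_spec(1)[OF \<phi>q(1)] gq]])
        show "AE \<xi> in lebesgue. cmod (fourier_L2 (\<phi> k) \<xi> - g \<xi> / hw s \<xi>) \<le> 1 * cmod (sob s (\<phi> k) \<xi> - g \<xi>)"
        proof (rule AE_I2)
          fix \<xi> :: 'a
          define z where "z = fourier_L2 (\<phi> k) \<xi> - g \<xi> / hw s \<xi>"
          have "sob s (\<phi> k) \<xi> - g \<xi> = hw s \<xi> * z" using hw0[of \<xi>] by (simp add: sob_def z_def right_diff_distrib)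
          moreover have "1 * cmod z \<le> cmod (hw s \<xi>) * cmod z" by (rule mult_right_mono[OF hw_ge_1[OF s0]]) simp
          ultimately show "cmod (fourier_L2 (\<phi> k) \<xi> - g \<xi> / hw s \<xi>) \<le> 1 * cmod (sob s (\<phi> k) \<xi> - g \<xi>)"
            unfolding z_def[symmetric] by (simp add: norm_mult)
        qed
      qed simp
      then show "norm (norm2 lebesgue (\<lambda>\<xi>. fourier_L2 (\<phi> k) \<xi> - g \<xi> / hw s \<xi>)) \<le> norm2 lebesgue (\<lambda>\<xi>. sob s (\<phi> k) \<xi> - g \<xi>)"
        by simp
    qed
  qed
  have sv: "AE \<xi> in lebesgue. sob s v \<xi> = g \<xi>"
    using fv by eventually_elim (simp add: sob_def hw0)
  have vs: "v \<in> sobolev s"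
    using v(1) sq_int_cong_AE[OF g(1) sob_measurable[OF v(1)] sv] by (simp add: sobolev_iff)
  have lim: "(\<lambda>k. sobolev_norm s (\<lambda>x. v x - \<phi> k x)) \<longlonglongrightarrow> 0"
  proof -
    have "sobolev_norm s (\<lambda>x. v x - \<phi> k x) = norm2 lebesgue (\<lambda>\<xi>. sob s (\<phi> k) \<xi> - g \<xi>)" for k
      unfolding sobolev_norm_eq norm2_minus_commute[of lebesgue "sob s (\<phi> k)" g]
    proof (rule norm2_cong_AE)
      show "sob s (\<lambda>x. v x - \<phi> k x) \<in> borel_measurable lebesgue" by (rule sob_measurable[OF sq_int_diff[OF v(1) \<phi>q(1)]])
      show "(\<lambda>\<xi>. g \<xi> - sob s (\<phi> k) \<xi>) \<in> borel_measurable lebesgue" by (rule sq_int_measurable[OF sq_int_diff[OF g(1) sobq]])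
      show "AE \<xi> in lebesgue. sob s (\<lambda>x. v x - \<phi> k x) \<xi> = g \<xi> - sob s (\<phi> k) \<xi>"
        using sob_lincomb[OF v(1) \<phi>q(1)[of k], of s 1 "-1"] sv by eventually_elim simp
    qed
    then show ?thesis using g(2) by simp
  qed
  have "v \<in> sobolev_tilde s U"
  proof -
    have "\<exists>\<psi>\<in>test_functions U. sobolev_norm s (\<lambda>x. v x - \<psi> x) < e" if "e > 0" for e
    proof -
      from LIMSEQ_D[OF lim that] obtain k where "norm (sobolev_norm s (\<lambda>x. v x - \<phi> k x) - 0) < e" by blast
      then have "sobolev_norm s (\<lambda>x. v x - \<phi> k x) < e" by simp
      then show ?thesis using \<phi>(1)[of k] unfolding V_def by (rule bexI)
    qed
    then show ?thesis using vs by (simp add: sobolev_tilde_def)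
  qed
  moreover have "\<forall>\<psi>\<in>test_functions U. sform s U q v \<psi> = ip h \<psi>"
  proof
    fix \<psi> assume \<psi>: "\<psi> \<in> test_functions U"
    have re: "Re (sform s U q v w) = Re (ip h w)" if w: "w \<in> V" for w
    proof -
      have "(\<lambda>k. A (\<phi> k) w) \<longlonglongrightarrow> Re (sform s U q v w)"
        unfolding A_def by (intro tendsto_intros sform_tendsto[OF q r0 \<phi>s vs Vs[OF w] lim])
      from LIMSEQ_unique[OF this \<phi>(3)[OF w]] have "Re (sform s U q v w) = Re (ip w h)" by (simp add: l_def)
      then show ?thesis unfolding ip_commute[of h w] by simp
    qed
    define w where "w x = \<i> * \<psi> x + 0 * \<psi> x" for x
    have w: "w \<in> V" unfolding w_def V_def using \<psi> \<psi> by (rule test_functions_lincomb)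
    have \<psi>V: "\<psi> \<in> V" using \<psi> by (simp add: V_def)
    have "sform s U q v w = cnj (\<i> * sform s U q \<psi> v)"
      unfolding sform_commute[of q v w] w_def sform_lincomb[OF q r0 Vs[OF \<psi>V] Vs[OF \<psi>V] vs] by simp
    also have "\<dots> = - \<i> * sform s U q v \<psi>" unfolding sform_commute[of q \<psi> v] by simp
    finally have 1: "sform s U q v w = - \<i> * sform s U q v \<psi>" .
    have "ip h w = cnj (\<i> * ip \<psi> h)"
      unfolding ip_commute[of h w] w_def ip_lincomb[OF Vq(1)[OF \<psi>V] Vq(1)[OF \<psi>V] h] by simp
    also have "\<dots> = - \<i> * ip h \<psi>" unfolding ip_commute[of \<psi> h] by simp
    finally have 2: "ip h w = - \<i> * ip h \<psi>" .
    have "Im (sform s U q v \<psi>) = Im (ip h \<psi>)" using re[OF w] unfolding 1 2 by simp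
    with re[OF \<psi>V] show "sform s U q v \<psi> = ip h \<psi>" by (rule complex_eqI)
  qed
  ultimately have "weak_solution q h v" unfolding weak_solution_def weak_solution_sform[OF vs] by blast
  then show ?thesis by (rule that)
qed

text \<open>A null solution solves the equation with right-hand side 0, so the a priori bound annihilates it.\<close>

lemma no_zero_eigenvalue:
  assumes q: "bounded_potential U pot_bound q"
  shows "\<not> zero_dirichlet_eigenvalue s U q"
proof
  assume "zero_dirichlet_eigenvalue s U q"
  then obtain v where v: "v \<in> sobolev_tilde s U" "\<not> (AE x in lebesgue. v x = 0)"
    "\<forall>\<phi>\<in>test_functions U. schroedinger s q U v \<phi> = 0"
    by (auto simp: zero_dirichlet_eigenvalue_def)
  then have w: "weak_solution q (\<lambda>x. 0) v" by (simp add: weak_solution_def)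
  have "norm2 lebesgue v \<le> 0" using weak_solution_bound[OF q w] by simp
  then have "norm2 lebesgue v = 0" using norm2_nonneg[of lebesgue v] by linarith
  moreover have "sq_int lebesgue v" using v(1) by (simp add: sobolev_tilde_def sobolev_iff)
  ultimately show False using v(2) norm2_eq_0_AE by blast
qed

end

section \<open>Differences of Dirichlet-to-Neumann maps\<close>

lemma frac_kernel_commute: "frac_kernel s x y = frac_kernel s y x"
  by (simp add: frac_kernel_def norm_minus_commute)

text \<open>The integral operator with the kernel of the fractional Laplacian, meaningful at distance at least 1 from
  the support of u.\<close>

definition kernel_op :: "real \<Rightarrow> ('a::euclidean_space \<Rightarrow> complex) \<Rightarrow> 'a \<Rightarrow> complex" where
  "kernel_op s u y = (\<integral>x. of_real (frac_kernel s x y) * u x \<partial>lebesgue)"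

lemma frac_kernel_measurable_1:
  "(\<lambda>x::'a::euclidean_space. complex_of_real (frac_kernel s x y)) \<in> borel_measurable lebesgue"
proof (rule lborel_imp_lebesgue_measurable)
  show "(\<lambda>x::'a. complex_of_real (frac_kernel s x y)) \<in> borel_measurable borel"
    unfolding frac_kernel_def by measurable
qed

lemma kernel_op_measurable:
  fixes u :: "'a::euclidean_space \<Rightarrow> complex"
  assumes u: "u \<in> borel_measurable lebesgue"
  shows "kernel_op s u \<in> borel_measurable lebesgue"
proof -
  obtain w where w: "w \<in> borel_measurable borel" "AE x in lebesgue. u x = w x"
    using borel_representative[OF u] .
  note w(1)[measurable]
  have wl: "w \<in> borel_measurable lebesgue" by (rule lborel_imp_lebesgue_measurable[OF w(1)])
  have "kernel_op s u y = (\<integral>x. of_real (frac_kernel s x y) * w x \<partial>lborel)" for y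
  proof -
    have km: "(\<lambda>x. complex_of_real (frac_kernel s x y)) \<in> borel_measurable borel"
      unfolding frac_kernel_def by measurable
    have "kernel_op s u y = (\<integral>x. of_real (frac_kernel s x y) * w x \<partial>lebesgue)"
      unfolding kernel_op_def
    proof (rule integral_cong_AE)
      show "AE x in lebesgue. of_real (frac_kernel s x y) * u x = of_real (frac_kernel s x y) * w x"
        using w(2) by eventually_elim simp
    qed (intro borel_measurable_times frac_kernel_measurable_1 u wl)+
    also have "\<dots> = (\<integral>x. of_real (frac_kernel s x y) * w x \<partial>lborel)"
      using km w(1) by (subst integral_completion) auto
    finally show ?thesis .
  qed
  moreover have "(\<lambda>y. \<integral>x. of_real (frac_kernel s x y) * w x \<partial>lborel) \<in> borel_measurable borel"
    unfolding frac_kernel_def by measurable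
  ultimately have "kernel_op s u \<in> borel_measurable borel" by presburger
  then show ?thesis by (rule lborel_imp_lebesgue_measurable)
qed

lemma frac_laplacian_integrable:
  assumes u: "sq_int lebesgue u" and \<phi>: "\<phi> \<in> test_functions V" and V: "bounded V" and s: "0 < s" "s < 1"
  shows "integrable lebesgue (\<lambda>\<xi>. of_real (norm \<xi> powr (2 * s)) * fourier_L2 u \<xi> * inverse_fourier_integral \<phi> \<xi>)"
proof -
  define P :: real where "P = (2 * pi) ^ DIM('a)"
  have cont: "continuous_on UNIV \<phi>" by (rule test_functions_continuous[OF \<phi>])
  note \<phi>m[measurable] = borel_measurable_continuous_onI[OF cont]
  define \<psi> where "\<psi> x = cnj (\<phi> x)" for x
  have \<psi>: "\<psi> \<in> test_functions V" unfolding \<psi>_def by (rule test_functions_cnj[OF \<phi>])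
  have contp: "continuous_on UNIV \<psi>" by (rule test_functions_continuous[OF \<psi>])
  obtain R where R: "V \<subseteq> ball 0 R" using V by (metis bounded_subset_ballD)
  note \<psi>L = test_functions_L2_ball[OF \<psi> R]
  have inv: "inverse_fourier_integral \<phi> \<xi> = cnj (fourier_integral \<psi> \<xi>) / of_real P" for \<xi>
  proof -
    have "inverse_fourier_integral \<phi> \<xi> = fint \<phi> (-\<xi>) / of_real P"
      unfolding inverse_fourier_integral_def fint_def P_def by (subst integral_completion) auto
    also have "fint \<phi> (-\<xi>) = cnj (fint \<psi> \<xi>)" using fint_cnj[of \<psi> \<xi>] by (simp add: \<psi>_def)
    finally show ?thesis unfolding fourier_integral_continuous_eq[OF contp] .
  qed
  have sq: "sq_int lebesgue (\<lambda>\<xi>. of_real (norm \<xi> powr (2 * s)) * fourier_integral \<psi> \<xi>)"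
  proof (rule sq_int_bound[OF test_functions_decay[OF \<psi> V], of _ 1])
    show "(\<lambda>\<xi>. of_real (norm \<xi> powr (2 * s)) * fourier_integral \<psi> \<xi>) \<in> borel_measurable lebesgue"
      by (intro borel_measurable_times norm_powr_measurable sq_int_measurable[OF plancherel_L2_ball(1)[OF \<psi>L]])
    show "AE \<xi> in lebesgue. cmod (of_real (norm \<xi> powr (2 * s)) * fourier_integral \<psi> \<xi>)
        \<le> 1 * cmod (of_real (1 + (norm \<xi>)\<^sup>2) * fourier_integral \<psi> \<xi>)"
    proof (rule AE_I2)
      fix \<xi> :: 'a
      have "norm \<xi> powr (2 * s) \<le> \<bar>1 + (norm \<xi>)\<^sup>2\<bar>" using powr_le_one_plus_square[OF s, of "norm \<xi>"] by simp
      then show "cmod (of_real (norm \<xi> powr (2 * s)) * fourier_integral \<psi> \<xi>)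
        \<le> 1 * cmod (of_real (1 + (norm \<xi>)\<^sup>2) * fourier_integral \<psi> \<xi>)"
        unfolding norm_mult norm_of_real mult_1_left by (intro mult_right_mono) auto
    qed
  qed
  have "integrable lebesgue (\<lambda>\<xi>. (fourier_L2 u \<xi> * cnj (of_real (norm \<xi> powr (2 * s)) * fourier_integral \<psi> \<xi>)) / of_real P)"
    by (intro integrable_divide_zero sq_int_mult_integrable sq_int_cnj fourier_L2_spec(1)[OF u] sq) 
  moreover have "(\<lambda>\<xi>. (fourier_L2 u \<xi> * cnj (of_real (norm \<xi> powr (2 * s)) * fourier_integral \<psi> \<xi>)) / of_real P)
      = (\<lambda>\<xi>. of_real (norm \<xi> powr (2 * s)) * fourier_L2 u \<xi> * inverse_fourier_integral \<phi> \<xi>)"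
    unfolding inv by (simp add: mult_ac)
  ultimately show ?thesis by simp
qed

lemma frac_laplacian_diff:
  fixes u w :: "'a::euclidean_space \<Rightarrow> complex"
  assumes u: "sq_int lebesgue u" and w: "sq_int lebesgue w"
    and \<phi>: "\<phi> \<in> test_functions V" and V: "bounded V" and s: "0 < s" "s < 1"
  shows "frac_laplacian s u \<phi> - frac_laplacian s w \<phi> = frac_laplacian s (\<lambda>x. u x - w x) \<phi>"
proof -
  note i1 = frac_laplacian_integrable[OF u \<phi> V s] and i2 = frac_laplacian_integrable[OF w \<phi> V s]
  note i3 = frac_laplacian_integrable[OF sq_int_diff[OF u w] \<phi> V s]
  have "frac_laplacian s u \<phi> - frac_laplacian s w \<phi>
     = (\<integral>\<xi>. of_real (norm \<xi> powr (2 * s)) * fourier_L2 u \<xi> * inverse_fourier_integral \<phi> \<xi>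
        - of_real (norm \<xi> powr (2 * s)) * fourier_L2 w \<xi> * inverse_fourier_integral \<phi> \<xi> \<partial>lebesgue)"
    unfolding frac_laplacian_def by (rule Bochner_Integration.integral_diff[OF i1 i2, symmetric])
  also have "\<dots> = frac_laplacian s (\<lambda>x. u x - w x) \<phi>"
    unfolding frac_laplacian_def
  proof (rule integral_cong_AE[OF borel_measurable_integrable[OF Bochner_Integration.integrable_diff[OF i1 i2]] borel_measurable_integrable[OF i3]])
    show "AE \<xi> in lebesgue. of_real (norm \<xi> powr (2 * s)) * fourier_L2 u \<xi> * inverse_fourier_integral \<phi> \<xi>
        - of_real (norm \<xi> powr (2 * s)) * fourier_L2 w \<xi> * inverse_fourier_integral \<phi> \<xi>
        = of_real (norm \<xi> powr (2 * s)) * fourier_L2 (\<lambda>x. u x - w x) \<xi> * inverse_fourier_integral \<phi> \<xi>"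
      using fourier_L2_diff[OF u w] by eventually_elim (simp add: left_diff_distrib right_diff_distrib)
  qed
  finally show ?thesis .
qed

definition ind :: "'a::euclidean_space set \<Rightarrow> 'a \<Rightarrow> complex" where
  "ind S x = (if x \<in> S then 1 else 0)"

lemma ind_measurable:
  assumes [measurable]: "S \<in> sets borel"
  shows "ind S \<in> borel_measurable lebesgue"
  unfolding ind_def[abs_def] by (rule lborel_imp_lebesgue_measurable) measurable

lemma sq_int_ind:
  assumes "S \<in> sets borel" "S \<subseteq> ball 0 r"
  shows "sq_int lebesgue (ind S)"
  by (rule sq_int_bound[OF sq_int_indicator_ball[of r] ind_measurable[OF assms(1)], of 1])
     (use assms(2) in \<open>intro AE_I2, auto simp: ind_def indicator_def\<close>)

lemma bounded_on_set_norm2: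
  fixes h :: "'a::euclidean_space \<Rightarrow> complex"
  assumes S: "S \<in> sets borel" "S \<subseteq> ball 0 r" and h: "h \<in> borel_measurable lebesgue"
    and bd: "\<And>x. x \<in> S \<Longrightarrow> cmod (h x) \<le> c" and c: "c \<ge> 0"
  shows "sq_int lebesgue (\<lambda>x. ind S x * h x)" "norm2 lebesgue (\<lambda>x. ind S x * h x) \<le> c * norm2 lebesgue (ind S)"
proof -
  note i = sq_int_ind[OF S]
  have m: "(\<lambda>x. ind S x * h x) \<in> borel_measurable lebesgue" by (intro borel_measurable_times h ind_measurable S)
  have b: "AE x in lebesgue. cmod (ind S x * h x) \<le> c * cmod (ind S x)"
    using bd by (intro AE_I2) (simp add: ind_def)
  show "sq_int lebesgue (\<lambda>x. ind S x * h x)" by (rule sq_int_bound[OF i m b])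
  show "norm2 lebesgue (\<lambda>x. ind S x * h x) \<le> c * norm2 lebesgue (ind S)" by (rule norm2_bound[OF i m b c])
qed

lemma bounded_on_set_pairing:
  fixes h :: "'a::euclidean_space \<Rightarrow> complex"
  assumes S: "S \<in> sets borel" "S \<subseteq> ball 0 r" and h: "h \<in> borel_measurable lebesgue"
    and bd: "\<And>x. x \<in> S \<Longrightarrow> cmod (h x) \<le> c" and c: "c \<ge> 0" and d: "sq_int lebesgue d"
  shows "integrable lebesgue (\<lambda>x. ind S x * h x * d x)"
    "cmod (\<integral>x. ind S x * h x * d x \<partial>lebesgue) \<le> c * norm2 lebesgue (ind S) * norm2 lebesgue d"
proof -
  note n = bounded_on_set_norm2[OF S h bd c]
  show "integrable lebesgue (\<lambda>x. ind S x * h x * d x)" by (rule sq_int_mult_integrable[OF n(1) d])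
  show "cmod (\<integral>x. ind S x * h x * d x \<partial>lebesgue) \<le> c * norm2 lebesgue (ind S) * norm2 lebesgue d"
    by (rule order_trans[OF Cauchy_Schwarz_norm2[OF n(1) d] mult_right_mono[OF n(2)]]) simp_all
qed

text \<open>At distance at least 1 the bounded kernel frac_kernel agrees with the true kernel of the fractional
  Laplacian.\<close>

locale fractional_exterior = fractional_domain +
  fixes W :: "'a set" and R' :: real
  assumes WR: "W \<subseteq> ball 0 R'" and Wb: "W \<in> sets borel"
    and sep: "\<And>x y. x \<in> U \<Longrightarrow> y \<in> W \<Longrightarrow> norm (x - y) \<ge> 1"
begin

lemma W_bounded: "bounded W"
  using WR bounded_ball bounded_subset by blast

lemma W_lebesgue: "W \<in> sets lebesgue"
  using Wb by simp

definition NU :: real where "NU = norm2 lebesgue (ind U)"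
definition NW :: real where "NW = norm2 lebesgue (ind W)"
definition kernel_bound :: real where
  "kernel_bound = heat_const DIM('a) s / (subord_const s * (2 * pi) ^ DIM('a))"

lemma NU_nonneg: "NU \<ge> 0" and NW_nonneg: "NW \<ge> 0"
  by (simp_all add: NU_def NW_def)

lemma kernel_bound_nonneg: "kernel_bound \<ge> 0"
  unfolding kernel_bound_def using heat_const_nonneg[of "DIM('a)" s] subord_const_pos[OF s] by simp

lemma frac_kernel_le: "cmod (of_real (frac_kernel s (x::'a) y)) \<le> kernel_bound"
  unfolding norm_of_real kernel_bound_def by (rule frac_kernel_bound[OF s])

lemma L2_extend_zero:
  assumes "f \<in> L2 W"
  shows "sq_int lebesgue (extend_zero W f)" "norm2 lebesgue (extend_zero W f) = L2_norm W f" "L2_ball R' (extend_zero W f)"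
proof -
  have f: "f \<in> borel_measurable (lebesgue_on W)" "integrable (lebesgue_on W) (\<lambda>x. (cmod (f x))\<^sup>2)"
    using assms by (auto simp: L2_def)
  have m: "extend_zero W f \<in> borel_measurable lebesgue"
    unfolding extend_zero_def using f(1) W_lebesgue by (simp add: borel_measurable_if)
  have eq: "(\<lambda>x. indicator W x *\<^sub>R (cmod (f x))\<^sup>2) = (\<lambda>x. (cmod (extend_zero W f x))\<^sup>2)"
    by (auto simp: extend_zero_def indicator_def)
  have "integrable lebesgue (\<lambda>x. indicator W x *\<^sub>R (cmod (f x))\<^sup>2)"
    using f(2) W_lebesgue by (subst (asm) integrable_restrict_space) auto
  then show 1: "sq_int lebesgue (extend_zero W f)" using m unfolding eq by (simp add: sq_int_def)
  have "(\<integral>x. (cmod (f x))\<^sup>2 \<partial>lebesgue_on W) = (\<integral>x. indicator W x *\<^sub>R (cmod (f x))\<^sup>2 \<partial>lebesgue)"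
    using W_lebesgue by (intro integral_restrict_space) simp
  then show "norm2 lebesgue (extend_zero W f) = L2_norm W f" unfolding eq by (simp add: norm2_def L2_norm_def)
  have "extend_zero W f x = 0" if "R' \<le> norm x" for x
    using that WR by (auto simp: extend_zero_def)
  then show "L2_ball R' (extend_zero W f)" using 1 by (simp add: L2_ball_def)
qed

text \<open>For exterior data f the correction solves the Dirichlet problem with this right-hand side: seen from
  U, the fractional Laplacian of f is minus the kernel applied to f.\<close>

definition source :: "('a \<Rightarrow> complex) \<Rightarrow> 'a \<Rightarrow> complex" where
  "source f = (\<lambda>y. ind U y * kernel_op s (extend_zero W f) y)"

text \<open>Only the L1 norm of f matters, and it is bounded by the L2 norm since W is bounded.\<close>

lemma exterior_pairing_bound:
  fixes h :: "'a \<Rightarrow> complex"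
  assumes f: "f \<in> L2 W" and h: "h \<in> borel_measurable lebesgue" and bd: "\<And>x. x \<in> W \<Longrightarrow> cmod (h x) \<le> c" and c: "c \<ge> 0"
  shows "integrable lebesgue (\<lambda>x. h x * extend_zero W f x)"
    "cmod (\<integral>x. h x * extend_zero W f x \<partial>lebesgue) \<le> c * NW * L2_norm W f"
proof -
  have eq: "(\<lambda>x. ind W x * h x * extend_zero W f x) = (\<lambda>x. h x * extend_zero W f x)"
    by (auto simp: ind_def extend_zero_def)
  note b = bounded_on_set_pairing[OF Wb WR h bd c L2_extend_zero(1)[OF f], unfolded eq]
  show "integrable lebesgue (\<lambda>x. h x * extend_zero W f x)" by (rule b(1))
  show "cmod (\<integral>x. h x * extend_zero W f x \<partial>lebesgue) \<le> c * NW * L2_norm W f"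
    using b(2) unfolding NW_def L2_extend_zero(2)[OF f] .
qed

lemma source_bound:
  assumes f: "f \<in> L2 W"
  shows "sq_int lebesgue (source f)" "norm2 lebesgue (source f) \<le> kernel_bound * NW * L2_norm W f * NU"
proof -
  have b: "cmod (kernel_op s (extend_zero W f) y) \<le> kernel_bound * NW * L2_norm W f" for y
    unfolding kernel_op_def
    by (rule exterior_pairing_bound(2)[OF f frac_kernel_measurable_1 frac_kernel_le kernel_bound_nonneg])
  have c: "kernel_bound * NW * L2_norm W f \<ge> 0"
    using kernel_bound_nonneg NW_nonneg L2_extend_zero(2)[OF f, symmetric] by simp
  note m = kernel_op_measurable[OF sq_int_measurable[OF L2_extend_zero(1)[OF f]]]
  show "sq_int lebesgue (source f)" "norm2 lebesgue (source f) \<le> kernel_bound * NW * L2_norm W f * NU"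
    unfolding source_def NU_def by (rule bounded_on_set_norm2[OF Ub UR m b c])+
qed

lemma is_correction_iff_weak_solution:
  assumes f: "f \<in> L2 W"
  shows "is_correction s U W q f v \<longleftrightarrow> weak_solution q (source f) v"
proof -
  have "- frac_laplacian s (extend_zero W f) \<phi> = (\<integral>x. source f x * \<phi> x \<partial>lebesgue)" if \<phi>: "\<phi> \<in> test_functions U" for \<phi>
  proof -
    have "AE x in lebesgue. x \<notin> W \<longrightarrow> extend_zero W f x = 0" by (simp add: extend_zero_def)
    moreover have "1 \<le> norm (x - y)" if "x \<in> W" "y \<in> U" for x y
      using sep[OF that(2,1)] by (simp add: norm_minus_commute)
    ultimately
    have "frac_laplacian s (extend_zero W f) \<phi>
        = - (\<integral>y. kernel_op s (extend_zero W f) y * \<phi> y \<partial>lebesgue)"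
      unfolding kernel_op_def by (intro frac_laplacian_kernel[OF s L2_extend_zero(3)[OF f] _ Wb \<phi> U_bounded])
    moreover have "(\<lambda>y. kernel_op s (extend_zero W f) y * \<phi> y) = (\<lambda>y. source f y * \<phi> y)"
      using test_functions_outside[OF \<phi>] by (auto simp: source_def ind_def)
    ultimately show ?thesis by simp
  qed
  then show ?thesis unfolding is_correction_def weak_solution_def by auto
qed

text \<open>The solution operator; by weak_solution_bound the choice matters only on a null set.\<close>

definition sol :: "('a \<Rightarrow> real) \<Rightarrow> ('a \<Rightarrow> complex) \<Rightarrow> 'a \<Rightarrow> complex" where
  "sol q h = (SOME v. weak_solution q h v)"

lemma sol_weak_solution:
  assumes "bounded_potential U pot_bound q" "sq_int lebesgue h"
  shows "weak_solution q h (sol q h)"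
proof -
  obtain v where "weak_solution q h v" by (rule weak_solution_exists[OF assms])
  then show ?thesis unfolding sol_def by (rule someI[of "weak_solution q h"])
qed

lemma weak_solution_sq_int: "weak_solution q h v \<Longrightarrow> sq_int lebesgue v"
  by (simp add: weak_solution_def sobolev_tilde_def sobolev_iff)

lemma weak_solution_outside: "weak_solution q h v \<Longrightarrow> AE x in lebesgue. x \<notin> U \<longrightarrow> v x = 0"
  using sobolev_tilde_outside[OF _ U_bounded Ub s] by (simp add: weak_solution_def)

lemma weak_solution_sum:
  assumes q: "bounded_potential U pot_bound q" and A: "finite A"
    and h: "\<And>a. a \<in> A \<Longrightarrow> sq_int lebesgue (h a)" and v: "\<And>a. a \<in> A \<Longrightarrow> weak_solution q (h a) (v a)"
  shows "weak_solution q (\<lambda>x. \<Sum>a\<in>A. c a * h a x) (\<lambda>x. \<Sum>a\<in>A. c a * v a x)"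
  using A h v
proof (induction A rule: finite_induct)
  case empty
  show ?case using weak_solution_zero by simp
next
  case (insert a A)
  have "weak_solution q (\<lambda>x. c a * h a x + 1 * (\<Sum>a\<in>A. c a * h a x)) (\<lambda>x. c a * v a x + 1 * (\<Sum>a\<in>A. c a * v a x))"
    using insert by (intro weak_solution_lincomb[OF q] sq_int_sum sq_int_cmult) auto
  then show ?case using insert by simp
qed

text \<open>The matrix of the solution operator against a finite family. Through the finite rank kernel it
  determines the Dirichlet-to-Neumann map.\<close>

definition moment :: "('b \<Rightarrow> 'a \<Rightarrow> complex) \<Rightarrow> ('a \<Rightarrow> real) \<Rightarrow> 'b \<Rightarrow> 'b \<Rightarrow> complex" where
  "moment m q a b = (\<integral>x. ind U x * m a x * sol q (\<lambda>x. ind U x * m b x) x \<partial>lebesgue)"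

lemma moment_bound:
  assumes q: "bounded_potential U pot_bound q"
    and m: "m a \<in> borel_measurable lebesgue" "\<And>x. x \<in> U \<Longrightarrow> cmod (m a x) \<le> 1"
      "m b \<in> borel_measurable lebesgue" "\<And>x. x \<in> U \<Longrightarrow> cmod (m b x) \<le> 1"
  shows "cmod (moment m q a b) \<le> NU * NU / pot_bound"
proof -
  note n = bounded_on_set_norm2[OF Ub UR m(3,4), simplified]
  note w = sol_weak_solution[OF q n(1)]
  have "cmod (moment m q a b) \<le> NU * norm2 lebesgue (sol q (\<lambda>x. ind U x * m b x))"
    unfolding moment_def NU_def using bounded_on_set_pairing(2)[OF Ub UR m(1,2) _ weak_solution_sq_int[OF w]] by simp
  also have "\<dots> \<le> NU * (NU / pot_bound)"
  proof (rule mult_left_mono[OF _ NU_nonneg])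
    have "norm2 lebesgue (sol q (\<lambda>x. ind U x * m b x)) \<le> norm2 lebesgue (\<lambda>x. ind U x * m b x) / pot_bound"
      by (rule weak_solution_bound[OF q w n(1)])
    also have "\<dots> \<le> NU / pot_bound" using n(2) pot_bound_pos by (intro divide_right_mono) (auto simp: NU_def)
    finally show "norm2 lebesgue (sol q (\<lambda>x. ind U x * m b x)) \<le> NU / pot_bound" .
  qed
  finally show ?thesis by simp
qed

text \<open>The difference of the maps sends f to the kernel applied to the difference d of the two corrections.
  The kernel enters twice: in the source, which is a combination of the m a up to \<delta>, and in
  the observation of d, which up to \<delta> only sees the integrals of d against the m a. What is left
  when both approximations are made is a combination of differences of moments, with coefficients
  bounded by B.\<close>

lemma dn_difference_bound:
  fixes m b :: "'b \<Rightarrow> 'a \<Rightarrow> complex"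
  assumes q1: "bounded_potential U pot_bound q1" and q2: "bounded_potential U pot_bound q2"
    and A: "finite A"
    and m: "\<And>a. a \<in> A \<Longrightarrow> m a \<in> borel_measurable lebesgue" "\<And>a x. a \<in> A \<Longrightarrow> x \<in> U \<Longrightarrow> cmod (m a x) \<le> 1"
    and b: "\<And>a. a \<in> A \<Longrightarrow> b a \<in> borel_measurable lebesgue" "\<And>a y. a \<in> A \<Longrightarrow> y \<in> W \<Longrightarrow> cmod (b a y) \<le> B"
    and B: "B \<ge> 0" and \<delta>: "0 \<le> \<delta>" "\<delta> \<le> 1"
    and approx: "\<And>x y. x \<in> U \<Longrightarrow> y \<in> W \<Longrightarrow> cmod (of_real (frac_kernel s x y) - (\<Sum>a\<in>A. m a x * b a y)) \<le> \<delta>"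
    and mom: "\<And>a a'. a \<in> A \<Longrightarrow> a' \<in> A \<Longrightarrow> cmod (moment m q1 a a' - moment m q2 a a') \<le> \<eta>"
  shows "L2_bounded_by W (\<lambda>f \<phi>. dn_map s U W q1 f \<phi> - dn_map s U W q2 f \<phi>)
    (NW\<^sup>2 * (\<delta> * (NU\<^sup>2 * (4 * kernel_bound + 2) / pot_bound) + (real (card A))\<^sup>2 * B\<^sup>2 * \<eta>))"
  unfolding L2_bounded_by_def
proof
  fix f assume f: "f \<in> L2 W"
  define F where "F = extend_zero W f"
  define n where "n = L2_norm W f"
  have n0: "n \<ge> 0" unfolding n_def L2_extend_zero(2)[OF f, symmetric] by simp
  note Fs = L2_extend_zero(1)[OF f, folded F_def]
  note src = source_bound[OF f, folded n_def]
  define v1 where "v1 = sol q1 (source f)"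
  define v2 where "v2 = sol q2 (source f)"
  note w1 = sol_weak_solution[OF q1 src(1), folded v1_def] and w2 = sol_weak_solution[OF q2 src(1), folded v2_def]
  note v1s = weak_solution_sq_int[OF w1] and v2s = weak_solution_sq_int[OF w2]
  define d where "d x = v1 x - v2 x" for x
  have ds: "sq_int lebesgue d" unfolding d_def by (rule sq_int_diff[OF v1s v2s])
  have d0: "AE x in lebesgue. x \<notin> U \<longrightarrow> d x = 0"
    using weak_solution_outside[OF w1] weak_solution_outside[OF w2] by eventually_elim (simp add: d_def)
  have dL: "L2_ball R d"
  proof -
    have "AE x in lebesgue. R \<le> norm x \<longrightarrow> d x = 0" using d0 by eventually_elim (use UR in auto)
    then show ?thesis using ds by (simp add: L2_ball_def)
  qed
  have ext: "exterior_solution s U W q1 f = (\<lambda>x. F x + v1 x)" "exterior_solution s U W q2 f = (\<lambda>x. F x + v2 x)"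
    unfolding exterior_solution_def is_correction_iff_weak_solution[OF f] F_def v1_def v2_def sol_def by simp_all
  define g where "g y = - kernel_op s d y" for y
  have gm: "g \<in> borel_measurable lebesgue"
    unfolding g_def by (intro borel_measurable_uminus kernel_op_measurable sq_int_measurable[OF ds])
  have rep: "dn_map s U W q1 f \<phi> - dn_map s U W q2 f \<phi> = (\<integral>x. g x * \<phi> x \<partial>lebesgue_on W)"
    if \<phi>: "\<phi> \<in> test_functions W" for \<phi>
  proof -
    have "dn_map s U W q1 f \<phi> - dn_map s U W q2 f \<phi> = frac_laplacian s (\<lambda>x. (F x + v1 x) - (F x + v2 x)) \<phi>"
      unfolding dn_map_def ext restrict_apply'[OF \<phi>]
      by (rule frac_laplacian_diff[OF sq_int_add[OF Fs v1s] sq_int_add[OF Fs v2s] \<phi> W_bounded s])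
    also have "(\<lambda>x. (F x + v1 x) - (F x + v2 x)) = d" by (simp add: d_def[abs_def])
    also have "frac_laplacian s d \<phi> = - (\<integral>y. kernel_op s d y * \<phi> y \<partial>lebesgue)"
      unfolding kernel_op_def by (rule frac_laplacian_kernel[OF s dL d0 Ub \<phi> W_bounded sep])
    also have "\<dots> = (\<integral>y. - (kernel_op s d y * \<phi> y) \<partial>lebesgue)" by (rule Bochner_Integration.integral_minus[symmetric])
    also have "\<dots> = (\<integral>y. indicator W y *\<^sub>R (g y * \<phi> y) \<partial>lebesgue)"
      using test_functions_outside[OF \<phi>]
      by (intro Bochner_Integration.integral_cong refl) (auto simp: g_def indicator_def)
    also have "\<dots> = (\<integral>x. g x * \<phi> x \<partial>lebesgue_on W)"
      using W_lebesgue by (intro integral_restrict_space[symmetric]) simp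
    finally show ?thesis .
  qed
  define mU where "mU a x = ind U x * m a x" for a x
  have mUs: "sq_int lebesgue (mU a)" if "a \<in> A" for a
    unfolding mU_def using bounded_on_set_norm2(1)[OF Ub UR m(1)[OF that] m(2)[OF that]] by simp
  define c where "c a = (\<integral>x. b a x * F x \<partial>lebesgue)" for a
  have cb: "cmod (c a) \<le> B * NW * n" and ci: "integrable lebesgue (\<lambda>x. b a x * F x)" if "a \<in> A" for a
    unfolding c_def F_def n_def using exterior_pairing_bound[OF f b(1)[OF that] b(2)[OF that] B] by auto
  \<comment> \<open>r is the part of the source that the finite rank kernel misses.\<close>
  define r where "r y = source f y - (\<Sum>a\<in>A. c a * mU a y)" for y
  have rs: "sq_int lebesgue r"
    unfolding r_def by (intro sq_int_diff src(1) sq_int_sum A sq_int_cmult mUs)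
  have rb: "cmod (r y) \<le> (\<delta> * NW * n) * cmod (ind U y)" for y
  proof (cases "y \<in> U")
    case False
    then show ?thesis by (simp add: r_def source_def mU_def ind_def)
  next
    case True
    define D where "D x = of_real (frac_kernel s x y) - (\<Sum>a\<in>A. m a y * b a x)" for x
    have Dm: "D \<in> borel_measurable lebesgue"
      unfolding D_def by (intro borel_measurable_diff frac_kernel_measurable_1 borel_measurable_sum borel_measurable_times b(1)) auto
    have Db: "cmod (D x) \<le> \<delta>" if "x \<in> W" for x
      unfolding D_def frac_kernel_commute[of s x y] by (rule approx[OF True that])
    have "r y = kernel_op s F y - (\<Sum>a\<in>A. c a * m a y)"
      using True by (simp add: r_def source_def mU_def ind_def F_def)
    also have "\<dots> = (\<integral>x. D x * F x \<partial>lebesgue)"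
    proof -
      have i1: "integrable lebesgue (\<lambda>x. of_real (frac_kernel s x y) * F x)"
        unfolding F_def by (rule exterior_pairing_bound(1)[OF f frac_kernel_measurable_1 frac_kernel_le kernel_bound_nonneg])
      have i2: "integrable lebesgue (\<lambda>x. \<Sum>a\<in>A. m a y * (b a x * F x))"
        by (intro Bochner_Integration.integrable_sum integrable_mult_right ci)
      have "(\<integral>x. D x * F x \<partial>lebesgue) = (\<integral>x. of_real (frac_kernel s x y) * F x - (\<Sum>a\<in>A. m a y * (b a x * F x)) \<partial>lebesgue)"
        unfolding D_def by (simp only: left_diff_distrib sum_distrib_right mult.assoc)
      also have "\<dots> = kernel_op s F y - (\<integral>x. (\<Sum>a\<in>A. m a y * (b a x * F x)) \<partial>lebesgue)"
        unfolding kernel_op_def by (rule Bochner_Integration.integral_diff[OF i1 i2])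
      also have "(\<integral>x. (\<Sum>a\<in>A. m a y * (b a x * F x)) \<partial>lebesgue) = (\<Sum>a\<in>A. \<integral>x. m a y * (b a x * F x) \<partial>lebesgue)"
        by (intro Bochner_Integration.integral_sum integrable_mult_right ci)
      also have "\<dots> = (\<Sum>a\<in>A. c a * m a y)"
        unfolding c_def integral_mult_right_zero by (simp only: mult.commute)
      finally show ?thesis by simp
    qed
    finally have "cmod (r y) \<le> \<delta> * NW * n"
      unfolding F_def n_def using exterior_pairing_bound(2)[OF f Dm Db \<delta>(1)] by simp
    then show ?thesis using True by (simp add: ind_def)
  qed
  have rn: "norm2 lebesgue r \<le> \<delta> * NW * n * NU"
    unfolding NU_def using \<delta> NW_nonneg n0
    by (intro norm2_bound[OF sq_int_ind[OF Ub UR] sq_int_measurable[OF rs]] AE_I2 rb mult_nonneg_nonneg)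
  define G where "G q a = sol q (mU a)" for q a
  have Gw: "weak_solution q (mU a) (G q a)" if "bounded_potential U pot_bound q" "a \<in> A" for q a
    unfolding G_def by (rule sol_weak_solution[OF that(1) mUs[OF that(2)]])
  \<comment> \<open>By linearity \<rho> solves the Dirichlet problem with right-hand side r, hence is of order \<delta>.\<close>
  define \<rho> where "\<rho> q v x = v x - (\<Sum>a\<in>A. c a * G q a x)" for q v x
  have \<rho>b: "sq_int lebesgue (\<rho> q v)" "norm2 lebesgue (\<rho> q v) \<le> \<delta> * NW * n * NU / pot_bound"
    if q: "bounded_potential U pot_bound q" and v: "weak_solution q (source f) v" for q v
  proof -
    have "weak_solution q (\<lambda>x. 1 * source f x + (-1) * (\<Sum>a\<in>A. c a * mU a x)) (\<lambda>x. 1 * v x + (-1) * (\<Sum>a\<in>A. c a * G q a x))"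
      by (rule weak_solution_lincomb[OF q v weak_solution_sum[OF q A mUs Gw[OF q]] src(1) sq_int_sum[OF A sq_int_cmult[OF mUs]]])
    then have w: "weak_solution q r (\<rho> q v)" by (simp add: r_def[abs_def] \<rho>_def[abs_def])
    show "sq_int lebesgue (\<rho> q v)" by (rule weak_solution_sq_int[OF w])
    show "norm2 lebesgue (\<rho> q v) \<le> \<delta> * NW * n * NU / pot_bound"
      by (rule order_trans[OF weak_solution_bound[OF q w rs] divide_right_mono[OF rn]]) (use pot_bound_pos in simp)
  qed
  note \<rho>1 = \<rho>b[OF q1 w1] and \<rho>2 = \<rho>b[OF q2 w2]
  define \<sigma> where "\<sigma> x = \<rho> q1 v1 x - \<rho> q2 v2 x" for x
  have \<sigma>s: "sq_int lebesgue \<sigma>" unfolding \<sigma>_def by (rule sq_int_diff[OF \<rho>1(1) \<rho>2(1)])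
  have \<sigma>n: "norm2 lebesgue \<sigma> \<le> 2 * (\<delta> * NW * n * NU / pot_bound)"
  proof -
    have "norm2 lebesgue \<sigma> \<le> norm2 lebesgue (\<rho> q1 v1) + norm2 lebesgue (\<rho> q2 v2)"
      using norm2_triangle[OF \<rho>1(1) sq_int_uminus[OF \<rho>2(1)]] by (simp add: \<sigma>_def[abs_def])
    then show ?thesis unfolding mult_2 by (rule order_trans[OF _ add_mono[OF \<rho>1(2) \<rho>2(2)]])
  qed
  have dn: "norm2 lebesgue d \<le> 2 * (kernel_bound * NW * n * NU / pot_bound)"
  proof -
    have k: "norm2 lebesgue (source f) / pot_bound \<le> kernel_bound * NW * n * NU / pot_bound"
      using src(2) pot_bound_pos by (intro divide_right_mono) auto
    have "norm2 lebesgue v1 \<le> kernel_bound * NW * n * NU / pot_bound" "norm2 lebesgue v2 \<le> kernel_bound * NW * n * NU / pot_bound"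
      using order_trans[OF weak_solution_bound[OF q1 w1 src(1)] k] order_trans[OF weak_solution_bound[OF q2 w2 src(1)] k] by auto
    moreover have "norm2 lebesgue d \<le> norm2 lebesgue v1 + norm2 lebesgue v2"
      using norm2_triangle[OF v1s sq_int_uminus[OF v2s]] by (simp add: d_def[abs_def])
    ultimately show ?thesis unfolding mult_2 by (meson add_mono order_trans)
  qed
  \<comment> \<open>The moments of d are the combinations of the moment differences, up to \<sigma>, which is of order \<delta>.\<close>
  have dmom: "(\<integral>x. mU a x * d x \<partial>lebesgue) = (\<Sum>a'\<in>A. c a' * (moment m q1 a a' - moment m q2 a a')) + (\<integral>x. mU a x * \<sigma> x \<partial>lebesgue)"
    if a: "a \<in> A" for a
  proof -
    have int: "integrable lebesgue (\<lambda>x. mU a x * G q a' x)" if "bounded_potential U pot_bound q" "a' \<in> A" for q a'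
      by (rule sq_int_mult_integrable[OF mUs[OF a] weak_solution_sq_int[OF Gw[OF that]]])
    have mq: "(\<integral>x. mU a x * G q a' x \<partial>lebesgue) = moment m q a a'" for q a'
      unfolding moment_def G_def mU_def[abs_def] ..
    have i1: "integrable lebesgue (\<lambda>x. \<Sum>a'\<in>A. c a' * (mU a x * G q1 a' x - mU a x * G q2 a' x))"
      by (intro Bochner_Integration.integrable_sum integrable_mult_right Bochner_Integration.integrable_diff int q1 q2)
    have i2: "integrable lebesgue (\<lambda>x. mU a x * \<sigma> x)" by (rule sq_int_mult_integrable[OF mUs[OF a] \<sigma>s])
    have "mU a x * d x = (\<Sum>a'\<in>A. c a' * (mU a x * G q1 a' x - mU a x * G q2 a' x)) + mU a x * \<sigma> x" for x
    proof -
      have "(\<Sum>a'\<in>A. c a' * (mU a x * G q1 a' x - mU a x * G q2 a' x))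
          = mU a x * ((\<Sum>a'\<in>A. c a' * G q1 a' x) - (\<Sum>a'\<in>A. c a' * G q2 a' x))"
        unfolding sum_subtractf[symmetric] sum_distrib_left
        by (intro sum.cong refl) (simp only: right_diff_distrib mult.left_commute)
      then show ?thesis by (simp add: d_def \<sigma>_def \<rho>_def right_diff_distrib)
    qed
    then have "(\<integral>x. mU a x * d x \<partial>lebesgue) = (\<integral>x. (\<Sum>a'\<in>A. c a' * (mU a x * G q1 a' x - mU a x * G q2 a' x)) \<partial>lebesgue) + (\<integral>x. mU a x * \<sigma> x \<partial>lebesgue)"
      using Bochner_Integration.integral_add[OF i1 i2] by presburger
    also have "(\<integral>x. (\<Sum>a'\<in>A. c a' * (mU a x * G q1 a' x - mU a x * G q2 a' x)) \<partial>lebesgue)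
        = (\<Sum>a'\<in>A. \<integral>x. c a' * (mU a x * G q1 a' x - mU a x * G q2 a' x) \<partial>lebesgue)"
      by (intro Bochner_Integration.integral_sum integrable_mult_right Bochner_Integration.integrable_diff int q1 q2)
    also have "\<dots> = (\<Sum>a'\<in>A. c a' * (moment m q1 a a' - moment m q2 a a'))"
    proof (intro sum.cong refl)
      fix a' assume a': "a' \<in> A"
      show "(\<integral>x. c a' * (mU a x * G q1 a' x - mU a x * G q2 a' x) \<partial>lebesgue) = c a' * (moment m q1 a a' - moment m q2 a a')"
        unfolding integral_mult_right_zero Bochner_Integration.integral_diff[OF int[OF q1 a'] int[OF q2 a']] mq ..
    qed
    finally show ?thesis .
  qed
  have \<eta>0: "A \<noteq> {} \<Longrightarrow> \<eta> \<ge> 0" using mom norm_ge_zero order_trans by blast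
  define T where "T = NW * (\<delta> * (NU\<^sup>2 * (4 * kernel_bound + 2) / pot_bound) + (real (card A))\<^sup>2 * B\<^sup>2 * \<eta>)"
  have gb: "cmod (g y) \<le> T * n" if y: "y \<in> W" for y
  proof -
    define p where "p x = (\<Sum>a\<in>A. m a x * b a y)" for x
    have pm: "p \<in> borel_measurable lebesgue" unfolding p_def by (intro borel_measurable_sum borel_measurable_times m(1)) auto
    define D where "D x = of_real (frac_kernel s x y) - p x" for x
    have Dm: "D \<in> borel_measurable lebesgue" unfolding D_def by (intro borel_measurable_diff frac_kernel_measurable_1 pm)
    have Db: "cmod (D x) \<le> \<delta>" if "x \<in> U" for x unfolding D_def p_def by (rule approx[OF that y])
    have pb: "cmod (p x) \<le> kernel_bound + 1" if "x \<in> U" for x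
    proof -
      have "p x = of_real (frac_kernel s x y) - D x" by (simp add: D_def)
      then have "cmod (p x) \<le> cmod (of_real (frac_kernel s x y)) + cmod (D x)" by (simp only: norm_triangle_ineq4)
      then show ?thesis using frac_kernel_le[of x y] Db[OF that] \<delta> by linarith
    qed
    have kb1: "kernel_bound + 1 \<ge> 0" using kernel_bound_nonneg by simp
    note pD = bounded_on_set_pairing[OF Ub UR Dm Db \<delta>(1) ds, folded NU_def]
    note p\<sigma> = bounded_on_set_pairing[OF Ub UR pm pb kb1 \<sigma>s, folded NU_def]
    have im: "integrable lebesgue (\<lambda>x. b a y * (mU a x * d x))" if "a \<in> A" for a
      by (intro integrable_mult_right sq_int_mult_integrable[OF mUs[OF that] ds])
    have psum: "ind U x * p x * z = (\<Sum>a\<in>A. b a y * (mU a x * z))" for x z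
      unfolding p_def mU_def sum_distrib_left sum_distrib_right by (intro sum.cong refl) (simp only: mult_ac)
    have pint: "(\<integral>x. ind U x * p x * z x \<partial>lebesgue) = (\<Sum>a\<in>A. b a y * (\<integral>x. mU a x * z x \<partial>lebesgue))"
      if z: "sq_int lebesgue z" for z
    proof -
      have "(\<integral>x. ind U x * p x * z x \<partial>lebesgue) = (\<integral>x. (\<Sum>a\<in>A. b a y * (mU a x * z x)) \<partial>lebesgue)"
        unfolding psum by (rule refl)
      also have "\<dots> = (\<Sum>a\<in>A. \<integral>x. b a y * (mU a x * z x) \<partial>lebesgue)"
        by (intro Bochner_Integration.integral_sum integrable_mult_right sq_int_mult_integrable mUs z)
      finally show ?thesis by (simp only: integral_mult_right_zero)
    qed
    have "kernel_op s d y = (\<integral>x. ind U x * D x * d x + ind U x * p x * d x \<partial>lebesgue)"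
      unfolding kernel_op_def
    proof (rule integral_cong_AE)
      show "(\<lambda>x. of_real (frac_kernel s x y) * d x) \<in> borel_measurable lebesgue"
        by (intro borel_measurable_times frac_kernel_measurable_1 sq_int_measurable[OF ds])
      show "(\<lambda>x. ind U x * D x * d x + ind U x * p x * d x) \<in> borel_measurable lebesgue"
        by (intro borel_measurable_add borel_measurable_times ind_measurable[OF Ub] Dm pm sq_int_measurable[OF ds])
      show "AE x in lebesgue. of_real (frac_kernel s x y) * d x = ind U x * D x * d x + ind U x * p x * d x"
        using d0 by eventually_elim (auto simp: ind_def D_def left_diff_distrib)
    qed
    also have "\<dots> = (\<integral>x. ind U x * D x * d x \<partial>lebesgue) + (\<integral>x. ind U x * p x * d x \<partial>lebesgue)"
      unfolding psum by (intro Bochner_Integration.integral_add pD(1) Bochner_Integration.integrable_sum im)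
    also have "(\<integral>x. ind U x * p x * d x \<partial>lebesgue) = (\<Sum>a\<in>A. b a y * (\<integral>x. mU a x * d x \<partial>lebesgue))"
      by (rule pint[OF ds])
    also have "\<dots> = (\<Sum>a\<in>A. b a y * (\<Sum>a'\<in>A. c a' * (moment m q1 a a' - moment m q2 a a'))) + (\<Sum>a\<in>A. b a y * (\<integral>x. mU a x * \<sigma> x \<partial>lebesgue))"
      unfolding sum.distrib[symmetric] distrib_left[symmetric] by (intro sum.cong refl) (simp only: dmom)
    also have "(\<Sum>a\<in>A. b a y * (\<integral>x. mU a x * \<sigma> x \<partial>lebesgue)) = (\<integral>x. ind U x * p x * \<sigma> x \<partial>lebesgue)"
      by (rule pint[OF \<sigma>s, symmetric])
    finally have eq: "kernel_op s d y = (\<integral>x. ind U x * D x * d x \<partial>lebesgue)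
      + ((\<Sum>a\<in>A. b a y * (\<Sum>a'\<in>A. c a' * (moment m q1 a a' - moment m q2 a a'))) + (\<integral>x. ind U x * p x * \<sigma> x \<partial>lebesgue))" .
    have t1: "cmod (\<integral>x. ind U x * D x * d x \<partial>lebesgue) \<le> \<delta> * NU * (2 * (kernel_bound * NW * n * NU / pot_bound))"
      by (rule order_trans[OF pD(2) mult_left_mono[OF dn]]) (simp_all add: mult_nonneg_nonneg[OF \<delta>(1) NU_nonneg])
    have t3: "cmod (\<integral>x. ind U x * p x * \<sigma> x \<partial>lebesgue) \<le> (kernel_bound + 1) * NU * (2 * (\<delta> * NW * n * NU / pot_bound))"
      by (rule order_trans[OF p\<sigma>(2) mult_left_mono[OF \<sigma>n]]) (simp_all add: mult_nonneg_nonneg[OF kb1 NU_nonneg])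
    have t2: "cmod (\<Sum>a\<in>A. b a y * (\<Sum>a'\<in>A. c a' * (moment m q1 a a' - moment m q2 a a')))
        \<le> real (card A) * (B * (real (card A) * (B * NW * n * \<eta>)))"
    proof (rule sum_norm_le[THEN order_trans])
      fix a assume a: "a \<in> A"
      have "cmod (\<Sum>a'\<in>A. c a' * (moment m q1 a a' - moment m q2 a a')) \<le> (\<Sum>a'\<in>A. B * NW * n * \<eta>)"
      proof (rule sum_norm_le)
        fix a' assume a': "a' \<in> A"
        show "cmod (c a' * (moment m q1 a a' - moment m q2 a a')) \<le> B * NW * n * \<eta>"
          unfolding norm_mult using cb[OF a'] mom[OF a a'] B NW_nonneg n0 by (intro mult_mono) auto
      qed
      then have "cmod (\<Sum>a'\<in>A. c a' * (moment m q1 a a' - moment m q2 a a')) \<le> real (card A) * (B * NW * n * \<eta>)" by simp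
      then show "cmod (b a y * (\<Sum>a'\<in>A. c a' * (moment m q1 a a' - moment m q2 a a'))) \<le> B * (real (card A) * (B * NW * n * \<eta>))"
        unfolding norm_mult using b(2)[OF a y] B by (intro mult_mono) auto
    qed simp
    have "cmod (g y) = cmod (kernel_op s d y)" by (simp add: g_def)
    also have "\<dots> \<le> \<delta> * NU * (2 * (kernel_bound * NW * n * NU / pot_bound))
        + (real (card A) * (B * (real (card A) * (B * NW * n * \<eta>))) + (kernel_bound + 1) * NU * (2 * (\<delta> * NW * n * NU / pot_bound)))"
      unfolding eq by (intro norm_triangle_le add_mono t1 t2 t3 order_trans[OF norm_triangle_ineq])
    also have "\<dots> = T * n"
      unfolding T_def divide_inverse by (simp add: algebra_simps power2_eq_square)
    finally show ?thesis .
  qed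
  show "\<exists>g\<in>L2 W. (\<forall>\<phi>\<in>test_functions W. dn_map s U W q1 f \<phi> - dn_map s U W q2 f \<phi> = (\<integral>x. g x * \<phi> x \<partial>lebesgue_on W)) \<and>
        L2_norm W g \<le> NW\<^sup>2 * (\<delta> * (NU\<^sup>2 * (4 * kernel_bound + 2) / pot_bound) + (real (card A))\<^sup>2 * B\<^sup>2 * \<eta>) * L2_norm W f"
  proof (intro bexI conjI ballI)
    show "dn_map s U W q1 f \<phi> - dn_map s U W q2 f \<phi> = (\<integral>x. g x * \<phi> x \<partial>lebesgue_on W)" if "\<phi> \<in> test_functions W" for \<phi>
      by (rule rep[OF that])
    have eqs: "(\<lambda>x. indicator W x *\<^sub>R (cmod (g x))\<^sup>2) = (\<lambda>x. (cmod (ind W x * g x))\<^sup>2)"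
      by (auto simp: ind_def indicator_def)
    have Tn: "T * n \<ge> 0"
    proof (cases "W = {}")
      case True
      then have "NW = 0" unfolding NW_def by (simp add: ind_def[abs_def])
      then show ?thesis by (simp add: T_def)
    next
      case False
      then show ?thesis using gb norm_ge_zero order_trans by blast
    qed
    note gn = bounded_on_set_norm2[OF Wb WR gm gb Tn]
    have "integrable lebesgue (\<lambda>x. indicator W x *\<^sub>R (cmod (g x))\<^sup>2)" unfolding eqs by (rule sq_int_integrable[OF gn(1)])
    then have "integrable (lebesgue_on W) (\<lambda>x. (cmod (g x))\<^sup>2)" using W_lebesgue by (subst integrable_restrict_space) auto
    moreover have "g \<in> borel_measurable (lebesgue_on W)" using gm by (rule measurable_restrict_space1)
    ultimately show "g \<in> L2 W" by (simp add: L2_def)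
    have "(\<integral>x. (cmod (g x))\<^sup>2 \<partial>lebesgue_on W) = (\<integral>x. indicator W x *\<^sub>R (cmod (g x))\<^sup>2 \<partial>lebesgue)"
      using W_lebesgue by (intro integral_restrict_space) simp
    then have "L2_norm W g = norm2 lebesgue (\<lambda>x. ind W x * g x)" unfolding L2_norm_def norm2_def eqs by simp
    also have "\<dots> \<le> T * n * NW" using gn(2) unfolding NW_def .
    finally show "L2_norm W g \<le> NW\<^sup>2 * (\<delta> * (NU\<^sup>2 * (4 * kernel_bound + 2) / pot_bound) + (real (card A))\<^sup>2 * B\<^sup>2 * \<eta>) * L2_norm W f"
      unfolding T_def n_def by (simp only: power2_eq_square mult_ac)
  qed
qed

end

section \<open>Finite rank approximation of the kernel\<close>

text \<open>Multi-indices with all entries at most d. A box rather than a simplex makes the count a power.\<close>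

definition multi_box :: "nat \<Rightarrow> ('a::euclidean_space \<Rightarrow> nat) set" where
  "multi_box d = PiE Basis (\<lambda>_. {..d})"

definition monomial :: "('a::euclidean_space \<Rightarrow> nat) \<Rightarrow> 'a \<Rightarrow> real" where
  "monomial \<alpha> x = (\<Prod>i\<in>Basis. (x \<bullet> i) ^ \<alpha> i)"

lemma finite_multi_box: "finite (multi_box d)"
  unfolding multi_box_def by (intro finite_PiE) auto

lemma card_multi_box: "card (multi_box d :: ('a::euclidean_space \<Rightarrow> nat) set) = Suc d ^ DIM('a)"
  unfolding multi_box_def by (subst card_PiE) auto

lemma monomial_bound: "norm x \<le> 1 \<Longrightarrow> \<bar>monomial \<alpha> x\<bar> \<le> 1"
proof -
  assume x: "norm x \<le> 1"
  have "\<bar>monomial \<alpha> x\<bar> = (\<Prod>i\<in>Basis. \<bar>x \<bullet> i\<bar> ^ \<alpha> i)"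
    by (simp add: monomial_def abs_prod power_abs)
  also have "\<dots> \<le> 1"
  proof (intro prod_le_1 conjI zero_le_power power_le_one)
    fix i :: 'a assume "i \<in> Basis"
    then show "\<bar>x \<bullet> i\<bar> \<le> 1" using Basis_le_norm[of i x] x by linarith
  qed auto
  finally show ?thesis .
qed

lemma monomial_measurable [measurable]: "monomial \<alpha> \<in> borel_measurable borel"
  unfolding monomial_def[abs_def] by measurable

text \<open>The bound C on the coefficients is tracked explicitly, because it enters, squared, the accuracy with
  which the moments must be known. The exterior domain lies in the ball of radius 3.\<close>

definition poly_kernel :: "nat \<Rightarrow> real \<Rightarrow> ('a::euclidean_space \<Rightarrow> 'a \<Rightarrow> real) \<Rightarrow> bool" where
  "poly_kernel d C p \<longleftrightarrow> (\<exists>b. (\<forall>\<alpha>\<in>multi_box d. b \<alpha> \<in> borel_measurable borel \<and> (\<forall>y\<in>ball 0 3. \<bar>b \<alpha> y\<bar> \<le> C)) \<and>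
     (\<forall>x y. p x y = (\<Sum>\<alpha>\<in>multi_box d. monomial \<alpha> x * b \<alpha> y)))"

lemma poly_kernelE:
  assumes "poly_kernel d C p"
  obtains b where "\<forall>\<alpha>\<in>multi_box d. b \<alpha> \<in> borel_measurable borel" "\<forall>\<alpha>\<in>multi_box d. \<forall>y\<in>ball 0 3. \<bar>b \<alpha> y\<bar> \<le> C"
    "\<forall>x y. p x y = (\<Sum>\<alpha>\<in>multi_box d. monomial \<alpha> x * b \<alpha> y)"
  using assms unfolding poly_kernel_def by blast

text \<open>Multiplication by a coordinate of x shifts the multi-indices; indices outside the image get
  coefficient 0.\<close>

lemma poly_kernel_reindex:
  fixes p q :: "'a::euclidean_space \<Rightarrow> 'a \<Rightarrow> real"
  assumes p: "poly_kernel d C p" and C: "C \<ge> 0" and inj: "inj_on T (multi_box d)" and T: "T ` multi_box d \<subseteq> multi_box d'"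
    and q: "\<And>x y \<alpha>. \<alpha> \<in> multi_box d \<Longrightarrow> monomial (T \<alpha>) x = f x * monomial \<alpha> x" "\<And>x y. q x y = f x * p x y"
  shows "poly_kernel d' C q"
proof -
  obtain b where b: "\<forall>\<alpha>\<in>multi_box d. b \<alpha> \<in> borel_measurable borel" "\<forall>\<alpha>\<in>multi_box d. \<forall>y\<in>ball 0 3. \<bar>b \<alpha> y\<bar> \<le> C"
    "\<forall>x y. p x y = (\<Sum>\<alpha>\<in>multi_box d. monomial \<alpha> x * b \<alpha> y)"
    using p by (rule poly_kernelE)
  define b' where "b' \<beta> = (if \<beta> \<in> T ` multi_box d then b (inv_into (multi_box d) T \<beta>) else (\<lambda>_. 0))" for \<beta>
  have b'T: "b' (T \<alpha>) = b \<alpha>" if "\<alpha> \<in> multi_box d" for \<alpha>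
    using that by (simp add: b'_def inv_into_f_f[OF inj])
  have "q x y = (\<Sum>\<alpha>\<in>multi_box d'. monomial \<alpha> x * b' \<alpha> y)" for x y
  proof -
    have "q x y = (\<Sum>\<alpha>\<in>multi_box d. f x * (monomial \<alpha> x * b \<alpha> y))"
      unfolding q(2) b(3)[rule_format] by (rule sum_distrib_left)
    also have "\<dots> = (\<Sum>\<alpha>\<in>multi_box d. monomial (T \<alpha>) x * b' (T \<alpha>) y)"
      by (intro sum.cong refl) (simp add: q(1) b'T)
    also have "\<dots> = (\<Sum>\<beta>\<in>T ` multi_box d. monomial \<beta> x * b' \<beta> y)"
      by (simp add: sum.reindex[OF inj])
    also have "\<dots> = (\<Sum>\<beta>\<in>multi_box d'. monomial \<beta> x * b' \<beta> y)"
      by (intro sum.mono_neutral_left finite_multi_box T) (auto simp: b'_def)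
    finally show ?thesis .
  qed
  moreover have "b' \<beta> \<in> borel_measurable borel \<and> (\<forall>y\<in>ball 0 3. \<bar>b' \<beta> y\<bar> \<le> C)" for \<beta>
  proof (cases "\<beta> \<in> T ` multi_box d")
    case True
    then obtain \<alpha> where "\<alpha> \<in> multi_box d" "\<beta> = T \<alpha>" by blast
    then show ?thesis using b(1,2) b'T by simp
  next
    case False
    then show ?thesis using C by (simp add: b'_def)
  qed
  ultimately show ?thesis unfolding poly_kernel_def by blast
qed

lemma poly_kernel_mono:
  assumes p: "poly_kernel d C p" and d: "d \<le> d'" and C: "0 \<le> C" "C \<le> C'"
  shows "poly_kernel d' C' p"
proof -
  have "poly_kernel d' C p"
  proof (rule poly_kernel_reindex[OF p C(1), where T = "\<lambda>\<alpha>. \<alpha>" and f = "\<lambda>_. 1"])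
    show "(\<lambda>\<alpha>. \<alpha>) ` multi_box d \<subseteq> multi_box d'"
      by (auto simp: multi_box_def PiE_iff intro: order_trans[OF _ d])
  qed auto
  then show ?thesis unfolding poly_kernel_def using C(2) by (meson order_trans)
qed

lemma poly_kernel_mult_coordinate:
  fixes p :: "'a::euclidean_space \<Rightarrow> 'a \<Rightarrow> real"
  assumes p: "poly_kernel d C p" and C: "C \<ge> 0" and i: "i \<in> Basis"
  shows "poly_kernel (Suc d) C (\<lambda>x y. (x \<bullet> i) * p x y)"
proof (rule poly_kernel_reindex[OF p C, where T = "\<lambda>\<alpha>. \<alpha>(i := Suc (\<alpha> i))" and f = "\<lambda>x. x \<bullet> i"])
  show "inj_on (\<lambda>\<alpha>. \<alpha>(i := Suc (\<alpha> i))) (multi_box d)"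
  proof (rule inj_onI)
    fix \<alpha> \<beta> :: "'a \<Rightarrow> nat" assume eq: "\<alpha>(i := Suc (\<alpha> i)) = \<beta>(i := Suc (\<beta> i))"
    show "\<alpha> = \<beta>"
    proof
      fix j show "\<alpha> j = \<beta> j" using fun_cong[OF eq, of j] fun_cong[OF eq, of i] by (cases "j = i") auto
    qed
  qed
  show "(\<lambda>\<alpha>. \<alpha>(i := Suc (\<alpha> i))) ` multi_box d \<subseteq> multi_box (Suc d)"
    using i by (auto simp: multi_box_def PiE_iff extensional_def) (blast intro: le_SucI)
  show "monomial (\<alpha>(i := Suc (\<alpha> i))) x = (x \<bullet> i) * monomial \<alpha> x" for \<alpha> and x :: 'a
  proof -
    have "monomial (\<alpha>(i := Suc (\<alpha> i))) x = (x \<bullet> i) ^ Suc (\<alpha> i) * (\<Prod>j\<in>Basis - {i}. (x \<bullet> j) ^ (\<alpha>(i := Suc (\<alpha> i))) j)"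
      unfolding monomial_def using i by (subst prod.remove[of _ i]) auto
    also have "(\<Prod>j\<in>Basis - {i}. (x \<bullet> j) ^ (\<alpha>(i := Suc (\<alpha> i))) j) = (\<Prod>j\<in>Basis - {i}. (x \<bullet> j) ^ \<alpha> j)"
      by (intro prod.cong refl) auto
    also have "(x \<bullet> i) ^ Suc (\<alpha> i) * (\<Prod>j\<in>Basis - {i}. (x \<bullet> j) ^ \<alpha> j) = (x \<bullet> i) * monomial \<alpha> x"
      unfolding monomial_def using i by (subst prod.remove[of _ i]) auto
    finally show ?thesis .
  qed
qed auto

lemma poly_kernel_add:
  assumes p: "poly_kernel d C p" and q: "poly_kernel d D q"
  shows "poly_kernel d (C + D) (\<lambda>x y. p x y + q x y)"
proof -
  obtain b where b: "\<forall>\<alpha>\<in>multi_box d. b \<alpha> \<in> borel_measurable borel" "\<forall>\<alpha>\<in>multi_box d. \<forall>y\<in>ball 0 3. \<bar>b \<alpha> y\<bar> \<le> C"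
    "\<forall>x y. p x y = (\<Sum>\<alpha>\<in>multi_box d. monomial \<alpha> x * b \<alpha> y)"
    using p by (rule poly_kernelE)
  obtain c where c: "\<forall>\<alpha>\<in>multi_box d. c \<alpha> \<in> borel_measurable borel" "\<forall>\<alpha>\<in>multi_box d. \<forall>y\<in>ball 0 3. \<bar>c \<alpha> y\<bar> \<le> D"
    "\<forall>x y. q x y = (\<Sum>\<alpha>\<in>multi_box d. monomial \<alpha> x * c \<alpha> y)"
    using q by (rule poly_kernelE)
  have bd: "\<bar>b \<alpha> y + c \<alpha> y\<bar> \<le> C + D" if "\<alpha> \<in> multi_box d" "y \<in> ball 0 3" for \<alpha> y
  proof -
    have "\<bar>b \<alpha> y\<bar> \<le> C" "\<bar>c \<alpha> y\<bar> \<le> D" using b(2) c(2) that by blast+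
    then show ?thesis by linarith
  qed
  show ?thesis
    unfolding poly_kernel_def
  proof (intro exI[of _ "\<lambda>\<alpha> y. b \<alpha> y + c \<alpha> y"] conjI ballI allI)
    fix \<alpha> :: "'a \<Rightarrow> nat" assume "\<alpha> \<in> multi_box d"
    then show "(\<lambda>y. b \<alpha> y + c \<alpha> y) \<in> borel_measurable borel" using b(1) c(1) by (intro borel_measurable_add) auto
  qed (use bd b(3) c(3) in \<open>auto simp: distrib_left sum.distrib\<close>)
qed

lemma poly_kernel_mult_coefficient:
  assumes p: "poly_kernel d C p" and C: "C \<ge> 0" and h: "h \<in> borel_measurable borel" "\<And>y. y \<in> ball 0 3 \<Longrightarrow> \<bar>h y\<bar> \<le> D" and D: "D \<ge> 0"
  shows "poly_kernel d (D * C) (\<lambda>x y. h y * p x y)"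
proof -
  obtain b where b: "\<forall>\<alpha>\<in>multi_box d. b \<alpha> \<in> borel_measurable borel" "\<forall>\<alpha>\<in>multi_box d. \<forall>y\<in>ball 0 3. \<bar>b \<alpha> y\<bar> \<le> C"
    "\<forall>x y. p x y = (\<Sum>\<alpha>\<in>multi_box d. monomial \<alpha> x * b \<alpha> y)"
    using p by (rule poly_kernelE)
  have bd: "\<bar>h y * b \<alpha> y\<bar> \<le> D * C" if "\<alpha> \<in> multi_box d" "y \<in> ball 0 3" for \<alpha> y
    unfolding abs_mult using h(2)[OF that(2)] b(2) that D by (intro mult_mono) auto
  show ?thesis
    unfolding poly_kernel_def
  proof (intro exI[of _ "\<lambda>\<alpha> y. h y * b \<alpha> y"] conjI ballI allI)
    fix \<alpha> :: "'a \<Rightarrow> nat" assume "\<alpha> \<in> multi_box d"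
    then show "(\<lambda>y. h y * b \<alpha> y) \<in> borel_measurable borel" using b(1) h(1) by (intro borel_measurable_times) auto
  qed (use bd b(3) in \<open>auto simp: sum_distrib_left mult_ac\<close>)
qed

lemma poly_kernel_zero: "poly_kernel d 0 (\<lambda>x y. 0)"
  unfolding poly_kernel_def by (intro exI[of _ "\<lambda>_ _. 0"]) auto

lemma poly_kernel_sum:
  assumes "finite I" "\<And>i. i \<in> I \<Longrightarrow> poly_kernel d (C i) (p i)"
  shows "poly_kernel d (\<Sum>i\<in>I. C i) (\<lambda>x y. \<Sum>i\<in>I. p i x y)"
  using assms
proof (induction I rule: finite_induct)
  case (insert i I)
  then have "poly_kernel d (C i + (\<Sum>i\<in>I. C i)) (\<lambda>x y. p i x y + (\<Sum>i\<in>I. p i x y))"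
    by (intro poly_kernel_add) auto
  then show ?case using insert by simp
qed (simp add: poly_kernel_zero)

lemma poly_kernel_one: "poly_kernel 0 1 (\<lambda>x y. 1)"
proof -
  have box: "multi_box 0 = {\<lambda>i\<in>(Basis::'a set). 0::nat}"
    unfolding multi_box_def by (auto simp: PiE_eq_singleton)
  have "monomial (\<lambda>i\<in>(Basis::'a set). 0) x = 1" for x :: 'a
    unfolding monomial_def by (intro prod.neutral) auto
  then show ?thesis unfolding poly_kernel_def box by (intro exI[of _ "\<lambda>_ _. 1"]) auto
qed

text \<open>The squared distance lies between 1 and 16; centred at 10 and rescaled it stays away from the
  singularity of the power.\<close>

definition dist_var :: "'a::euclidean_space \<Rightarrow> 'a \<Rightarrow> real" where
  "dist_var x y = 1 - (norm (x - y))\<^sup>2 / 10"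

text \<open>Expand |x - y|^2 = |x|^2 + |y|^2 - 2 x \<bullet> y. Each factor raises the degree in every coordinate by at
  most 2, and for |y| < 3 the coefficients grow by the factor 1 + n: at most 1 for the part in y alone,
  and 1/10 + 3/5 < 1 for each coordinate.\<close>

lemma poly_kernel_mult_dist_var:
  fixes p :: "'a::euclidean_space \<Rightarrow> 'a \<Rightarrow> real" and C :: real
  assumes p: "poly_kernel d C p" and C: "C \<ge> 0"
  shows "poly_kernel (d + 2) ((1 + DIM('a)) * C) (\<lambda>x y. dist_var x y * p x y)"
proof -
  have p2: "poly_kernel (d + 2) C p" by (rule poly_kernel_mono[OF p]) (use C in auto)
  have p1: "poly_kernel (Suc d) C p" by (rule poly_kernel_mono[OF p]) (use C in auto)
  have t0: "poly_kernel (d + 2) (1 * C) (\<lambda>x y. (1 - (norm y)\<^sup>2 / 10) * p x y)"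
  proof (rule poly_kernel_mult_coefficient[OF p2 C])
    fix y :: 'a assume "y \<in> ball 0 3"
    then have "norm y < 3" by simp
    then have "(norm y)\<^sup>2 \<le> 3\<^sup>2" by (intro power_mono) auto
    then show "\<bar>1 - (norm y)\<^sup>2 / 10\<bar> \<le> 1" by simp
  qed auto
  have t1: "poly_kernel (d + 2) (1/10 * C) (\<lambda>x y. (- (1/10)) * ((x \<bullet> i) * ((x \<bullet> i) * p x y)))" if "i \<in> Basis" for i
  proof (rule poly_kernel_mult_coefficient[where h = "\<lambda>y. - (1/10)"])
    show "poly_kernel (d + 2) C (\<lambda>x y. (x \<bullet> i) * ((x \<bullet> i) * p x y))"
      using poly_kernel_mult_coordinate[OF poly_kernel_mult_coordinate[OF p C that] C that] by simp
  qed (use C in auto)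
  have t2: "poly_kernel (d + 2) (3/5 * C) (\<lambda>x y. ((y \<bullet> i) / 5) * ((x \<bullet> i) * p x y))" if "i \<in> Basis" for i
  proof (rule poly_kernel_mult_coefficient)
    show "poly_kernel (d + 2) C (\<lambda>x y. (x \<bullet> i) * p x y)"
      using poly_kernel_mult_coordinate[OF p1 C that] by simp
    fix y :: 'a assume "y \<in> ball 0 3"
    then show "\<bar>(y \<bullet> i) / 5\<bar> \<le> 3/5" using Basis_le_norm[OF that, of y] by simp
  qed (use C in auto)
  have "poly_kernel (d + 2) (1 * C + (\<Sum>i\<in>(Basis::'a set). 1/10 * C + 3/5 * C))
      (\<lambda>x y. (1 - (norm y)\<^sup>2 / 10) * p x y + (\<Sum>i\<in>Basis. (- (1/10)) * ((x \<bullet> i) * ((x \<bullet> i) * p x y)) + ((y \<bullet> i) / 5) * ((x \<bullet> i) * p x y)))"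
    by (intro poly_kernel_add[OF t0] poly_kernel_sum poly_kernel_zero poly_kernel_add t1 t2) auto
  moreover have "(1 - (norm y)\<^sup>2 / 10) * p x y + (\<Sum>i\<in>Basis. (- (1/10)) * ((x \<bullet> i) * ((x \<bullet> i) * p x y)) + ((y \<bullet> i) / 5) * ((x \<bullet> i) * p x y))
      = dist_var x y * p x y" for x y
  proof -
    have "(norm (x - y))\<^sup>2 = (norm x)\<^sup>2 + (norm y)\<^sup>2 - 2 * (x \<bullet> y)"
      by (simp add: power2_norm_eq_inner inner_diff_left inner_diff_right inner_commute)
    moreover have "(norm x)\<^sup>2 = (\<Sum>i\<in>Basis. (x \<bullet> i) * (x \<bullet> i))"
      unfolding power2_norm_eq_inner by (rule euclidean_inner)
    moreover have "x \<bullet> y = (\<Sum>i\<in>Basis. (x \<bullet> i) * (y \<bullet> i))" by (rule euclidean_inner)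
    ultimately have 1: "dist_var x y = 1 - (norm y)\<^sup>2 / 10 + ((- (1/10)) * (\<Sum>i\<in>Basis. (x \<bullet> i) * (x \<bullet> i)) + (1/5) * (\<Sum>i\<in>Basis. (x \<bullet> i) * (y \<bullet> i)))"
      unfolding dist_var_def by (simp add: diff_divide_distrib add_divide_distrib)
    have 2: "(\<Sum>i\<in>Basis. (- (1/10)) * ((x \<bullet> i) * ((x \<bullet> i) * p x y)) + ((y \<bullet> i) / 5) * ((x \<bullet> i) * p x y))
        = ((- (1/10)) * (\<Sum>i\<in>Basis. (x \<bullet> i) * (x \<bullet> i)) + (1/5) * (\<Sum>i\<in>Basis. (x \<bullet> i) * (y \<bullet> i))) * p x y"
      unfolding sum.distrib distrib_right sum_distrib_left sum_distrib_right
      by (intro arg_cong2[where f="(+)"] sum.cong refl) simp_all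
    show ?thesis unfolding 1 2 by (rule distrib_right[symmetric])
  qed
  ultimately have "poly_kernel (d + 2) (1 * C + (\<Sum>i\<in>(Basis::'a set). 1/10 * C + 3/5 * C)) (\<lambda>x y. dist_var x y * p x y)"
    by simp
  moreover have "1 * C + (\<Sum>i\<in>(Basis::'a set). 1/10 * C + 3/5 * C) \<le> (1 + DIM('a)) * C"
  proof -
    have "(\<Sum>i\<in>(Basis::'a set). 1/10 * C + 3/5 * C) \<le> (\<Sum>i\<in>(Basis::'a set). C)"
      using C by (intro sum_mono) linarith
    then show ?thesis by (simp add: distrib_right)
  qed
  moreover have "0 \<le> 1 * C + (\<Sum>i\<in>(Basis::'a set). 1/10 * C + 3/5 * C)"
    using C by (intro add_nonneg_nonneg sum_nonneg) auto
  ultimately show ?thesis by (elim poly_kernel_mono[OF _ order_refl, rotated])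
qed

lemma poly_kernel_dist_var_power:
  "poly_kernel (2 * k) ((1 + DIM('a)) ^ k) (\<lambda>x y::'a::euclidean_space. dist_var x y ^ k)"
proof (induction k)
  case 0
  then show ?case using poly_kernel_one by simp
next
  case (Suc k)
  have "2 * Suc k = 2 * k + 2" by simp
  moreover have "poly_kernel (2 * k + 2) (real (1 + DIM('a)) * (1 + DIM('a)) ^ k) (\<lambda>x y::'a. dist_var x y * dist_var x y ^ k)"
    by (rule poly_kernel_mult_dist_var[OF Suc]) simp
  moreover have "real (1 + DIM('a)) = 1 + real DIM('a)" by simp
  ultimately show ?case by (simp only: power_Suc of_nat_mult of_nat_power)
qed

lemma dist_var_range:
  fixes x y :: "'a::euclidean_space"
  assumes "norm x < 1" "2 < norm y" "norm y < 3"
  shows "\<bar>dist_var x y\<bar> \<le> 9/10" "norm (x - y) > 1"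
proof -
  show 1: "norm (x - y) > 1" using norm_triangle_ineq2[of y x] assms by (simp add: norm_minus_commute)
  have 2: "norm (x - y) \<le> 4" using norm_triangle_ineq4[of x y] assms by simp
  have "1\<^sup>2 \<le> (norm (x - y))\<^sup>2" using 1 by (intro power_mono) auto
  moreover have "(norm (x - y))\<^sup>2 \<le> 4\<^sup>2" using 2 by (intro power_mono) auto
  ultimately have "1 \<le> (norm (x - y))\<^sup>2" "(norm (x - y))\<^sup>2 \<le> 16" by simp_all
  then show "\<bar>dist_var x y\<bar> \<le> 9/10" unfolding dist_var_def abs_le_iff by linarith
qed

text \<open>The terms of the series are bounded at radius 19/20, so at radius 9/10 they decay like
  ((9/10) / (19/20))^k = (18/19)^k.\<close>

lemma binomial_series_truncation:
  fixes a :: real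
  obtains c :: "nat \<Rightarrow> real" and K where "K > 0" "\<forall>k. \<bar>c k\<bar> \<le> K * (20/19) ^ k"
    "\<forall>z L. \<bar>z\<bar> \<le> 9/10 \<longrightarrow> \<bar>(1 - z) powr a - (\<Sum>k<L. c k * z ^ k)\<bar> \<le> K * (18/19) ^ L"
proof -
  define c where "c k = (a gchoose k) * (-1) ^ k" for k
  have sums: "(\<lambda>k. c k * z ^ k) sums (1 - z) powr a" if "\<bar>z\<bar> < 1" for z
  proof -
    have "(\<lambda>k. (a gchoose k) * (- z) ^ k) sums (1 + - z) powr a" using that by (intro gen_binomial_real) simp
    moreover have "(a gchoose k) * (- z) ^ k = c k * z ^ k" for k
      unfolding c_def power_minus[of z] by simp
    ultimately show ?thesis by simp
  qed
  have "summable (\<lambda>k. c k * (19/20) ^ k)" using sums[of "19/20"] by (auto simp: sums_iff)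
  then have "Bseq (\<lambda>k. c k * (19/20) ^ k)" using summable_LIMSEQ_zero convergent_imp_Bseq convergentI by blast
  then obtain K0 where K0: "K0 > 0" "\<forall>k. norm (c k * (19/20) ^ k) \<le> K0" by (auto simp: Bseq_def)
  have cb: "\<bar>c k\<bar> \<le> K0 * (20/19) ^ k" for k
  proof -
    have "\<bar>c k\<bar> * (19/20) ^ k \<le> K0" using K0(2) by (simp add: abs_mult)
    then have "\<bar>c k\<bar> * (19/20) ^ k * (20/19) ^ k \<le> K0 * (20/19) ^ k" by (intro mult_right_mono) auto
    moreover have "(19/20::real) ^ k * (20/19) ^ k = 1" by (simp flip: power_mult_distrib)
    ultimately show ?thesis by (simp add: mult.assoc)
  qed
  have tail: "\<bar>(1 - z) powr a - (\<Sum>k<L. c k * z ^ k)\<bar> \<le> (19 * K0) * (18/19) ^ L" if z: "\<bar>z\<bar> \<le> 9/10" for z L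
  proof -
    have s: "(\<lambda>k. c k * z ^ k) sums (1 - z) powr a" using z by (intro sums) simp
    have "(1 - z) powr a - (\<Sum>k<L. c k * z ^ k) = (\<Sum>k. c (k + L) * z ^ (k + L))"
      using suminf_split_initial_segment[OF sums_summable[OF s], of L] sums_unique[OF s] by simp
    also have "\<bar>\<dots>\<bar> \<le> (\<Sum>k. K0 * (18/19) ^ L * (18/19) ^ k)"
    proof -
      have b: "norm (c (k + L) * z ^ (k + L)) \<le> K0 * (18/19) ^ L * (18/19) ^ k" for k
      proof -
        have "norm (c (k + L) * z ^ (k + L)) \<le> (K0 * (20/19) ^ (k + L)) * (9/10) ^ (k + L)"
        proof -
          have "norm (c (k + L) * z ^ (k + L)) = \<bar>c (k + L)\<bar> * \<bar>z\<bar> ^ (k + L)"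
            by (simp add: abs_mult power_abs)
          also have "\<dots> \<le> (K0 * (20/19) ^ (k + L)) * (9/10) ^ (k + L)"
            by (rule mult_mono[OF cb power_mono[OF z]]) (use K0(1) in auto)
          finally show ?thesis .
        qed
        also have "\<dots> = K0 * ((20/19) * (9/10)) ^ (k + L)" by (simp only: power_mult_distrib mult.assoc)
        also have "(20/19) * (9/10) = (18/19 :: real)" by simp
        finally show ?thesis by (simp add: power_add mult_ac)
      qed
      have sm: "summable (\<lambda>k. K0 * (18/19) ^ L * (18/19::real) ^ k)" by (intro summable_mult summable_geometric) simp
      have "norm (\<Sum>k. c (k + L) * z ^ (k + L)) \<le> (\<Sum>k. K0 * (18/19) ^ L * (18/19) ^ k)"
        by (rule norm_suminf_le[OF b sm])
      then show ?thesis by simp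
    qed
    also have "\<dots> = K0 * (18/19) ^ L * (\<Sum>k. (18/19::real) ^ k)" by (intro suminf_mult summable_geometric) simp
    also have "(\<Sum>k. (18/19::real) ^ k) = 19" by (subst suminf_geometric) auto
    finally show ?thesis by (simp add: mult_ac)
  qed
  have "\<bar>c k\<bar> \<le> (19 * K0) * (20/19) ^ k" for k
  proof -
    have "K0 * (20/19::real) ^ k \<le> (19 * K0) * (20/19) ^ k" using K0(1) by (intro mult_right_mono) auto
    then show ?thesis using cb[of k] by linarith
  qed
  then show ?thesis using that[of "19 * K0" c] K0(1) tail by simp
qed

text \<open>With z = dist_var x y the squared distance is 10 (1 - z), so the kernel is a constant times
  (1 - z)^a with a = -(n + 2s)/2. Truncating the binomial series gives a polynomial of degree below L
  in z, hence of degree at most 2L in each coordinate of x.\<close>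

lemma kernel_finite_rank:
  fixes s :: real
  assumes s: "0 < s" "s < 1"
  obtains K :: real where "K > 0"
    "\<forall>L. \<exists>b::('a::euclidean_space \<Rightarrow> nat) \<Rightarrow> 'a \<Rightarrow> complex.
       (\<forall>\<alpha>\<in>multi_box (2 * L). b \<alpha> \<in> borel_measurable lebesgue \<and> (\<forall>y\<in>ball 0 3. cmod (b \<alpha> y) \<le> K * real (2 * (1 + DIM('a))) ^ L)) \<and>
       (\<forall>x y. norm x < 1 \<longrightarrow> 2 < norm y \<longrightarrow> norm y < 3 \<longrightarrow>
         cmod (of_real (frac_kernel s x y) - (\<Sum>\<alpha>\<in>multi_box (2 * L). of_real (monomial \<alpha> x) * b \<alpha> y)) \<le> K * (18/19) ^ L)"
proof -
  define n where "n = real DIM('a)"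
  have n: "n \<ge> 1" by (simp add: n_def Suc_le_eq)
  define a where "a = - ((n + 2 * s) / 2)"
  define H where "H = heat_const DIM('a) s / (subord_const s * (2 * pi) ^ DIM('a)) * 10 powr a"
  have H: "H \<ge> 0" unfolding H_def using heat_const_nonneg[of "DIM('a)" s] subord_const_pos[OF s] by simp
  obtain c K where K: "K > 0" and c: "\<forall>k. \<bar>c k\<bar> \<le> K * (20/19) ^ k"
    and app: "\<forall>z L. \<bar>z\<bar> \<le> 9/10 \<longrightarrow> \<bar>(1 - z) powr a - (\<Sum>k<L. c k * z ^ k)\<bar> \<le> K * (18/19) ^ L"
    by (rule binomial_series_truncation[of a])
  have kern: "frac_kernel s x y = H * (1 - dist_var x y) powr a"
    if "norm x < 1" "2 < norm y" "norm y < 3" for x y :: 'a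
  proof -
    define r where "r = norm (x - y)"
    have r: "r > 1" unfolding r_def using that by (rule dist_var_range(2))
    have "2 * a = - (n + 2 * s)" by (simp add: a_def field_simps)
    then have "r powr (- (n + 2 * s)) = (r powr 2) powr a" unfolding powr_powr by simp
    also have "r powr 2 = 10 * (1 - dist_var x y)" using r by (simp add: powr_numeral dist_var_def r_def)
    also have "\<dots> powr a = 10 powr a * (1 - dist_var x y) powr a"
      by (rule powr_mult)
    finally have "r powr (- (n + 2 * s)) = 10 powr a * (1 - dist_var x y) powr a" .
    then show ?thesis using r unfolding frac_kernel_def H_def r_def[symmetric] n_def by simp
  qed
  define K' where "K' = H * K + 1"
  have K': "K' > 0" using H K by (simp add: K'_def add_nonneg_pos)
  define r where "r = 2 * (1 + n)"
  have "\<exists>b::('a \<Rightarrow> nat) \<Rightarrow> 'a \<Rightarrow> complex.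
       (\<forall>\<alpha>\<in>multi_box (2 * L). b \<alpha> \<in> borel_measurable lebesgue \<and> (\<forall>y\<in>ball 0 3. cmod (b \<alpha> y) \<le> K' * r ^ L)) \<and>
       (\<forall>x y. norm x < 1 \<longrightarrow> 2 < norm y \<longrightarrow> norm y < 3 \<longrightarrow>
         cmod (of_real (frac_kernel s x y) - (\<Sum>\<alpha>\<in>multi_box (2 * L). of_real (monomial \<alpha> x) * b \<alpha> y)) \<le> K' * (18/19) ^ L)" for L
  proof -
    have summand: "poly_kernel (2 * L) (\<bar>H * c k\<bar> * (1 + n) ^ k) (\<lambda>x y::'a. (H * c k) * dist_var x y ^ k)" if "k < L" for k
    proof (rule poly_kernel_mult_coefficient[where h = "\<lambda>_. H * c k"])
      have "poly_kernel (2 * k) ((1 + n) ^ k) (\<lambda>x y::'a. dist_var x y ^ k)"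
        using poly_kernel_dist_var_power[of k, where 'a='a] by (simp add: n_def)
      then show "poly_kernel (2 * L) ((1 + n) ^ k) (\<lambda>x y::'a. dist_var x y ^ k)"
        by (rule poly_kernel_mono) (use that n in auto)
    qed (use n in auto)
    have "poly_kernel (2 * L) (\<Sum>k<L. \<bar>H * c k\<bar> * (1 + n) ^ k) (\<lambda>x y::'a. \<Sum>k<L. (H * c k) * dist_var x y ^ k)"
      by (intro poly_kernel_sum poly_kernel_zero summand) auto
    then obtain b where b: "\<forall>\<alpha>\<in>multi_box (2 * L). b \<alpha> \<in> borel_measurable borel"
      "\<forall>\<alpha>\<in>multi_box (2 * L). \<forall>y\<in>ball 0 3. \<bar>b \<alpha> y\<bar> \<le> (\<Sum>k<L. \<bar>H * c k\<bar> * (1 + n) ^ k)"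
      "\<forall>x y::'a. (\<Sum>k<L. (H * c k) * dist_var x y ^ k) = (\<Sum>\<alpha>\<in>multi_box (2 * L). monomial \<alpha> x * b \<alpha> y)"
      by (rule poly_kernelE)
    have "(\<Sum>k<L. \<bar>H * c k\<bar> * (1 + n) ^ k) \<le> K' * r ^ L"
    proof -
      have "(\<Sum>k<L. \<bar>H * c k\<bar> * (1 + n) ^ k) \<le> (\<Sum>k<L. (H * K) * r ^ k)"
      proof (rule sum_mono)
        fix k
        have "\<bar>H * c k\<bar> * (1 + n) ^ k \<le> (H * (K * (20/19) ^ k)) * (1 + n) ^ k"
          unfolding abs_mult using H c n by (intro mult_right_mono mult_mono) auto
        also have "\<dots> = (H * K) * ((20/19) * (1 + n)) ^ k" by (simp only: power_mult_distrib mult.assoc)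
        also have "\<dots> \<le> (H * K) * r ^ k"
          unfolding r_def using H K n by (intro mult_left_mono power_mono mult_right_mono) auto
        finally show "\<bar>H * c k\<bar> * (1 + n) ^ k \<le> (H * K) * r ^ k" .
      qed
      also have "\<dots> = (H * K) * (\<Sum>k<L. r ^ k)" by (simp add: sum_distrib_left)
      also have "(\<Sum>k<L. r ^ k) \<le> r ^ L"
      proof (induction L)
        case (Suc L)
        have "r ^ L + r ^ L \<le> r ^ Suc L"
        proof -
          have "2 * r ^ L \<le> r * r ^ L" using n by (intro mult_right_mono) (auto simp: r_def)
          then show ?thesis by simp
        qed
        then show ?case using Suc by simp
      qed simp
      then have "(H * K) * (\<Sum>k<L. r ^ k) \<le> (H * K) * r ^ L" using H K by (intro mult_left_mono) auto
      also have "\<dots> \<le> K' * r ^ L" unfolding K'_def using n by (intro mult_right_mono) (auto simp: r_def)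
      finally show ?thesis .
    qed
    note bound = this
    have approx: "\<bar>frac_kernel s x y - (\<Sum>\<alpha>\<in>multi_box (2 * L). monomial \<alpha> x * b \<alpha> y)\<bar> \<le> K' * (18/19) ^ L"
      if xy: "norm x < 1" "2 < norm y" "norm y < 3" for x y :: 'a
    proof -
      have "(\<Sum>\<alpha>\<in>multi_box (2 * L). monomial \<alpha> x * b \<alpha> y) = H * (\<Sum>k<L. c k * dist_var x y ^ k)"
        unfolding b(3)[rule_format, symmetric] by (simp add: sum_distrib_left mult.assoc)
      then have "\<bar>frac_kernel s x y - (\<Sum>\<alpha>\<in>multi_box (2 * L). monomial \<alpha> x * b \<alpha> y)\<bar>
          = H * \<bar>(1 - dist_var x y) powr a - (\<Sum>k<L. c k * dist_var x y ^ k)\<bar>"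
        using H unfolding kern[OF xy] by (simp add: abs_mult flip: right_diff_distrib)
      also have "\<dots> \<le> H * (K * (18/19) ^ L)"
        using app dist_var_range(1)[OF xy] H by (intro mult_left_mono) auto
      also have "\<dots> \<le> K' * (18/19) ^ L" unfolding K'_def by (simp add: distrib_right)
      finally show ?thesis .
    qed
    show ?thesis
    proof (intro exI[of _ "\<lambda>\<alpha> y. complex_of_real (b \<alpha> y)"] conjI ballI allI impI)
      fix \<alpha> :: "'a \<Rightarrow> nat" assume \<alpha>: "\<alpha> \<in> multi_box (2 * L)"
      have [measurable]: "b \<alpha> \<in> borel_measurable borel" using b(1) \<alpha> by blast
      have "(\<lambda>y. complex_of_real (b \<alpha> y)) \<in> borel_measurable borel" by measurable
      then show "(\<lambda>y. complex_of_real (b \<alpha> y)) \<in> borel_measurable lebesgue" by (rule lborel_imp_lebesgue_measurable)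
      fix y :: 'a assume "y \<in> ball 0 3"
      then show "cmod (complex_of_real (b \<alpha> y)) \<le> K' * r ^ L" using b(2) \<alpha> bound by (force simp del: mem_ball)
    next
      fix x y :: 'a assume xy: "norm x < 1" "2 < norm y" "norm y < 3"
      have "cmod (of_real (frac_kernel s x y - (\<Sum>\<alpha>\<in>multi_box (2 * L). monomial \<alpha> x * b \<alpha> y))) \<le> K' * (18/19) ^ L"
        unfolding norm_of_real by (rule approx[OF xy])
      then show "cmod (of_real (frac_kernel s x y) - (\<Sum>\<alpha>\<in>multi_box (2 * L). of_real (monomial \<alpha> x) * of_real (b \<alpha> y))) \<le> K' * (18/19) ^ L"
        by (simp only: of_real_diff of_real_sum of_real_mult)
    qed
  qed
  note main = this
  have r: "r = real (2 * (1 + DIM('a)))" by (simp add: r_def n_def)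
  show ?thesis by (rule that[OF K']) (use main in \<open>simp only: r simp_thms\<close>)
qed

section \<open>Separated families of bump functions\<close>

lemma real_polynomial_function_derivative:
  fixes g :: "'a::real_normed_vector \<Rightarrow> real"
  assumes "real_polynomial_function g"
  shows "\<exists>D. (\<forall>x. (g has_derivative D x) (at x)) \<and> (\<forall>b. real_polynomial_function (\<lambda>x. D x b))"
  using assms
proof (induction rule: real_polynomial_function.induct)
  case (linear f)
  have "(f has_derivative f) (at x)" for x by (rule bounded_linear_imp_has_derivative[OF linear])
  then show ?case by (intro exI[of _ "\<lambda>x. f"]) (auto intro: real_polynomial_function.intros(2))
next
  case (const c)
  show ?case by (intro exI[of _ "\<lambda>x h. 0"]) (auto intro: real_polynomial_function.intros(2))
next
  case (add f g)
  then obtain D E where "\<forall>x. (f has_derivative D x) (at x)" "\<forall>b. real_polynomial_function (\<lambda>x. D x b)"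
    "\<forall>x. (g has_derivative E x) (at x)" "\<forall>b. real_polynomial_function (\<lambda>x. E x b)" by blast
  then show ?case
    by (intro exI[of _ "\<lambda>x h. D x h + E x h"]) (auto intro: has_derivative_add real_polynomial_function.intros(3))
next
  case (mult f g)
  then obtain D E where D: "\<forall>x. (f has_derivative D x) (at x)" "\<forall>b. real_polynomial_function (\<lambda>x. D x b)"
    and E: "\<forall>x. (g has_derivative E x) (at x)" "\<forall>b. real_polynomial_function (\<lambda>x. E x b)" by blast
  show ?case
  proof (intro exI[of _ "\<lambda>x h. f x * E x h + D x h * g x"] conjI allI)
    show "((\<lambda>x. f x * g x) has_derivative (\<lambda>h. f x * E x h + D x h * g x)) (at x)" for x
      by (rule has_derivative_mult[OF D(1)[rule_format] E(1)[rule_format]])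
    show "real_polynomial_function (\<lambda>x. f x * E x b + D x b * g x)" for b
      by (intro real_polynomial_function.intros(3) real_polynomial_function.intros(4) mult.hyps D(2)[rule_format] E(2)[rule_format])
  qed
qed

lemma has_real_derivative_pos_part_power:
  "((\<lambda>t::real. max 0 t ^ Suc (Suc k)) has_real_derivative (real (Suc (Suc k)) * max 0 t ^ Suc k)) (at t)"
proof -
  consider "t > 0" | "t < 0" | "t = 0" by linarith
  then show ?thesis
  proof cases
    case 1
    have "((\<lambda>t. t ^ Suc (Suc k)) has_real_derivative (real (Suc (Suc k)) * t ^ Suc k)) (at t)"
      using DERIV_pow[of "Suc (Suc k)" t UNIV] by simp
    then have "((\<lambda>t. max 0 t ^ Suc (Suc k)) has_real_derivative (real (Suc (Suc k)) * t ^ Suc k)) (at t)"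
      by (rule has_field_derivative_transform_within_open[where S="{0<..}"]) (use 1 in auto)
    then show ?thesis using 1 by (simp add: max_def)
  next
    case 2
    have "((\<lambda>t. 0) has_real_derivative 0) (at t)" by simp
    then have "((\<lambda>t. max 0 t ^ Suc (Suc k)) has_real_derivative 0) (at t)"
      by (rule has_field_derivative_transform_within_open[where S="{..<0}"]) (use 2 in auto)
    then show ?thesis using 2 by (simp add: max_def)
  next
    case 3
    have "((\<lambda>h::real. max 0 h ^ Suc (Suc k) / h) \<longlongrightarrow> 0) (at 0)"
    proof (rule Lim_null_comparison)
      have "((\<lambda>h::real. \<bar>h\<bar> ^ Suc k) \<longlongrightarrow> \<bar>0\<bar> ^ Suc k) (at 0)" by (intro tendsto_intros)
      then show "((\<lambda>h::real. \<bar>h\<bar> ^ Suc k) \<longlongrightarrow> 0) (at 0)" by simp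
      have "norm (max 0 h ^ Suc (Suc k) / h) \<le> \<bar>h\<bar> ^ Suc k" if "h \<noteq> 0" for h :: real
      proof (cases "h > 0")
        case True
        then show ?thesis by (simp add: max_def)
      next
        case False
        then have "max 0 h ^ Suc (Suc k) / h = 0" by simp
        note e = this
        show ?thesis unfolding e norm_zero by (rule zero_le_power) simp
      qed
      then show "\<forall>\<^sub>F h in at 0. norm (max 0 h ^ Suc (Suc k) / h) \<le> \<bar>h\<bar> ^ Suc k"
        by (auto simp: eventually_at_filter)
    qed
    then show ?thesis unfolding 3 by (simp add: DERIV_def)
  qed
qed

text \<open>Polynomials times a power of the cut-off (1 - |x|^2)_+. This class is closed under differentiation as
  long as the power stays positive, which makes all derivatives of a bump continuous and supported in
  the unit ball.\<close>

definition bumpy :: "nat \<Rightarrow> ('a::euclidean_space \<Rightarrow> real) \<Rightarrow> bool" where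
  "bumpy k f \<longleftrightarrow> (\<exists>g. real_polynomial_function g \<and> f = (\<lambda>x. g x * max 0 (1 - (norm x)\<^sup>2) ^ k))"

lemma real_polynomial_function_norm_squared:
  "real_polynomial_function (\<lambda>x::'a::euclidean_space. (norm x)\<^sup>2)"
proof -
  have "(\<lambda>x::'a. (norm x)\<^sup>2) = (\<lambda>x. \<Sum>b\<in>Basis. (x \<bullet> b)\<^sup>2)" by (auto simp: norm_squared_Basis)
  note e = this
  show ?thesis unfolding e
    by (intro real_polynomial_function_sum real_polynomial_function_power real_polynomial_function.intros(1) bounded_linear_inner_left finite_Basis)
qed

lemma bumpy_continuous: "bumpy k f \<Longrightarrow> continuous_on UNIV f"
proof -
  assume "bumpy k f"
  then obtain g where g: "real_polynomial_function g" "f = (\<lambda>x. g x * max 0 (1 - (norm x)\<^sup>2) ^ k)"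
    by (auto simp: bumpy_def)
  show ?thesis unfolding g(2)
    by (intro continuous_intros continuous_on_polymonial_function g(1)[unfolded real_polynomial_function_eq])
qed

lemma bumpy_outside: "bumpy (Suc k) f \<Longrightarrow> norm x \<ge> 1 \<Longrightarrow> f x = 0"
proof -
  assume "bumpy (Suc k) f" "norm x \<ge> 1"
  moreover from this have "max 0 (1 - (norm x)\<^sup>2) = 0" by simp
  ultimately show ?thesis unfolding bumpy_def by auto
qed

text \<open>Differentiation lowers the power of the cut-off by one.\<close>

lemma bumpy_derivative:
  fixes f :: "'a::euclidean_space \<Rightarrow> real"
  assumes "bumpy (Suc (Suc k)) f"
  shows "\<exists>D. (\<forall>x. (f has_derivative D x) (at x)) \<and> (\<forall>b. bumpy (Suc k) (\<lambda>x. D x b))"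
proof -
  obtain g where g: "real_polynomial_function g" "f = (\<lambda>x. g x * max 0 (1 - (norm x)\<^sup>2) ^ Suc (Suc k))"
    using assms by (auto simp: bumpy_def)
  obtain E where E: "\<forall>x. (g has_derivative E x) (at x)" "\<forall>b. real_polynomial_function (\<lambda>x. E x b)"
    using real_polynomial_function_derivative[OF g(1)] by blast
  define m where "m x = max 0 (1 - (norm x)\<^sup>2)" for x :: 'a
  define c where "c = real (Suc (Suc k))"
  have dm: "((\<lambda>x. m x ^ Suc (Suc k)) has_derivative (\<lambda>h. (c * m x ^ Suc k) * (- 2 * (x \<bullet> h)))) (at x)" for x :: 'a
  proof -
    have "((\<lambda>x::'a. 1 - x \<bullet> x) has_derivative (\<lambda>h. 0 - (x \<bullet> h + h \<bullet> x))) (at x)"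
      by (intro has_derivative_diff has_derivative_const has_derivative_inner has_derivative_ident)
    then have 1: "((\<lambda>x::'a. 1 - (norm x)\<^sup>2) has_derivative (\<lambda>h. - 2 * (x \<bullet> h))) (at x)"
      by (simp add: power2_norm_eq_inner inner_commute)
    have 2: "((\<lambda>t. max 0 t ^ Suc (Suc k)) has_derivative (\<lambda>h. (c * max 0 (1 - (norm x)\<^sup>2) ^ Suc k) * h)) (at (1 - (norm x)\<^sup>2))"
      using has_real_derivative_pos_part_power[of k "1 - (norm x)\<^sup>2"] unfolding has_field_derivative_def c_def .
    from has_derivative_compose[OF 1 2] show ?thesis unfolding m_def .
  qed
  define D where "D x h = g x * ((c * m x ^ Suc k) * (- 2 * (x \<bullet> h))) + E x h * m x ^ Suc (Suc k)" for x h
  have D: "(f has_derivative D x) (at x)" for x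
    unfolding g(2) m_def[symmetric] D_def[abs_def] by (rule has_derivative_mult[OF E(1)[rule_format] dm])
  have "bumpy (Suc k) (\<lambda>x. D x b)" for b
  proof -
    define p where "p x = g x * (c * (- 2 * (x \<bullet> b))) + E x b * (1 - (norm x)\<^sup>2)" for x
    have "real_polynomial_function p"
      unfolding p_def
      by (intro real_polynomial_function.intros(3) real_polynomial_function.intros(4) real_polynomial_function.intros(2) g(1) E(2)[rule_format]
          real_polynomial_function_diff real_polynomial_function_norm_squared real_polynomial_function.intros(1) bounded_linear_inner_left)
    moreover have "D x b = p x * m x ^ Suc k" for x
    proof -
      have gen: "u * ((c * P) * (- 2 * y)) + v * (w * P) = (u * (c * (- 2 * y)) + v * w) * P" for u v w y P :: real
        by (simp add: algebra_simps)
      have "m x ^ Suc (Suc k) = (1 - (norm x)\<^sup>2) * m x ^ Suc k"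
        by (cases "1 - (norm x)\<^sup>2 \<ge> 0") (simp_all add: m_def max_def)
      note eq = this
      show ?thesis unfolding D_def p_def eq by (rule gen)
    qed
    ultimately show ?thesis unfolding bumpy_def m_def by blast
  qed
  then show ?thesis using D by blast
qed

lemma bumpy_partial_derivs:
  assumes "bumpy (Suc m) f" "length bs \<le> m"
  shows "bumpy (Suc (m - length bs)) (partial_derivs bs f)"
  using assms(2)
proof (induction bs)
  case (Cons b bs)
  then have IH: "bumpy (Suc (m - length bs)) (partial_derivs bs f)" and l: "length bs < m" by auto
  then have "Suc (m - length bs) = Suc (Suc (m - length (b # bs)))" by simp
  with IH obtain D where D: "\<forall>x. (partial_derivs bs f has_derivative D x) (at x)" "\<forall>b. bumpy (Suc (m - length (b # bs))) (\<lambda>x. D x b)"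
    using bumpy_derivative[of "m - length (b # bs)" "partial_derivs bs f"] by auto
  have "partial_derivs (b # bs) f = (\<lambda>x. D x b)"
    using frechet_derivative_at[OF D(1)[rule_format], symmetric] by simp
  then show ?case using D(2) by simp
qed (use assms(1) in simp)

lemma bumpy_C_fun:
  assumes "bumpy (Suc m) f"
  shows "C_fun m f"
  unfolding C_fun_def
proof (intro ballI conjI impI allI)
  fix bs :: "'a list" assume bs: "bs \<in> deriv_words m"
  then have l: "length bs \<le> m" by (simp add: deriv_words_def)
  note b = bumpy_partial_derivs[OF assms l]
  show "continuous_on UNIV (partial_derivs bs f)" by (rule bumpy_continuous[OF b])
  fix x assume "length bs < m"
  then have "Suc (m - length bs) = Suc (Suc (m - Suc (length bs)))" by simp
  with b bumpy_derivative[of "m - Suc (length bs)" "partial_derivs bs f"]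
  show "partial_derivs bs f differentiable at x" by (auto simp: differentiable_def)
qed

definition bump :: "nat \<Rightarrow> 'a::euclidean_space \<Rightarrow> real" where
  "bump m x = max 0 (1 - (norm x)\<^sup>2) ^ Suc m"

lemma bump_bumpy: "bumpy (Suc m) (bump m)"
  unfolding bumpy_def bump_def[abs_def]
  by (intro exI[of _ "\<lambda>x. 1"]) (auto intro: real_polynomial_function.intros(2))

lemma bump_range: "0 \<le> bump m x" "bump m x \<le> 1"
proof -
  show "0 \<le> bump m x" by (simp add: bump_def)
  show "bump m x \<le> 1" unfolding bump_def by (rule power_le_one) auto
qed

lemma bump_zero [simp]: "bump m 0 = 1"
  by (simp add: bump_def)

lemma bump_partial_outside: "length bs \<le> m \<Longrightarrow> norm x \<ge> 1 \<Longrightarrow> partial_derivs bs (bump m) x = 0"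
  using bumpy_outside[OF bumpy_partial_derivs[OF bump_bumpy]] .

lemma finite_deriv_words: "finite (deriv_words m :: 'a::euclidean_space list set)"
  unfolding deriv_words_def using finite_lists_length_le[of "Basis :: 'a set" m] by simp

lemma bump_partial_bound:
  obtains K where "K > 0" "\<forall>bs\<in>deriv_words m. \<forall>x::'a::euclidean_space. \<bar>partial_derivs bs (bump m) x\<bar> \<le> K"
proof -
  have "\<exists>K. \<forall>x::'a. \<bar>partial_derivs bs (bump m) x\<bar> \<le> K" if "bs \<in> deriv_words m" for bs
  proof -
    have l: "length bs \<le> m" using that by (simp add: deriv_words_def)
    have c: "continuous_on UNIV (partial_derivs bs (bump m) :: 'a \<Rightarrow> real)"
      by (rule bumpy_continuous[OF bumpy_partial_derivs[OF bump_bumpy l]])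
    have "compact (partial_derivs bs (bump m) ` cball (0::'a) 1)"
      by (intro compact_continuous_image continuous_on_subset[OF c]) auto
    then obtain K where K: "\<forall>z\<in>partial_derivs bs (bump m) ` cball (0::'a) 1. norm z \<le> K"
      using compact_imp_bounded bounded_iff by blast
    have "\<bar>partial_derivs bs (bump m) x\<bar> \<le> max K 0" for x :: 'a
    proof (cases "norm x \<le> 1")
      case True
      then have "x \<in> cball 0 1" by simp
      then have "norm (partial_derivs bs (bump m) x) \<le> K" using K by blast
      then show ?thesis by simp
    next
      case False
      then show ?thesis using bump_partial_outside[OF l, of x] by simp
    qed
    then show ?thesis by blast
  qed
  then obtain K where K: "\<And>bs x. bs \<in> deriv_words m \<Longrightarrow> \<bar>partial_derivs bs (bump m) (x::'a)\<bar> \<le> K bs" by metis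
  define M where "M = (\<Sum>bs\<in>(deriv_words m::'a list set). \<bar>K bs\<bar>) + 1"
  have "\<bar>partial_derivs bs (bump m) x\<bar> \<le> M" if "bs \<in> deriv_words m" for bs and x :: 'a
  proof -
    have "\<bar>K bs\<bar> \<le> (\<Sum>bs\<in>(deriv_words m::'a list set). \<bar>K bs\<bar>)"
      by (rule member_le_sum[OF that _ finite_deriv_words]) simp
    then show ?thesis using K[OF that, of x] by (simp add: M_def)
  qed
  moreover have "M > 0" unfolding M_def by (intro add_nonneg_pos sum_nonneg) auto
  ultimately show ?thesis using that by blast
qed

text \<open>Scaling by t multiplies a derivative of order k by t^k. This is where the condition that \<epsilon> M^m is
  bounded comes from.\<close>

lemma partial_derivs_affine:
  fixes f :: "'a::euclidean_space \<Rightarrow> real"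
  assumes f: "C_fun m f"
  shows "bs \<in> deriv_words m \<Longrightarrow> partial_derivs bs (\<lambda>x. f (t *\<^sub>R (x - a))) = (\<lambda>x. t ^ length bs * partial_derivs bs f (t *\<^sub>R (x - a)))"
proof (induction bs)
  case (Cons b bs)
  note * = deriv_words_ConsD[OF Cons.prems]
  have "((\<lambda>x. t ^ length bs * partial_derivs bs f (t *\<^sub>R (x - a))) has_derivative
      (\<lambda>h. t ^ length bs * frechet_derivative (partial_derivs bs f) (at (t *\<^sub>R (x - a))) (t *\<^sub>R h))) (at x)" for x
  proof -
    have 1: "((\<lambda>x. t *\<^sub>R (x - a)) has_derivative (\<lambda>h. t *\<^sub>R (h - 0))) (at x)"
      by (intro has_derivative_scaleR_right has_derivative_diff has_derivative_ident has_derivative_const)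
    have 2: "(partial_derivs bs f has_derivative frechet_derivative (partial_derivs bs f) (at (t *\<^sub>R (x - a)))) (at (t *\<^sub>R (x - a)))"
      by (rule C_funD(2)[OF f]) (use * in auto)
    from has_derivative_mult_right[OF has_derivative_compose[OF 1 2], of "t ^ length bs"] show ?thesis by simp
  qed
  note fd = frechet_derivative_at[OF this, symmetric]
  have lin: "linear (frechet_derivative (partial_derivs bs f) (at y))" for y
    by (rule has_derivative_linear[OF C_funD(2)[OF f]]) (use * in auto)
  have IH: "partial_derivs bs (\<lambda>x. f (t *\<^sub>R (x - a))) = (\<lambda>x. t ^ length bs * partial_derivs bs f (t *\<^sub>R (x - a)))"
    using Cons.IH * by blast
  show ?case
  proof
    fix x
    have "partial_derivs (b # bs) (\<lambda>x. f (t *\<^sub>R (x - a))) x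
        = t ^ length bs * frechet_derivative (partial_derivs bs f) (at (t *\<^sub>R (x - a))) (t *\<^sub>R b)"
      by (simp only: partial_derivs.simps IH fd)
    also have "\<dots> = t ^ length (b # bs) * partial_derivs (b # bs) f (t *\<^sub>R (x - a))"
      using linear_scale[OF lin] by simp
    finally show "partial_derivs (b # bs) (\<lambda>x. f (t *\<^sub>R (x - a))) x = t ^ length (b # bs) * partial_derivs (b # bs) f (t *\<^sub>R (x - a))" .
  qed
qed simp

lemma C_fun_affine:
  fixes f :: "'a::euclidean_space \<Rightarrow> real"
  assumes f: "C_fun m f"
  shows "C_fun m (\<lambda>x. f (t *\<^sub>R (x - a)))"
  unfolding C_fun_def
proof (intro ballI conjI impI allI)
  fix bs :: "'a list" assume bs: "bs \<in> deriv_words m"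
  note eq = partial_derivs_affine[OF f bs, of t a]
  show "continuous_on UNIV (partial_derivs bs (\<lambda>x. f (t *\<^sub>R (x - a))))"
    unfolding eq by (intro continuous_on_mult continuous_on_const continuous_on_compose2[OF C_funD(1)[OF f bs]] continuous_intros) auto
  fix x assume l: "length bs < m"
  have 1: "((\<lambda>x. t *\<^sub>R (x - a)) has_derivative (\<lambda>h. t *\<^sub>R (h - 0))) (at x)"
    by (intro has_derivative_scaleR_right has_derivative_diff has_derivative_ident has_derivative_const)
  have "partial_derivs bs f differentiable at (t *\<^sub>R (x - a))"
    using C_funD(2)[OF f bs l] by (auto simp: differentiable_def)
  then obtain D where "(partial_derivs bs f has_derivative D) (at (t *\<^sub>R (x - a)))" by (auto simp: differentiable_def)
  from has_derivative_mult_right[OF has_derivative_compose[OF 1 this], of "t ^ length bs"]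
  show "partial_derivs bs (\<lambda>x. f (t *\<^sub>R (x - a))) differentiable at x"
    unfolding eq by (auto simp: differentiable_def)
qed

lemma partial_derivs_sum:
  assumes "finite J" "\<And>j. j \<in> J \<Longrightarrow> C_fun m (f j)"
  shows "C_fun m (\<lambda>x. \<Sum>j\<in>J. f j x)"
    "bs \<in> deriv_words m \<Longrightarrow> partial_derivs bs (\<lambda>x. \<Sum>j\<in>J. f j x) = (\<lambda>x. \<Sum>j\<in>J. partial_derivs bs (f j) x)"
proof -
  have "C_fun m (\<lambda>x. \<Sum>j\<in>J. f j x) \<and> (bs \<in> deriv_words m \<longrightarrow>
      partial_derivs bs (\<lambda>x. \<Sum>j\<in>J. f j x) = (\<lambda>x. \<Sum>j\<in>J. partial_derivs bs (f j) x))"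
    using assms
  proof (induction J rule: finite_induct)
    case empty
    show ?case by (simp add: C_fun_zero partial_derivs_zero)
  next
    case (insert j J)
    then show ?case using C_fun_add[of m "f j" "\<lambda>x. \<Sum>j\<in>J. f j x"] partial_derivs_add[of m "f j" "\<lambda>x. \<Sum>j\<in>J. f j x" bs] by simp
  qed
  then show "C_fun m (\<lambda>x. \<Sum>j\<in>J. f j x)"
    "bs \<in> deriv_words m \<Longrightarrow> partial_derivs bs (\<lambda>x. \<Sum>j\<in>J. f j x) = (\<lambda>x. \<Sum>j\<in>J. partial_derivs bs (f j) x)" by blast+
qed

definition grid :: "nat \<Rightarrow> ('a::euclidean_space \<Rightarrow> nat) set" where
  "grid M = PiE Basis (\<lambda>_. {1..M})"

lemma finite_grid: "finite (grid M)"
  unfolding grid_def by (intro finite_PiE) auto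

lemma card_grid: "card (grid M :: ('a::euclidean_space \<Rightarrow> nat) set) = M ^ DIM('a)"
  unfolding grid_def by (subst card_PiE) auto

text \<open>The points lie within distance 1/2 of the origin, and neighbours have distance 1 / (2 n M).\<close>

definition grid_point :: "nat \<Rightarrow> ('a::euclidean_space \<Rightarrow> nat) \<Rightarrow> 'a" where
  "grid_point M \<kappa> = (1 / (2 * DIM('a) * M)) *\<^sub>R (\<Sum>i\<in>Basis. real (\<kappa> i) *\<^sub>R i)"

lemma grid_point_inner:
  "i \<in> Basis \<Longrightarrow> grid_point M \<kappa> \<bullet> i = (1 / (2 * DIM('a) * M)) * real (\<kappa> (i::'a::euclidean_space))"
  by (simp add: grid_point_def inner_sum_left_Basis)

lemma grid_point_norm:
  assumes "\<kappa> \<in> grid M" "M \<ge> 1"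
  shows "norm (grid_point M \<kappa> :: 'a::euclidean_space) \<le> 1 / 2"
proof -
  have M: "real M > 0" and n: "real DIM('a) > 0" using assms(2) by auto
  have "norm (\<Sum>i\<in>Basis. real (\<kappa> i) *\<^sub>R i :: 'a) \<le> (\<Sum>i\<in>(Basis::'a set). real M)"
  proof (rule sum_norm_le)
    fix i :: 'a assume "i \<in> Basis"
    then show "norm (real (\<kappa> i) *\<^sub>R i) \<le> real M" using assms(1) by (auto simp: grid_def PiE_iff)
  qed
  then have "norm (\<Sum>i\<in>Basis. real (\<kappa> i) *\<^sub>R i :: 'a) \<le> real DIM('a) * M" by simp
  then have "(1 / (2 * DIM('a) * M)) * norm (\<Sum>i\<in>Basis. real (\<kappa> i) *\<^sub>R i :: 'a) \<le> (1 / (2 * DIM('a) * M)) * (real DIM('a) * M)"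
    by (intro mult_left_mono) auto
  also have "\<dots> = 1 / 2" using M n by simp
  finally show ?thesis by (simp add: grid_point_def)
qed

text \<open>The bumps have radius 1 / (4 n M), half the distance of neighbouring grid points, so their supports
  have disjoint interiors.\<close>

lemma grid_point_separated:
  fixes x :: "'a::euclidean_space"
  assumes k: "\<kappa> \<in> grid M" "\<kappa>' \<in> grid M" and M: "M \<ge> 1"
    and x: "norm ((4 * DIM('a) * M) *\<^sub>R (x - grid_point M \<kappa>)) < 1" "norm ((4 * DIM('a) * M) *\<^sub>R (x - grid_point M \<kappa>')) < 1"
  shows "\<kappa> = \<kappa>'"
proof (rule ccontr)
  assume ne: "\<kappa> \<noteq> \<kappa>'"
  define T where "T = real (2 * DIM('a) * M)"
  have T: "T > 0" using M by (simp add: T_def)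
  have T2: "real (4 * DIM('a) * M) = 2 * T" by (simp add: T_def)
  obtain i where i: "\<kappa> i \<noteq> \<kappa>' i" using ne by auto
  have iB: "i \<in> Basis" 
  proof (rule ccontr)
    assume "i \<notin> Basis"
    then have "\<kappa> i = undefined" "\<kappa>' i = undefined" using k by (auto simp: grid_def PiE_iff extensional_def)
    then show False using i by simp
  qed
  have tri: "norm (grid_point M \<kappa> - grid_point M \<kappa>') \<le> norm (x - grid_point M \<kappa>) + norm (x - grid_point M \<kappa>')"
    using norm_triangle_ineq4[of "x - grid_point M \<kappa>'" "x - grid_point M \<kappa>"] by simp
  have "(2 * T) * norm (x - grid_point M \<kappa>) < 1" "(2 * T) * norm (x - grid_point M \<kappa>') < 1"
    using x T unfolding T2 by simp_all
  then have "(2 * T) * (norm (x - grid_point M \<kappa>) + norm (x - grid_point M \<kappa>')) < 2"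
    unfolding distrib_left by linarith
  moreover have "(2 * T) * norm (grid_point M \<kappa> - grid_point M \<kappa>') \<le> (2 * T) * (norm (x - grid_point M \<kappa>) + norm (x - grid_point M \<kappa>'))"
    by (rule mult_left_mono[OF tri]) (use T in simp)
  ultimately have "2 * (T * norm (grid_point M \<kappa> - grid_point M \<kappa>')) < 2"
    unfolding mult.assoc by (rule le_less_trans[rotated])
  then have "T * norm (grid_point M \<kappa> - grid_point M \<kappa>') < 1" by simp
  moreover have "1 \<le> T * norm (grid_point M \<kappa> - grid_point M \<kappa>')"
  proof -
    have "1 \<le> \<bar>real (\<kappa> i) - real (\<kappa>' i)\<bar>" using i by linarith
    also have "\<dots> = \<bar>T * ((grid_point M \<kappa> - grid_point M \<kappa>') \<bullet> i)\<bar>"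
      using T M unfolding inner_diff_left grid_point_inner[OF iB] T_def by (simp add: right_diff_distrib)
    also have "\<dots> \<le> T * norm (grid_point M \<kappa> - grid_point M \<kappa>')"
      unfolding abs_mult using T Basis_le_norm[OF iB] by (intro mult_mono) auto
    finally show ?thesis .
  qed
  ultimately show False by linarith
qed

definition bumps :: "nat \<Rightarrow> nat \<Rightarrow> real \<Rightarrow> ('a::euclidean_space \<Rightarrow> nat) set \<Rightarrow> 'a \<Rightarrow> real" where
  "bumps m M \<epsilon> S x = (\<Sum>\<kappa>\<in>S. \<epsilon> * bump m ((4 * DIM('a) * M) *\<^sub>R (x - grid_point M \<kappa>)))"

text \<open>At every point at most one of the summands, and of their derivatives, is nonzero.\<close>

lemma disjoint_sum:
  fixes F :: "('a::euclidean_space \<Rightarrow> nat) \<Rightarrow> real"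
  assumes S: "S \<subseteq> grid M" and M: "M \<ge> 1" and b: "\<And>\<kappa>. \<bar>F \<kappa>\<bar> \<le> c" "c \<ge> 0"
    and z: "\<And>\<kappa>. norm ((4 * DIM('a) * M) *\<^sub>R (x - grid_point M \<kappa> :: 'a)) \<ge> 1 \<Longrightarrow> F \<kappa> = 0"
  shows "(\<Sum>\<kappa>\<in>S. F \<kappa>) = 0 \<or> (\<exists>\<kappa>\<in>S. (\<Sum>\<kappa>\<in>S. F \<kappa>) = F \<kappa>)" "\<bar>\<Sum>\<kappa>\<in>S. F \<kappa>\<bar> \<le> c"
proof -
  have fin: "finite S" using S finite_grid finite_subset by blast
  show 1: "(\<Sum>\<kappa>\<in>S. F \<kappa>) = 0 \<or> (\<exists>\<kappa>\<in>S. (\<Sum>\<kappa>\<in>S. F \<kappa>) = F \<kappa>)"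
  proof (cases "\<exists>\<kappa>\<in>S. norm ((4 * DIM('a) * M) *\<^sub>R (x - grid_point M \<kappa> :: 'a)) < 1")
    case True
    then obtain \<kappa> where \<kappa>: "\<kappa> \<in> S" "norm ((4 * DIM('a) * M) *\<^sub>R (x - grid_point M \<kappa> :: 'a)) < 1" by blast
    have "F \<kappa>' = 0" if "\<kappa>' \<in> S - {\<kappa>}" for \<kappa>'
    proof (rule z, rule ccontr)
      assume "\<not> 1 \<le> norm ((4 * DIM('a) * M) *\<^sub>R (x - grid_point M \<kappa>' :: 'a))"
      then have "norm ((4 * DIM('a) * M) *\<^sub>R (x - grid_point M \<kappa>' :: 'a)) < 1" by (simp only: not_le)
      from grid_point_separated[OF _ _ M \<kappa>(2) this] show False using that \<kappa>(1) S by blast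
    qed
    then have "(\<Sum>\<kappa>\<in>S. F \<kappa>) = F \<kappa>" using fin \<kappa>(1) by (simp add: sum.remove)
    then show ?thesis using \<kappa>(1) by blast
  next
    case False
    then have "F \<kappa> = 0" if "\<kappa> \<in> S" for \<kappa> using z that by (meson not_le)
    then show ?thesis by simp
  qed
  then show "\<bar>\<Sum>\<kappa>\<in>S. F \<kappa>\<bar> \<le> c" using b by (metis abs_zero)
qed

text \<open>Since the supports are disjoint, the sum obeys the bounds of a single bump. At a grid point that
  belongs to exactly one of two sets, the two sums take the values \<epsilon> and 0.\<close>

lemma bumps_family:
  obtains \<beta> where "\<beta> > 0"
    "\<forall>\<epsilon>>0::real. \<forall>M\<ge>1. \<epsilon> * real (4 * DIM('a::euclidean_space) * M) ^ m \<le> 1 \<longrightarrow> (\<forall>S\<subseteq>grid M.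
        (bumps m M \<epsilon> S :: 'a \<Rightarrow> real) \<in> Cc m (ball 0 1) \<and> C_norm m (cball 0 1) (bumps m M \<epsilon> S :: 'a \<Rightarrow> real) \<le> \<beta> \<and>
        (\<forall>x::'a. 0 \<le> bumps m M \<epsilon> S x \<and> bumps m M \<epsilon> S x \<le> \<epsilon>) \<and>
        (\<forall>S'\<subseteq>grid M. S \<noteq> S' \<longrightarrow> (\<exists>a\<in>ball (0::'a) 1. \<bar>bumps m M \<epsilon> S a - bumps m M \<epsilon> S' a\<bar> = \<epsilon>)))"
proof -
  obtain K where K: "K > 0" "\<forall>bs\<in>deriv_words m. \<forall>x::'a. \<bar>partial_derivs bs (bump m) x\<bar> \<le> K"
    by (rule bump_partial_bound)
  have main: "(bumps m M \<epsilon> S :: 'a \<Rightarrow> real) \<in> Cc m (ball 0 1)" "C_norm m (cball 0 1) (bumps m M \<epsilon> S :: 'a \<Rightarrow> real) \<le> K"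
    "\<forall>x::'a. 0 \<le> bumps m M \<epsilon> S x \<and> bumps m M \<epsilon> S x \<le> \<epsilon>"
    "\<forall>S'\<subseteq>grid M. S \<noteq> S' \<longrightarrow> (\<exists>a\<in>ball (0::'a) 1. \<bar>bumps m M \<epsilon> S a - bumps m M \<epsilon> S' a\<bar> = \<epsilon>)"
    if e: "\<epsilon> > 0" and M: "M \<ge> 1" and small: "\<epsilon> * real (4 * DIM('a) * M) ^ m \<le> 1" and S: "S \<subseteq> grid M" for \<epsilon> M S
  proof -
    define t where "t = real (4 * DIM('a) * M)"
    have "4 * DIM('a) * M \<ge> 4" using M by (simp add: Suc_le_eq)
    then have t: "t \<ge> 4" unfolding t_def by linarith
    have fin: "finite S" using S finite_grid finite_subset by blast
    define f where "f \<kappa> x = bump m (t *\<^sub>R (x - grid_point M \<kappa>))" for \<kappa> and x :: 'a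
    have bumps: "bumps m M \<epsilon> S = (\<lambda>x. \<Sum>\<kappa>\<in>S. \<epsilon> * f \<kappa> x)" by (simp add: bumps_def[abs_def] f_def t_def)
    have Cf0: "C_fun m (f \<kappa>)" for \<kappa> unfolding f_def by (rule C_fun_affine[OF bumpy_C_fun[OF bump_bumpy]])
    have Cf: "C_fun m (\<lambda>x. \<epsilon> * f \<kappa> x)" for \<kappa>
      by (rule C_fun_bounded_linear[OF bounded_linear_mult_right Cf0])
    have Cb: "C_fun m (bumps m M \<epsilon> S)" unfolding bumps by (rule partial_derivs_sum(1)[OF fin Cf])
    have out: "f \<kappa> x = 0" if "norm (t *\<^sub>R (x - grid_point M \<kappa>)) \<ge> 1" for \<kappa> x
      unfolding f_def using that by (rule bumpy_outside[OF bump_bumpy])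
    show "(bumps m M \<epsilon> S :: 'a \<Rightarrow> real) \<in> Cc m (ball 0 1)"
    proof -
      have "bumps m M \<epsilon> S x = 0" if x: "x \<notin> cball 0 (3/4)" for x :: 'a
      proof -
        have "\<epsilon> * f \<kappa> x = 0" if "\<kappa> \<in> S" for \<kappa>
        proof -
          have "norm (grid_point M \<kappa> :: 'a) \<le> 1/2" using grid_point_norm S M that by blast
          then have "1/4 \<le> norm (x - grid_point M \<kappa>)" using x norm_triangle_ineq2[of x "grid_point M \<kappa>"] by simp
          then have "4 * (1/4) \<le> t * norm (x - grid_point M \<kappa>)" using t by (intro mult_mono) auto
          then have "norm (t *\<^sub>R (x - grid_point M \<kappa>)) \<ge> 1" using t by simp
          then show ?thesis using out by simp
        qed
        then show ?thesis unfolding bumps by (intro sum.neutral ballI)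
      qed
      then have "compactly_supported_in (ball 0 1) (bumps m M \<epsilon> S)"
        unfolding compactly_supported_in_iff by (intro exI[of _ "cball 0 (3/4)"]) auto
      then show ?thesis using Cb by (simp add: Cc_def)
    qed
    have bound: "\<bar>partial_derivs bs (bumps m M \<epsilon> S) x\<bar> \<le> K" if bs: "bs \<in> deriv_words m" for bs and x :: 'a
    proof -
      have l: "length bs \<le> m" using bs by (simp add: deriv_words_def)
      define F where "F \<kappa> = \<epsilon> * (t ^ length bs * partial_derivs bs (bump m) (t *\<^sub>R (x - grid_point M \<kappa>)))" for \<kappa>
      have eq1: "partial_derivs bs (\<lambda>x. \<epsilon> * f \<kappa> x) x = F \<kappa>" for \<kappa>
        unfolding partial_derivs_bounded_linear[OF bounded_linear_mult_right Cf0 bs] F_def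
        unfolding f_def partial_derivs_affine[OF bumpy_C_fun[OF bump_bumpy] bs] ..
      have eq: "partial_derivs bs (bumps m M \<epsilon> S) x = (\<Sum>\<kappa>\<in>S. F \<kappa>)"
        unfolding bumps partial_derivs_sum(2)[OF fin Cf bs] eq1 ..
      have "\<bar>\<Sum>\<kappa>\<in>S. F \<kappa>\<bar> \<le> K"
      proof (rule disjoint_sum(2)[OF S M, where x = x])
        show "\<bar>F \<kappa>\<bar> \<le> K" for \<kappa>
        proof -
          have "t ^ length bs \<le> t ^ m" using t l by (intro power_increasing) auto
          then have "\<epsilon> * t ^ length bs \<le> \<epsilon> * t ^ m" using e by (intro mult_left_mono) auto
          then have "\<epsilon> * t ^ length bs \<le> 1" using small unfolding t_def by linarith
          moreover have "\<bar>partial_derivs bs (bump m) (t *\<^sub>R (x - grid_point M \<kappa>))\<bar> \<le> K" using K(2) bs by blast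
          ultimately have "(\<epsilon> * t ^ length bs) * \<bar>partial_derivs bs (bump m) (t *\<^sub>R (x - grid_point M \<kappa>))\<bar> \<le> 1 * K"
            using e t by (intro mult_mono) auto
          moreover have "\<bar>F \<kappa>\<bar> = (\<epsilon> * t ^ length bs) * \<bar>partial_derivs bs (bump m) (t *\<^sub>R (x - grid_point M \<kappa>))\<bar>"
            using e t by (simp add: F_def abs_mult)
          ultimately show ?thesis by simp
        qed
        show "F \<kappa> = 0" if "1 \<le> norm (real (4 * DIM('a) * M) *\<^sub>R (x - grid_point M \<kappa>))" for \<kappa>
          using bump_partial_outside[OF l that] unfolding F_def t_def by simp
      qed (use K in simp)
      then show ?thesis using eq by simp
    qed
    show "C_norm m (cball 0 1) (bumps m M \<epsilon> S :: 'a \<Rightarrow> real) \<le> K"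
      unfolding C_norm_def
    proof (rule cSUP_least)
      have "([], 0) \<in> deriv_words m \<times> cball (0::'a) 1" by (simp add: deriv_words_def)
      then show "deriv_words m \<times> cball (0::'a) 1 \<noteq> {}" by blast
    qed (use bound in auto)
    have range: "0 \<le> bumps m M \<epsilon> S' x \<and> bumps m M \<epsilon> S' x \<le> \<epsilon>" if S': "S' \<subseteq> grid M" for S' and x :: 'a
    proof -
      have z: "\<epsilon> * f \<kappa> x = 0" if "1 \<le> norm (real (4 * DIM('a) * M) *\<^sub>R (x - grid_point M \<kappa>))" for \<kappa>
        using out[of x \<kappa>] that unfolding t_def by simp
      have b: "\<bar>\<epsilon> * f \<kappa> x\<bar> \<le> \<epsilon>" for \<kappa>
        using e bump_range[of m "t *\<^sub>R (x - grid_point M \<kappa>)"] by (simp add: f_def abs_mult mult_left_le)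
      have "(\<Sum>\<kappa>\<in>S'. \<epsilon> * f \<kappa> x) = bumps m M \<epsilon> S' x" by (simp add: bumps_def f_def t_def)
      note eq = this
      have nn: "(\<Sum>\<kappa>\<in>S'. \<epsilon> * f \<kappa> x) \<ge> 0"
        by (intro sum_nonneg mult_nonneg_nonneg) (use e bump_range(1) in \<open>simp_all add: f_def\<close>)
      have le: "\<bar>\<Sum>\<kappa>\<in>S'. \<epsilon> * f \<kappa> x\<bar> \<le> \<epsilon>" by (rule disjoint_sum(2)[OF S' M b _ z]) (use e in simp_all)
      show ?thesis using nn le unfolding eq by simp
    qed
    then show "\<forall>x::'a. 0 \<le> bumps m M \<epsilon> S x \<and> bumps m M \<epsilon> S x \<le> \<epsilon>" using S by blast
    have at: "bumps m M \<epsilon> S' (grid_point M \<kappa>) = (if \<kappa> \<in> S' then \<epsilon> else 0)" if S': "S' \<subseteq> grid M" and \<kappa>: "\<kappa> \<in> grid M" for S' and \<kappa> :: "'a \<Rightarrow> nat"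
    proof -
      have fin': "finite S'" using S' finite_grid finite_subset by blast
      have "f \<kappa>' (grid_point M \<kappa>) = (if \<kappa>' = \<kappa> then 1 else 0)" if "\<kappa>' \<in> S'" for \<kappa>'
      proof (cases "\<kappa>' = \<kappa>")
        case True
        then show ?thesis by (simp add: f_def)
      next
        case False
        have "\<not> norm (t *\<^sub>R (grid_point M \<kappa> - grid_point M \<kappa>' :: 'a)) < 1"
        proof
          assume a: "norm (t *\<^sub>R (grid_point M \<kappa> - grid_point M \<kappa>' :: 'a)) < 1"
          have "norm (real (4 * DIM('a) * M) *\<^sub>R (grid_point M \<kappa> - grid_point M \<kappa> :: 'a)) < 1" by simp
          from grid_point_separated[OF \<kappa> _ M this a[unfolded t_def]] show False using that S' False by blast
        qed
        then show ?thesis using False out[of "grid_point M \<kappa>" \<kappa>'] by simp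
      qed
      then have "(\<Sum>\<kappa>'\<in>S'. \<epsilon> * f \<kappa>' (grid_point M \<kappa>)) = (\<Sum>\<kappa>'\<in>S'. if \<kappa>' = \<kappa> then \<epsilon> else 0)"
        by (intro sum.cong refl) simp
      also have "\<dots> = (if \<kappa> \<in> S' then \<epsilon> else 0)" using fin' by simp
      finally show ?thesis by (simp add: bumps_def f_def t_def)
    qed
    show "\<forall>S'\<subseteq>grid M. S \<noteq> S' \<longrightarrow> (\<exists>a\<in>ball (0::'a) 1. \<bar>bumps m M \<epsilon> S a - bumps m M \<epsilon> S' a\<bar> = \<epsilon>)"
    proof (intro allI impI)
      fix S' assume S': "S' \<subseteq> grid M" "S \<noteq> S'"
      then obtain \<kappa> where \<kappa>: "\<kappa> \<in> S \<longleftrightarrow> \<kappa> \<notin> S'" by blast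
      then have kg: "\<kappa> \<in> grid M" using S S'(1) by blast
      have "\<bar>bumps m M \<epsilon> S (grid_point M \<kappa>) - bumps m M \<epsilon> S' (grid_point M \<kappa>)\<bar> = \<epsilon>"
        unfolding at[OF S kg] at[OF S'(1) kg] using \<kappa> e by auto
      moreover have "grid_point M \<kappa> \<in> ball (0::'a) 1" using grid_point_norm[OF kg M] by simp
      ultimately show "\<exists>a\<in>ball (0::'a) 1. \<bar>bumps m M \<epsilon> S a - bumps m M \<epsilon> S' a\<bar> = \<epsilon>" by blast
    qed
  qed
  show ?thesis 
    by (rule that[OF K(1)], intro allI impI)
       (rule conjI[OF main(1) conjI[OF main(2) conjI[OF main(3) main(4)]]]; assumption)
qed

section \<open>Counting cells\<close>

text \<open>Sort the values into squares of side \<eta>. There are at most 2 N + 1 choices for each of the real and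
  imaginary parts, and two vectors in the same cell differ by at most 2 \<eta> in every entry.\<close>

lemma pigeonhole_complex_vectors:
  fixes v :: "'b \<Rightarrow> 'c \<Rightarrow> complex"
  assumes F: "finite F" and I: "finite I" and \<eta>: "\<eta> > 0"
    and bound: "\<And>x i. x \<in> F \<Longrightarrow> i \<in> I \<Longrightarrow> cmod (v x i) \<le> C" and N: "C / \<eta> \<le> real N"
    and many: "(2 * N + 1) ^ (2 * card I) < card F"
  shows "\<exists>x\<in>F. \<exists>y\<in>F. x \<noteq> y \<and> (\<forall>i\<in>I. cmod (v x i - v y i) \<le> 2 * \<eta>)"
proof -
  define c where "c x = restrict (\<lambda>i. (\<lfloor>Re (v x i) / \<eta>\<rfloor>, \<lfloor>Im (v x i) / \<eta>\<rfloor>)) I" for x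
  define cells where "cells = PiE I (\<lambda>_. {- int N..int N} \<times> {- int N..int N})"
  have fl: "\<lfloor>t / \<eta>\<rfloor> \<in> {- int N..int N}" if "\<bar>t\<bar> \<le> C" for t :: real
  proof -
    have "\<bar>t / \<eta>\<bar> \<le> C / \<eta>" using that \<eta> by (simp add: divide_right_mono)
    then have "\<bar>t / \<eta>\<bar> \<le> real N" using N by linarith
    then have "- real N \<le> t / \<eta>" "t / \<eta> \<le> real N" by linarith+
    then show ?thesis by (simp add: le_floor_iff floor_le_iff)
  qed
  have "c x \<in> cells" if "x \<in> F" for x
  proof -
    have "(\<lfloor>Re (v x i) / \<eta>\<rfloor>, \<lfloor>Im (v x i) / \<eta>\<rfloor>) \<in> {- int N..int N} \<times> {- int N..int N}" if "i \<in> I" for i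
      using bound[OF \<open>x \<in> F\<close> that] abs_Re_le_cmod[of "v x i"] abs_Im_le_cmod[of "v x i"]
      by (intro SigmaI fl) linarith+
    then show ?thesis unfolding cells_def c_def by (simp add: restrict_PiE_iff)
  qed
  then have sub: "c ` F \<subseteq> cells" by blast
  have fin: "finite cells" unfolding cells_def using I by (intro finite_PiE) auto
  have "card cells = (2 * N + 1) ^ (2 * card I)"
    unfolding cells_def using I by (simp add: card_PiE card_cartesian_product nat_add_distrib nat_mult_distrib power_mult power2_eq_square)
  then have "card (c ` F) < card F" using card_mono[OF fin sub] many by linarith
  then have "\<not> inj_on c F" by (rule pigeonhole)
  then obtain x y where xy: "x \<in> F" "y \<in> F" "x \<noteq> y" "c x = c y" by (auto simp: inj_on_def)
  have near: "\<bar>t - t'\<bar> \<le> \<eta>" if "\<lfloor>t / \<eta>\<rfloor> = \<lfloor>t' / \<eta>\<rfloor>" for t t' :: real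
  proof -
    have "\<bar>t / \<eta> - t' / \<eta>\<bar> < 1"
      using that floor_correct[of "t / \<eta>"] floor_correct[of "t' / \<eta>"] by linarith
    then have "\<bar>t - t'\<bar> / \<eta> < 1" using \<eta> by (simp add: diff_divide_distrib[symmetric])
    then show ?thesis using \<eta> by (simp add: field_simps)
  qed
  have "cmod (v x i - v y i) \<le> 2 * \<eta>" if i: "i \<in> I" for i
  proof -
    have "c x i = c y i" using xy(4) by simp
    then have "\<lfloor>Re (v x i) / \<eta>\<rfloor> = \<lfloor>Re (v y i) / \<eta>\<rfloor>" "\<lfloor>Im (v x i) / \<eta>\<rfloor> = \<lfloor>Im (v y i) / \<eta>\<rfloor>"
      using i by (simp_all add: c_def)
    from near[OF this(1)] near[OF this(2)] show ?thesis
      using cmod_le[of "v x i - v y i"] by simp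
  qed
  then show ?thesis using xy by blast
qed

lemma power_le_two_power:
  fixes r :: real
  obtains P :: nat where "r \<le> 2 ^ P"
  by (meson real_arch_pow[of 2 r] less_imp_le one_less_numeral_iff semiring_norm(76))

text \<open>The truncation order L is taken of size X. The number of cells is then the exponential of
  a multiple of \<open>X ^ (2 * n + 1)\<close>, while the number of candidate potentials is the exponential of
  a multiple of \<open>X ^ (2 * n + 3)\<close>.\<close>

lemma parameter_choice:
  fixes K r C0 C4 D :: real and n :: nat
  assumes K: "K > 0" and r: "r \<ge> 1" and C0: "C0 \<ge> 0" and D: "D > 0"
  obtains X0 where "X0 \<ge> 1"
    "\<forall>X\<ge>X0. \<forall>M::nat. X ^ (2 * n + 3) \<le> D * real M ^ n \<longrightarrow>
      (\<exists>L \<eta> N. \<eta> > 0 \<and> K * (18/19) ^ L \<le> 1 \<and> C4 * (18/19) ^ L \<le> 8 * exp (- X) \<and>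
        (real (Suc (2 * L) ^ n))\<^sup>2 * (K * r ^ L)\<^sup>2 * (2 * \<eta>) \<le> (18/19) ^ L \<and> C0 / \<eta> \<le> real N \<and>
        (2 * N + 1) ^ (2 * (Suc (2 * L) ^ n)\<^sup>2) < (2::nat) ^ (M ^ n))"
proof -
  define \<theta> where "\<theta> = (18/19 :: real)"
  \<comment> \<open>With L of size a X the error (18/19)^L is at most exp (-2 X), which leaves exp (-X) for the constants.\<close>
  define a where "a = 2 / ln (19/18::real)"
  have a: "a > 0" by (simp add: a_def)
  \<comment> \<open>The accuracy \<eta> is inverse to at most Q^L times a constant; 9^n comes from (2L+1)^(2n) <= (3^L)^(2n).\<close>
  define Q where "Q = 9 ^ n * r\<^sup>2 * (19/18)"
  have Q: "Q \<ge> 1"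
  proof -
    have "1 * 1 * 1 \<le> 9 ^ n * r\<^sup>2 * (19/18)"
      using r by (intro mult_mono one_le_power mult_nonneg_nonneg) auto
    then show ?thesis by (simp add: Q_def)
  qed
  define C6 where "C6 = 4 * C0 * K\<^sup>2 + 3"
  obtain P1 :: nat where P1: "C6 \<le> 2 ^ P1" by (rule power_le_two_power)
  obtain P2 :: nat where P2: "Q \<le> 2 ^ P2" by (rule power_le_two_power)
  define P where "P = P1 + P2"
  define E where "E = real (P * 2 * 4 ^ n) * (a + 2) ^ (2 * n + 1) * D"
  define X0 where "X0 = Max {1, K, C4, E + 1}"
  have X0: "X0 \<ge> 1" "X0 \<ge> K" "X0 \<ge> C4" "X0 \<ge> E + 1" by (simp_all add: X0_def)
  have "\<exists>L \<eta> N. \<eta> > 0 \<and> K * \<theta> ^ L \<le> 1 \<and> C4 * \<theta> ^ L \<le> 8 * exp (- X) \<and>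
        (real (Suc (2 * L) ^ n))\<^sup>2 * (K * r ^ L)\<^sup>2 * (2 * \<eta>) \<le> \<theta> ^ L \<and> C0 / \<eta> \<le> real N \<and>
        (2 * N + 1) ^ (2 * (Suc (2 * L) ^ n)\<^sup>2) < (2::nat) ^ (M ^ n)"
    if X: "X \<ge> X0" and M: "X ^ (2 * n + 3) \<le> D * real M ^ n" for X :: real and M :: nat
  proof -
    have X1: "X \<ge> 1" "X \<ge> K" "X \<ge> C4" "X > E" using X X0 by linarith+
    define L where "L = nat \<lceil>a * X\<rceil>"
    have aX: "a * X > 0" using a X1 by simp
    have L: "a * X \<le> real L" "real L \<le> a * X + 1" unfolding L_def using aX by linarith+
    have \<theta>0: "\<theta> ^ L > 0" by (simp add: \<theta>_def)
    have \<theta>L: "\<theta> ^ L \<le> exp (- 2 * X)"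
    proof -
      have l: "ln (19/18::real) > 0" by simp
      have "\<theta> = exp (- ln (19/18))" by (simp add: \<theta>_def exp_minus)
      then have 1: "\<theta> ^ L = exp (real L * - ln (19/18))" by (simp only: exp_of_nat_mult)
      have "2 * X = a * X * ln (19/18)" using l by (simp add: a_def)
      moreover have "a * X * ln (19/18) \<le> real L * ln (19/18)" using L(1) l by (intro mult_right_mono) auto
      ultimately have "2 * X \<le> real L * ln (19/18)" by linarith
      then show ?thesis unfolding 1 by simp
    qed
    have eX: "X \<le> exp X" using exp_ge_add_one_self[of X] by linarith
    have e2: "exp (- 2 * X) = exp (- X) * exp (- X)" by (simp flip: exp_add)
    have eX1: "X * exp (- X) \<le> 1" using eX by (simp add: exp_minus field_simps)
    have dec: "c * \<theta> ^ L \<le> exp (- X)" if c: "c \<le> X" for c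
    proof -
      have "c * \<theta> ^ L \<le> X * \<theta> ^ L" using c \<theta>0 by (intro mult_right_mono) auto
      also have "\<dots> \<le> X * exp (- 2 * X)" using \<theta>L X1 by (intro mult_left_mono) auto
      also have "\<dots> = (X * exp (- X)) * exp (- X)" unfolding e2 by simp
      also have "\<dots> \<le> 1 * exp (- X)" using eX1 by (intro mult_right_mono) auto
      finally show ?thesis by simp
    qed
    have d1: "K * \<theta> ^ L \<le> 1" using order_trans[OF dec[OF X1(2)], of 1] X1(1) by simp
    have d2: "C4 * \<theta> ^ L \<le> 8 * exp (- X)"
      using dec[OF X1(3)] exp_gt_zero[of "- X"] by linarith
    define A where "A = Suc (2 * L) ^ n"
    define Z where "Z = (real A)\<^sup>2 * (K * r ^ L)\<^sup>2"
    have A1: "A \<ge> 1" by (simp add: A_def)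
    have Z: "Z > 0" unfolding Z_def using A1 K r by (intro mult_pos_pos zero_less_power) auto
    define \<eta> where "\<eta> = \<theta> ^ L / (2 * Z)"
    have \<eta>: "\<eta> > 0" "Z * (2 * \<eta>) = \<theta> ^ L" unfolding \<eta>_def using Z \<theta>0 by simp_all
    define N where "N = nat \<lceil>C0 / \<eta>\<rceil>"
    have N: "C0 / \<eta> \<le> real N" "real N \<le> C0 / \<eta> + 1" 
    proof -
      have "C0 / \<eta> \<ge> 0" using C0 \<eta>(1) by simp
      then show "C0 / \<eta> \<le> real N" "real N \<le> C0 / \<eta> + 1" unfolding N_def by linarith+
    qed
    have three: "real (Suc (2 * L)) \<le> 3 ^ L"
      using Bernoulli_inequality[of "2::real" L] by simp
    have N2: "real (2 * N + 1) \<le> C6 * Q ^ L"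
    proof -
      have "C0 / \<eta> = 2 * C0 * K\<^sup>2 * ((real A)\<^sup>2 * (r\<^sup>2) ^ L * (1 / \<theta>) ^ L)"
        unfolding \<eta>_def Z_def by (simp add: power_mult_distrib power_divide power_mult[symmetric] mult.commute[of 2 L] power_even_eq)
      also have "\<dots> \<le> 2 * C0 * K\<^sup>2 * (((9::real) ^ n) ^ L * (r\<^sup>2) ^ L * (1 / \<theta>) ^ L)"
      proof -
        have "(real A)\<^sup>2 = (real (Suc (2 * L))) ^ (2 * n)" by (simp add: A_def power_mult[symmetric] mult.commute)
        also have "\<dots> \<le> (3 ^ L) ^ (2 * n)" using three by (intro power_mono) auto
        also have "\<dots> = ((3\<^sup>2) ^ n) ^ L" by (simp only: power_mult[symmetric] mult_ac)
        finally have "(real A)\<^sup>2 \<le> (9 ^ n) ^ L" by simp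
        then show ?thesis using C0 r by (intro mult_left_mono mult_right_mono) (auto simp: \<theta>_def)
      qed
      also have "\<dots> = 2 * C0 * K\<^sup>2 * Q ^ L"
      proof -
        have t: "1 / \<theta> = 19/18" by (simp add: \<theta>_def)
        show ?thesis unfolding t Q_def power_mult_distrib ..
      qed
      finally have "C0 / \<eta> \<le> 2 * C0 * K\<^sup>2 * Q ^ L" .
      then have "real (2 * N + 1) \<le> 4 * C0 * K\<^sup>2 * Q ^ L + 3" using N(2) by simp
      also have "\<dots> \<le> 4 * C0 * K\<^sup>2 * Q ^ L + 3 * Q ^ L" using one_le_power[OF Q, of L] by simp
      finally show ?thesis by (simp add: C6_def distrib_right)
    qed
    have N3: "2 * N + 1 \<le> 2 ^ (P * (L + 1))"
    proof -
      have "C6 * Q ^ L \<le> 2 ^ P1 * (2 ^ P2) ^ L"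
        using P1 P2 Q C0 by (intro mult_mono power_mono) (auto simp: C6_def)
      also have "\<dots> = 2 ^ (P1 + P2 * L)" by (simp add: power_add power_mult)
      also have "\<dots> \<le> (2::real) ^ (P * (L + 1))" by (rule power_increasing) (auto simp: P_def algebra_simps)
      finally have "real (2 * N + 1) \<le> real (2 ^ (P * (L + 1)))" using N2 by simp
      then show ?thesis by (simp only: of_nat_le_iff)
    qed
    \<comment> \<open>Since X > E, the exponent of the number of cells, of size E X^(2n+1), stays below X^(2n+3).\<close>
    have exps: "P * (L + 1) * (2 * A\<^sup>2) < M ^ n"
    proof -
      have "A\<^sup>2 \<le> ((2 * (L + 1)) ^ n)\<^sup>2" unfolding A_def by (intro power_mono) auto
      also have "\<dots> = 4 ^ n * (L + 1) ^ (2 * n)"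
        by (simp only: power_mult_distrib power_mult[symmetric] mult.commute[of n 2]) (simp add: power_mult)
      finally have "P * (L + 1) * (2 * A\<^sup>2) \<le> P * (L + 1) * (2 * (4 ^ n * (L + 1) ^ (2 * n)))"
        by (intro mult_left_mono) auto
      also have "\<dots> = (P * 2 * 4 ^ n) * (L + 1) ^ (2 * n + 1)" by (simp add: algebra_simps)
      finally have "real (P * (L + 1) * (2 * A\<^sup>2)) \<le> real ((P * 2 * 4 ^ n) * (L + 1) ^ (2 * n + 1))"
        by (simp only: of_nat_le_iff)
      also have "\<dots> = real (P * 2 * 4 ^ n) * real (L + 1) ^ (2 * n + 1)" by (simp only: of_nat_mult of_nat_power)
      also have "\<dots> \<le> real (P * 2 * 4 ^ n) * ((a + 2) * X) ^ (2 * n + 1)"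
      proof (intro mult_left_mono power_mono)
        show "real (L + 1) \<le> (a + 2) * X" using L(2) X1(1) by (simp add: distrib_right)
      qed auto
      finally have 1: "real (P * (L + 1) * (2 * A\<^sup>2)) * D \<le> real (P * 2 * 4 ^ n) * ((a + 2) * X) ^ (2 * n + 1) * D"
        using D by (intro mult_right_mono) auto
      have "real (P * 2 * 4 ^ n) * ((a + 2) * X) ^ (2 * n + 1) * D = E * X ^ (2 * n + 1)"
        unfolding E_def power_mult_distrib by (simp only: mult_ac)
      also have "\<dots> < X * X ^ (2 * n + 1)" using X1 by (intro mult_strict_right_mono) auto
      also have "\<dots> \<le> X ^ (2 * n + 3)"
        unfolding power_Suc[symmetric] using X1 by (intro power_increasing) auto
      also have "\<dots> \<le> D * real M ^ n" by (rule M)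
      finally have 2: "real (P * 2 * 4 ^ n) * ((a + 2) * X) ^ (2 * n + 1) * D < D * real M ^ n" .
      have "real (P * (L + 1) * (2 * A\<^sup>2)) * D < real (M ^ n) * D"
        using le_less_trans[OF 1 2] by (simp only: of_nat_power mult.commute[of D])
      then show ?thesis using D by (simp only: mult_less_cancel_right_pos of_nat_less_iff)
    qed
    have "(2 * N + 1) ^ (2 * A\<^sup>2) \<le> (2 ^ (P * (L + 1))) ^ (2 * A\<^sup>2)" using N3 by (rule power_mono) simp
    also have "\<dots> = 2 ^ (P * (L + 1) * (2 * A\<^sup>2))" by (simp only: power_mult)
    also have "\<dots> < 2 ^ (M ^ n)" using exps by (intro power_strict_increasing) auto
    finally have cells: "(2 * N + 1) ^ (2 * A\<^sup>2) < 2 ^ (M ^ n)" .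
    show ?thesis
      using \<eta>(1) d1 d2 \<eta>(2)[unfolded Z_def] N(1) cells unfolding A_def
      by (intro exI[of _ L] exI[of _ \<eta>] exI[of _ N]) simp
  qed
  then show ?thesis using that[OF X0(1)] unfolding \<theta>_def by blast
qed

section \<open>Two potentials with almost the same map\<close>

lemma L2_bounded_by_mono:
  assumes "L2_bounded_by W T C" "C \<le> C'"
  shows "L2_bounded_by W T C'"
  unfolding L2_bounded_by_def
proof
  fix f assume "f \<in> L2 W"
  then obtain g where g: "g \<in> L2 W" "\<forall>\<phi>\<in>test_functions W. T f \<phi> = (\<integral>x. g x * \<phi> x \<partial>lebesgue_on W)"
    "L2_norm W g \<le> C * L2_norm W f"
    using assms(1) unfolding L2_bounded_by_def by blast
  have "C * L2_norm W f \<le> C' * L2_norm W f"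
    using assms(2) by (intro mult_right_mono) (simp_all add: L2_norm_def)
  then show "\<exists>g\<in>L2 W. (\<forall>\<phi>\<in>test_functions W. T f \<phi> = (\<integral>x. g x * \<phi> x \<partial>lebesgue_on W)) \<and> L2_norm W g \<le> C' * L2_norm W f"
    using g by (intro bexI[of _ g]) auto
qed

text \<open>The finite rank approximation, the bound on moments and the count of cells combined, for an
  arbitrary family of 2^(M^n) small potentials. The constants depend on neither the family nor M.\<close>

lemma close_dn_maps:
  fixes s D :: real
  assumes s: "0 < s" "s < 1" and D: "D > 0"
  defines "U \<equiv> ball (0::'a::euclidean_space) 1"
    and "W \<equiv> ball (0::'a) 3 - cball 0 2"
  obtains r0 X0 :: real where "r0 > 0" "X0 \<ge> 1"
    "\<forall>q. bounded_potential U r0 q \<longrightarrow> \<not> zero_dirichlet_eigenvalue s U q"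
    "\<forall>X\<ge>X0. \<forall>M::nat. X ^ (2 * DIM('a) + 3) \<le> D * real M ^ DIM('a) \<longrightarrow>
      (\<forall>(q::'b \<Rightarrow> 'a \<Rightarrow> real) F. finite F \<longrightarrow> card F = 2 ^ (M ^ DIM('a)) \<longrightarrow>
        (\<forall>S\<in>F. bounded_potential U r0 (q S)) \<longrightarrow>
        (\<exists>S\<in>F. \<exists>S'\<in>F. S \<noteq> S' \<and>
          L2_bounded_by W (\<lambda>f \<phi>. dn_map s U W (q S) f \<phi> - dn_map s U W (q S') f \<phi>) (8 * exp (- X))))"
proof -
  interpret fractional_exterior s U 1 W 3
  proof
    show "U \<in> sets borel" "W \<in> sets borel" unfolding U_def W_def by auto
    show "1 \<le> norm (x - y)" if "x \<in> U" "y \<in> W" for x y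
      using that norm_triangle_ineq3[of y x] by (simp add: U_def W_def norm_minus_commute)
  qed (use s in \<open>auto simp: U_def W_def\<close>)
  obtain K :: real where K: "K > 0" and fr:
    "\<forall>L. \<exists>b::('a \<Rightarrow> nat) \<Rightarrow> 'a \<Rightarrow> complex.
       (\<forall>\<alpha>\<in>multi_box (2 * L). b \<alpha> \<in> borel_measurable lebesgue \<and> (\<forall>y\<in>ball 0 3. cmod (b \<alpha> y) \<le> K * real (2 * (1 + DIM('a))) ^ L)) \<and>
       (\<forall>x y. norm x < 1 \<longrightarrow> 2 < norm y \<longrightarrow> norm y < 3 \<longrightarrow>
         cmod (of_real (frac_kernel s x y) - (\<Sum>\<alpha>\<in>multi_box (2 * L). of_real (monomial \<alpha> x) * b \<alpha> y)) \<le> K * (18/19) ^ L)"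
    by (rule kernel_finite_rank[OF s])
  define r where "r = real (2 * (1 + DIM('a)))"
  have r: "r \<ge> 1" by (simp add: r_def)
  define G where "G = NU\<^sup>2 * (4 * kernel_bound + 2) / pot_bound"
  define C4 where "C4 = NW\<^sup>2 * (K * G + 1)"
  define C0 where "C0 = NU * NU / pot_bound"
  have C0: "C0 \<ge> 0" using NU_nonneg pot_bound_pos by (simp add: C0_def)
  obtain X0 where X0: "X0 \<ge> 1" and par:
    "\<forall>X\<ge>X0. \<forall>M::nat. X ^ (2 * DIM('a) + 3) \<le> D * real M ^ DIM('a) \<longrightarrow>
      (\<exists>L \<eta> N. \<eta> > 0 \<and> K * (18/19) ^ L \<le> 1 \<and> C4 * (18/19) ^ L \<le> 8 * exp (- X) \<and>
        (real (Suc (2 * L) ^ DIM('a)))\<^sup>2 * (K * r ^ L)\<^sup>2 * (2 * \<eta>) \<le> (18/19) ^ L \<and> C0 / \<eta> \<le> real N \<and>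
        (2 * N + 1) ^ (2 * (Suc (2 * L) ^ DIM('a))\<^sup>2) < (2::nat) ^ (M ^ DIM('a)))"
    by (rule parameter_choice[OF K r C0 D])
  have main: "\<exists>S\<in>F. \<exists>S'\<in>F. S \<noteq> S' \<and>
      L2_bounded_by W (\<lambda>f \<phi>. dn_map s U W (q S) f \<phi> - dn_map s U W (q S') f \<phi>) (8 * exp (- X))"
    if X: "X \<ge> X0" and M: "X ^ (2 * DIM('a) + 3) \<le> D * real M ^ DIM('a)"
      and F: "finite F" "card F = 2 ^ (M ^ DIM('a))" and q: "\<forall>S\<in>F. bounded_potential U pot_bound (q S)"
    for X M F and q :: "'b \<Rightarrow> 'a \<Rightarrow> real"
  proof -
    obtain L \<eta> N where \<eta>: "\<eta> > 0" and d1: "K * (18/19) ^ L \<le> 1" and d2: "C4 * (18/19) ^ L \<le> 8 * exp (- X)"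
      and d3: "(real (Suc (2 * L) ^ DIM('a)))\<^sup>2 * (K * r ^ L)\<^sup>2 * (2 * \<eta>) \<le> (18/19) ^ L"
      and N: "C0 / \<eta> \<le> real N" and cells: "(2 * N + 1) ^ (2 * (Suc (2 * L) ^ DIM('a))\<^sup>2) < (2::nat) ^ (M ^ DIM('a))"
      using par X M by blast
    obtain b :: "('a \<Rightarrow> nat) \<Rightarrow> 'a \<Rightarrow> complex" where
      b: "\<forall>\<alpha>\<in>multi_box (2 * L). b \<alpha> \<in> borel_measurable lebesgue \<and> (\<forall>y\<in>ball 0 3. cmod (b \<alpha> y) \<le> K * r ^ L)"
      and approx: "\<forall>x y. norm x < 1 \<longrightarrow> 2 < norm y \<longrightarrow> norm y < 3 \<longrightarrow>
         cmod (of_real (frac_kernel s x y) - (\<Sum>\<alpha>\<in>multi_box (2 * L). of_real (monomial \<alpha> x) * b \<alpha> y)) \<le> K * (18/19) ^ L"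
      using fr unfolding r_def by blast
    define A where "A = (multi_box (2 * L) :: ('a \<Rightarrow> nat) set)"
    have A: "finite A" "card A = Suc (2 * L) ^ DIM('a)" unfolding A_def by (rule finite_multi_box, rule card_multi_box)
    define mon where "mon \<alpha> x = complex_of_real (monomial \<alpha> x)" for \<alpha> and x :: 'a
    have mon1: "mon \<alpha> \<in> borel_measurable lebesgue" for \<alpha>
    proof -
      have "mon \<alpha> \<in> borel_measurable borel" unfolding mon_def[abs_def] by measurable
      then show ?thesis by (rule lborel_imp_lebesgue_measurable)
    qed
    have mon2: "cmod (mon \<alpha> x) \<le> 1" if "x \<in> U" for \<alpha> x
      unfolding mon_def norm_of_real using that by (intro monomial_bound) (simp add: U_def)
    define v where "v S = (\<lambda>(a, a'). moment mon (q S) a a')" for S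
    have "\<exists>S\<in>F. \<exists>S'\<in>F. S \<noteq> S' \<and> (\<forall>i\<in>A \<times> A. cmod (v S i - v S' i) \<le> 2 * \<eta>)"
    proof (rule pigeonhole_complex_vectors[where v = v, OF F(1) _ \<eta> _ N])
      show "finite (A \<times> A)" using A by simp
      show "cmod (v S i) \<le> C0" if "S \<in> F" for S i
        unfolding v_def C0_def split_beta
        by (rule moment_bound) (use q that mon1 mon2 in simp_all)
      have "card (A \<times> A) = (Suc (2 * L) ^ DIM('a))\<^sup>2" by (simp add: card_cartesian_product A(2) power2_eq_square)
      then show "(2 * N + 1) ^ (2 * card (A \<times> A)) < card F" using cells F(2) by simp
    qed
    then obtain S S' where S: "S \<in> F" "S' \<in> F" "S \<noteq> S'" "\<forall>i\<in>A \<times> A. cmod (v S i - v S' i) \<le> 2 * \<eta>"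
      by blast
    have "L2_bounded_by W (\<lambda>f \<phi>. dn_map s U W (q S) f \<phi> - dn_map s U W (q S') f \<phi>)
      (NW\<^sup>2 * ((K * (18/19) ^ L) * (NU\<^sup>2 * (4 * kernel_bound + 2) / pot_bound) + (real (card A))\<^sup>2 * (K * r ^ L)\<^sup>2 * (2 * \<eta>)))"
    proof (rule dn_difference_bound[where m = mon and b = b and A = A])
      show "cmod (b a y) \<le> K * r ^ L" if "a \<in> A" "y \<in> W" for a y
        using b that by (auto simp: A_def W_def)
      show "cmod (of_real (frac_kernel s x y) - (\<Sum>a\<in>A. mon a x * b a y)) \<le> K * (18/19) ^ L" if "x \<in> U" "y \<in> W" for x y
        using approx that unfolding A_def mon_def by (simp add: U_def W_def)
      show "cmod (moment mon (q S) a a' - moment mon (q S') a a') \<le> 2 * \<eta>" if "a \<in> A" "a' \<in> A" for a a'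
        using S(4) that by (auto simp: v_def)
    qed (use q S mon1 mon2 A b K r d1 in \<open>auto simp: A_def\<close>)
    then have "L2_bounded_by W (\<lambda>f \<phi>. dn_map s U W (q S) f \<phi> - dn_map s U W (q S') f \<phi>) (8 * exp (- X))"
    proof (rule L2_bounded_by_mono)
      have "NW\<^sup>2 * ((K * (18/19) ^ L) * G + (real (card A))\<^sup>2 * (K * r ^ L)\<^sup>2 * (2 * \<eta>))
          \<le> NW\<^sup>2 * ((K * (18/19) ^ L) * G + (18/19) ^ L)"
        using d3 unfolding A(2) by (intro mult_left_mono add_left_mono) auto
      also have "\<dots> = C4 * (18/19) ^ L" by (simp add: C4_def algebra_simps)
      also note d2
      finally show "NW\<^sup>2 * ((K * (18/19) ^ L) * (NU\<^sup>2 * (4 * kernel_bound + 2) / pot_bound) + (real (card A))\<^sup>2 * (K * r ^ L)\<^sup>2 * (2 * \<eta>)) \<le> 8 * exp (- X)"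
        unfolding G_def .
    qed
    then show ?thesis using S by blast
  qed
  show ?thesis
  proof (rule that[OF pot_bound_pos X0])
    show "\<forall>q. bounded_potential U pot_bound q \<longrightarrow> \<not> zero_dirichlet_eigenvalue s U q"
      using no_zero_eigenvalue by blast
  qed (intro allI impI main)
qed

section \<open>Essential suprema\<close>

lemma bounded_potentialI_Linf:
  assumes "q \<in> Linf U" "Linf_norm U q \<le> ereal c"
  shows "bounded_potential U c q"
  unfolding bounded_potential_def
proof
  show "q \<in> borel_measurable (lebesgue_on U)" using assms(1) by (simp add: Linf_def)
  have "AE x in lebesgue_on U. ereal \<bar>q x\<bar> \<le> Linf_norm U q" unfolding Linf_norm_def by (rule esssup_AE)
  then show "AE x in lebesgue_on U. \<bar>q x\<bar> \<le> c"
  proof eventually_elim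
    case (elim x)
    then have "ereal \<bar>q x\<bar> \<le> ereal c" using assms(2) by (rule order_trans)
    then show ?case by simp
  qed
qed

lemma bounded_potential_Linf:
  assumes "bounded_potential U c q"
  shows "Linf_norm U q \<le> ereal c" "q \<in> Linf U"
proof -
  have m: "q \<in> borel_measurable (lebesgue_on U)" and "AE x in lebesgue_on U. \<bar>q x\<bar> \<le> c"
    using assms by (auto simp: bounded_potential_def)
  then show 1: "Linf_norm U q \<le> ereal c" unfolding Linf_norm_def by (intro esssup_I) auto
  have "ereal c < \<infinity>" by simp
  with 1 have "Linf_norm U q < \<infinity>" by (rule le_less_trans)
  then show "q \<in> Linf U" using m by (simp add: Linf_def)
qed

text \<open>A continuous function exceeds every number below |f a| on a neighbourhood of a, which is not a null
  set.\<close>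

lemma Linf_norm_ge_continuous:
  fixes f :: "'a::euclidean_space \<Rightarrow> real"
  assumes U: "open U" "a \<in> U" and f: "continuous_on UNIV f"
  shows "ereal \<bar>f a\<bar> \<le> Linf_norm U f"
proof (rule ccontr)
  assume "\<not> ereal \<bar>f a\<bar> \<le> Linf_norm U f"
  then have "Linf_norm U f < ereal \<bar>f a\<bar>" by simp
  then obtain e where e: "Linf_norm U f < ereal e" "ereal e < ereal \<bar>f a\<bar>" using ereal_dense2 by blast
  define V where "V = U \<inter> {x. e < \<bar>f x\<bar>}"
  have "open {x. e < \<bar>f x\<bar>}" by (intro open_Collect_less continuous_intros f)
  then have V: "open V" using U by (auto simp: V_def)
  have "AE x in lebesgue_on U. ereal \<bar>f x\<bar> \<le> Linf_norm U f" unfolding Linf_norm_def by (rule esssup_AE)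
  then have "AE x in lebesgue_on U. x \<notin> V"
  proof eventually_elim
    case (elim x)
    then have "ereal \<bar>f x\<bar> < ereal e" using e(1) by (rule le_less_trans)
    then show ?case by (simp add: V_def)
  qed
  then have "AE x in lebesgue. x \<notin> V" using U by (subst (asm) AE_restrict_space_iff) (auto simp: V_def)
  then have "negligible V" using V by (subst negligible_iff_null_sets) (auto simp: AE_iff_null_sets)
  moreover have "a \<in> V" using U e by (simp add: V_def)
  ultimately show False using open_not_negligible[OF V] by blast
qed

section \<open>The scale of the grid\<close>

text \<open>M is the integer part of \<epsilon>^(-1/m) / (4 n), which is at least 1 for small \<epsilon>; rounding loses at most a
  factor 2, whence 8 n.\<close>

lemma grid_resolution:
  fixes m n :: nat and X0 :: real
  assumes m: "m \<ge> 1" and n: "n \<ge> 1" and X0: "X0 \<ge> 1"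
  defines "\<gamma> \<equiv> real n / ((2 * real n + 3) * real m)"
  obtains \<epsilon>0 where "\<epsilon>0 > 0"
    "\<forall>\<epsilon>. 0 < \<epsilon> \<longrightarrow> \<epsilon> < \<epsilon>0 \<longrightarrow> X0 \<le> \<epsilon> powr (- \<gamma>) \<and>
      (\<exists>M\<ge>1. \<epsilon> * real (4 * n * M) ^ m \<le> 1 \<and> (\<epsilon> powr (- \<gamma>)) ^ (2 * n + 3) \<le> real (8 * n) ^ n * real M ^ n)"
proof -
  have \<gamma>: "\<gamma> > 0" using m n by (simp add: \<gamma>_def)
  define \<epsilon>0 where "\<epsilon>0 = min (X0 powr (- 1 / \<gamma>)) (real (4 * n) powr (- real m))"
  have "\<epsilon>0 > 0" using X0 n by (simp add: \<epsilon>0_def)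
  moreover have "X0 \<le> \<epsilon> powr (- \<gamma>) \<and>
      (\<exists>M\<ge>1. \<epsilon> * real (4 * n * M) ^ m \<le> 1 \<and> (\<epsilon> powr (- \<gamma>)) ^ (2 * n + 3) \<le> real (8 * n) ^ n * real M ^ n)"
    if \<epsilon>: "0 < \<epsilon>" "\<epsilon> < \<epsilon>0" for \<epsilon>
  proof
    have "X0 = (X0 powr (- 1 / \<gamma>)) powr (- \<gamma>)" using X0 \<gamma> by (simp add: powr_powr)
    also have "\<dots> \<le> \<epsilon> powr (- \<gamma>)" using \<epsilon> \<gamma> by (intro powr_mono2') (auto simp: \<epsilon>0_def)
    finally show "X0 \<le> \<epsilon> powr (- \<gamma>)" .
    define Y where "Y = \<epsilon> powr (- 1 / real m)"
    have Y0: "Y > 0" using \<epsilon> by (simp add: Y_def)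
    have "real (4 * n) = (real (4 * n) powr (- real m)) powr (- 1 / real m)" using n m by (simp add: powr_powr)
    also have "\<dots> \<le> Y" unfolding Y_def using \<epsilon> m by (intro powr_mono2') (auto simp: \<epsilon>0_def)
    finally have Y: "real (4 * n) \<le> Y" .
    have n4: "real (4 * n) > 0" using n by simp
    have Yq: "Y / real (4 * n) \<ge> 1" using Y n4 by simp
    define M where "M = nat \<lfloor>Y / real (4 * n)\<rfloor>"
    have M: "M \<ge> 1" "real M \<le> Y / real (4 * n)" "Y / real (4 * n) \<le> 2 * real M"
    proof -
      have "\<lfloor>Y / real (4 * n)\<rfloor> \<ge> 1" using Yq by (simp only: one_le_floor)
      then show "M \<ge> 1" "real M \<le> Y / real (4 * n)" "Y / real (4 * n) \<le> 2 * real M"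
        unfolding M_def by linarith+
    qed
    have Ypow: "Y ^ k = \<epsilon> powr (- real k / real m)" for k
      using Y0 \<epsilon> by (simp add: Y_def powr_powr flip: powr_realpow)
    have "real (4 * n * M) \<le> Y" using M(2) n4 by (simp add: field_simps)
    then have "real (4 * n * M) ^ m \<le> Y ^ m" by (intro power_mono) auto
    also have "\<dots> = 1 / \<epsilon>" using m \<epsilon> by (simp add: Ypow powr_minus_divide)
    finally have 1: "\<epsilon> * real (4 * n * M) ^ m \<le> 1" using \<epsilon> by (simp add: pos_le_divide_eq mult.commute)
    have "(\<epsilon> powr (- \<gamma>)) ^ (2 * n + 3) = \<epsilon> powr (- \<gamma> * real (2 * n + 3))"
      using \<epsilon> by (simp add: powr_powr flip: powr_realpow)
    also have "- \<gamma> * real (2 * n + 3) = - real n / real m"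
    proof -
      define c where "c = 2 * real n + 3"
      have "c > 0" by (simp add: c_def add_nonneg_pos)
      moreover have "real (2 * n + 3) = c" by (simp add: c_def)
      ultimately show ?thesis unfolding \<gamma>_def c_def[symmetric] by simp
    qed
    also have "\<epsilon> powr (- real n / real m) = Y ^ n" by (simp add: Ypow)
    also have "\<dots> \<le> (real (8 * n) * real M) ^ n"
    proof (rule power_mono)
      show "Y \<le> real (8 * n) * real M" using M(3) n4 by (simp add: field_simps)
    qed (use Y0 in simp)
    also have "\<dots> = real (8 * n) ^ n * real M ^ n" by (rule power_mult_distrib)
    finally show "\<exists>M\<ge>1. \<epsilon> * real (4 * n * M) ^ m \<le> 1 \<and> (\<epsilon> powr (- \<gamma>)) ^ (2 * n + 3) \<le> real (8 * n) ^ n * real M ^ n"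
      using M(1) 1 by blast
  qed
  ultimately show ?thesis using that by blast
qed

theorem theorem1:
  fixes s :: real and m :: nat
  assumes "0 < s" "s < 1" "m \<ge> 1"
  defines "B \<equiv> ball (0 :: real ^ 'n) 1"
    and "W \<equiv> ball (0 :: real ^ 'n) 3 - cball 0 2"
    and "n \<equiv> real CARD('n)"
  shows "\<exists>r0>0. \<exists>\<beta>>0. \<exists>\<epsilon>0>0. \<forall>\<epsilon>. 0 < \<epsilon> \<and> \<epsilon> < \<epsilon>0 \<longrightarrow>
    (\<forall>q0\<in>Linf B. Linf_norm B q0 \<le> ereal (r0 / 2) \<longrightarrow>
      (\<exists>q1 q2.
        (\<forall>q\<in>{q1, q2}.
           admissible s B q \<and>
           (\<lambda>x. q x - q0 x) \<in> Cc m B \<and>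
           C_norm m (cball 0 1) (\<lambda>x. q x - q0 x) \<le> \<beta> \<and>
           Linf_norm B (\<lambda>x. q x - q0 x) \<le> ereal \<epsilon>) \<and>
        Linf_norm B (\<lambda>x. q1 x - q2 x) = ereal \<epsilon> \<and>
        L2_opnorm W (\<lambda>f \<phi>. dn_map s B W q1 f \<phi> - dn_map s B W q2 f \<phi>)
          \<le> ereal (8 * exp (- (\<epsilon> powr (- (n / ((2 * n + 3) * real m))))))))"
proof -
  have U: "B = ball 0 1" by (simp add: B_def)
  have dim: "DIM(real ^ 'n) = CARD('n)" by simp
  define N where "N = CARD('n)"
  have N: "N \<ge> 1" by (simp add: N_def Suc_le_eq)
  obtain r0 X0 :: real where r0: "r0 > 0" and X0: "X0 \<ge> 1"
    and adm: "\<forall>q. bounded_potential B r0 q \<longrightarrow> \<not> zero_dirichlet_eigenvalue s B q"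
    and close: "\<forall>X\<ge>X0. \<forall>M::nat. X ^ (2 * N + 3) \<le> real (8 * N) ^ N * real M ^ N \<longrightarrow>
      (\<forall>(q::((real ^ 'n) \<Rightarrow> nat) set \<Rightarrow> real ^ 'n \<Rightarrow> real) F. finite F \<longrightarrow> card F = 2 ^ (M ^ N) \<longrightarrow>
        (\<forall>S\<in>F. bounded_potential B r0 (q S)) \<longrightarrow>
        (\<exists>S\<in>F. \<exists>S'\<in>F. S \<noteq> S' \<and>
          L2_bounded_by W (\<lambda>f \<phi>. dn_map s B W (q S) f \<phi> - dn_map s B W (q S') f \<phi>) (8 * exp (- X))))"
    using close_dn_maps[where 'a = "real ^ 'n" and 'b = "((real ^ 'n) \<Rightarrow> nat) set", OF assms(1,2), of "real (8 * N) ^ N" thesis]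
    unfolding dim B_def[symmetric] W_def[symmetric] N_def[symmetric] using N by fastforce
  obtain \<beta> where \<beta>: "\<beta> > 0" and bumps: "\<forall>\<epsilon>>0::real. \<forall>M\<ge>1. \<epsilon> * real (4 * N * M) ^ m \<le> 1 \<longrightarrow> (\<forall>S\<subseteq>grid M.
        (bumps m M \<epsilon> S :: real ^ 'n \<Rightarrow> real) \<in> Cc m (ball 0 1) \<and> C_norm m (cball 0 1) (bumps m M \<epsilon> S :: real ^ 'n \<Rightarrow> real) \<le> \<beta> \<and>
        (\<forall>x::real ^ 'n. 0 \<le> bumps m M \<epsilon> S x \<and> bumps m M \<epsilon> S x \<le> \<epsilon>) \<and>
        (\<forall>S'\<subseteq>grid M. S \<noteq> S' \<longrightarrow> (\<exists>a\<in>ball (0::real ^ 'n) 1. \<bar>bumps m M \<epsilon> S a - bumps m M \<epsilon> S' a\<bar> = \<epsilon>)))"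
    using bumps_family[where 'a = "real ^ 'n" and m = m and thesis = thesis] unfolding dim N_def[symmetric] by blast
  define \<gamma> where "\<gamma> = real N / ((2 * real N + 3) * real m)"
  obtain \<epsilon>1 where \<epsilon>1: "\<epsilon>1 > 0" and res: "\<forall>\<epsilon>. 0 < \<epsilon> \<longrightarrow> \<epsilon> < \<epsilon>1 \<longrightarrow> X0 \<le> \<epsilon> powr (- \<gamma>) \<and>
      (\<exists>M\<ge>1. \<epsilon> * real (4 * N * M) ^ m \<le> 1 \<and> (\<epsilon> powr (- \<gamma>)) ^ (2 * N + 3) \<le> real (8 * N) ^ N * real M ^ N)"
    using grid_resolution[OF assms(3) N X0, of thesis] unfolding \<gamma>_def by blast
  \<comment> \<open>With \<epsilon> <= r0 / 2 the perturbed potentials q0 + p S stay below r0.\<close>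
  define \<epsilon>0 where "\<epsilon>0 = min \<epsilon>1 (r0 / 2)"
  have \<epsilon>0: "\<epsilon>0 > 0" using \<epsilon>1 r0 by (simp add: \<epsilon>0_def)
  have main: "\<exists>q1 q2.
        (\<forall>q\<in>{q1, q2}.
           admissible s B q \<and>
           (\<lambda>x. q x - q0 x) \<in> Cc m B \<and>
           C_norm m (cball 0 1) (\<lambda>x. q x - q0 x) \<le> \<beta> \<and>
           Linf_norm B (\<lambda>x. q x - q0 x) \<le> ereal \<epsilon>) \<and>
        Linf_norm B (\<lambda>x. q1 x - q2 x) = ereal \<epsilon> \<and>
        L2_opnorm W (\<lambda>f \<phi>. dn_map s B W q1 f \<phi> - dn_map s B W q2 f \<phi>)
          \<le> ereal (8 * exp (- (\<epsilon> powr (- (n / ((2 * n + 3) * real m))))))"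
    if e: "0 < \<epsilon> \<and> \<epsilon> < \<epsilon>0" and q0: "q0 \<in> Linf B" "Linf_norm B q0 \<le> ereal (r0 / 2)" for \<epsilon> q0
  proof -
    have \<epsilon>: "0 < \<epsilon>" "\<epsilon> < \<epsilon>1" "\<epsilon> \<le> r0 / 2" using e by (auto simp: \<epsilon>0_def)
    define X where "X = \<epsilon> powr (- \<gamma>)"
    obtain M where X: "X0 \<le> X" and M: "M \<ge> 1" and small: "\<epsilon> * real (4 * N * M) ^ m \<le> 1"
      and many: "X ^ (2 * N + 3) \<le> real (8 * N) ^ N * real M ^ N"
      using res \<epsilon> unfolding X_def by blast
    define F where "F = Pow (grid M :: ((real ^ 'n) \<Rightarrow> nat) set)"
    have F: "finite F" "card F = 2 ^ (M ^ N)"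
      unfolding F_def by (simp_all add: finite_grid card_Pow card_grid N_def)
    define p where "p S = (bumps m M \<epsilon> S :: real ^ 'n \<Rightarrow> real)" for S
    have p: "p S \<in> Cc m B" "C_norm m (cball 0 1) (p S) \<le> \<beta>" "0 \<le> p S x" "p S x \<le> \<epsilon>" if "S \<in> F" for S x
      using bumps \<epsilon>(1) M small that unfolding p_def F_def U by blast+
    have apart: "\<exists>a\<in>B. \<bar>p S a - p S' a\<bar> = \<epsilon>" if "S \<in> F" "S' \<in> F" "S \<noteq> S'" for S S'
      using bumps \<epsilon>(1) M small that unfolding p_def F_def U by blast
    have pc: "continuous_on UNIV (p S)" if "S \<in> F" for S
      using p(1)[OF that] by (auto simp: Cc_def intro: C_fun_continuous)
    have meas: "f \<in> borel_measurable (lebesgue_on B)" if "continuous_on UNIV f" for f :: "real ^ 'n \<Rightarrow> real"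
      by (intro measurable_restrict_space1 lborel_imp_lebesgue_measurable borel_measurable_continuous_onI that)
    define q where "q S x = q0 x + p S x" for S x
    have diff: "(\<lambda>x. q S x - q0 x) = p S" for S by (simp add: q_def)
    have q0b: "bounded_potential B (r0 / 2) q0" by (rule bounded_potentialI_Linf[OF q0])
    have qb: "bounded_potential B r0 (q S)" if S: "S \<in> F" for S
      unfolding bounded_potential_def
    proof
      show "q S \<in> borel_measurable (lebesgue_on B)"
        using q0b meas[OF pc[OF S]] unfolding q_def[abs_def] bounded_potential_def by (intro borel_measurable_add) auto
      have "AE x in lebesgue_on B. \<bar>q0 x\<bar> \<le> r0 / 2" using q0b by (simp add: bounded_potential_def)
      then show "AE x in lebesgue_on B. \<bar>q S x\<bar> \<le> r0"
      proof eventually_elim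
        case (elim x)
        then show ?case using p(3,4)[OF S, of x] \<epsilon>(3) unfolding q_def by linarith
      qed
    qed
    have props: "admissible s B (q S) \<and> (\<lambda>x. q S x - q0 x) \<in> Cc m B \<and>
        C_norm m (cball 0 1) (\<lambda>x. q S x - q0 x) \<le> \<beta> \<and> Linf_norm B (\<lambda>x. q S x - q0 x) \<le> ereal \<epsilon>" if S: "S \<in> F" for S
    proof -
      have "admissible s B (q S)"
        using bounded_potential_Linf(2)[OF qb[OF S]] adm qb[OF S] by (simp add: admissible_def)
      moreover have "bounded_potential B \<epsilon> (p S)"
        using meas[OF pc[OF S]] p(3,4)[OF S] by (auto simp: bounded_potential_def)
      ultimately show ?thesis unfolding diff using p(1,2)[OF S] bounded_potential_Linf(1) by blast
    qed
    obtain S S' where S: "S \<in> F" "S' \<in> F" "S \<noteq> S'" and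
      dn: "L2_bounded_by W (\<lambda>f \<phi>. dn_map s B W (q S) f \<phi> - dn_map s B W (q S') f \<phi>) (8 * exp (- X))"
      using close[rule_format, OF X many F, of q] qb by blast
    have qd: "(\<lambda>x. q S x - q S' x) = (\<lambda>x. p S x - p S' x)" by (simp add: q_def)
    have pdc: "continuous_on UNIV (\<lambda>x. p S x - p S' x)" using pc S by (intro continuous_on_diff) auto
    have "Linf_norm B (\<lambda>x. q S x - q S' x) = ereal \<epsilon>"
    proof (rule antisym)
      have "\<bar>p S x - p S' x\<bar> \<le> \<epsilon>" for x
        using p(3,4)[OF S(1), of x] p(3,4)[OF S(2), of x] by linarith
      then have "bounded_potential B \<epsilon> (\<lambda>x. p S x - p S' x)"
        using meas[OF pdc] by (auto simp: bounded_potential_def)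
      then show "Linf_norm B (\<lambda>x. q S x - q S' x) \<le> ereal \<epsilon>" unfolding qd by (rule bounded_potential_Linf)
      obtain a where a: "a \<in> B" "\<bar>p S a - p S' a\<bar> = \<epsilon>" using apart[OF S] by blast
      show "ereal \<epsilon> \<le> Linf_norm B (\<lambda>x. q S x - q S' x)"
        unfolding qd using Linf_norm_ge_continuous[OF _ a(1) pdc] a(2) by (simp add: U)
    qed
    moreover have "L2_opnorm W (\<lambda>f \<phi>. dn_map s B W (q S) f \<phi> - dn_map s B W (q S') f \<phi>) \<le> ereal (8 * exp (- X))"
      unfolding L2_opnorm_def using dn by (intro Inf_lower) auto
    moreover have "X = \<epsilon> powr (- (n / ((2 * n + 3) * real m)))" by (simp add: X_def \<gamma>_def n_def N_def)
    ultimately show ?thesis using props S by (intro exI[of _ "q S"] exI[of _ "q S'"]) simp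
  qed
  show ?thesis
  proof (rule exI[of _ r0], rule conjI[OF r0], rule exI[of _ \<beta>], rule conjI[OF \<beta>], rule exI[of _ \<epsilon>0], rule conjI[OF \<epsilon>0],
      intro allI impI ballI)
  qed (rule main)
qed

end
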